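(* Let $\alpha>0$, let $\nu=\nu_N$ be positive integers with $\alpha_N:=\nu/N\to\alpha$ as $N\to\infty$, and let $\tau$ take the critical value $\tau=\tau_c=1/\sqrt{1+\alpha_N}$. Then for each $k\in\mathbb N$, $$\lim_{N\to\infty}R_{N,k}(z_1,\dots,z_k)=R_k(z_1,\dots,z_k)=\det\big[K(z_j,z_l)\big]_{1\le j,l\le k}$$ uniformly for $z_1,\dots,z_k$ in compact subsets of $\mathbb C$, where $R_{N,k}$ is the $k$-point correlation function of the rescaled (at the origin) eigenvalue process of the Dirac matrix $\mathcal D$, and $$K(z,w)=|zw|\,e^{z^2\bar w^2-|z|^4/2-|w|^4/2}\,\operatorname{erfc}\Big(-\frac{z^2+\bar w^2}{\sqrt2}\Big).$$
   Context: Random matrix model: let $P,Q$ be independent $N\times(N+\nu)$ random matrices with independent centred complex Gaussian entries whose real and imaginary parts are independent with variance $1/(4N)$ each; $X_1=\sqrt{1+\tau}P+\sqrt{1-\tau}Q$, $X_2=\sqrt{1+\tau}P-\sqrt{1-\tau}Q$, and $\mathcal D=\begin{pmatrix} 0 & X_1 \\ X_2^* & 0 \end{pmatrix}$. Besides the eigenvalue $0$ of multiplicity $\nu$, $\mathcal D$ has $2N$ complex eigenvalues $\{\pm\zeta_j\}_{j=1}^N$. The eigenvalue system $\boldsymbol\zeta=(\zeta_1,\dots,\zeta_N)\in\mathbb C^N$ (considered in the full complex plane) has joint probability density $$d\mathbf P_N(\boldsymbol\zeta)=\frac1{Z_N}e^{-\mathbf H_N(\boldsymbol\zeta)}\prod_{j=1}^N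 dA(\zeta_j),\qquad \mathbf H_N(\boldsymbol\zeta)=\sum_{j\ne k}\log\frac1{|\zeta_j^2-\zeta_k^2|}+N\sum_{j=1}^N V_N(\zeta_j),$$ where $dA(\zeta)=d^2\zeta/\pi$, the sum over $j\neq k$ is over ordered pairs, $Z_N$ is the normalisation constant, and $$V_N(\zeta)=\frac1N\log\frac1{K_\nu(AN|\zeta|^2)\,|\zeta|^{2\nu+2}}-B\operatorname{Re}\zeta^2,\qquad A=\frac2{1-\tau^2},\quad B=\frac{2\tau}{1-\tau^2},$$ with $K_\nu$ the modified Bessel function of the second kind. Correlation functions: $$\mathbf R_{N,k}(\zeta_1,\dots,\zeta_k)=\frac1{Z_N}\frac{N!}{(N-k)!}\int_{\mathbb C^{N-k}}e^{-\mathbf H_N(\boldsymbol\zeta)}\prod_{j=k+1}^N dA(\zeta_j).$$ The rescaled process is $z_j=(N\delta)^{1/4}\zeta_j$ with $\delta=\dfrac1{(1-\tau^2)^2\alpha_N}$, and its $k$-point correlation function is $$R_{N,k}(z_1,\dots,z_k)=\frac1{(N\delta)^{k/2}}\,\mathbf R_{N,k}\Big(\frac{z_1}{(N\delta)^{1/4}},\dots,\frac{z_k}{(N\delta)^{1/4}}\Big)$$ (extended by continuity where some $z_j=0$). Here $\operatorname{erfc}(z)=\frac2{\sqrt\pi}\int_z^\infty e^{-t^2}\,dt$ is the (entire) complementary error function. *)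

theory Defs
  imports
    "HOL-Analysis.Analysis"
    "Jordan_Normal_Form.Determinant"
begin

text \<open>Modified Bessel function of the second kind of order \<open>\<nu>\<close>, for arguments \<open>x > 0\<close>:
  \<open>K\<^sub>\<nu>(x) = \<integral>\<^sub>0\<^sup>\<infinity> exp(- x cosh t) cosh(\<nu> t) dt\<close>.\<close>

definition bessel_K :: "real \<Rightarrow> real \<Rightarrow> real" where
  "bessel_K \<nu> x = (LBINT t:{0..}. exp (- x * cosh t) * cosh (\<nu> * t))"

text \<open>Complementary error function on the complex plane; the contour from \<open>z\<close> to \<open>+\<infinity>\<close>
  is the horizontal ray \<open>z + s\<close>, \<open>s \<ge> 0\<close>.\<close>

definition erfc :: "complex \<Rightarrow> complex" where
  "erfc z = complex_of_real (2 / sqrt pi) * (LBINT s:{0..}. exp (- (z + complex_of_real s)\<^sup>2))"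

text \<open>The area measure \<open>dA(\<zeta>) = d\<^sup>2\<zeta> / \<pi>\<close>.\<close>

definition area_measure :: "complex measure" where
  "area_measure = scale_measure (ennreal (1 / pi)) lborel"

text \<open>\<open>log (1 / x)\<close> for \<open>x \<ge> 0\<close>, with value \<open>+\<infinity>\<close> at \<open>x = 0\<close> (on the reals, \<open>ln 0 = 0\<close>
  would give colliding eigenvalues a positive density).\<close>

definition log_recip :: "real \<Rightarrow> ereal" where
  "log_recip x = (if x = 0 then \<infinity> else ereal (ln (1 / x)))"

text \<open>\<open>exp (- h)\<close> for \<open>h > -\<infinity>\<close>, with \<open>exp (- \<infinity>) = 0\<close>.\<close>

definition exp_neg :: "ereal \<Rightarrow> real" where
  "exp_neg h = (if h = \<infinity> then 0 else exp (- real_of_ereal h))"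

text \<open>The potential is meaningful for \<open>\<zeta> \<noteq> 0\<close> only; its value at \<open>0\<close> is arbitrary and is never
  used except on null sets, see \<open>rescaled_correlation\<close> below.\<close>

definition potential :: "nat \<Rightarrow> nat \<Rightarrow> real \<Rightarrow> complex \<Rightarrow> real" where
  "potential N \<nu> \<tau> \<zeta> =
    (let A = 2 / (1 - \<tau>\<^sup>2); B = 2 * \<tau> / (1 - \<tau>\<^sup>2) in
      1 / real N * ln (1 / (bessel_K (real \<nu>) (A * real N * (cmod \<zeta>)\<^sup>2) * cmod \<zeta> ^ (2 * \<nu> + 2)))
      - B * Re (\<zeta>\<^sup>2))"

text \<open>An eigenvalue system \<open>(\<zeta>\<^sub>1, \<dots>, \<zeta>\<^sub>N)\<close> is a function on indices \<open>0, \<dots>, N - 1\<close>; values at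
  larger indices are ignored.\<close>

definition hamiltonian :: "nat \<Rightarrow> nat \<Rightarrow> real \<Rightarrow> (nat \<Rightarrow> complex) \<Rightarrow> ereal" where
  "hamiltonian N \<nu> \<tau> \<zeta> =
    (\<Sum>(j, l) \<in> {(j, l). j < N \<and> l < N \<and> j \<noteq> l}. log_recip (cmod ((\<zeta> j)\<^sup>2 - (\<zeta> l)\<^sup>2)))
    + ereal (real N * (\<Sum>j<N. potential N \<nu> \<tau> (\<zeta> j)))"

definition partition_function :: "nat \<Rightarrow> nat \<Rightarrow> real \<Rightarrow> real" where
  "partition_function N \<nu> \<tau> =
    (\<integral>\<zeta>. exp_neg (hamiltonian N \<nu> \<tau> \<zeta>) \<partial>(\<Pi>\<^sub>M j\<in>{..<N}. area_measure))"

text \<open>The \<open>k\<close>-point correlation function at \<open>(\<zeta>\<^sub>0, \<dots>, \<zeta>\<^bsub>k-1\<^esub>)\<close>, for \<open>k \<le> N\<close>.\<close>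

definition correlation ::
  "nat \<Rightarrow> nat \<Rightarrow> real \<Rightarrow> nat \<Rightarrow> (nat \<Rightarrow> complex) \<Rightarrow> real" where
  "correlation N \<nu> \<tau> k \<zeta> =
    1 / partition_function N \<nu> \<tau> * (fact N / fact (N - k)) *
    (\<integral>\<eta>. exp_neg (hamiltonian N \<nu> \<tau> (\<lambda>j. if j < k then \<zeta> j else \<eta> j))
       \<partial>(\<Pi>\<^sub>M j\<in>{k..<N}. area_measure))"

text \<open>Rescaling \<open>z = (N \<delta>)\<^bsup>1/4\<^esup> \<zeta>\<close> at the origin, with
  \<open>\<delta> = 1 / ((1 - \<tau>\<^sup>2)\<^sup>2 \<alpha>\<^sub>N)\<close> and \<open>\<alpha>\<^sub>N = \<nu> / N\<close>.\<close>

definition scaling :: "nat \<Rightarrow> nat \<Rightarrow> real \<Rightarrow> real" where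
  "scaling N \<nu> \<tau> = real N * (1 / ((1 - \<tau>\<^sup>2)\<^sup>2 * (real \<nu> / real N)))"

definition rescaled_correlation_nonzero ::
  "nat \<Rightarrow> nat \<Rightarrow> real \<Rightarrow> nat \<Rightarrow> (nat \<Rightarrow> complex) \<Rightarrow> real" where
  "rescaled_correlation_nonzero N \<nu> \<tau> k z =
    1 / scaling N \<nu> \<tau> powr (real k / 2) *
    correlation N \<nu> \<tau> k (\<lambda>j. z j / complex_of_real (scaling N \<nu> \<tau> powr (1 / 4)))"

text \<open>Extension by continuity to points with vanishing coordinates. The topology is the product
  topology on \<open>nat \<Rightarrow> complex\<close>; since only the first \<open>k\<close> coordinates matter, the limit is the
  one in \<open>\<complex>\<^sup>k\<close>.\<close>

definition rescaled_correlation ::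
  "nat \<Rightarrow> nat \<Rightarrow> real \<Rightarrow> nat \<Rightarrow> (nat \<Rightarrow> complex) \<Rightarrow> real" where
  "rescaled_correlation N \<nu> \<tau> k z =
    (if \<forall>j<k. z j \<noteq> 0 then rescaled_correlation_nonzero N \<nu> \<tau> k z
     else Lim (at z within {w. \<forall>j<k. w j \<noteq> 0}) (rescaled_correlation_nonzero N \<nu> \<tau> k))"

definition limit_kernel :: "complex \<Rightarrow> complex \<Rightarrow> complex" where
  "limit_kernel z w =
    complex_of_real (cmod (z * w)) *
    exp (z\<^sup>2 * (cnj w)\<^sup>2 - complex_of_real (cmod z ^ 4) / 2 - complex_of_real (cmod w ^ 4) / 2) *
    erfc (- ((z\<^sup>2 + (cnj w)\<^sup>2) / complex_of_real (sqrt 2)))"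

definition critical_tau :: "nat \<Rightarrow> nat \<Rightarrow> real" where
  "critical_tau N \<nu> = 1 / sqrt (1 + real \<nu> / real N)"

end

theory Submission
  imports Defs "HOL-Probability.Probability" "HOL-Real_Asymp.Real_Asymp"
begin

text \<open>
  In the variable \<open>u = \<zeta>\<^sup>2\<close> the density is a squared Vandermonde determinant times the weight
  \<open>|u|\<^sup>\<nu> K\<^sub>\<nu>(a|u|) exp (b Re u)\<close>, so the correlation functions are determinants of the
  reproducing kernel of the orthogonal polynomials. Writing \<open>K\<^sub>\<nu>\<close> as a Gamma mixture of Gaussians
  shows that these are scaled Laguerre polynomials: their generating function integrates in closed
  form against exponentials, and comparing power series coefficients gives orthogonality and the norms.

  By the Hille--Hardy formula the kernel, a sum over \<open>j < N\<close>, is a contour integral around a circle.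
  At the critical \<open>\<tau>\<close> its saddle point merges with the pole at \<open>s = 1\<close>. On the scale
  \<open>s = exp (\<omega> / \<rho>)\<close>, \<open>\<rho>\<^sup>2 = N (N + \<nu>) / \<nu>\<close>, the integrand converges dominatedly to
  \<open>exp (\<omega>\<^sup>2 / 2 - \<omega> Z) / (- \<omega>)\<close>, whose integral along \<open>Re \<omega> = -1\<close> is an \<open>erfc\<close>, while the weight
  converges by concentration of the Gamma distribution. All limits are taken along convergent sequences
  of arguments, so that compactness makes them uniform.
\<close>

section \<open>Determinants\<close>

text \<open>Truncating the kernel sum at \<open>j < N\<close> inserts \<open>1 / (1 - s)\<close> and
  a power \<open>s^(-(N-1))\<close> into the Hille--Hardy generating function. At the critical
  parameter the exponent \<open>- \<nu> log (1 - (N / \<nu>) (s - 1)) - N log s\<close> has zero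
  derivative at \<open>s = 1\<close>, so the saddle sits exactly on this truncation pole. The circle
  must stay inside the pole for the series to converge, yet within the saddle scale for the Gaussian
  approximation to see it; radius \<open>exp (- 1 / \<rho>)\<close> does both and becomes the line
  \<open>Re \<omega> = -1\<close>. The origin needs separate care. Orthonormality only involves
  integrals, but correlation functions are evaluated at given points, and the potential has a
  conventional value at 0. The determinant formula is therefore proved at every point, and away from
  0 the kernel is rewritten in a form that is continuous through 0; this form identifies the
  extension by continuity.\<close>

lemma card_permutes_extending:
  fixes f :: "nat \<Rightarrow> nat"
  assumes "k \<le> N" "f \<in> {0..<k} \<rightarrow>\<^sub>E {0..<N}" "inj_on f {0..<k}"
  shows "card {\<sigma>. \<sigma> permutes {0..<N} \<and> restrict \<sigma> {0..<k} = f} = fact (N - k)"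
proof -
  have fS: "f ` {0..<k} \<subseteq> {0..<N}" using assms(2) by auto
  have "card ({0..<N} - f ` {0..<k}) = card {k..<N}"
    using fS assms(3) by (simp add: card_Diff_subset card_image)
  then obtain g where g: "bij_betw g {k..<N} ({0..<N} - f ` {0..<k})"
    by (metis finite_Diff finite_atLeastLessThan finite_same_card_bij)
  define \<sigma>0 where "\<sigma>0 i = (if i < k then f i else if i < N then g i else i)" for i
  have "bij_betw \<sigma>0 ({0..<k} \<union> {k..<N}) (f ` {0..<k} \<union> ({0..<N} - f ` {0..<k}))"
  proof (rule bij_betw_combine)
    show "bij_betw \<sigma>0 {0..<k} (f ` {0..<k})"
      using assms(3) by (auto simp: bij_betw_def inj_on_def \<sigma>0_def)
    show "bij_betw \<sigma>0 {k..<N} ({0..<N} - f ` {0..<k})"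
      using g by (rule bij_betw_cong[THEN iffD1, rotated]) (auto simp: \<sigma>0_def)
  qed auto
  then have "bij_betw \<sigma>0 {0..<N} {0..<N}"
    using fS assms(1) by (simp add: ivl_disj_un Un_absorb1)
  then have \<sigma>0: "\<sigma>0 permutes {0..<N}"
    by (rule bij_imp_permutes) (use assms(1) in \<open>auto simp: \<sigma>0_def\<close>)
  have r0: "restrict \<sigma>0 {0..<k} = f"
    using assms(2) by (auto simp: \<sigma>0_def restrict_def fun_eq_iff PiE_def extensional_def)
  \<comment> \<open>The extensions of \<open>f\<close> form a coset: composing the one extension
    \<open>\<sigma>0\<close> with the permutations of the remaining indices \<open>{k..<N}\<close>
    gives them all, each once.\<close>
  have "{\<sigma>. \<sigma> permutes {0..<N} \<and> restrict \<sigma> {0..<k} = f} = (\<lambda>\<rho>. \<sigma>0 \<circ> \<rho>) ` {\<rho>. \<rho> permutes {k..<N}}"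
  proof (intro equalityI subsetI)
    fix \<sigma> assume "\<sigma> \<in> {\<sigma>. \<sigma> permutes {0..<N} \<and> restrict \<sigma> {0..<k} = f}"
    then have \<sigma>: "\<sigma> permutes {0..<N}" "restrict \<sigma> {0..<k} = f" by auto
    define \<rho> where "\<rho> = Hilbert_Choice.inv \<sigma>0 \<circ> \<sigma>"
    have "\<rho> permutes {0..<N}" unfolding \<rho>_def
      by (intro permutes_compose \<sigma> permutes_inv \<sigma>0)
    moreover have "\<rho> x = x" if "x \<in> {0..<N} - {k..<N}" for x
    proof -
      have "\<sigma> x = \<sigma>0 x" using that \<sigma>(2) r0 by (metis DiffE atLeastLessThan_iff not_le restrict_apply')
      then show ?thesis using \<sigma>0 by (simp add: \<rho>_def permutes_inverses)
    qed
    ultimately have "\<rho> permutes {k..<N}" by (rule permutes_superset)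
    moreover have "\<sigma> = \<sigma>0 \<circ> \<rho>"
      using \<sigma>0 by (auto simp: \<rho>_def fun_eq_iff permutes_inverses)
    ultimately show "\<sigma> \<in> (\<lambda>\<rho>. \<sigma>0 \<circ> \<rho>) ` {\<rho>. \<rho> permutes {k..<N}}" by blast
  next
    fix \<sigma> assume "\<sigma> \<in> (\<lambda>\<rho>. \<sigma>0 \<circ> \<rho>) ` {\<rho>. \<rho> permutes {k..<N}}"
    then obtain \<rho> where \<rho>: "\<rho> permutes {k..<N}" "\<sigma> = \<sigma>0 \<circ> \<rho>" by auto
    have "\<rho> permutes {0..<N}" using \<rho>(1) by (rule permutes_subset) auto
    then have "\<sigma> permutes {0..<N}" unfolding \<rho>(2) by (intro permutes_compose \<sigma>0)
    moreover have "\<rho> i = i" if "i < k" for i using \<rho>(1) that by (simp add: permutes_def)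
    then have "restrict \<sigma> {0..<k} = restrict \<sigma>0 {0..<k}" by (auto simp: \<rho>(2) restrict_def fun_eq_iff)
    ultimately show "\<sigma> \<in> {\<sigma>. \<sigma> permutes {0..<N} \<and> restrict \<sigma> {0..<k} = f}" using r0 by simp
  qed
  moreover have "inj_on (\<lambda>\<rho>. \<sigma>0 \<circ> \<rho>) {\<rho>. \<rho> permutes {k..<N}}"
    using permutes_inj[OF \<sigma>0] by (auto simp: inj_on_def fun_eq_iff inj_def)
  ultimately show ?thesis by (simp add: card_image card_permutations)
qed

text \<open>Permutations are grouped by their restriction, each injective one having
  \<open>(N - k)!\<close> extensions. A non-injective \<open>f\<close> has an empty fibre, so
  \<open>Q f = 0\<close> there lets the sum run over all functions, the index set used by
  \<open>det_kernel_expansion\<close>.\<close>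

lemma sum_permutes_restrict:
  fixes Q :: "(nat \<Rightarrow> nat) \<Rightarrow> 'a::{comm_ring_1,semiring_char_0}"
  assumes "k \<le> N"
    and "\<And>f. f \<in> {0..<k} \<rightarrow>\<^sub>E {0..<N} \<Longrightarrow> \<not> inj_on f {0..<k} \<Longrightarrow> Q f = 0"
  shows "(\<Sum>\<sigma> | \<sigma> permutes {0..<N}. Q (restrict \<sigma> {0..<k})) = fact (N - k) * (\<Sum>f\<in>{0..<k} \<rightarrow>\<^sub>E {0..<N}. Q f)"
proof -
  let ?S = "{\<sigma>. \<sigma> permutes {0..<N}}" and ?T = "{0..<k} \<rightarrow>\<^sub>E {0..<N}"
  have "(\<Sum>\<sigma>\<in>?S. Q (restrict \<sigma> {0..<k})) =
    (\<Sum>f\<in>?T. \<Sum>\<sigma> | \<sigma> \<in> ?S \<and> restrict \<sigma> {0..<k} = f. Q (restrict \<sigma> {0..<k}))"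
  proof (rule sum.group[symmetric])
    show "(\<lambda>\<sigma>. restrict \<sigma> {0..<k}) ` ?S \<subseteq> ?T"
      using assms(1) by (auto simp: permutes_def PiE_def extensional_def)
  qed (auto intro: finite_permutations finite_PiE)
  also have "\<dots> = (\<Sum>f\<in>?T. fact (N - k) * Q f)"
  proof (rule sum.cong[OF refl])
    fix f assume f: "f \<in> ?T"
    have "(\<Sum>\<sigma> | \<sigma> \<in> ?S \<and> restrict \<sigma> {0..<k} = f. Q (restrict \<sigma> {0..<k})) =
       of_nat (card {\<sigma>. \<sigma> permutes {0..<N} \<and> restrict \<sigma> {0..<k} = f}) * Q f"
      by simp
    also have "\<dots> = fact (N - k) * Q f"
    proof (cases "inj_on f {0..<k}")
      case True
      then show ?thesis using card_permutes_extending[OF assms(1) f] by simp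
    next
      case False
      then show ?thesis using assms(2)[OF f] by simp
    qed
    finally show "(\<Sum>\<sigma> | \<sigma> \<in> ?S \<and> restrict \<sigma> {0..<k} = f. Q (restrict \<sigma> {0..<k})) = fact (N - k) * Q f" .
  qed
  finally show ?thesis by (simp add: sum_distrib_left)
qed

text \<open>Multilinearity in the rows: \<open>f\<close> records which summand is picked in each
  row, as in the proof of the Cauchy--Binet formula before equal index sets are collected.\<close>

lemma det_kernel_expansion:
  fixes a b :: "nat \<Rightarrow> nat \<Rightarrow> 'a::comm_ring_1"
  shows "Determinant.det (mat k k (\<lambda>(i, l). \<Sum>j<N. a j i * b j l)) =
    (\<Sum>f\<in>{0..<k} \<rightarrow>\<^sub>E {0..<N}. (\<Prod>i<k. a (f i) i) * Determinant.det (mat k k (\<lambda>(i, l). b (f i) l)))"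
proof -
  have "Determinant.det (mat k k (\<lambda>(i, l). \<Sum>j<N. a j i * b j l)) =
    (\<Sum>p | p permutes {0..<k}. signof p * (\<Prod>i = 0..<k. \<Sum>j\<in>{0..<N}. a j i * b j (p i)))"
    by (subst det_def'[of _ k]) (auto intro!: sum.cong prod.cong simp: lessThan_atLeast0 dest: permutes_in_image)
  also have "\<dots> = (\<Sum>p | p permutes {0..<k}. \<Sum>f\<in>{0..<k} \<rightarrow>\<^sub>E {0..<N}. signof p * (\<Prod>i = 0..<k. a (f i) i * b (f i) (p i)))"
    by (simp add: prod_sum_PiE sum_distrib_left)
  also have "\<dots> = (\<Sum>f\<in>{0..<k} \<rightarrow>\<^sub>E {0..<N}. \<Sum>p | p permutes {0..<k}. signof p * (\<Prod>i = 0..<k. a (f i) i * b (f i) (p i)))"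
    by (rule sum.swap)
  also have "\<dots> = (\<Sum>f\<in>{0..<k} \<rightarrow>\<^sub>E {0..<N}. (\<Prod>i<k. a (f i) i) * Determinant.det (mat k k (\<lambda>(i, l). b (f i) l)))"
    by (rule sum.cong[OF refl], subst det_def'[of _ k])
      (auto intro!: sum.cong prod.cong simp: prod.distrib sum_distrib_left lessThan_atLeast0 mult_ac dest: permutes_in_image)
  finally show ?thesis .
qed

lemma det_repeated_index:
  assumes "\<not> inj_on f {0..<k}"
  shows "Determinant.det (mat k k (\<lambda>(i, l). b (f i) l)) = (0::'a::comm_ring_1)"
proof -
  obtain i j where "i < k" "j < k" "i \<noteq> j" "f i = f j"
    using assms by (auto simp: inj_on_def)
  then show ?thesis
    by (intro det_identical_rows[of _ k i j]) (auto simp: row_def)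
qed

text \<open>All variables beyond the first \<open>k\<close> are integrated at once. After expanding
  over pairs \<open>\<sigma>\<close>, \<open>\<pi>\<close>, orthonormality forces
  \<open>\<pi> = \<sigma>\<close> on \<open>{k..<N}\<close>, so
  \<open>\<pi> = \<sigma> \<circ> \<rho>\<close> with \<open>\<rho>\<close> permuting the first
  \<open>k\<close> indices. The sum over \<open>\<rho>\<close> is a \<open>k\<close> by
  \<open>k\<close> determinant that sees \<open>\<sigma>\<close> only through its first
  \<open>k\<close> values, and the sum over \<open>\<sigma>\<close> then collapses to the kernel
  determinant.\<close>

lemma (in sigma_finite_measure) integral_det_squared:
  fixes \<Phi> :: "nat \<Rightarrow> 'a \<Rightarrow> complex"
  assumes kN: "k \<le> N"
    and int: "\<And>i j. i < N \<Longrightarrow> j < N \<Longrightarrow> integrable M (\<lambda>x. \<Phi> i x * cnj (\<Phi> j x))"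
    and orth: "\<And>i j. i < N \<Longrightarrow> j < N \<Longrightarrow> (\<integral>x. \<Phi> i x * cnj (\<Phi> j x) \<partial>M) = (if i = j then 1 else 0)"
  shows "(\<integral>\<eta>. complex_of_real ((cmod (Determinant.det (mat N N (\<lambda>(i, j). \<Phi> j (if i < k then \<zeta> i else \<eta> i)))))\<^sup>2)
      \<partial>(\<Pi>\<^sub>M j\<in>{k..<N}. M)) =
    fact (N - k) * Determinant.det (mat k k (\<lambda>(i, l). \<Sum>j<N. \<Phi> j (\<zeta> i) * cnj (\<Phi> j (\<zeta> l))))"
proof -
  let ?P = "{\<sigma>. \<sigma> permutes {0..<N}}"
  interpret product_sigma_finite "\<lambda>_::nat. M" by standard
  define A where "A \<sigma> \<pi> = (\<Prod>i<k. \<Phi> (\<sigma> i) (\<zeta> i) * cnj (\<Phi> (\<pi> i) (\<zeta> i)))" for \<sigma> \<pi> :: "nat \<Rightarrow> nat"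
  have lt: "\<sigma> i < N" if "\<sigma> \<in> ?P" "i < N" for \<sigma> i
    using that permutes_in_image[of \<sigma> "{0..<N}" i] by simp
  have split: "(\<Prod>i = 0..<N. g i) = (\<Prod>i<k. g i) * (\<Prod>i\<in>{k..<N}. g i)" for g :: "nat \<Rightarrow> complex"
    using kN by (simp add: lessThan_atLeast0 prod.atLeastLessThan_concat)
  have exp: "complex_of_real ((cmod (Determinant.det (mat N N (\<lambda>(i, j). \<Phi> j (if i < k then \<zeta> i else \<eta> i)))))\<^sup>2) =
    (\<Sum>\<sigma>\<in>?P. \<Sum>\<pi>\<in>?P. (signof \<sigma> * signof \<pi> * A \<sigma> \<pi>) * (\<Prod>i\<in>{k..<N}. \<Phi> (\<sigma> i) (\<eta> i) * cnj (\<Phi> (\<pi> i) (\<eta> i))))" for \<eta>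
  proof -
    let ?D = "Determinant.det (mat N N (\<lambda>(i, j). \<Phi> j (if i < k then \<zeta> i else \<eta> i)))"
    have D: "?D = (\<Sum>\<sigma>\<in>?P. signof \<sigma> * (\<Prod>i=0..<N. \<Phi> (\<sigma> i) (if i < k then \<zeta> i else \<eta> i)))"
      by (subst det_def'[of _ N]) (auto intro!: sum.cong prod.cong dest: permutes_in_image)
    have "complex_of_real ((cmod ?D)\<^sup>2) = ?D * cnj ?D" by (rule complex_norm_square)
    also have "\<dots> = (\<Sum>\<sigma>\<in>?P. \<Sum>\<pi>\<in>?P. (signof \<sigma> * (\<Prod>i=0..<N. \<Phi> (\<sigma> i) (if i < k then \<zeta> i else \<eta> i)))
       * (signof \<pi> * (\<Prod>i=0..<N. cnj (\<Phi> (\<pi> i) (if i < k then \<zeta> i else \<eta> i)))))"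
      unfolding D by (simp add: sum_product)
    also have "\<dots> = (\<Sum>\<sigma>\<in>?P. \<Sum>\<pi>\<in>?P. (signof \<sigma> * signof \<pi> * A \<sigma> \<pi>) * (\<Prod>i\<in>{k..<N}. \<Phi> (\<sigma> i) (\<eta> i) * cnj (\<Phi> (\<pi> i) (\<eta> i))))"
      unfolding split A_def by (intro sum.cong refl) (simp add: prod.distrib mult_ac)
    finally show ?thesis .
  qed
  have intp: "integrable (\<Pi>\<^sub>M j\<in>{k..<N}. M) (\<lambda>\<eta>. \<Prod>i\<in>{k..<N}. \<Phi> (\<sigma> i) (\<eta> i) * cnj (\<Phi> (\<pi> i) (\<eta> i)))"
    if "\<sigma> \<in> ?P" "\<pi> \<in> ?P" for \<sigma> \<pi>
    by (intro product_integrable_prod int lt[OF that(1)] lt[OF that(2)]) auto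
  have valp: "(\<integral>\<eta>. (\<Prod>i\<in>{k..<N}. \<Phi> (\<sigma> i) (\<eta> i) * cnj (\<Phi> (\<pi> i) (\<eta> i))) \<partial>(\<Pi>\<^sub>M j\<in>{k..<N}. M)) =
     (if \<forall>i\<in>{k..<N}. \<sigma> i = \<pi> i then 1 else 0)"
    if "\<sigma> \<in> ?P" "\<pi> \<in> ?P" for \<sigma> \<pi>
  proof -
    have "(\<integral>\<eta>. (\<Prod>i\<in>{k..<N}. \<Phi> (\<sigma> i) (\<eta> i) * cnj (\<Phi> (\<pi> i) (\<eta> i))) \<partial>(\<Pi>\<^sub>M j\<in>{k..<N}. M)) =
      (\<Prod>i\<in>{k..<N}. \<integral>x. \<Phi> (\<sigma> i) x * cnj (\<Phi> (\<pi> i) x) \<partial>M)"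
      by (intro product_integral_prod int lt[OF that(1)] lt[OF that(2)]) auto
    also have "\<dots> = (\<Prod>i\<in>{k..<N}. if \<sigma> i = \<pi> i then 1 else 0)"
      by (intro prod.cong refl orth lt[OF that(1)] lt[OF that(2)]) auto
    finally show ?thesis by auto
  qed
  have inner: "(\<Sum>\<pi>\<in>?P. signof \<sigma> * signof \<pi> * A \<sigma> \<pi> * (if \<forall>i\<in>{k..<N}. \<sigma> i = \<pi> i then 1 else 0)) =
    (\<Prod>i<k. \<Phi> (\<sigma> i) (\<zeta> i)) * Determinant.det (mat k k (\<lambda>(i, l). cnj (\<Phi> (\<sigma> i) (\<zeta> l))))"
    if \<sigma>: "\<sigma> permutes {0..<N}" for \<sigma>
  proof -
    have "(\<Sum>\<pi>\<in>?P. signof \<sigma> * signof \<pi> * A \<sigma> \<pi> * (if \<forall>i\<in>{k..<N}. \<sigma> i = \<pi> i then 1 else 0)) =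
      (\<Sum>\<pi> | \<pi> \<in> ?P \<and> (\<forall>i\<in>{k..<N}. \<sigma> i = \<pi> i). signof \<sigma> * signof \<pi> * A \<sigma> \<pi>)"
      by (simp add: sum.inter_filter[symmetric] finite_permutations if_distrib cong: if_cong)
    also have "{\<pi>. \<pi> \<in> ?P \<and> (\<forall>i\<in>{k..<N}. \<sigma> i = \<pi> i)} = (\<lambda>\<rho>. \<sigma> \<circ> \<rho>) ` {\<rho>. \<rho> permutes {0..<k}}"
    proof (intro equalityI subsetI)
      fix \<pi> assume "\<pi> \<in> {\<pi>. \<pi> \<in> ?P \<and> (\<forall>i\<in>{k..<N}. \<sigma> i = \<pi> i)}"
      then have \<pi>: "\<pi> permutes {0..<N}" "\<And>i. i \<in> {k..<N} \<Longrightarrow> \<pi> i = \<sigma> i" by auto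
      have "Hilbert_Choice.inv \<sigma> \<circ> \<pi> permutes {0..<k}"
      proof (rule permutes_superset)
        show "Hilbert_Choice.inv \<sigma> \<circ> \<pi> permutes {0..<N}" by (intro permutes_compose \<pi> permutes_inv \<sigma>)
        show "(Hilbert_Choice.inv \<sigma> \<circ> \<pi>) x = x" if "x \<in> {0..<N} - {0..<k}" for x
          using \<pi>(2)[of x] that \<sigma> by (simp add: permutes_inverses)
      qed
      moreover have "\<pi> = \<sigma> \<circ> (Hilbert_Choice.inv \<sigma> \<circ> \<pi>)" using \<sigma> by (auto simp: fun_eq_iff permutes_inverses)
      ultimately show "\<pi> \<in> (\<lambda>\<rho>. \<sigma> \<circ> \<rho>) ` {\<rho>. \<rho> permutes {0..<k}}" by blast
    next
      fix \<pi> assume "\<pi> \<in> (\<lambda>\<rho>. \<sigma> \<circ> \<rho>) ` {\<rho>. \<rho> permutes {0..<k}}"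
      then obtain \<rho> where \<rho>: "\<rho> permutes {0..<k}" "\<pi> = \<sigma> \<circ> \<rho>" by auto
      have "\<rho> permutes {0..<N}" using \<rho>(1) by (rule permutes_subset) (use kN in auto)
      then show "\<pi> \<in> {\<pi>. \<pi> \<in> ?P \<and> (\<forall>i\<in>{k..<N}. \<sigma> i = \<pi> i)}"
        using \<rho> permutes_compose[OF _ \<sigma>] by (auto simp: permutes_def)
    qed
    also have "(\<Sum>\<pi>\<in>\<dots>. signof \<sigma> * signof \<pi> * A \<sigma> \<pi>) =
      (\<Sum>\<rho> | \<rho> permutes {0..<k}. signof \<sigma> * signof (\<sigma> \<circ> \<rho>) * A \<sigma> (\<sigma> \<circ> \<rho>))"
      using permutes_inj[OF \<sigma>] by (subst sum.reindex) (auto simp: inj_on_def fun_eq_iff inj_def)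
    also have "\<dots> = (\<Sum>\<rho> | \<rho> permutes {0..<k}. (\<Prod>i<k. \<Phi> (\<sigma> i) (\<zeta> i)) * (signof \<rho> * (\<Prod>i=0..<k. cnj (\<Phi> (\<sigma> (\<rho> i)) (\<zeta> i)))))"
    proof (intro sum.cong refl)
      fix \<rho> assume "\<rho> \<in> {\<rho>. \<rho> permutes {0..<k}}"
      then have "sign (\<sigma> \<circ> \<rho>) = sign \<sigma> * sign \<rho>"
        using \<sigma> by (intro sign_compose) (auto simp: permutation_permutes)
      then have "sign \<sigma> * sign (\<sigma> \<circ> \<rho>) = sign \<rho>" by simp
      then have "(signof \<sigma> * signof (\<sigma> \<circ> \<rho>) :: complex) = signof \<rho>"
        by (metis of_int_mult)
      then show "signof \<sigma> * signof (\<sigma> \<circ> \<rho>) * A \<sigma> (\<sigma> \<circ> \<rho>) =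
         (\<Prod>i<k. \<Phi> (\<sigma> i) (\<zeta> i)) * (signof \<rho> * (\<Prod>i=0..<k. cnj (\<Phi> (\<sigma> (\<rho> i)) (\<zeta> i))))"
        by (simp add: A_def prod.distrib lessThan_atLeast0)
    qed
    also have "\<dots> = (\<Prod>i<k. \<Phi> (\<sigma> i) (\<zeta> i)) * Determinant.det (mat k k (\<lambda>(i, l). cnj (\<Phi> (\<sigma> l) (\<zeta> i))))"
      by (subst det_def'[of _ k]) (auto intro!: arg_cong2[where f="(*)"] sum.cong prod.cong simp: sum_distrib_left[symmetric] dest: permutes_in_image)
    also have "mat k k (\<lambda>(i, l). cnj (\<Phi> (\<sigma> l) (\<zeta> i))) = transpose_mat (mat k k (\<lambda>(i, l). cnj (\<Phi> (\<sigma> i) (\<zeta> l))))"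
      by (rule eq_matI) auto
    also have "Determinant.det \<dots> = Determinant.det (mat k k (\<lambda>(i, l). cnj (\<Phi> (\<sigma> i) (\<zeta> l))))"
      by (rule det_transpose[of _ k]) auto
    finally show ?thesis .
  qed
  define Q where "Q f = (\<Prod>i<k. \<Phi> (f i) (\<zeta> i)) * Determinant.det (mat k k (\<lambda>(i, l). cnj (\<Phi> (f i) (\<zeta> l))))" for f :: "nat \<Rightarrow> nat"
  have "(\<integral>\<eta>. complex_of_real ((cmod (Determinant.det (mat N N (\<lambda>(i, j). \<Phi> j (if i < k then \<zeta> i else \<eta> i)))))\<^sup>2)
      \<partial>(\<Pi>\<^sub>M j\<in>{k..<N}. M)) =
      (\<Sum>\<sigma>\<in>?P. \<Sum>\<pi>\<in>?P. signof \<sigma> * signof \<pi> * A \<sigma> \<pi> * (if \<forall>i\<in>{k..<N}. \<sigma> i = \<pi> i then 1 else 0))"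
  proof -
    let ?M = "\<Pi>\<^sub>M j\<in>{k..<N}. M"
    let ?c = "\<lambda>\<sigma> \<pi>. signof \<sigma> * signof \<pi> * A \<sigma> \<pi> :: complex"
    let ?g = "\<lambda>\<sigma> \<pi> \<eta>. \<Prod>i\<in>{k..<N}. \<Phi> (\<sigma> i) (\<eta> i) * cnj (\<Phi> (\<pi> i) (\<eta> i))"
    have "(\<integral>\<eta>. (\<Sum>\<sigma>\<in>?P. \<Sum>\<pi>\<in>?P. ?c \<sigma> \<pi> * ?g \<sigma> \<pi> \<eta>) \<partial>?M) =
      (\<Sum>\<sigma>\<in>?P. \<integral>\<eta>. (\<Sum>\<pi>\<in>?P. ?c \<sigma> \<pi> * ?g \<sigma> \<pi> \<eta>) \<partial>?M)"
      by (intro Bochner_Integration.integral_sum Bochner_Integration.integrable_sum integrable_mult_right intp)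
    also have "\<dots> = (\<Sum>\<sigma>\<in>?P. \<Sum>\<pi>\<in>?P. \<integral>\<eta>. ?c \<sigma> \<pi> * ?g \<sigma> \<pi> \<eta> \<partial>?M)"
      by (intro sum.cong refl Bochner_Integration.integral_sum integrable_mult_right intp)
    also have "\<dots> = (\<Sum>\<sigma>\<in>?P. \<Sum>\<pi>\<in>?P. ?c \<sigma> \<pi> * (if \<forall>i\<in>{k..<N}. \<sigma> i = \<pi> i then 1 else 0))"
      by (intro sum.cong refl) (simp only: integral_mult_right_zero valp)
    finally show ?thesis unfolding exp .
  qed
  also have "\<dots> = (\<Sum>\<sigma>\<in>?P. Q (restrict \<sigma> {0..<k}))"
  proof (intro sum.cong refl)
    fix \<sigma> assume "\<sigma> \<in> ?P"
    then have "(\<Sum>\<pi>\<in>?P. signof \<sigma> * signof \<pi> * A \<sigma> \<pi> * (if \<forall>i\<in>{k..<N}. \<sigma> i = \<pi> i then 1 else 0)) =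
     (\<Prod>i<k. \<Phi> (\<sigma> i) (\<zeta> i)) * Determinant.det (mat k k (\<lambda>(i, l). cnj (\<Phi> (\<sigma> i) (\<zeta> l))))" using inner by blast
    also have "\<dots> = Q (restrict \<sigma> {0..<k})"
      unfolding Q_def by (intro arg_cong2[where f="(*)"] arg_cong[where f=Determinant.det] eq_matI prod.cong) auto
    finally show "(\<Sum>\<pi>\<in>?P. signof \<sigma> * signof \<pi> * A \<sigma> \<pi> * (if \<forall>i\<in>{k..<N}. \<sigma> i = \<pi> i then 1 else 0)) = Q (restrict \<sigma> {0..<k})" .
  qed
  also have "\<dots> = fact (N - k) * (\<Sum>f\<in>{0..<k} \<rightarrow>\<^sub>E {0..<N}. Q f)"
    by (rule sum_permutes_restrict[OF kN])
      (simp add: Q_def det_repeated_index[of _ k "\<lambda>j l. cnj (\<Phi> j (\<zeta> l))", simplified])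
  also have "(\<Sum>f\<in>{0..<k} \<rightarrow>\<^sub>E {0..<N}. Q f) =
     Determinant.det (mat k k (\<lambda>(i, l). \<Sum>j<N. \<Phi> j (\<zeta> i) * cnj (\<Phi> j (\<zeta> l))))"
    unfolding Q_def det_kernel_expansion ..
  finally show ?thesis .
qed

section \<open>Polynomial bases, the Vandermonde determinant and the interaction term\<close>

text \<open>The matrix is the Vandermonde matrix times the coefficient matrix, which the degree
  bound makes upper triangular; its diagonal consists of the leading coefficients.\<close>

lemma det_poly_matrix:
  fixes p :: "nat \<Rightarrow> 'a::idom poly"
  assumes "\<And>j. j < N \<Longrightarrow> degree (p j) \<le> j"
  shows "Determinant.det (mat N N (\<lambda>(i, j). poly (p j) (u i))) =
    Determinant.det (mat N N (\<lambda>(i, j). u i ^ j)) * (\<Prod>j<N. coeff (p j) j)"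
proof -
  let ?V = "mat N N (\<lambda>(i, j). u i ^ j)" and ?C = "mat N N (\<lambda>(m, j). coeff (p j) m)"
  have "mat N N (\<lambda>(i, j). poly (p j) (u i)) = ?V * ?C"
  proof (rule eq_matI)
    fix i j assume ij: "i < dim_row (?V * ?C)" "j < dim_col (?V * ?C)"
    have "poly (p j) (u i) = (\<Sum>m\<le>degree (p j). coeff (p j) m * u i ^ m)" by (rule poly_altdef)
    also have "\<dots> = (\<Sum>m\<in>{0..<N}. u i ^ m * coeff (p j) m)"
      using assms[of j] ij by (intro sum.mono_neutral_cong_left) (auto simp: coeff_eq_0 mult.commute)
    finally show "mat N N (\<lambda>(i, j). poly (p j) (u i)) $$ (i, j) = (?V * ?C) $$ (i, j)"
      using ij by (simp add: scalar_prod_def)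
  qed auto
  moreover have "Determinant.det (?V * ?C) = Determinant.det ?V * Determinant.det ?C"
    by (rule det_mult[of _ N]) auto
  moreover have "Determinant.det ?C = (\<Prod>j<N. coeff (p j) j)"
  proof (subst det_upper_triangular[of _ N])
    show "upper_triangular ?C"
    proof (rule upper_triangularI)
      fix i j assume "j < i" "i < dim_row ?C"
      then show "?C $$ (i, j) = 0" using assms[of j] by (simp add: coeff_eq_0)
    qed
  qed (auto simp: prod_list_diag_prod lessThan_atLeast0)
  ultimately show ?thesis by simp
qed

text \<open>Expanding in the Newton basis \<open>\<Prod>i<j. X - u i\<close> makes the matrix triangular.\<close>

lemma det_vandermonde:
  fixes u :: "nat \<Rightarrow> 'a::idom"
  shows "Determinant.det (mat N N (\<lambda>(i, j). u i ^ j)) = (\<Prod>j<N. \<Prod>i<j. u j - u i)"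
proof -
  define p where "p j = (\<Prod>i<j. [:- u i, 1:])" for j
  have deg: "degree (p j) = j" for j
    unfolding p_def by (subst degree_prod_eq_sum_degree) auto
  have lead: "coeff (p j) j = 1" for j
    using deg[of j] lead_coeff_prod[of "\<lambda>i. [:- u i, 1:]" "{..<j}"] by (simp add: p_def)
  have "Determinant.det (mat N N (\<lambda>(i, j). poly (p j) (u i))) = (\<Prod>j<N. \<Prod>i<j. u j - u i)"
  proof (subst det_lower_triangular[of N])
    show "mat N N (\<lambda>(i, j). poly (p j) (u i)) $$ (i, j) = 0" if "i < j" "j < N" for i j
      using that by (auto simp: p_def poly_prod)
  qed (auto simp: prod_list_diag_prod p_def poly_prod lessThan_atLeast0 intro!: prod.cong)
  moreover have "Determinant.det (mat N N (\<lambda>(i, j). poly (p j) (u i))) =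
    Determinant.det (mat N N (\<lambda>(i, j). u i ^ j)) * (\<Prod>j<N. coeff (p j) j)"
    by (rule det_poly_matrix) (simp add: deg)
  ultimately show ?thesis by (simp add: lead)
qed

text \<open>The Hamiltonian runs over ordered pairs, so each unordered pair contributes twice; this
  produces the square of the Vandermonde modulus.\<close>

lemma prod_offdiagonal_norm:
  fixes u :: "nat \<Rightarrow> complex"
  shows "(\<Prod>(j, l)\<in>{(j, l). j < N \<and> l < N \<and> j \<noteq> l}. cmod (u j - u l)) =
    (cmod (Determinant.det (mat N N (\<lambda>(i, j). u i ^ j))))\<^sup>2"
proof -
  let ?L = "{(j, l). j < N \<and> l < N \<and> l < j}" and ?U = "{(j, l). j < N \<and> l < N \<and> j < l}"
  have L: "?L = Sigma {..<N} (\<lambda>j. {..<j})" by auto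
  then have finL: "finite ?L" by simp
  have U: "?U = prod.swap ` ?L" by auto
  have finU: "finite ?U" unfolding U using finL by simp
  have disj: "?L \<inter> ?U = {}" by auto
  have "{(j, l). j < N \<and> l < N \<and> j \<noteq> l} = ?L \<union> ?U" by auto
  then have "(\<Prod>(j, l)\<in>{(j, l). j < N \<and> l < N \<and> j \<noteq> l}. cmod (u j - u l)) =
    (\<Prod>(j, l)\<in>?L. cmod (u j - u l)) * (\<Prod>(j, l)\<in>?U. cmod (u j - u l))"
    by (simp only: prod.union_disjoint[OF finL finU disj])
  also have "(\<Prod>(j, l)\<in>?U. cmod (u j - u l)) = (\<Prod>(j, l)\<in>?L. cmod (u j - u l))"
    unfolding U by (subst prod.reindex) (auto simp: inj_on_def norm_minus_commute case_prod_unfold intro!: prod.cong)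
  also have "(\<Prod>(j, l)\<in>?L. cmod (u j - u l)) = cmod (Determinant.det (mat N N (\<lambda>(i, j). u i ^ j)))"
    unfolding L det_vandermonde by (subst prod.Sigma[symmetric]) (auto simp: prod_norm)
  finally show ?thesis by (simp add: power2_eq_square)
qed

section \<open>Radial and rotational integration in the plane\<close>

lemma area_measure_density: "area_measure = density lborel (\<lambda>_. ennreal (1 / pi))"
  unfolding area_measure_def
  by (rule measure_eqI) (simp_all add: emeasure_density nn_integral_cmult)

lemma sets_area_measure [measurable_cong, simp]: "sets area_measure = sets borel"
  by (simp add: area_measure_density)

lemma space_area_measure [simp]: "space area_measure = UNIV"
  by (simp add: area_measure_density)

text \<open>Makes Fubini in real and imaginary part available on the complex plane; it suffices to
  compare the measures of open boxes.\<close>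

lemma lborel_complex_pair:
  "(lborel :: complex measure) = distr (lborel \<Otimes>\<^sub>M lborel) borel (\<lambda>(x, y). Complex x y)"
proof (rule lborel_eqI)
  fix l u :: complex assume le: "\<And>b. b \<in> Basis \<Longrightarrow> l \<bullet> b \<le> u \<bullet> b"
  have m: "(\<lambda>(x, y). Complex x y) \<in> measurable (lborel \<Otimes>\<^sub>M lborel :: (real \<times> real) measure) borel"
    unfolding Complex_eq by measurable
  have "(\<lambda>(x, y). Complex x y) -` box l u = {Re l<..<Re u} \<times> {Im l<..<Im u}"
    by (auto simp: in_box_complex_iff)
  then show "emeasure (distr (lborel \<Otimes>\<^sub>M lborel) borel (\<lambda>(x, y). Complex x y)) (box l u) = (\<Prod>b\<in>Basis. (u - l) \<bullet> b)"
    using le[of 1] le[of \<i>]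
    by (subst emeasure_distr[OF m])
      (auto simp: space_pair_measure lborel.emeasure_pair_measure_Times Basis_complex_def ennreal_mult' inner_complex_def)
qed simp

lemma nn_integral_complex:
  assumes [measurable]: "f \<in> borel_measurable borel"
  shows "(\<integral>\<^sup>+z. f z \<partial>lborel) = (\<integral>\<^sup>+y. \<integral>\<^sup>+x. f (Complex x y) \<partial>lborel \<partial>lborel)"
    and "(\<integral>\<^sup>+z. f z \<partial>lborel) = (\<integral>\<^sup>+x. \<integral>\<^sup>+y. f (Complex x y) \<partial>lborel \<partial>lborel)"
proof -
  have [measurable]: "(\<lambda>(x, y). Complex x y) \<in> measurable (lborel \<Otimes>\<^sub>M lborel :: (real \<times> real) measure) borel"
    unfolding Complex_eq by measurable
  have *: "(\<integral>\<^sup>+z. f z \<partial>lborel) = (\<integral>\<^sup>+p. f (case p of (x, y) \<Rightarrow> Complex x y) \<partial>(lborel \<Otimes>\<^sub>M lborel))"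
    by (subst lborel_complex_pair, subst nn_integral_distr) auto
  show "(\<integral>\<^sup>+z. f z \<partial>lborel) = (\<integral>\<^sup>+y. \<integral>\<^sup>+x. f (Complex x y) \<partial>lborel \<partial>lborel)"
    unfolding * by (subst lborel_pair.nn_integral_snd[symmetric]) auto
  show "(\<integral>\<^sup>+z. f z \<partial>lborel) = (\<integral>\<^sup>+x. \<integral>\<^sup>+y. f (Complex x y) \<partial>lborel \<partial>lborel)"
    unfolding * by (subst lborel.nn_integral_fst[symmetric]) auto
qed

text \<open>A rotation is a product of three shears, and shears preserve Lebesgue measure by Fubini.\<close>

lemma nn_integral_rotate:
  fixes c :: complex
  assumes [measurable]: "f \<in> borel_measurable borel" and c: "cmod c = 1" "c \<noteq> -1"
  shows "(\<integral>\<^sup>+z. f (c * z) \<partial>lborel) = (\<integral>\<^sup>+z. f z \<partial>lborel)"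
proof -
  have [measurable]: "(\<lambda>z. Complex (g z) (h z)) \<in> borel_measurable borel"
    if [measurable]: "g \<in> borel_measurable borel" "h \<in> borel_measurable borel" for g h :: "complex \<Rightarrow> real"
    unfolding Complex_eq by measurable
  have sh1: "(\<integral>\<^sup>+z. g (Complex (Re z + k * Im z) (Im z)) \<partial>lborel) = (\<integral>\<^sup>+z. g z \<partial>lborel)"
    if [measurable]: "g \<in> borel_measurable borel" for g :: "complex \<Rightarrow> ennreal" and k
  proof -
    have "(\<integral>\<^sup>+x. g (Complex (x + k * y) y) \<partial>lborel) = (\<integral>\<^sup>+x. g (Complex x y) \<partial>lborel)" for y
      using nn_integral_real_affine[of "\<lambda>x. g (Complex x y)" 1 "k * y"]
      by (simp add: add.commute Complex_eq)
    then show ?thesis by (simp add: nn_integral_complex(1))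
  qed
  have sh2: "(\<integral>\<^sup>+z. g (Complex (Re z) (Im z + k * Re z)) \<partial>lborel) = (\<integral>\<^sup>+z. g z \<partial>lborel)"
    if [measurable]: "g \<in> borel_measurable borel" for g :: "complex \<Rightarrow> ennreal" and k
  proof -
    have "(\<integral>\<^sup>+y. g (Complex x (y + k * x)) \<partial>lborel) = (\<integral>\<^sup>+y. g (Complex x y) \<partial>lborel)" for x
      using nn_integral_real_affine[of "\<lambda>y. g (Complex x y)" 1 "k * x"]
      by (simp add: add.commute Complex_eq)
    then show ?thesis by (simp add: nn_integral_complex(2))
  qed
  define p q where "p = Re c" and "q = Im c"
  have pq: "p\<^sup>2 + q\<^sup>2 = 1" using c(1) cmod_power2[of c] by (simp add: p_def q_def)
  have "p \<noteq> -1" using pq c(2) by (auto simp: p_def q_def complex_eq_iff)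
  then have p1: "1 + p \<noteq> 0" by linarith
  \<comment> \<open>Minus the tangent of half the rotation angle; the value \<open>c = -1\<close> is
    excluded because the tangent is infinite there.\<close>
  define a where "a = - q / (1 + p)"
  have a1: "1 + a * q = p"
  proof -
    have "1 + a * q = (1 + p - q\<^sup>2) / (1 + p)" using p1 by (simp add: a_def field_simps power2_eq_square)
    also have "1 + p - q\<^sup>2 = p * (1 + p)" using pq by (simp add: power2_eq_square algebra_simps)
    finally show ?thesis using p1 by simp
  qed
  have a2: "a * (1 + p) = - q" using p1 by (simp add: a_def)
  define S where "S z = Complex (Re z + a * Im z) (Im z)" for z
  define R where "R z = Complex (Re z) (Im z + q * Re z)" for z
  have [measurable]: "S \<in> borel_measurable borel" "R \<in> borel_measurable borel"
    unfolding S_def R_def by measurable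
  have "S (R (S z)) = c * z" for z
  proof (rule complex_eqI)
    have "Re (S (R (S z))) = (1 + a * q) * Re z + (a + a * (1 + a * q)) * Im z"
      by (simp add: S_def R_def algebra_simps)
    also have "a + a * (1 + a * q) = a * (1 + p)" unfolding a1 by (simp add: algebra_simps)
    finally show "Re (S (R (S z))) = Re (c * z)" unfolding a1 a2 by (simp add: p_def q_def)
    have "Im (S (R (S z))) = (1 + a * q) * Im z + q * Re z"
      by (simp add: S_def R_def algebra_simps)
    then show "Im (S (R (S z))) = Im (c * z)" unfolding a1 by (simp add: p_def q_def)
  qed
  then have "(\<integral>\<^sup>+z. f (c * z) \<partial>lborel) = (\<integral>\<^sup>+z. f (S (R (S z))) \<partial>lborel)" by simp
  also have "\<dots> = (\<integral>\<^sup>+z. f (S (R z)) \<partial>lborel)"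
    using sh1[of "\<lambda>z. f (S (R z))" a] by (simp add: S_def[symmetric])
  also have "\<dots> = (\<integral>\<^sup>+z. f (S z) \<partial>lborel)"
    using sh2[of "\<lambda>z. f (S z)" q] by (simp add: R_def[symmetric])
  also have "\<dots> = (\<integral>\<^sup>+z. f z \<partial>lborel)"
    using sh1[of f a] by (simp add: S_def[symmetric])
  finally show ?thesis .
qed

lemma distr_rotate_area:
  assumes c: "cmod c = 1" "c \<noteq> -1"
  shows "distr area_measure borel (\<lambda>z. c * z) = area_measure"
proof (rule measure_eqI)
  fix A assume "A \<in> sets (distr area_measure borel (\<lambda>z. c * z))"
  then have [measurable]: "A \<in> sets borel" by simp
  have "emeasure (distr area_measure borel (\<lambda>z. c * z)) A = (\<integral>\<^sup>+z. indicator A (c * z) \<partial>area_measure)"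
  proof -
    have "emeasure (distr area_measure borel (\<lambda>z. c * z)) A = (\<integral>\<^sup>+z. indicator A z \<partial>distr area_measure borel (\<lambda>z. c * z))"
      by simp
    also have "\<dots> = (\<integral>\<^sup>+z. indicator A (c * z) \<partial>area_measure)"
      by (rule nn_integral_distr) measurable
    finally show ?thesis .
  qed
  also have "\<dots> = ennreal (1 / pi) * (\<integral>\<^sup>+z. indicator A (c * z) \<partial>lborel)"
    by (simp add: area_measure_density nn_integral_density nn_integral_cmult)
  also have "\<dots> = ennreal (1 / pi) * (\<integral>\<^sup>+z. indicator A z \<partial>lborel)"
    using nn_integral_rotate[of "indicator A" c] c by simp
  also have "\<dots> = emeasure area_measure A"
    by (simp add: area_measure_density emeasure_density nn_integral_cmult)
  finally show "emeasure (distr area_measure borel (\<lambda>z. c * z)) A = emeasure area_measure A" .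
qed simp

text \<open>A disc of radius \<open>sqrt x\<close> has mass \<open>x\<close> under
  \<open>area_measure\<close>. Hence polar coordinates in the variable \<open>r = |z|^2\<close>
  carry no Jacobian. The half-lines \<open>{..x}\<close> suffice for the comparison.\<close>

lemma distr_norm_square_area:
  "distr area_measure borel (\<lambda>z. (cmod z)\<^sup>2) = density lborel (indicator {0..})"
proof (rule measure_eqI_generator_eq[where E="range atMost" and A="\<lambda>n. {..real n}" and \<Omega>=UNIV])
  show "Int_stable (range atMost :: real set set)"
    by (auto simp: Int_stable_def)
  show "sets (distr area_measure borel (\<lambda>z. (cmod z)\<^sup>2)) = sigma_sets UNIV (range atMost)"
    and "sets (density lborel (indicator {0..})) = sigma_sets UNIV (range atMost :: real set set)"
    by (simp_all add: borel_eq_atMost)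
  have key: "emeasure (distr area_measure borel (\<lambda>z. (cmod z)\<^sup>2)) {..x} = ennreal x" for x :: real
  proof -
    have "emeasure (distr area_measure borel (\<lambda>z. (cmod z)\<^sup>2)) {..x} = emeasure area_measure {z. (cmod z)\<^sup>2 \<le> x}"
      by (subst emeasure_distr) (auto simp: vimage_def)
    also have "\<dots> = ennreal x"
    proof (cases "x \<ge> 0")
      case True
      have "(cmod z)\<^sup>2 \<le> x \<longleftrightarrow> cmod z \<le> sqrt x" for z
        using real_sqrt_le_iff[of "(cmod z)\<^sup>2" x] by (simp only: real_sqrt_abs abs_norm_cancel)
      then have "{z. (cmod z)\<^sup>2 \<le> x} = cball 0 (sqrt x)"
        by (simp only: cball_def dist_0_norm)
      then have "emeasure area_measure {z. (cmod z)\<^sup>2 \<le> x} = ennreal (1 / pi) * emeasure lborel (cball (0::complex) (sqrt x))"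
        by (simp add: area_measure_density emeasure_density nn_integral_cmult_indicator)
      also have "\<dots> = ennreal (1 / pi * (pi * x))"
        using True by (subst emeasure_cball) (auto simp: unit_ball_vol_2 ennreal_mult'[symmetric])
      finally show ?thesis by simp
    next
      case False
      then have "\<not> (cmod z)\<^sup>2 \<le> x" for z using zero_le_power2[of "cmod z"] by linarith
      then have "{z. (cmod z)\<^sup>2 \<le> x} = {}" by simp
      then show ?thesis using False by (simp add: ennreal_neg)
    qed
    finally show ?thesis .
  qed
  have key2: "emeasure (density lborel (indicator {0..})) {..x} = ennreal x" for x :: real
  proof -
    have "emeasure (density lborel (indicator {0..})) {..x} = (\<integral>\<^sup>+r. indicator {0..x} r \<partial>lborel)"
    proof (subst emeasure_density)
      have "indicator {0..} r * indicator {..x} r = (indicator {0..x} r :: ennreal)" for r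
        by (simp add: indicator_def)
      then show "(\<integral>\<^sup>+r. indicator {0..} r * indicator {..x} r \<partial>lborel) = (\<integral>\<^sup>+r. indicator {0..x} r \<partial>lborel)"
        by (simp only:)
    qed simp_all
    then show ?thesis by (cases "x \<ge> 0") (auto simp: ennreal_neg)
  qed
  show "emeasure (distr area_measure borel (\<lambda>z. (cmod z)\<^sup>2)) X = emeasure (density lborel (indicator {0..})) X"
    if "X \<in> range atMost" for X
  proof -
    from that obtain x where "X = {..x}" by (rule rangeE)
    then show ?thesis by (simp only: key key2)
  qed
  show "emeasure (distr area_measure borel (\<lambda>z. (cmod z)\<^sup>2)) {..real n} \<noteq> \<infinity>" for n :: nat
    unfolding key by simp
  show "(\<Union>n. {..real n}) = UNIV" using real_arch_simple by blast
  show "range atMost \<subseteq> Pow (UNIV :: real set)" by simp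
  show "range (\<lambda>n. {..real n}) \<subseteq> range atMost" by blast
qed

lemma nn_integral_radial:
  assumes [measurable]: "f \<in> borel_measurable borel"
  shows "(\<integral>\<^sup>+z. f ((cmod z)\<^sup>2) \<partial>area_measure) = (\<integral>\<^sup>+r. f r * indicator {0..} r \<partial>lborel)"
proof -
  have "(\<integral>\<^sup>+z. f ((cmod z)\<^sup>2) \<partial>area_measure) = (\<integral>\<^sup>+r. f r \<partial>(distr area_measure borel (\<lambda>z. (cmod z)\<^sup>2)))"
    by (subst nn_integral_distr) auto
  then show ?thesis
    unfolding distr_norm_square_area by (subst (asm) nn_integral_density) (auto simp: mult.commute)
qed

section \<open>Gamma and Gaussian moments, and the Gamma mixture\<close>

lemma nn_integral_power_exp:
  assumes "p > 0"
  shows "(\<integral>\<^sup>+t. ennreal (t ^ k * exp (- p * t)) * indicator {0..} t \<partial>lborel) = ennreal (fact k / p ^ Suc k)"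
proof -
  have "ennreal (fact k) = ennreal p * (\<integral>\<^sup>+t. ennreal ((p * t) ^ k * exp (- (p * t))) * indicator {0..} (p * t) \<partial>lborel)"
    using nn_intergal_power_times_exp_Ici[of k] assms
    by (subst (asm) nn_integral_real_affine[where c=p and t=0]) auto
  also have "(\<integral>\<^sup>+t. ennreal ((p * t) ^ k * exp (- (p * t))) * indicator {0..} (p * t) \<partial>lborel) =
    (\<integral>\<^sup>+t. ennreal (p ^ k) * (ennreal (t ^ k * exp (- p * t)) * indicator {0..} t) \<partial>lborel)"
    using assms by (intro nn_integral_cong)
      (auto simp: ennreal_mult'[symmetric] power_mult_distrib zero_le_mult_iff mult_ac split: split_indicator)
  also have "\<dots> = ennreal (p ^ k) * (\<integral>\<^sup>+t. ennreal (t ^ k * exp (- p * t)) * indicator {0..} t \<partial>lborel)"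
    by (rule nn_integral_cmult) simp
  finally have "ennreal (fact k) = ennreal (p ^ Suc k) * (\<integral>\<^sup>+t. ennreal (t ^ k * exp (- p * t)) * indicator {0..} t \<partial>lborel)"
    using assms by (simp add: ennreal_mult' mult.assoc)
  then have "ennreal (1 / p ^ Suc k) * ennreal (fact k) =
     (ennreal (1 / p ^ Suc k) * ennreal (p ^ Suc k)) * (\<integral>\<^sup>+t. ennreal (t ^ k * exp (- p * t)) * indicator {0..} t \<partial>lborel)"
    by (simp only: mult.assoc)
  moreover have "ennreal (1 / p ^ Suc k) * ennreal (p ^ Suc k) = 1"
    using assms by (subst ennreal_mult'[symmetric]) auto
  moreover have "ennreal (1 / p ^ Suc k) * ennreal (fact k) = ennreal (fact k / p ^ Suc k)"
    using assms by (subst ennreal_mult'[symmetric]) auto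
  ultimately show ?thesis by simp
qed

lemma nn_integral_odd_power_gauss:
  assumes "p > 0"
  shows "(\<integral>\<^sup>+r. ennreal (r ^ (2 * m + 1) * exp (- p * r\<^sup>2)) * indicator {0..} r \<partial>lborel) = ennreal (fact m / (2 * p ^ Suc m))"
proof -
  define s where "s = sqrt p"
  have s: "s > 0" "s\<^sup>2 = p" using assms by (auto simp: s_def)
  have sp: "s ^ (2 * m + 2) = p ^ Suc m" using s(2) by (simp add: power_mult[symmetric] power_add power2_eq_square[symmetric] power_mult)
  have "(\<integral>\<^sup>+x. ennreal (x ^ (2 * m + 1) * exp (- x\<^sup>2)) * indicator {0..} x \<partial>lborel) =
    (\<integral>\<^sup>+x. ennreal (indicator {0..} x *\<^sub>R (exp (- x\<^sup>2) * x ^ (2 * m + 1))) \<partial>lborel)"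
    by (intro nn_integral_cong) (auto split: split_indicator simp: mult.commute)
  also have "\<dots> = ennreal (fact m / 2)"
    using gaussian_moment_odd_pos[of m]
    by (subst nn_integral_eq_integral) (auto simp: has_bochner_integral_iff split: split_indicator)
  finally have "ennreal (fact m / 2) = (\<integral>\<^sup>+x. ennreal (x ^ (2 * m + 1) * exp (- x\<^sup>2)) * indicator {0..} x \<partial>lborel)" ..
  also have "\<dots> = ennreal s * (\<integral>\<^sup>+r. ennreal ((s * r) ^ (2 * m + 1) * exp (- (s * r)\<^sup>2)) * indicator {0..} (s * r) \<partial>lborel)"
    using s by (subst nn_integral_real_affine[where c=s and t=0]) auto
  also have "(\<integral>\<^sup>+r. ennreal ((s * r) ^ (2 * m + 1) * exp (- (s * r)\<^sup>2)) * indicator {0..} (s * r) \<partial>lborel) =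
    (\<integral>\<^sup>+r. ennreal (s ^ (2 * m + 1)) * (ennreal (r ^ (2 * m + 1) * exp (- p * r\<^sup>2)) * indicator {0..} r) \<partial>lborel)"
    using s by (intro nn_integral_cong)
      (auto simp: ennreal_mult'[symmetric] power_mult_distrib zero_le_mult_iff mult_ac split: split_indicator)
  also have "\<dots> = ennreal (s ^ (2 * m + 1)) * (\<integral>\<^sup>+r. ennreal (r ^ (2 * m + 1) * exp (- p * r\<^sup>2)) * indicator {0..} r \<partial>lborel)"
    by (rule nn_integral_cmult) simp
  finally have "ennreal (fact m / 2) = ennreal (p ^ Suc m) * (\<integral>\<^sup>+r. ennreal (r ^ (2 * m + 1) * exp (- p * r\<^sup>2)) * indicator {0..} r \<partial>lborel)"
    using s unfolding sp[symmetric] by (simp add: ennreal_mult' mult.assoc)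
  then have "ennreal (1 / p ^ Suc m) * ennreal (fact m / 2) =
     (ennreal (1 / p ^ Suc m) * ennreal (p ^ Suc m)) * (\<integral>\<^sup>+r. ennreal (r ^ (2 * m + 1) * exp (- p * r\<^sup>2)) * indicator {0..} r \<partial>lborel)"
    by (simp only: mult.assoc)
  moreover have "ennreal (1 / p ^ Suc m) * ennreal (p ^ Suc m) = 1"
    using assms by (subst ennreal_mult'[symmetric]) auto
  moreover have "ennreal (1 / p ^ Suc m) * ennreal (fact m / 2) = ennreal (fact m / (2 * p ^ Suc m))"
    using assms by (subst ennreal_mult'[symmetric]) auto
  ultimately show ?thesis by simp
qed

text \<open>For \<open>\<nu> \<ge> 1\<close> and \<open>c > 0\<close> this is
  \<open>2 c^(\<nu>/2) K_\<nu>(2 sqrt c)\<close>. Unlike \<open>K_\<nu>\<close> it stays finite and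
  continuous down to \<open>c = 0\<close>, so the weight can be handled at the origin.\<close>

definition gamma_mixture :: "nat \<Rightarrow> real \<Rightarrow> real" where
  "gamma_mixture \<nu> c = (LBINT t:{0..}. t ^ (\<nu> - 1) * exp (- t - c / t))"

lemma gamma_mixture_integrable:
  assumes "c \<ge> 0"
  shows "set_integrable lborel {0..} (\<lambda>t::real. t ^ (\<nu> - 1) * exp (- t - c / t))"
  unfolding set_integrable_def
proof (rule Bochner_Integration.integrable_bound)
  show "integrable lborel (\<lambda>t::real. indicator {0..} t *\<^sub>R (t ^ (\<nu> - 1) * exp (- t)))"
  proof (rule integrableI_nonneg)
    have "(\<integral>\<^sup>+t. ennreal (indicator {0..} t *\<^sub>R (t ^ (\<nu> - 1) * exp (- t))) \<partial>lborel) =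
      (\<integral>\<^sup>+t. ennreal (t ^ (\<nu> - 1) * exp (- t)) * indicator {0..} t \<partial>lborel)"
      by (intro nn_integral_cong) (auto split: split_indicator)
    then show "(\<integral>\<^sup>+t. ennreal (indicator {0..} t *\<^sub>R (t ^ (\<nu> - 1) * exp (- t))) \<partial>lborel) < \<infinity>"
      unfolding nn_intergal_power_times_exp_Ici by simp
  qed (auto split: split_indicator)
  show "AE t in lborel. norm (indicator {0..} t *\<^sub>R (t ^ (\<nu> - 1) * exp (- t - c / t))) \<le> norm (indicator {0..} t *\<^sub>R (t ^ (\<nu> - 1) * exp (- t)))"
    using assms by (auto simp: abs_mult split: split_indicator intro!: mult_left_mono)
qed measurable

lemma nn_integral_gamma_mixture:
  assumes "c \<ge> 0"
  shows "ennreal (gamma_mixture \<nu> c) = (\<integral>\<^sup>+t. ennreal (t ^ (\<nu> - 1) * exp (- t - c / t)) * indicator {0..} t \<partial>lborel)"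
proof -
  have "ennreal (gamma_mixture \<nu> c) = (\<integral>\<^sup>+t. ennreal (indicator {0..} t *\<^sub>R (t ^ (\<nu> - 1) * exp (- t - c / t))) \<partial>lborel)"
    unfolding gamma_mixture_def set_lebesgue_integral_def
    using gamma_mixture_integrable[OF assms, of \<nu>] unfolding set_integrable_def
    by (rule nn_integral_eq_integral[symmetric]) (simp add: indicator_def)
  also have "\<dots> = (\<integral>\<^sup>+t. ennreal (t ^ (\<nu> - 1) * exp (- t - c / t)) * indicator {0..} t \<partial>lborel)"
    by (rule nn_integral_cong) (simp add: indicator_def)
  finally show ?thesis .
qed

lemma gamma_mixture_nonneg: "gamma_mixture \<nu> c \<ge> 0"
  unfolding gamma_mixture_def set_lebesgue_integral_def
  by (rule integral_nonneg_AE) (auto split: split_indicator)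

section \<open>Laguerre polynomials and the Hille--Hardy formula\<close>

text \<open>Fubini for absolutely convergent double series, stated with \<open>sums\<close> so that
  the closed forms of rows and columns can be inserted directly; the proof passes through unordered
  summation over pairs.\<close>

lemma sums_swap:
  fixes f :: "nat \<Rightarrow> nat \<Rightarrow> 'a::banach"
  assumes row: "\<And>m. (\<lambda>n. f m n) sums g m"
    and abs: "\<And>m. summable (\<lambda>n. norm (f m n))"
    and sum: "summable (\<lambda>m. \<Sum>n. norm (f m n))"
    and col: "\<And>n. (\<lambda>m. f m n) sums h n"
    and g: "g sums S"
  shows "h sums S"
proof -
  have "(\<lambda>x. norm ((\<lambda>(m, n). f m n) x)) summable_on (UNIV \<times> UNIV)"
  proof (rule Infinite_Sum.abs_summable_on_Sigma_iff[THEN iffD2], intro conjI ballI)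
    fix m
    show "(\<lambda>n. norm (case (m, n) of (m, n) \<Rightarrow> f m n)) summable_on UNIV"
      using abs[of m] by (simp add: summable_on_UNIV_nonneg_real_iff)
  next
    have "infsum (\<lambda>n. norm (f m n)) UNIV = (\<Sum>n. norm (f m n))" for m
      using abs[of m] by (intro infsumI norm_summable_imp_has_sum summable_sums) auto
    moreover have "0 \<le> (\<Sum>n. norm (f m n))" for m
      using abs[of m] by (intro suminf_nonneg) auto
    ultimately show "(\<lambda>m. norm (infsum (\<lambda>n. norm (case (m, n) of (m, n) \<Rightarrow> f m n)) UNIV)) summable_on UNIV"
      using sum by (simp add: summable_on_UNIV_nonneg_real_iff)
  qed
  then have abs2: "(\<lambda>x. norm ((\<lambda>(m, n). f m n) x)) summable_on (UNIV \<times> UNIV)" .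
  then have "(\<lambda>(m, n). f m n) summable_on (UNIV \<times> UNIV)"
    by (rule Infinite_Sum.abs_summable_summable)
  then obtain T where T: "((\<lambda>(m, n). f m n) has_sum T) (UNIV \<times> UNIV)"
    by (auto simp: summable_on_def)
  have row': "((\<lambda>n. f m n) has_sum g m) UNIV" for m
    using norm_summable_imp_has_sum[OF abs row] .
  have "(g has_sum T) UNIV"
    using has_sum_SigmaD[OF T] row' by simp
  then have "T = S" using g has_sum_imp_sums sums_unique2 by blast
  have T2: "((\<lambda>(n, m). f m n) has_sum T) (UNIV \<times> UNIV)"
    using has_sum_swap[THEN iffD1, OF T] by (simp add: case_prod_unfold)
  have "(\<lambda>x. norm ((\<lambda>(n, m). f m n) x)) summable_on (UNIV \<times> UNIV)"
    using summable_on_swap[THEN iffD1, OF abs2] by (simp add: case_prod_unfold)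
  then have "(\<lambda>m. norm (f m n)) summable_on UNIV" for n
    by (drule_tac Infinite_Sum.abs_summable_on_Sigma_iff[THEN iffD1]) simp
  then have col': "((\<lambda>m. f m n) has_sum h n) UNIV" for n
    by (intro norm_summable_imp_has_sum[OF _ col]) (simp add: summable_on_UNIV_nonneg_real_iff)
  have "(h has_sum T) UNIV"
    using has_sum_SigmaD[OF T2] col' by simp
  with \<open>T = S\<close> show ?thesis using has_sum_imp_sums by blast
qed

text \<open>Induction on \<open>n\<close>: one more factor \<open>1 / (1 - s)\<close> is a Cauchy
  product with the geometric series, and the coefficients add up by the hockey-stick identity. The
  same product at the real number \<open>norm s\<close> gives absolute convergence.\<close>

lemma negative_binomial_sums:
  fixes s :: "'a::{real_normed_field,banach}"
  assumes "norm s < 1"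
  shows "(\<lambda>i. of_nat ((i + n) choose n) * s ^ i) sums (1 / (1 - s) ^ Suc n)"
    and "summable (\<lambda>i. norm (of_nat ((i + n) choose n) * s ^ i))"
proof -
  have "(\<lambda>i. of_nat ((i + n) choose n) * s ^ i) sums (1 / (1 - s) ^ Suc n) \<and>
    summable (\<lambda>i. norm (of_nat ((i + n) choose n) * s ^ i))" if "norm s < 1"
    for s :: "'b::{real_normed_field,banach}"
    using that
  proof (induction n arbitrary: s)
    case 0
    then show ?case using geometric_sums[of s] by (simp add: norm_power)
  next
    case (Suc n)
    have key: "(\<Sum>i\<le>k. of_nat ((i + n) choose n) * s ^ i * s ^ (k - i)) =
      of_nat ((k + Suc n) choose Suc n) * s ^ k" for k and s :: "'c::{real_normed_field,banach}"
    proof -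
      have "(\<Sum>i\<le>k. of_nat ((i + n) choose n) * s ^ i * s ^ (k - i)) =
        (\<Sum>i\<le>k. of_nat ((n + i) choose n) * s ^ k)"
        by (intro sum.cong) (auto simp: mult.assoc power_add[symmetric] add.commute)
      also have "\<dots> = of_nat (\<Sum>i\<le>k. (n + i) choose n) * s ^ k"
        by (simp add: sum_distrib_right)
      finally show ?thesis by (simp only: choose_rising_sum(1)) (simp add: add_ac)
    qed
    have 1: "(\<lambda>k. of_nat ((k + Suc n) choose Suc n) * s ^ k) sums
      ((\<Sum>i. of_nat ((i + n) choose n) * s ^ i) * (\<Sum>i. s ^ i))"
      using Cauchy_product_sums[of "\<lambda>i. of_nat ((i + n) choose n) * s ^ i" "\<lambda>i. s ^ i"]
        Suc.IH[OF Suc.prems] Suc.prems by (simp add: key norm_power)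
    have 2: "(\<lambda>k. of_nat ((k + Suc n) choose Suc n) * norm s ^ k) sums
      ((\<Sum>i. of_nat ((i + n) choose n) * norm s ^ i) * (\<Sum>i. norm s ^ i))"
      using Cauchy_product_sums[of "\<lambda>i. of_nat ((i + n) choose n) * norm s ^ i" "\<lambda>i. norm s ^ i"]
        Suc.IH[OF Suc.prems] Suc.prems by (simp add: key norm_power norm_mult)
    have "(\<Sum>i. of_nat ((i + n) choose n) * s ^ i) = 1 / (1 - s) ^ Suc n"
      by (rule sums_unique[OF conjunct1[OF Suc.IH[OF Suc.prems]], symmetric])
    then have "(\<Sum>i. of_nat ((i + n) choose n) * s ^ i) * (\<Sum>i. s ^ i) = 1 / (1 - s) ^ Suc (Suc n)"
      using Suc.prems by (simp add: suminf_geometric)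
    then show ?case
      using 1 sums_summable[OF 2] by (simp only: norm_mult norm_power norm_of_nat)
  qed
  then show "(\<lambda>i. of_nat ((i + n) choose n) * s ^ i) sums (1 / (1 - s) ^ Suc n)"
    and "summable (\<lambda>i. norm (of_nat ((i + n) choose n) * s ^ i))"
    using assms by blast+
qed

text \<open>The device by which integrals and sums are extracted from generating functions. Any
  positive radius is enough, so each generating function has to be evaluated only for small
  arguments.\<close>

lemma power_series_unique:
  fixes a b :: "nat \<Rightarrow> complex"
  assumes "r > 0"
    and a: "\<And>w. norm w < r \<Longrightarrow> (\<lambda>m. a m * w ^ m) sums f w"
    and b: "\<And>w. norm w < r \<Longrightarrow> (\<lambda>m. b m * w ^ m) sums f w"
  shows "a m = b m"
proof -
  have conv: "fps_conv_radius (Abs_fps c) > 0" if "\<And>w. norm w < r \<Longrightarrow> (\<lambda>m. c m * w ^ m) sums f w"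
    for c :: "nat \<Rightarrow> complex"
  proof -
    have "summable (\<lambda>m. c m * (of_real (r / 2)) ^ m)"
      using that[of "of_real (r / 2)"] \<open>r > 0\<close> by (auto simp: sums_iff)
    then have "conv_radius c \<ge> norm (of_real (r / 2) :: complex)"
      by (rule conv_radius_geI)
    then show ?thesis using \<open>r > 0\<close>
      by (simp add: fps_conv_radius_def) (smt (verit) ereal_less(2) half_gt_zero order_less_le_trans)
  qed
  have "Abs_fps a = Abs_fps b"
  proof (rule eval_fps_eqD)
    show "eventually (\<lambda>z. eval_fps (Abs_fps a) z = eval_fps (Abs_fps b) z) (nhds 0)"
      using eventually_nhds_in_open[of "ball 0 r" "0::complex"] \<open>r > 0\<close>
      by (auto elim!: eventually_mono simp: eval_fps_def sums_unique[OF a, symmetric] sums_unique[OF b, symmetric])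
  qed (use conv a b in auto)
  then show ?thesis by (metis fps_nth_Abs_fps)
qed

section \<open>Generating functions of the Laguerre polynomials\<close>

text \<open>The generalised Laguerre polynomial of degree \<open>j\<close> and parameter
  \<open>\<nu>\<close>. It is polymorphic so that its real values at \<open>- norm x\<close> can
  serve as majorants of the complex ones.\<close>

definition laguerre :: "nat \<Rightarrow> nat \<Rightarrow> 'a::field_char_0 \<Rightarrow> 'a" where
  "laguerre \<nu> j x = (\<Sum>m\<le>j. of_nat ((j + \<nu>) choose (j - m)) * (- x) ^ m / fact m)"

text \<open>At a negative argument all terms of the polynomial are nonnegative, so the triangle
  inequality is exactly an evaluation at \<open>- norm x\<close>.\<close>

lemma norm_laguerre_le:
  fixes x :: "'a::real_normed_field"
  shows "norm (laguerre \<nu> j x) \<le> laguerre \<nu> j (- norm x)"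
  unfolding laguerre_def
  by (rule sum_norm_le) (simp add: norm_mult norm_divide norm_power)

lemma laguerre_nonneg: "x \<le> 0 \<Longrightarrow> laguerre \<nu> j (x::real) \<ge> 0"
  unfolding laguerre_def by (intro sum_nonneg) auto

text \<open>Summing over \<open>j\<close> first, for fixed power \<open>m\<close> of
  \<open>x\<close>, gives a negative binomial series; the remaining sum over \<open>m\<close> is an
  exponential series. The majorant is the same computation at \<open>norm s\<close> and
  \<open>- norm x\<close>.\<close>

lemma laguerre_sums:
  fixes s x :: "'a::{real_normed_field,banach}"
  assumes "norm s < 1"
  shows "(\<lambda>j. s ^ j * laguerre \<nu> j x) sums (exp (- (x * s / (1 - s))) / (1 - s) ^ Suc \<nu>)"
proof (rule sums_swap)
  define f where "f m j = (if m \<le> j then s ^ j * (of_nat ((j + \<nu>) choose (j - m)) * (- x) ^ m / fact m) else 0)" for m j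
  have shift: "f m (i + m) = ((- x * s) ^ m / fact m) * (of_nat ((i + (m + \<nu>)) choose (m + \<nu>)) * s ^ i)" for m i
  proof -
    have "(i + (m + \<nu>)) choose (m + \<nu>) = (i + (m + \<nu>)) choose i"
      using binomial_symmetric[of i "i + (m + \<nu>)"] by simp
    then show ?thesis by (simp add: f_def power_add power_mult_distrib power_minus' add_ac)
  qed
  have nshift: "norm (f m (i + m)) = (norm (x * s) ^ m / fact m) * (of_nat ((i + (m + \<nu>)) choose (m + \<nu>)) * norm s ^ i)" for m i
    unfolding shift by (simp add: norm_mult norm_divide norm_power)
  have z: "f m i = 0" if "i < m" for m i using that by (simp add: f_def)
  define g where "g m = (- x * s / (1 - s)) ^ m / fact m * (1 / (1 - s) ^ Suc \<nu>)" for m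
  define G where "G m = (norm x * norm s / (1 - norm s)) ^ m / fact m * (1 / (1 - norm s) ^ Suc \<nu>)" for m
  have ns: "norm (norm s) < 1" using assms by simp
  have "(\<lambda>i. f m (i + m)) sums g m" for m
    unfolding shift g_def power_divide
    using sums_mult[OF negative_binomial_sums(1)[OF assms, of "m + \<nu>"], of "(- x * s) ^ m / fact m"]
    by (simp add: power_add mult_ac)
  then show row: "(\<lambda>j. f m j) sums g m" for m
    using sums_zero_iff_shift[of m "f m"] z by blast
  have n0: "(\<lambda>i. norm (f m (i + m))) sums G m" for m
    unfolding nshift G_def power_divide
    using sums_mult[OF negative_binomial_sums(1)[OF ns, of "m + \<nu>"], of "norm (x * s) ^ m / fact m"]
    by (simp add: power_add mult_ac norm_mult power_mult_distrib)
  have nrow: "(\<lambda>j. norm (f m j)) sums G m" for m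
    by (rule iffD1[OF sums_zero_iff_shift[of m "\<lambda>j. norm (f m j)"] n0]) (simp add: z)
  then show "summable (\<lambda>j. norm (f m j))" for m using sums_summable by blast
  have "(\<lambda>m. \<Sum>j. norm (f m j)) = G" using nrow sums_unique by (metis ext)
  moreover have "summable G" unfolding G_def
    using summable_exp[of "norm x * norm s / (1 - norm s)"]
    by (intro summable_mult2) (simp add: divide_inverse mult_ac)
  ultimately show "summable (\<lambda>m. \<Sum>j. norm (f m j))" by simp
  show "(\<lambda>m. f m j) sums (s ^ j * laguerre \<nu> j x)" for j
  proof -
    have "(\<lambda>m. f m j) sums (\<Sum>m\<in>{..j}. f m j)"
      by (rule sums_finite) (auto simp: f_def)
    then show ?thesis by (simp add: f_def laguerre_def sum_distrib_left)
  qed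
  have "(\<lambda>m. (- x * s / (1 - s)) ^ m /\<^sub>R fact m) sums exp (- x * s / (1 - s))"
    by (rule exp_converges)
  then have "(\<lambda>m. (- x * s / (1 - s)) ^ m / fact m) sums exp (- x * s / (1 - s))"
    by (simp add: scaleR_conv_of_real divide_inverse mult.commute)
  from sums_mult2[OF this, of "1 / (1 - s) ^ Suc \<nu>"]
  show "g sums (exp (- (x * s / (1 - s))) / (1 - s) ^ Suc \<nu>)"
    by (simp add: g_def[abs_def])
qed

text \<open>The generating function at \<open>s (1 + w)\<close> is expanded in \<open>w\<close> in
  two ways. Directly, the binomial theorem produces the left side. On the other hand
  \<open>1 - s (1 + w) = (1 - s) (1 - \<rho> w)\<close> with \<open>\<rho> = s / (1 - s)\<close>
  turns it into a generating function in \<open>\<rho> w\<close> with argument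
  \<open>x / (1 - s)\<close>.\<close>

lemma laguerre_binomial_sums:
  fixes s x :: complex
  assumes s: "norm s < 1"
  shows "(\<lambda>j. of_nat (j choose m) * s ^ j * laguerre \<nu> j x) sums
    (exp (- (x * s / (1 - s))) / (1 - s) ^ Suc \<nu> * (s / (1 - s)) ^ m * laguerre \<nu> m (x / (1 - s)))"
proof -
  \<comment> \<open>For \<open>s \<noteq> 0\<close> this makes \<open>norm s * (1 + \<eta>)\<close>
    the midpoint of \<open>norm s\<close> and 1, so \<open>s (1 + w)\<close> stays inside the unit
    disc for \<open>norm w < \<eta>\<close>.\<close>
  define \<eta> where "\<eta> = (if s = 0 then 1 else (1 / norm s - 1) / 2)"
  have \<eta>: "\<eta> > 0" "norm s * (1 + \<eta>) < 1"
    using s by (auto simp: \<eta>_def field_simps)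
  have sne: "1 - s \<noteq> 0" using s by auto
  define A where "A m = (\<Sum>j. of_nat (j choose m) * s ^ j * laguerre \<nu> j x)" for m
  have big: "summable (\<lambda>j. (norm s * (1 + \<eta>)) ^ j * laguerre \<nu> j (- norm x))"
    using laguerre_sums[of "norm s * (1 + \<eta>)" \<nu> "- norm x"] \<eta> by (auto simp: sums_iff)
  have binle: "of_nat (j choose m) * \<eta> ^ m \<le> (1 + \<eta>) ^ j" for j m
  proof (cases "m \<le> j")
    case True
    have "(1 + \<eta>) ^ j = (\<Sum>k\<le>j. of_nat (j choose k) * \<eta> ^ k)"
      using binomial_ring[of \<eta> 1 j] by (simp add: add.commute)
    also have "\<dots> \<ge> of_nat (j choose m) * \<eta> ^ m"
      using True \<eta> by (intro member_le_sum) auto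
    finally show ?thesis .
  qed (use \<eta> in \<open>simp add: binomial_eq_0\<close>)
  have Asum: "(\<lambda>j. of_nat (j choose m) * s ^ j * laguerre \<nu> j x) sums A m" for m
    unfolding A_def
  proof (rule summable_sums, rule summable_comparison_test', rule summable_mult[OF big, of "1 / \<eta> ^ m"])
    fix j
    have "norm (of_nat (j choose m) * s ^ j * laguerre \<nu> j x) \<le> of_nat (j choose m) * norm s ^ j * laguerre \<nu> j (- norm x)"
      by (simp add: norm_mult norm_power norm_laguerre_le mult_left_mono)
    also have "\<dots> \<le> ((1 + \<eta>) ^ j / \<eta> ^ m) * norm s ^ j * laguerre \<nu> j (- norm x)"
      using binle[of j m] \<eta> by (intro mult_right_mono laguerre_nonneg) (auto simp: field_simps)
    finally show "norm (of_nat (j choose m) * s ^ j * laguerre \<nu> j x) \<le> 1 / \<eta> ^ m * ((norm s * (1 + \<eta>)) ^ j * laguerre \<nu> j (- norm x))"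
      by (simp add: power_mult_distrib mult_ac)
  qed
  define F where "F w = exp (- (x * (s * (1 + w)) / (1 - s * (1 + w)))) / (1 - s * (1 + w)) ^ Suc \<nu>" for w
  have left: "(\<lambda>m. A m * w ^ m) sums F w" if w: "norm w < \<eta>" for w
  proof (rule sums_swap)
    define f where "f j m = of_nat (j choose m) * w ^ m * s ^ j * laguerre \<nu> j x" for j m
    have fz: "f j m = 0" if "m \<notin> {..j}" for j m using that by (simp add: f_def binomial_eq_0)
    have "(\<lambda>m. f j m) sums (\<Sum>m\<le>j. f j m)" for j by (rule sums_finite) (use fz in auto)
    moreover have "(\<Sum>m\<le>j. f j m) = (s * (1 + w)) ^ j * laguerre \<nu> j x" for j
      using binomial_ring[of w 1 j]
      by (simp add: f_def sum_distrib_left sum_distrib_right power_mult_distrib add.commute mult_ac)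
    ultimately show "(\<lambda>m. f j m) sums ((s * (1 + w)) ^ j * laguerre \<nu> j x)" for j by simp
    have fs: "(\<lambda>m. norm (f j m)) sums (\<Sum>m\<le>j. norm (f j m))" for j by (rule sums_finite) (use fz in auto)
    then show "summable (\<lambda>m. norm (f j m))" for j by (simp add: sums_iff)
    have eq: "(\<Sum>m. norm (f j m)) = (norm s * (1 + norm w)) ^ j * norm (laguerre \<nu> j x)" for j
      using sums_unique[OF fs[of j], symmetric] binomial_ring[of "norm w" 1 j]
      by (simp add: f_def norm_mult norm_power sum_distrib_left sum_distrib_right power_mult_distrib add.commute mult_ac)
    show "summable (\<lambda>j. \<Sum>m. norm (f j m))"
      unfolding eq
    proof (rule summable_comparison_test'[OF big])
      fix j
      show "norm ((norm s * (1 + norm w)) ^ j * norm (laguerre \<nu> j x)) \<le> (norm s * (1 + \<eta>)) ^ j * laguerre \<nu> j (- norm x)"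
        using w \<eta> by (auto simp: abs_mult power_mult_distrib intro!: mult_mono norm_laguerre_le power_mono laguerre_nonneg)
    qed
    show "(\<lambda>j. f j m) sums (A m * w ^ m)" for m
      using sums_mult2[OF Asum[of m], of "w ^ m"] by (simp add: f_def mult_ac)
    have "norm (s * (1 + w)) < 1"
      using \<eta> w norm_triangle_ineq[of 1 w] by (auto simp: norm_mult intro!: le_less_trans[OF mult_left_mono \<eta>(2)])
    from laguerre_sums[OF this, of \<nu> x]
    show "(\<lambda>j. (s * (1 + w)) ^ j * laguerre \<nu> j x) sums F w" by (simp add: F_def)
  qed
  define \<rho> where "\<rho> = s / (1 - s)"
  define P where "P = exp (- (x * s / (1 - s))) / (1 - s) ^ Suc \<nu>"
  define r where "r = min \<eta> (1 / (norm \<rho> + 1))"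
  have "r > 0" using \<eta> by (simp add: r_def add_nonneg_pos)
  have right: "(\<lambda>m. (P * \<rho> ^ m * laguerre \<nu> m (x / (1 - s))) * w ^ m) sums F w" if w: "norm w < r" for w
  proof -
    have nr: "norm (\<rho> * w) < 1"
    proof -
      have "norm w < 1 / (norm \<rho> + 1)" using w by (simp add: r_def)
      then have "norm w * (norm \<rho> + 1) < 1"
        by (simp add: pos_less_divide_eq add_nonneg_pos)
      then show ?thesis using norm_ge_zero[of w] unfolding norm_mult by (simp add: algebra_simps)
        (use norm_ge_zero[of w] in linarith)
    qed
    have e: "1 - s * (1 + w) = (1 - s) * (1 - \<rho> * w)" using sne by (simp add: \<rho>_def field_simps)
    have ne: "1 - \<rho> * w \<noteq> 0" using nr by auto
    have "x * (s * (1 + w)) / (1 - s * (1 + w)) = x * s / (1 - s) + x / (1 - s) * (\<rho> * w) / (1 - \<rho> * w)"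
    proof -
      have "x * (s * (1 + w)) / (1 - s * (1 + w)) = x * (1 - (1 - s) * (1 - \<rho> * w)) / ((1 - s) * (1 - \<rho> * w))"
        unfolding e by (simp add: e[symmetric])
      also have "\<dots> = x * s / (1 - s) + x / (1 - s) * (\<rho> * w) / (1 - \<rho> * w)"
        using sne ne by (simp add: divide_simps) (simp add: algebra_simps)
      finally show ?thesis .
    qed
    then have "exp (- (x * (s * (1 + w)) / (1 - s * (1 + w)))) =
        exp (- (x * s / (1 - s))) * exp (- (x / (1 - s) * (\<rho> * w) / (1 - \<rho> * w)))"
      by (simp only: exp_add[symmetric] minus_add_distrib)
    then have "F w = P * (exp (- (x / (1 - s) * (\<rho> * w) / (1 - \<rho> * w))) / (1 - \<rho> * w) ^ Suc \<nu>)"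
      unfolding F_def P_def by (simp only: e power_mult_distrib times_divide_times_eq)
    then show ?thesis using sums_mult[OF laguerre_sums[OF nr, of \<nu> "x / (1 - s)"], of P]
      by (simp add: power_mult_distrib mult_ac)
  qed
  have "A m = P * \<rho> ^ m * laguerre \<nu> m (x / (1 - s))" for m
    by (rule power_series_unique[OF \<open>r > 0\<close> left right]) (auto simp: r_def)
  with Asum[of m] show ?thesis by (simp add: P_def \<rho>_def)
qed

section \<open>The Bessel series and the product of two Laguerre polynomials\<close>

text \<open>The entire function with
  \<open>I_\<nu>(2 sqrt z) = z^(\<nu>/2) bessel_series \<nu> z\<close>; in this form no branch of
  the root has to be chosen.\<close>

definition bessel_series :: "nat \<Rightarrow> complex \<Rightarrow> complex" where
  "bessel_series \<nu> z = (\<Sum>k. z ^ k / (fact k * fact (k + \<nu>)))"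

lemma bessel_series_sums:
  "(\<lambda>k. z ^ k / (fact k * fact (k + \<nu>))) sums bessel_series \<nu> z"
  "summable (\<lambda>k. norm (z ^ k / (fact k * fact (k + \<nu>))))"
proof -
  have e: "summable (\<lambda>k. norm z ^ k / fact k)"
    using summable_exp[of "norm z"] by (simp add: divide_inverse mult.commute)
  show "summable (\<lambda>k. norm (z ^ k / (fact k * fact (k + \<nu>))))"
  proof (rule summable_comparison_test'[OF e])
    fix k
    have "norm z ^ k / (fact k * fact (k + \<nu>)) \<le> norm z ^ k / (fact k * 1)"
      by (intro divide_left_mono mult_left_mono fact_ge_1 mult_pos_pos) auto
    then show "norm (norm (z ^ k / (fact k * fact (k + \<nu>)))) \<le> norm z ^ k / fact k"
      by (simp add: norm_divide norm_mult norm_power)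
  qed
  then show "(\<lambda>k. z ^ k / (fact k * fact (k + \<nu>))) sums bessel_series \<nu> z"
    unfolding bessel_series_def by (rule summable_sums[OF summable_norm_cancel])
qed

lemma exp_sums_div: "(\<lambda>n. z ^ n / fact n) sums exp (z :: 'a :: {real_normed_field,banach})"
  using exp_converges[of z] by (simp add: scaleR_conv_of_real divide_inverse mult.commute)

text \<open>With the Laguerre polynomial written out, the double series over \<open>k\<close> and
  \<open>m - k\<close> factorises into an exponential series and the Bessel series.\<close>

lemma laguerre_bessel_sums:
  "(\<lambda>m. z ^ m / fact (m + \<nu>) * laguerre \<nu> m x) sums (exp z * bessel_series \<nu> (- x * z))"
proof (rule sums_swap)
  define f where "f k m = (if k \<le> m then z ^ m * (- x) ^ k / (fact (m - k) * fact (k + \<nu>) * fact k) else 0)" for k m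
  have shift: "f k (n + k) = (- x * z) ^ k / (fact k * fact (k + \<nu>)) * (z ^ n / fact n)" for k n
    by (simp add: f_def power_add power_mult_distrib power_minus' field_simps)
  have z0: "f k m = 0" if "m < k" for k m using that by (simp add: f_def)
  have "(\<lambda>n. f k (n + k)) sums ((- x * z) ^ k / (fact k * fact (k + \<nu>)) * exp z)" for k
    unfolding shift by (intro sums_mult exp_sums_div)
  then show "(\<lambda>m. f k m) sums ((- x * z) ^ k / (fact k * fact (k + \<nu>)) * exp z)" for k
    using sums_zero_iff_shift[of k "f k"] z0 by blast
  have n0: "(\<lambda>n. norm (f k (n + k))) sums (norm ((- x * z) ^ k / (fact k * fact (k + \<nu>))) * exp (norm z))" for k
    unfolding shift norm_mult norm_divide norm_power[of z] norm_fact by (intro sums_mult exp_sums_div)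
  have n: "(\<lambda>m. norm (f k m)) sums (norm ((- x * z) ^ k / (fact k * fact (k + \<nu>))) * exp (norm z))" for k
    by (rule iffD1[OF sums_zero_iff_shift[of k "\<lambda>m. norm (f k m)"] n0]) (simp add: z0)
  then show "summable (\<lambda>m. norm (f k m))" for k by (simp add: sums_iff)
  show "summable (\<lambda>k. \<Sum>m. norm (f k m))"
    unfolding sums_unique[OF n, symmetric] by (intro summable_mult2 bessel_series_sums(2))
  show "(\<lambda>k. f k m) sums (z ^ m / fact (m + \<nu>) * laguerre \<nu> m x)" for m
  proof -
    have "(\<lambda>k. f k m) sums (\<Sum>k\<in>{..m}. f k m)"
      by (rule sums_finite) (auto simp: f_def)
    moreover have "f k m = z ^ m / fact (m + \<nu>) * (of_nat ((m + \<nu>) choose (m - k)) * (- x) ^ k / fact k)" if "k \<le> m" for k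
    proof -
      have "of_nat ((m + \<nu>) choose (m - k)) = (fact (m + \<nu>) / (fact (m - k) * fact (k + \<nu>)) :: complex)"
        using that by (subst binomial_fact) (auto simp: add_ac)
      then show ?thesis using that by (simp add: f_def)
    qed
    ultimately show ?thesis by (simp add: laguerre_def sum_distrib_left)
  qed
  show "(\<lambda>k. (- x * z) ^ k / (fact k * fact (k + \<nu>)) * exp z) sums (exp z * bessel_series \<nu> (- x * z))"
    using sums_mult2[OF bessel_series_sums(1), of "- x * z" \<nu> "exp z"] by (simp add: mult.commute)
qed

text \<open>Only \<open>laguerre \<nu> j y\<close> is expanded, in powers of \<open>y\<close> with
  coefficients proportional to \<open>j choose m\<close>. The sum over \<open>j\<close> is then
  \<open>laguerre_binomial_sums\<close>, and the sum over \<open>m\<close> is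
  \<open>laguerre_bessel_sums\<close> at the argument \<open>x / (1 - s)\<close>.\<close>

lemma hille_hardy:
  fixes s x y :: complex
  assumes s: "norm s < 1"
  shows "(\<lambda>j. s ^ j * (fact j / fact (j + \<nu>)) * laguerre \<nu> j x * laguerre \<nu> j y) sums
    (exp (- ((x + y) * s / (1 - s))) / (1 - s) ^ Suc \<nu> * bessel_series \<nu> (x * y * s / (1 - s)\<^sup>2))"
    and "summable (\<lambda>j. norm (s ^ j * (fact j / fact (j + \<nu>)) * laguerre \<nu> j x * laguerre \<nu> j y))"
proof -
  define \<eta> where "\<eta> = (if s = 0 then 1 else (1 / norm s - 1) / 2)"
  have \<eta>: "\<eta> > 0" "norm s * (1 + \<eta>) < 1"
    using s by (auto simp: \<eta>_def field_simps)
  have big: "summable (\<lambda>j. (norm s * (1 + \<eta>)) ^ j * laguerre \<nu> j (- norm x))"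
    using laguerre_sums[of "norm s * (1 + \<eta>)" \<nu> "- norm x"] \<eta> by (auto simp: sums_iff)
  define C where "C = exp (norm y / \<eta>)"
  \<comment> \<open>The factorial beats every geometric rate, in particular \<open>\<eta>\<close>.
    With this rate the binomial coefficients sum to \<open>(1 + \<eta>)^j\<close>, which
    \<open>norm s ^ j\<close> can still absorb.\<close>
  have ytail: "norm y ^ m / fact (m + \<nu>) \<le> C * \<eta> ^ m" for m
  proof -
    have "(norm y / \<eta>) ^ m / fact m \<le> C"
      unfolding C_def using \<eta> sum_le_suminf[of "\<lambda>m. (norm y / \<eta>) ^ m / fact m" "{m}"] exp_sums_div[of "norm y / \<eta>"]
      by (auto simp: sums_iff)
    then have "norm y ^ m / fact m \<le> C * \<eta> ^ m"
      using \<eta> by (simp add: power_divide field_simps)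
    moreover have "norm y ^ m / fact (m + \<nu>) \<le> norm y ^ m / fact m"
      by (intro divide_left_mono fact_mono) auto
    ultimately show ?thesis by linarith
  qed
  define f where "f j m = s ^ j * laguerre \<nu> j x * (of_nat (j choose m) * (- y) ^ m / fact (m + \<nu>))" for j m
  have fz: "f j m = 0" if "m \<notin> {..j}" for j m using that by (simp add: f_def binomial_eq_0)
  define T where "T j = s ^ j * (fact j / fact (j + \<nu>)) * laguerre \<nu> j x * laguerre \<nu> j y" for j
  have lag: "(\<Sum>m\<le>j. f j m) = T j" for j
  proof -
    have "of_nat (j choose m) * (- y) ^ m / fact (m + \<nu>) =
      (fact j / fact (j + \<nu>)) * (of_nat ((j + \<nu>) choose (j - m)) * (- y) ^ m / fact m)" if "m \<le> j" for m
    proof -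
      have "of_nat ((j + \<nu>) choose (j - m)) = (fact (j + \<nu>) / (fact (j - m) * fact (m + \<nu>)) :: complex)"
        using that by (subst binomial_fact) (auto simp: add_ac)
      moreover have "of_nat (j choose m) = (fact j / (fact m * fact (j - m)) :: complex)"
        using that by (subst binomial_fact) auto
      ultimately show ?thesis by simp
    qed
    then show ?thesis
      unfolding f_def T_def laguerre_def[of \<nu> j y] sum_distrib_left
      by (intro sum.cong refl) (simp add: mult_ac)
  qed
  have row: "(\<lambda>m. f j m) sums T j" for j
    unfolding lag[symmetric] by (rule sums_finite) (use fz in auto)
  have fs: "(\<lambda>m. norm (f j m)) sums (\<Sum>m\<le>j. norm (f j m))" for j by (rule sums_finite) (use fz in auto)
  have bound: "(\<Sum>m\<le>j. norm (f j m)) \<le> C * ((norm s * (1 + \<eta>)) ^ j * laguerre \<nu> j (- norm x))" for j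
  proof -
    have "(\<Sum>m\<le>j. norm (f j m)) = norm s ^ j * norm (laguerre \<nu> j x) * (\<Sum>m\<le>j. of_nat (j choose m) * (norm y ^ m / fact (m + \<nu>)))"
      by (simp add: f_def norm_mult norm_divide norm_power sum_distrib_left)
    also have "\<dots> \<le> norm s ^ j * laguerre \<nu> j (- norm x) * (\<Sum>m\<le>j. of_nat (j choose m) * (C * \<eta> ^ m))"
      by (intro mult_mono sum_mono mult_left_mono ytail norm_laguerre_le sum_nonneg) (auto simp: laguerre_nonneg)
    also have "(\<Sum>m\<le>j. of_nat (j choose m) * (C * \<eta> ^ m)) = C * (1 + \<eta>) ^ j"
      using binomial_ring[of \<eta> 1 j] by (simp add: sum_distrib_left add.commute mult_ac)
    finally show ?thesis by (simp add: power_mult_distrib mult_ac)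
  qed
  show "summable (\<lambda>j. norm (s ^ j * (fact j / fact (j + \<nu>)) * laguerre \<nu> j x * laguerre \<nu> j y))"
  proof (rule summable_comparison_test'[OF summable_mult[OF big, of C]])
    fix j
    have "norm (T j) \<le> (\<Sum>m\<le>j. norm (f j m))" unfolding lag[symmetric] by (rule norm_sum)
    then show "norm (norm (s ^ j * (fact j / fact (j + \<nu>)) * laguerre \<nu> j x * laguerre \<nu> j y)) \<le> C * ((norm s * (1 + \<eta>)) ^ j * laguerre \<nu> j (- norm x))"
      using bound[of j] unfolding T_def by simp
  qed
  then have Tsum: "T sums (suminf T)" unfolding T_def by (rule summable_sums[OF summable_norm_cancel])
  have sumf: "summable (\<lambda>j. \<Sum>m. norm (f j m))"
    unfolding sums_unique[OF fs, symmetric]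
  proof (rule summable_comparison_test'[OF summable_mult[OF big, of C]])
    fix j
    show "norm (\<Sum>m\<le>j. norm (f j m)) \<le> C * ((norm s * (1 + \<eta>)) ^ j * laguerre \<nu> j (- norm x))"
      using bound[of j] sum_nonneg[of "{..j}" "\<lambda>m. norm (f j m)"] by simp
  qed
  define P where "P = exp (- (x * s / (1 - s))) / (1 - s) ^ Suc \<nu>"
  have col: "(\<lambda>j. f j m) sums (P * ((- (y * s / (1 - s))) ^ m / fact (m + \<nu>) * laguerre \<nu> m (x / (1 - s))))" for m
    using sums_mult2[OF laguerre_binomial_sums[OF s, of m \<nu> x], of "(- y) ^ m / fact (m + \<nu>)"]
    by (simp add: f_def P_def power_mult_distrib power_divide power_minus' mult_ac)
  have "(\<lambda>m. P * ((- (y * s / (1 - s))) ^ m / fact (m + \<nu>) * laguerre \<nu> m (x / (1 - s)))) sums suminf T"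
    by (rule sums_swap[OF row sums_summable[OF fs] sumf col Tsum])
  moreover have "(\<lambda>m. P * ((- (y * s / (1 - s))) ^ m / fact (m + \<nu>) * laguerre \<nu> m (x / (1 - s)))) sums
     (P * (exp (- (y * s / (1 - s))) * bessel_series \<nu> (- (x / (1 - s)) * (- (y * s / (1 - s))))))"
    by (intro sums_mult laguerre_bessel_sums)
  ultimately have "suminf T = P * (exp (- (y * s / (1 - s))) * bessel_series \<nu> (- (x / (1 - s)) * (- (y * s / (1 - s)))))"
    by (rule sums_unique2)
  also have "- (x / (1 - s)) * (- (y * s / (1 - s))) = x * y * s / (1 - s)\<^sup>2"
    by (simp add: power2_eq_square)
  also have "P * (exp (- (y * s / (1 - s))) * bessel_series \<nu> (x * y * s / (1 - s)\<^sup>2)) =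
    exp (- ((x + y) * s / (1 - s))) / (1 - s) ^ Suc \<nu> * bessel_series \<nu> (x * y * s / (1 - s)\<^sup>2)"
  proof -
    have "exp (- ((x + y) * s / (1 - s))) = exp (- (x * s / (1 - s))) * exp (- (y * s / (1 - s)))"
      by (simp add: exp_add[symmetric] ring_distribs add_divide_distrib)
    then show ?thesis by (simp add: P_def)
  qed
  finally show "(\<lambda>j. s ^ j * (fact j / fact (j + \<nu>)) * laguerre \<nu> j x * laguerre \<nu> j y) sums
    (exp (- ((x + y) * s / (1 - s))) / (1 - s) ^ Suc \<nu> * bessel_series \<nu> (x * y * s / (1 - s)\<^sup>2))"
    using Tsum unfolding T_def by simp
qed

section \<open>The Bessel weight and orthogonality\<close>

text \<open>The substitution \<open>t = (x / 2) exp s\<close> turns \<open>t + (x / 2)^2 / t\<close>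
  into \<open>x cosh s\<close> and the half-line into the whole line. Folding \<open>s\<close> onto
  \<open>- s\<close> replaces \<open>exp (\<nu> s)\<close> by \<open>2 cosh (\<nu> s)\<close> on
  \<open>s \<ge> 0\<close>.\<close>

lemma bessel_K_eq_gamma_mixture:
  assumes x: "x > 0" and \<nu>: "\<nu> \<ge> 1"
  shows "bessel_K (real \<nu>) x = (1 / 2) * (2 / x) ^ \<nu> * gamma_mixture \<nu> ((x / 2)\<^sup>2)"
proof -
  define f where "f t = t ^ (\<nu> - 1) * exp (- t - (x / 2)\<^sup>2 / t)" for t :: real
  define g where "g s = (x / 2) * exp s" for s :: real
  define h where "h s = exp (real \<nu> * s - x * cosh s)" for s :: real
  have fint: "set_integrable lborel {0<..} f"
    using gamma_mixture_integrable[of "(x / 2)\<^sup>2" \<nu>] unfolding f_def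
    by (rule set_integrable_subset) auto
  have "gamma_mixture \<nu> ((x / 2)\<^sup>2) = (LBINT t:{0<..}. f t)"
    unfolding gamma_mixture_def set_lebesgue_integral_def f_def
    by (rule integral_cong_AE) (measurable, use AE_lborel_singleton[of "0::real"] in eventually_elim, auto simp: indicator_def)
  then have fval: "f absolutely_integrable_on {0<..} \<and> integral {0<..} f = gamma_mixture \<nu> ((x / 2)\<^sup>2)"
    using set_borel_integral_eq_integral[OF fint] fint
    by (auto simp: set_integrable_def integrable_completion f_def)
  have img: "g ` UNIV = {0<..}"
  proof (intro equalityI subsetI)
    fix y :: real assume "y \<in> {0<..}"
    then have "y = g (ln (2 * y / x))" using x by (simp add: g_def)
    then show "y \<in> g ` UNIV" by blast
  qed (use x in \<open>auto simp: g_def\<close>)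
  have "(\<lambda>s. \<bar>(x / 2) * exp s\<bar> * f (g s)) absolutely_integrable_on UNIV \<and>
    integral UNIV (\<lambda>s. \<bar>(x / 2) * exp s\<bar> * f (g s)) = gamma_mixture \<nu> ((x / 2)\<^sup>2)"
  proof -
    have der: "(g has_field_derivative (x / 2) * exp s) (at s within UNIV)" for s
      unfolding g_def by (auto intro!: derivative_eq_intros)
    have inj: "inj_on g UNIV" using x by (auto simp: g_def inj_on_def)
    show ?thesis
      using has_absolute_integral_change_of_variables_1'[OF _ der inj, of f "gamma_mixture \<nu> ((x / 2)\<^sup>2)"] fval
      unfolding img by simp
  qed
  moreover have fg: "\<bar>(x / 2) * exp s\<bar> * f (g s) = (x / 2) ^ \<nu> * h s" for s
  proof -
    have e: "- g s - (x / 2)\<^sup>2 / g s = - (x * cosh s)"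
      using x by (simp add: g_def cosh_def exp_minus field_simps power2_eq_square)
    have "\<bar>(x / 2) * exp s\<bar> * f (g s) = (g s * g s ^ (\<nu> - 1)) * exp (- (x * cosh s))"
      using x unfolding f_def e by (simp add: g_def)
    also have "g s * g s ^ (\<nu> - 1) = g s ^ \<nu>" using \<nu> by (simp add: power_eq_if)
    also have "g s ^ \<nu> = (x / 2) ^ \<nu> * exp (real \<nu> * s)"
      by (simp add: g_def power_mult_distrib exp_of_nat_mult power_divide)
    finally show ?thesis by (simp add: h_def exp_diff exp_minus field_simps)
  qed
  ultimately have 1: "set_integrable lebesgue UNIV (\<lambda>s. (x / 2) ^ \<nu> * h s)"
    "integral UNIV (\<lambda>s. (x / 2) ^ \<nu> * h s) = gamma_mixture \<nu> ((x / 2)\<^sup>2)" by simp_all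
  have hm [measurable]: "h \<in> borel_measurable borel" unfolding h_def cosh_def by measurable
  have i1: "integrable lborel (\<lambda>s. (x / 2) ^ \<nu> * h s)"
    using 1(1) by (simp add: set_integrable_def integrable_completion)
  then have hint: "integrable lborel h" using x by simp
  have val: "(x / 2) ^ \<nu> * (LBINT s. h s) = gamma_mixture \<nu> ((x / 2)\<^sup>2)"
    using trans[OF integral_lborel[OF i1, symmetric] 1(2)] by (simp only: integral_mult_right_zero)
  have hint': "integrable lborel (\<lambda>s. h (- s))"
    using lborel_integrable_real_affine[OF hint, of "-1" 0] by simp
  have ia: "integrable lborel (\<lambda>s. indicator {0..} s * h s)" "integrable lborel (\<lambda>s. indicator {..<0} s * h s)"
    "integrable lborel (\<lambda>s. indicator {0..} s * h (- s))"
    using hint hint' by (auto intro!: integrable_real_mult_indicator simp: mult.commute[of "indicator _ _"])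
  have "(LBINT s. h s) = (LBINT s. indicator {0..} s * h s + indicator {..<0} s * h s)"
    by (intro Bochner_Integration.integral_cong refl) (auto simp: indicator_def)
  also have "\<dots> = (LBINT s. indicator {0..} s * h s) + (LBINT s. indicator {..<0} s * h s)"
    by (rule Bochner_Integration.integral_add[OF ia(1,2)])
  also have "(LBINT s. indicator {..<0} s * h s) = (LBINT s. indicator {..<0} (- s) * h (- s))"
    by (subst lborel_integral_real_affine[where c="-1" and t=0]) auto
  also have "\<dots> = (LBINT s. indicator {0..} s * h (- s))"
    by (rule integral_cong_AE) (measurable, use AE_lborel_singleton[of "0::real"] in eventually_elim, auto simp: indicator_def)
  also have "(LBINT s. indicator {0..} s * h s) + (LBINT s. indicator {0..} s * h (- s)) =
    (LBINT s. indicator {0..} s * h s + indicator {0..} s * h (- s))"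
    by (rule Bochner_Integration.integral_add[OF ia(1,3), symmetric])
  also have "\<dots> = (LBINT s. 2 * (indicator {0..} s *\<^sub>R (exp (- x * cosh s) * cosh (real \<nu> * s))))"
  proof (intro Bochner_Integration.integral_cong refl)
    fix s
    have "h s = exp (- x * cosh s) * exp (real \<nu> * s)" "h (- s) = exp (- x * cosh s) * exp (- (real \<nu> * s))"
      by (simp_all add: h_def exp_add[symmetric])
    moreover have "exp (real \<nu> * s) + exp (- (real \<nu> * s)) = 2 * cosh (real \<nu> * s)" by (simp add: cosh_def)
    ultimately have "h s + h (- s) = 2 * (exp (- x * cosh s) * cosh (real \<nu> * s))"
      by (simp add: distrib_left[symmetric])
    then show "indicator {0..} s * h s + indicator {0..} s * h (- s) = 2 * (indicator {0..} s *\<^sub>R (exp (- x * cosh s) * cosh (real \<nu> * s)))"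
      by (simp add: indicator_def)
  qed
  also have "\<dots> = 2 * bessel_K (real \<nu>) x"
    unfolding bessel_K_def set_lebesgue_integral_def by (rule integral_mult_right_zero)
  finally have "(x / 2) ^ \<nu> * (2 * bessel_K (real \<nu>) x) = gamma_mixture \<nu> ((x / 2)\<^sup>2)" using val by simp
  then show ?thesis using x by (simp add: field_simps power_divide)
qed

lemma borel_measurable_gamma_mixture [measurable]: "gamma_mixture \<nu> \<in> borel_measurable borel"
  unfolding gamma_mixture_def set_lebesgue_integral_def by measurable

text \<open>In the variable \<open>u = z\<^sup>2\<close> this is, up to a constant, the weight \<open>|u|\<^sup>\<nu> K\<^sub>\<nu>(a|u|)\<close>.\<close>

definition radial_weight :: "real \<Rightarrow> nat \<Rightarrow> complex \<Rightarrow> real" where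
  "radial_weight a \<nu> z = (cmod z)\<^sup>2 * gamma_mixture \<nu> ((a / 2)\<^sup>2 * ((cmod z)\<^sup>2)\<^sup>2)"

lemma radial_weight_nonneg: "radial_weight a \<nu> z \<ge> 0"
  by (simp add: radial_weight_def gamma_mixture_nonneg)

lemma borel_measurable_radial_weight [measurable]: "radial_weight a \<nu> \<in> borel_measurable borel"
  unfolding radial_weight_def by measurable

text \<open>Polar coordinates followed by Tonelli. Once the mixing variable \<open>t\<close> is on
  the outside, the inner integral in \<open>r\<close> is Gaussian and explicit for the test
  functions of interest.\<close>

lemma nn_integral_radial_weight:
  assumes [measurable]: "f \<in> borel_measurable borel" and a: "a > 0" and f0: "\<And>r. r \<ge> 0 \<Longrightarrow> f r \<ge> 0"
  shows "(\<integral>\<^sup>+z. ennreal (f ((cmod z)\<^sup>2) * radial_weight a \<nu> z) \<partial>area_measure) =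
    (\<integral>\<^sup>+t. (\<integral>\<^sup>+r. ennreal (f r * r * t ^ (\<nu> - 1) * exp (- t - (a / 2)\<^sup>2 * r\<^sup>2 / t)) * indicator {0..} r \<partial>lborel) * indicator {0..} t \<partial>lborel)"
proof -
  have "(\<integral>\<^sup>+z. ennreal (f ((cmod z)\<^sup>2) * radial_weight a \<nu> z) \<partial>area_measure) =
     (\<integral>\<^sup>+r. ennreal (f r * (r * gamma_mixture \<nu> ((a / 2)\<^sup>2 * r\<^sup>2))) * indicator {0..} r \<partial>lborel)"
    using nn_integral_radial[of "\<lambda>r. ennreal (f r * (r * gamma_mixture \<nu> ((a / 2)\<^sup>2 * r\<^sup>2)))"]
    by (simp add: radial_weight_def)
  also have "\<dots> = (\<integral>\<^sup>+r. (\<integral>\<^sup>+t. ennreal (f r * r * t ^ (\<nu> - 1) * exp (- t - (a / 2)\<^sup>2 * r\<^sup>2 / t)) * indicator {0..} r * indicator {0..} t \<partial>lborel) \<partial>lborel)"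
  proof (rule nn_integral_cong)
    fix r :: real
    show "ennreal (f r * (r * gamma_mixture \<nu> ((a / 2)\<^sup>2 * r\<^sup>2))) * indicator {0..} r =
      (\<integral>\<^sup>+t. ennreal (f r * r * t ^ (\<nu> - 1) * exp (- t - (a / 2)\<^sup>2 * r\<^sup>2 / t)) * indicator {0..} r * indicator {0..} t \<partial>lborel)"
    proof (cases "r \<ge> 0")
      case True
      have "ennreal (f r * (r * gamma_mixture \<nu> ((a / 2)\<^sup>2 * r\<^sup>2))) = ennreal (f r * r) * ennreal (gamma_mixture \<nu> ((a / 2)\<^sup>2 * r\<^sup>2))"
        using True f0[of r] by (simp add: ennreal_mult'[symmetric] gamma_mixture_nonneg mult.assoc)
      also have "\<dots> = ennreal (f r * r) * (\<integral>\<^sup>+t. ennreal (t ^ (\<nu> - 1) * exp (- t - (a / 2)\<^sup>2 * r\<^sup>2 / t)) * indicator {0..} t \<partial>lborel)"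
        by (subst nn_integral_gamma_mixture) auto
      also have "\<dots> = (\<integral>\<^sup>+t. ennreal (f r * r) * (ennreal (t ^ (\<nu> - 1) * exp (- t - (a / 2)\<^sup>2 * r\<^sup>2 / t)) * indicator {0..} t) \<partial>lborel)"
        by (rule nn_integral_cmult[symmetric]) measurable
      also have "\<dots> = (\<integral>\<^sup>+t. ennreal (f r * r * t ^ (\<nu> - 1) * exp (- t - (a / 2)\<^sup>2 * r\<^sup>2 / t)) * indicator {0..} r * indicator {0..} t \<partial>lborel)"
        using True f0[of r] by (intro nn_integral_cong) (auto simp: indicator_def ennreal_mult'[symmetric] mult.assoc)
      finally show ?thesis using True by simp
    qed simp
  qed
  also have "\<dots> = (\<integral>\<^sup>+t. (\<integral>\<^sup>+r. ennreal (f r * r * t ^ (\<nu> - 1) * exp (- t - (a / 2)\<^sup>2 * r\<^sup>2 / t)) * indicator {0..} r * indicator {0..} t \<partial>lborel) \<partial>lborel)"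
    by (rule lborel_pair.Fubini'[symmetric]) measurable
  also have "\<dots> = (\<integral>\<^sup>+t. (\<integral>\<^sup>+r. ennreal (f r * r * t ^ (\<nu> - 1) * exp (- t - (a / 2)\<^sup>2 * r\<^sup>2 / t)) * indicator {0..} r \<partial>lborel) * indicator {0..} t \<partial>lborel)"
    by (intro nn_integral_cong nn_integral_multc) measurable
  finally show ?thesis .
qed

text \<open>The mixture contains a division by \<open>t\<close>, whose value at \<open>t = 0\<close>
  is a mere convention; identities have to be checked only for \<open>t > 0\<close>.\<close>

lemma nn_integral_cong_pos:
  fixes f g :: "real \<Rightarrow> ennreal"
  assumes "\<And>t. t > 0 \<Longrightarrow> f t = g t"
  shows "(\<integral>\<^sup>+t. f t * indicator {0..} t \<partial>lborel) = (\<integral>\<^sup>+t. g t * indicator {0..} t \<partial>lborel)"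
  using AE_lborel_singleton[of "0::real"] assms
  by (intro nn_integral_cong_AE) (auto elim!: eventually_mono simp: indicator_def order_less_le)

text \<open>For fixed \<open>t\<close> the radial integral is an odd Gaussian moment with precision
  \<open>(a / 2)^2 / t\<close> and contributes \<open>m! t^(m+1)\<close> up to constants; the outer
  integral in \<open>t\<close> is then the Gamma integral for \<open>(m + \<nu>)!\<close>.\<close>

lemma radial_weight_moment:
  assumes a: "a > 0" and \<nu>: "\<nu> \<ge> 1"
  shows "(\<integral>\<^sup>+z. ennreal (((cmod z)\<^sup>2) ^ (2 * m) * radial_weight a \<nu> z) \<partial>area_measure) =
    ennreal (fact m * fact (m + \<nu>) / (2 * ((a / 2)\<^sup>2) ^ Suc m))"
proof -
  let ?\<beta> = "(a / 2)\<^sup>2"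
  have "(\<integral>\<^sup>+z. ennreal (((cmod z)\<^sup>2) ^ (2 * m) * radial_weight a \<nu> z) \<partial>area_measure) =
    (\<integral>\<^sup>+t. (\<integral>\<^sup>+r. ennreal (r ^ (2 * m) * r * t ^ (\<nu> - 1) * exp (- t - ?\<beta> * r\<^sup>2 / t)) * indicator {0..} r \<partial>lborel) * indicator {0..} t \<partial>lborel)"
    using a by (intro nn_integral_radial_weight[of "\<lambda>r. r ^ (2 * m)"]) auto
  also have "\<dots> = (\<integral>\<^sup>+t. ennreal (fact m / (2 * ?\<beta> ^ Suc m)) * ennreal (t ^ (m + \<nu>) * exp (- 1 * t)) * indicator {0..} t \<partial>lborel)"
  proof (rule nn_integral_cong_pos)
    fix t :: real assume t: "t > 0"
    have "(\<integral>\<^sup>+r. ennreal (r ^ (2 * m) * r * t ^ (\<nu> - 1) * exp (- t - ?\<beta> * r\<^sup>2 / t)) * indicator {0..} r \<partial>lborel) =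
      (\<integral>\<^sup>+r. ennreal (t ^ (\<nu> - 1) * exp (- t)) * (ennreal (r ^ (2 * m + 1) * exp (- (?\<beta> / t) * r\<^sup>2)) * indicator {0..} r) \<partial>lborel)"
    proof (rule nn_integral_cong)
      fix r
      have "exp (- t - ?\<beta> * r\<^sup>2 / t) = exp (- t) * exp (- (?\<beta> / t) * r\<^sup>2)"
        by (simp add: exp_add[symmetric])
      then show "ennreal (r ^ (2 * m) * r * t ^ (\<nu> - 1) * exp (- t - ?\<beta> * r\<^sup>2 / t)) * indicator {0..} r =
        ennreal (t ^ (\<nu> - 1) * exp (- t)) * (ennreal (r ^ (2 * m + 1) * exp (- (?\<beta> / t) * r\<^sup>2)) * indicator {0..} r)"
        using t by (simp add: indicator_def ennreal_mult'[symmetric] mult_ac)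
    qed
    also have "\<dots> = ennreal (t ^ (\<nu> - 1) * exp (- t)) * (\<integral>\<^sup>+r. ennreal (r ^ (2 * m + 1) * exp (- (?\<beta> / t) * r\<^sup>2)) * indicator {0..} r \<partial>lborel)"
      by (rule nn_integral_cmult) measurable
    also have "\<dots> = ennreal (t ^ (\<nu> - 1) * exp (- t)) * ennreal (fact m / (2 * (?\<beta> / t) ^ Suc m))"
      using t a by (subst nn_integral_odd_power_gauss) auto
    also have "\<dots> = ennreal (t ^ (\<nu> - 1) * exp (- t) * (fact m / (2 * (?\<beta> / t) ^ Suc m)))"
      using t by (subst ennreal_mult') auto
    also have "t ^ (\<nu> - 1) * exp (- t) * (fact m / (2 * (?\<beta> / t) ^ Suc m)) = fact m / (2 * ?\<beta> ^ Suc m) * (t ^ (\<nu> - 1) * t ^ Suc m * exp (- 1 * t))"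
      using t a by (simp only: power_divide) (simp add: field_simps)
    also have "t ^ (\<nu> - 1) * t ^ Suc m = t ^ (m + \<nu>)"
    proof -
      have "\<nu> - 1 + Suc m = m + \<nu>" using \<nu> by simp
      then show ?thesis by (metis power_add)
    qed
    finally show "(\<integral>\<^sup>+r. ennreal (r ^ (2 * m) * r * t ^ (\<nu> - 1) * exp (- t - ?\<beta> * r\<^sup>2 / t)) * indicator {0..} r \<partial>lborel) =
      ennreal (fact m / (2 * ?\<beta> ^ Suc m)) * ennreal (t ^ (m + \<nu>) * exp (- 1 * t))"
      using t by (subst ennreal_mult'[symmetric]) auto
  qed
  also have "\<dots> = ennreal (fact m / (2 * ?\<beta> ^ Suc m)) * (\<integral>\<^sup>+t. ennreal (t ^ (m + \<nu>) * exp (- 1 * t)) * indicator {0..} t \<partial>lborel)"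
    unfolding mult.assoc by (rule nn_integral_cmult) measurable
  also have "\<dots> = ennreal (fact m / (2 * ?\<beta> ^ Suc m)) * ennreal (fact (m + \<nu>))"
    by (subst nn_integral_power_exp) auto
  also have "\<dots> = ennreal (fact m * fact (m + \<nu>) / (2 * ?\<beta> ^ Suc m))"
    by (subst ennreal_mult'[symmetric]) auto
  finally show ?thesis .
qed

text \<open>The square \<open>(t - a r / 2)^2 / t \<ge> 0\<close> gives
  \<open>a r \<le> t + (a / 2)^2 r^2 / t\<close>. For \<open>c < a\<close> only the fraction
  \<open>c / a\<close> of the quadratic form is spent on \<open>c r\<close>, and the rest makes both
  integrals converge.\<close>

lemma radial_weight_exp_finite:
  assumes c: "0 \<le> c" "c < a"
  shows "(\<integral>\<^sup>+z. ennreal (exp (c * (cmod z)\<^sup>2) * radial_weight a \<nu> z) \<partial>area_measure) < \<infinity>"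
proof -
  let ?\<beta> = "(a / 2)\<^sup>2"
  have a: "a > 0" using c by simp
  \<comment> \<open>The fraction of the exponent that remains after \<open>c r\<close> has been paid
    for.\<close>
  define q where "q = 1 - c / a"
  have q: "0 < q" using c a by (simp add: q_def field_simps)
  have ca: "c = (1 - q) * a" using a by (simp add: q_def)
  have q1: "q \<le> 1" using c a by (simp add: q_def)
  have key: "c * r - t - ?\<beta> * r\<^sup>2 / t \<le> - q * t - (q * ?\<beta> / t) * r\<^sup>2" if "t > 0" for r t
  proof -
    have "0 \<le> (1 - q) * ((t - a * r / 2)\<^sup>2 / t)" using that q1 by simp
    also have "(t - a * r / 2)\<^sup>2 / t = t - a * r + ?\<beta> * r\<^sup>2 / t" using that by (simp add: power2_eq_square field_simps)
    finally have 1: "0 \<le> (1 - q) * (t - a * r + ?\<beta> * r\<^sup>2 / t)" .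
    obtain Y where Y: "Y = ?\<beta> * r\<^sup>2 / t" by blast
    have "(1 - q) * a * r - t - Y \<le> - q * t - q * Y"
      using 1 unfolding Y[symmetric] by (simp add: algebra_simps)
    moreover have "q * Y = (q * ?\<beta> / t) * r\<^sup>2" by (simp add: Y)
    ultimately show ?thesis unfolding ca using Y by linarith
  qed
  have "(\<integral>\<^sup>+z. ennreal (exp (c * (cmod z)\<^sup>2) * radial_weight a \<nu> z) \<partial>area_measure) =
    (\<integral>\<^sup>+t. (\<integral>\<^sup>+r. ennreal (exp (c * r) * r * t ^ (\<nu> - 1) * exp (- t - ?\<beta> * r\<^sup>2 / t)) * indicator {0..} r \<partial>lborel) * indicator {0..} t \<partial>lborel)"
    using a by (intro nn_integral_radial_weight[of "\<lambda>r. exp (c * r)"]) auto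
  also have "\<dots> = (\<integral>\<^sup>+t. (if t > 0 then (\<integral>\<^sup>+r. ennreal (exp (c * r) * r * t ^ (\<nu> - 1) * exp (- t - ?\<beta> * r\<^sup>2 / t)) * indicator {0..} r \<partial>lborel) else 0) * indicator {0..} t \<partial>lborel)"
    by (rule nn_integral_cong_pos) simp
  also have "\<dots> \<le> (\<integral>\<^sup>+t. ennreal (1 / (2 * (q * ?\<beta>))) * (ennreal (t ^ (\<nu> - 1 + 1) * exp (- q * t)) * indicator {0..} t) \<partial>lborel)"
  proof (intro nn_integral_mono)
    fix t :: real
    show "(if t > 0 then (\<integral>\<^sup>+r. ennreal (exp (c * r) * r * t ^ (\<nu> - 1) * exp (- t - ?\<beta> * r\<^sup>2 / t)) * indicator {0..} r \<partial>lborel) else 0) * indicator {0..} t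
       \<le> ennreal (1 / (2 * (q * ?\<beta>))) * (ennreal (t ^ (\<nu> - 1 + 1) * exp (- q * t)) * indicator {0..} t)"
    proof (cases "t > 0")
      case t: True
      have "(\<integral>\<^sup>+r. ennreal (exp (c * r) * r * t ^ (\<nu> - 1) * exp (- t - ?\<beta> * r\<^sup>2 / t)) * indicator {0..} r \<partial>lborel) \<le>
        (\<integral>\<^sup>+r. ennreal (t ^ (\<nu> - 1) * exp (- q * t)) * (ennreal (r ^ (2 * 0 + 1) * exp (- (q * ?\<beta> / t) * r\<^sup>2)) * indicator {0..} r) \<partial>lborel)"
      proof (rule nn_integral_mono)
        fix r :: real
        show "ennreal (exp (c * r) * r * t ^ (\<nu> - 1) * exp (- t - ?\<beta> * r\<^sup>2 / t)) * indicator {0..} r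
          \<le> ennreal (t ^ (\<nu> - 1) * exp (- q * t)) * (ennreal (r ^ (2 * 0 + 1) * exp (- (q * ?\<beta> / t) * r\<^sup>2)) * indicator {0..} r)"
        proof (cases "r \<ge> 0")
          case r: True
          have "exp (c * r) * exp (- t - ?\<beta> * r\<^sup>2 / t) \<le> exp (- q * t) * exp (- (q * ?\<beta> / t) * r\<^sup>2)"
            unfolding exp_add[symmetric] using key[OF t, of r] by simp
          then have "(r * t ^ (\<nu> - 1)) * (exp (c * r) * exp (- t - ?\<beta> * r\<^sup>2 / t)) \<le> (r * t ^ (\<nu> - 1)) * (exp (- q * t) * exp (- (q * ?\<beta> / t) * r\<^sup>2))"
            using r t by (intro mult_left_mono) auto
          then have "ennreal (exp (c * r) * r * t ^ (\<nu> - 1) * exp (- t - ?\<beta> * r\<^sup>2 / t)) \<le>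
             ennreal ((t ^ (\<nu> - 1) * exp (- q * t)) * (r ^ (2 * 0 + 1) * exp (- (q * ?\<beta> / t) * r\<^sup>2)))"
            by (intro ennreal_leI) (simp add: mult_ac)
          then show ?thesis using r t by (simp add: ennreal_mult')
        qed simp
      qed
      also have "\<dots> = ennreal (t ^ (\<nu> - 1) * exp (- q * t)) * ennreal (fact 0 / (2 * (q * ?\<beta> / t) ^ Suc 0))"
        using t q a by (subst nn_integral_cmult, measurable, subst nn_integral_odd_power_gauss) auto
      also have "\<dots> = ennreal (1 / (2 * (q * ?\<beta>))) * ennreal (t ^ (\<nu> - 1 + 1) * exp (- q * t))"
        using t q by (subst (1 2) ennreal_mult'[symmetric]) (auto simp: field_simps)
      finally show ?thesis using t by (simp add: mult.assoc)
    qed simp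
  qed
  also have "\<dots> = ennreal (1 / (2 * (q * ?\<beta>))) * (\<integral>\<^sup>+t. ennreal (t ^ (\<nu> - 1 + 1) * exp (- q * t)) * indicator {0..} t \<partial>lborel)"
    by (rule nn_integral_cmult) measurable
  also have "\<dots> < \<infinity>"
    using q by (subst nn_integral_power_exp) (auto simp: ennreal_mult_less_top)
  finally show ?thesis .
qed

lemma integrable_radial_weight:
  fixes F :: "complex \<Rightarrow> complex"
  assumes [measurable]: "F \<in> borel_measurable borel"
    and F: "\<And>z. cmod (F z) \<le> C * exp (c * (cmod z)\<^sup>2)" and c: "c < a" and a: "a > 0"
  shows "integrable area_measure (\<lambda>z. F z * of_real (radial_weight a \<nu> z))"
proof (rule Bochner_Integration.integrable_bound)
  \<comment> \<open>Replacing a negative rate by 0 only weakens the bound and meets the sign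
    condition of \<open>radial_weight_exp_finite\<close>.\<close>
  define c' where "c' = max c 0"
  have c': "0 \<le> c'" "c' < a" "c \<le> c'" using c a by (auto simp: c'_def)
  have C: "C \<ge> 0" using order_trans[OF norm_ge_zero F[of 0]] by simp
  show "integrable area_measure (\<lambda>z. C * (exp (c' * (cmod z)\<^sup>2) * radial_weight a \<nu> z))"
  proof (intro integrable_mult_right integrableI_nonneg)
    show "(\<integral>\<^sup>+z. ennreal (exp (c' * (cmod z)\<^sup>2) * radial_weight a \<nu> z) \<partial>area_measure) < \<infinity>"
      by (rule radial_weight_exp_finite[OF c'(1,2)])
    show "AE z in area_measure. 0 \<le> exp (c' * (cmod z)\<^sup>2) * radial_weight a \<nu> z"
      by (simp add: radial_weight_nonneg)
  qed measurable
  show "AE z in area_measure. cmod (F z * of_real (radial_weight a \<nu> z)) \<le> norm (C * (exp (c' * (cmod z)\<^sup>2) * radial_weight a \<nu> z))"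
  proof (rule AE_I2)
    fix z
    have "cmod (F z) \<le> C * exp (c' * (cmod z)\<^sup>2)"
      using order_trans[OF F mult_left_mono[OF _ C]] c'(3) by (metis exp_le_cancel_iff mult_right_mono zero_le_power2)
    from mult_right_mono[OF this radial_weight_nonneg[of a \<nu> z]]
    show "cmod (F z * of_real (radial_weight a \<nu> z)) \<le> norm (C * (exp (c' * (cmod z)\<^sup>2) * radial_weight a \<nu> z))"
      using radial_weight_nonneg[of a \<nu> z] C
      by (simp add: norm_mult abs_mult mult.assoc)
  qed
qed measurable

lemma borel_measurable_cnj [measurable]: "cnj \<in> borel_measurable borel"
  by (intro borel_measurable_continuous_onI continuous_intros)

section \<open>Monomials and exponentials integrated against the weight\<close>

lemma sums_integral_dominated:
  fixes f :: "nat \<Rightarrow> 'a \<Rightarrow> complex"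
  assumes int: "\<And>k. integrable M (f k)" and sums: "\<And>x. (\<lambda>k. f k x) sums F x"
    and bound: "\<And>n x. norm (\<Sum>k<n. f k x) \<le> w x" and w: "integrable M w"
  shows "(\<lambda>k. integral\<^sup>L M (f k)) sums integral\<^sup>L M F"
proof -
  have [measurable]: "f k \<in> borel_measurable M" for k by (rule borel_measurable_integrable[OF int])
  have lim: "(\<lambda>n. \<Sum>k<n. f k x) \<longlonglongrightarrow> F x" for x using sums[of x] by (simp add: sums_def)
  have [measurable]: "F \<in> borel_measurable M"
    by (rule borel_measurable_LIMSEQ_metric[OF _ lim]) measurable
  have "(\<lambda>n. \<integral>x. (\<Sum>k<n. f k x) \<partial>M) \<longlonglongrightarrow> integral\<^sup>L M F"
    by (rule integral_dominated_convergence[OF _ _ w]) (use lim bound in auto)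
  then show ?thesis by (simp add: sums_def Bochner_Integration.integral_sum int)
qed

lemma power_le_exp:
  assumes "x \<ge> 0" "\<epsilon> > 0"
  shows "x ^ m \<le> fact m / \<epsilon> ^ m * exp (\<epsilon> * x :: real)"
proof -
  have "(\<Sum>n\<in>{m}. (\<epsilon> * x) ^ n / fact n) \<le> exp (\<epsilon> * x)"
    using exp_sums_div[of "\<epsilon> * x"] assms unfolding sums_iff
    by (metis (no_types, lifting) divide_nonneg_pos fact_gt_zero finite.emptyI finite.insertI less_imp_le mult_nonneg_nonneg sum_le_suminf zero_le_power)
  then show ?thesis using assms by (simp add: power_mult_distrib field_simps)
qed

lemma norm_exp_partial_sum_le:
  "norm (\<Sum>k<n. w ^ k / fact k) \<le> exp (norm (w :: complex))"
proof -
  have "norm (\<Sum>k<n. w ^ k / fact k) \<le> (\<Sum>k<n. norm w ^ k / fact k)"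
    by (rule sum_norm_le) (simp add: norm_divide norm_power)
  also have "\<dots> \<le> exp (norm w)"
    using exp_sums_div[of "norm w"] unfolding sums_iff
    by (metis (no_types, lifting) divide_nonneg_pos fact_gt_zero finite_lessThan norm_ge_zero sum_le_suminf zero_le_power)
  finally show ?thesis .
qed

definition radial_moment :: "real \<Rightarrow> nat \<Rightarrow> nat \<Rightarrow> real" where
  "radial_moment a \<nu> m = fact m * fact (m + \<nu>) / (2 * ((a / 2)\<^sup>2) ^ Suc m)"

lemma square_power_bound:
  assumes "\<epsilon> > 0"
  shows "cmod ((z\<^sup>2) ^ m * ((cnj z)\<^sup>2) ^ n) \<le> fact (m + n) / \<epsilon> ^ (m + n) * exp (\<epsilon> * (cmod z)\<^sup>2)"
  using power_le_exp[of "(cmod z)\<^sup>2" \<epsilon> "m + n"] assms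
  by (simp add: norm_mult norm_power power_add)

text \<open>The diagonal case is \<open>radial_weight_moment\<close>. For
  \<open>m \<noteq> n\<close> a suitable rotation, which preserves both the measure and the radial
  weight, changes the sign of the integrand.\<close>

lemma radial_moment_integral:
  assumes a: "a > 0" and \<nu>: "\<nu> \<ge> 1"
  shows "(\<integral>z. (z\<^sup>2) ^ m * ((cnj z)\<^sup>2) ^ n * of_real (radial_weight a \<nu> z) \<partial>area_measure) =
    (if m = n then of_real (radial_moment a \<nu> m) else 0)"
proof -
  define G where "G z = (z\<^sup>2) ^ m * ((cnj z)\<^sup>2) ^ n * complex_of_real (radial_weight a \<nu> z)" for z
  have [measurable]: "G \<in> borel_measurable borel" unfolding G_def by measurable
  show ?thesis
  proof (cases "m = n")
    case True
    have eq: "G z = of_real (((cmod z)\<^sup>2) ^ (2 * m) * radial_weight a \<nu> z)" for z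
    proof -
      have "(z\<^sup>2) ^ m * ((cnj z)\<^sup>2) ^ m = (z * cnj z) ^ (2 * m)"
        by (simp add: power_mult_distrib power_mult)
      also have "\<dots> = of_real (((cmod z)\<^sup>2) ^ (2 * m))" by (simp add: complex_norm_square[symmetric])
      finally show ?thesis by (simp add: G_def True)
    qed
    have "(\<integral>z. G z \<partial>area_measure) = of_real (\<integral>z. ((cmod z)\<^sup>2) ^ (2 * m) * radial_weight a \<nu> z \<partial>area_measure)"
      unfolding eq by (rule integral_complex_of_real)
    also have "(\<integral>z. ((cmod z)\<^sup>2) ^ (2 * m) * radial_weight a \<nu> z \<partial>area_measure) = radial_moment a \<nu> m"
    proof (subst integral_eq_nn_integral)
      show "enn2real (\<integral>\<^sup>+z. ennreal (((cmod z)\<^sup>2) ^ (2 * m) * radial_weight a \<nu> z) \<partial>area_measure) = radial_moment a \<nu> m"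
        unfolding radial_weight_moment[OF a \<nu>] radial_moment_def by (rule enn2real_ennreal) simp
    qed (auto simp: radial_weight_nonneg)
    finally show ?thesis using True by (simp add: G_def)
  next
    case False
    \<comment> \<open>The rotation multiplies the integrand by
      \<open>cis (2 (m - n) \<theta>) = -1\<close>. As \<open>|\<theta>| \<le> pi / 2\<close>, the
      rotation is not \<open>-1\<close>, as \<open>distr_rotate_area\<close> requires.\<close>
    define \<theta> where "\<theta> = pi / (2 * (real m - real n))"
    define c where "c = cis \<theta>"
    have mn: "\<bar>real m - real n\<bar> \<ge> 1" using False by linarith
    have "\<bar>\<theta>\<bar> = pi / (2 * \<bar>real m - real n\<bar>)" unfolding \<theta>_def by (simp only: abs_divide abs_mult abs_numeral) simp
    also have "\<dots> \<le> pi / (2 * 1)" using mn by (intro divide_left_mono mult_left_mono mult_pos_pos) auto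
    finally have "cos \<theta> \<ge> 0" by (intro cos_ge_zero) auto
    then have c: "cmod c = 1" "c \<noteq> -1" by (auto simp: c_def complex_eq_iff)
    have "(c\<^sup>2) ^ m * ((cnj c)\<^sup>2) ^ n = cis (2 * (real m - real n) * \<theta>)"
    proof -
      have "(c\<^sup>2) ^ m = cis (real (2 * m) * \<theta>)" "((cnj c)\<^sup>2) ^ n = cis (real (2 * n) * (- \<theta>))"
        unfolding c_def cis_cnj power_mult[symmetric] by (rule Complex.DeMoivre, rule Complex.DeMoivre)
      then show ?thesis by (simp add: cis_mult algebra_simps)
    qed
    also have "2 * (real m - real n) * \<theta> = pi" using mn by (simp add: \<theta>_def)
    finally have cc: "(c\<^sup>2) ^ m * ((cnj c)\<^sup>2) ^ n = -1" by simp
    have "G (c * z) = ((c\<^sup>2) ^ m * ((cnj c)\<^sup>2) ^ n) * G z" for z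
      by (simp add: G_def power_mult_distrib radial_weight_def norm_mult c(1) mult_ac)
    then have neg: "G (c * z) = - G z" for z unfolding cc by simp
    have "(\<integral>z. G z \<partial>area_measure) = (\<integral>z. G z \<partial>distr area_measure borel (\<lambda>z. c * z))"
      unfolding distr_rotate_area[OF c] ..
    also have "\<dots> = (\<integral>z. G (c * z) \<partial>area_measure)" by (rule integral_distr) measurable
    also have "\<dots> = - (\<integral>z. G z \<partial>area_measure)" unfolding neg by simp
    finally show ?thesis using False by (simp add: G_def)
  qed
qed

lemma integrable_exp_radial_weight:
  assumes "c < a" "a > 0"
  shows "integrable area_measure (\<lambda>z. C * exp (c * (cmod z)\<^sup>2) * radial_weight a \<nu> z)"
proof -
  have "integrable area_measure (\<lambda>z. complex_of_real (C * exp (c * (cmod z)\<^sup>2)) * of_real (radial_weight a \<nu> z))"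
    by (rule integrable_radial_weight[of _ "\<bar>C\<bar>" c]) (use assms in \<open>auto simp: norm_mult abs_mult\<close>)
  then have "integrable area_measure (\<lambda>z. complex_of_real (C * exp (c * (cmod z)\<^sup>2) * radial_weight a \<nu> z))" by simp
  then show ?thesis unfolding complex_of_real_integrable_eq .
qed

lemma norm_exp_le: "cmod (exp w) \<le> exp (cmod w)"
  by (simp add: complex_Re_le_cmod)

text \<open>Of the exponential series only the term \<open>n = m\<close> survives, by the
  orthogonality of distinct powers.\<close>

lemma radial_moment_exp:
  assumes a: "a > 0" and \<nu>: "\<nu> \<ge> 1" and \<mu>: "cmod \<mu> < a"
  shows "(\<integral>z. (z\<^sup>2) ^ m * exp (\<mu> * (cnj z)\<^sup>2) * of_real (radial_weight a \<nu> z) \<partial>area_measure) =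
    \<mu> ^ m / fact m * of_real (radial_moment a \<nu> m)"
proof (rule sums_unique2)
  \<comment> \<open>Half of the gap below the decay rate \<open>a\<close> pays for the monomial, the
    other half keeps the majorant integrable.\<close>
  define \<epsilon> where "\<epsilon> = (a - cmod \<mu>) / 2"
  have \<epsilon>: "\<epsilon> > 0" "cmod \<mu> + \<epsilon> < a" using \<mu> by (auto simp: \<epsilon>_def field_simps)
  define C where "C = fact m / \<epsilon> ^ m"
  define f where "f n z = (z\<^sup>2) ^ m * ((\<mu> * (cnj z)\<^sup>2) ^ n / fact n) * complex_of_real (radial_weight a \<nu> z)" for n z
  have zm: "cmod ((z\<^sup>2) ^ m) \<le> C * exp (\<epsilon> * (cmod z)\<^sup>2)" for z
    using square_power_bound[OF \<epsilon>(1), of z m 0] by (simp add: C_def)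
  show "(\<lambda>n. integral\<^sup>L area_measure (f n)) sums (\<integral>z. (z\<^sup>2) ^ m * exp (\<mu> * (cnj z)\<^sup>2) * of_real (radial_weight a \<nu> z) \<partial>area_measure)"
  proof (rule sums_integral_dominated)
    show "(\<lambda>n. f n z) sums ((z\<^sup>2) ^ m * exp (\<mu> * (cnj z)\<^sup>2) * of_real (radial_weight a \<nu> z))" for z
      unfolding f_def by (intro sums_mult sums_mult2 exp_sums_div)
    show "integrable area_measure (\<lambda>z. C * exp ((\<epsilon> + cmod \<mu>) * (cmod z)\<^sup>2) * radial_weight a \<nu> z)"
      using \<epsilon> a by (intro integrable_exp_radial_weight) auto
    show "norm (\<Sum>k<n. f k z) \<le> C * exp ((\<epsilon> + cmod \<mu>) * (cmod z)\<^sup>2) * radial_weight a \<nu> z" for n z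
    proof -
      have "(\<Sum>k<n. f k z) = (z\<^sup>2) ^ m * (\<Sum>k<n. (\<mu> * (cnj z)\<^sup>2) ^ k / fact k) * complex_of_real (radial_weight a \<nu> z)"
        unfolding f_def sum_distrib_left sum_distrib_right ..
      also have "norm \<dots> = cmod ((z\<^sup>2) ^ m) * cmod (\<Sum>k<n. (\<mu> * (cnj z)\<^sup>2) ^ k / fact k) * radial_weight a \<nu> z"
        by (simp add: norm_mult radial_weight_nonneg)
      also have "\<dots> \<le> (C * exp (\<epsilon> * (cmod z)\<^sup>2)) * exp (cmod (\<mu> * (cnj z)\<^sup>2)) * radial_weight a \<nu> z"
        by (intro mult_mono zm norm_exp_partial_sum_le radial_weight_nonneg order_refl mult_nonneg_nonneg)
          (use \<epsilon>(1) in \<open>auto simp: C_def\<close>)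
      also have "\<dots> = C * exp ((\<epsilon> + cmod \<mu>) * (cmod z)\<^sup>2) * radial_weight a \<nu> z"
        by (simp add: norm_mult norm_power distrib_right exp_add)
      finally show ?thesis .
    qed
    show "integrable area_measure (f n)" for n
    proof -
      have "integrable area_measure (\<lambda>z. ((z\<^sup>2) ^ m * ((cnj z)\<^sup>2) ^ n) * of_real (radial_weight a \<nu> z))"
        using a by (intro integrable_radial_weight[OF _ square_power_bound[of "a / 2"]]) auto
      then have "integrable area_measure (\<lambda>z. (\<mu> ^ n / fact n) * (((z\<^sup>2) ^ m * ((cnj z)\<^sup>2) ^ n) * of_real (radial_weight a \<nu> z)))"
        by (rule integrable_mult_right)
      moreover have "(\<mu> ^ n / fact n) * (((z\<^sup>2) ^ m * ((cnj z)\<^sup>2) ^ n) * of_real (radial_weight a \<nu> z)) = f n z" for z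
        by (simp add: f_def power_mult_distrib)
      ultimately show ?thesis by simp
    qed
  qed
  have "integral\<^sup>L area_measure (f n) = (if n = m then \<mu> ^ n / fact n * of_real (radial_moment a \<nu> m) else 0)" for n
  proof -
    have fn: "f n = (\<lambda>z. (\<mu> ^ n / fact n) * ((z\<^sup>2) ^ m * ((cnj z)\<^sup>2) ^ n * of_real (radial_weight a \<nu> z)))"
      by (simp add: f_def power_mult_distrib fun_eq_iff)
    have "integral\<^sup>L area_measure (f n) = (\<mu> ^ n / fact n) * (\<integral>z. (z\<^sup>2) ^ m * ((cnj z)\<^sup>2) ^ n * of_real (radial_weight a \<nu> z) \<partial>area_measure)"
      by (simp only: integral_mult_right_zero fn)
    then show ?thesis unfolding radial_moment_integral[OF a \<nu>] by simp
  qed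
  then show "(\<lambda>n. integral\<^sup>L area_measure (f n)) sums (\<mu> ^ m / fact m * of_real (radial_moment a \<nu> m))"
    using sums_single[of m "\<lambda>n. \<mu> ^ n / fact n * of_real (radial_moment a \<nu> m)"] by simp
qed

text \<open>Expanding the first exponential leaves a negative binomial series in
  \<open>q = 4 \<xi> \<mu> / a^2\<close>. The condition \<open>cmod \<xi> + cmod \<mu> < a\<close>
  serves twice: for integrability, and through \<open>4 x y \<le> (x + y)^2\<close> for
  \<open>cmod q < 1\<close>.\<close>

lemma radial_exp_inner_product:
  assumes a: "a > 0" and \<nu>: "\<nu> \<ge> 1" and \<mu>: "cmod \<xi> + cmod \<mu> < a"
  shows "(\<integral>z. exp (\<xi> * z\<^sup>2) * exp (\<mu> * (cnj z)\<^sup>2) * of_real (radial_weight a \<nu> z) \<partial>area_measure) =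
    of_real (2 * fact \<nu> / a\<^sup>2) / (1 - 4 * \<xi> * \<mu> / of_real (a\<^sup>2)) ^ Suc \<nu>"
proof (rule sums_unique2)
  have \<mu>a: "cmod \<mu> < a" using \<mu> norm_ge_zero[of \<xi>] by linarith
  define \<epsilon> where "\<epsilon> = (a - cmod \<mu>) / 2"
  have \<epsilon>: "\<epsilon> > 0" "cmod \<mu> + \<epsilon> < a" using \<mu>a by (auto simp: \<epsilon>_def field_simps)
  define f where "f m z = ((\<xi> * z\<^sup>2) ^ m / fact m) * exp (\<mu> * (cnj z)\<^sup>2) * complex_of_real (radial_weight a \<nu> z)" for m z
  show "(\<lambda>n. integral\<^sup>L area_measure (f n)) sums (\<integral>z. exp (\<xi> * z\<^sup>2) * exp (\<mu> * (cnj z)\<^sup>2) * of_real (radial_weight a \<nu> z) \<partial>area_measure)"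
  proof (rule sums_integral_dominated)
    show "(\<lambda>n. f n z) sums (exp (\<xi> * z\<^sup>2) * exp (\<mu> * (cnj z)\<^sup>2) * of_real (radial_weight a \<nu> z))" for z
      unfolding f_def by (intro sums_mult sums_mult2 exp_sums_div)
    show "integrable area_measure (\<lambda>z. 1 * exp ((cmod \<xi> + cmod \<mu>) * (cmod z)\<^sup>2) * radial_weight a \<nu> z)"
      using \<mu> a by (intro integrable_exp_radial_weight) auto
    show "norm (\<Sum>k<n. f k z) \<le> 1 * exp ((cmod \<xi> + cmod \<mu>) * (cmod z)\<^sup>2) * radial_weight a \<nu> z" for n z
    proof -
      have "(\<Sum>k<n. f k z) = (\<Sum>k<n. (\<xi> * z\<^sup>2) ^ k / fact k) * exp (\<mu> * (cnj z)\<^sup>2) * complex_of_real (radial_weight a \<nu> z)"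
        unfolding f_def sum_distrib_right ..
      also have "norm \<dots> = cmod (\<Sum>k<n. (\<xi> * z\<^sup>2) ^ k / fact k) * cmod (exp (\<mu> * (cnj z)\<^sup>2)) * radial_weight a \<nu> z"
        by (simp only: norm_mult norm_of_real abs_of_nonneg[OF radial_weight_nonneg])
      also have "\<dots> \<le> exp (cmod (\<xi> * z\<^sup>2)) * exp (cmod (\<mu> * (cnj z)\<^sup>2)) * radial_weight a \<nu> z"
        by (intro mult_mono norm_exp_partial_sum_le norm_exp_le radial_weight_nonneg order_refl mult_nonneg_nonneg) auto
      also have "\<dots> = 1 * exp ((cmod \<xi> + cmod \<mu>) * (cmod z)\<^sup>2) * radial_weight a \<nu> z"
        by (simp add: norm_mult norm_power distrib_right exp_add)
      finally show ?thesis .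
    qed
    show "integrable area_measure (f n)" for n
      unfolding f_def
    proof (rule integrable_radial_weight)
      show "cmod ((\<xi> * z\<^sup>2) ^ n / fact n * exp (\<mu> * (cnj z)\<^sup>2)) \<le> (cmod \<xi> ^ n / fact n * (fact n / \<epsilon> ^ n)) * exp ((\<epsilon> + cmod \<mu>) * (cmod z)\<^sup>2)" for z
      proof -
        have "cmod ((\<xi> * z\<^sup>2) ^ n / fact n * exp (\<mu> * (cnj z)\<^sup>2)) = (cmod \<xi> ^ n / fact n) * cmod ((z\<^sup>2) ^ n * ((cnj z)\<^sup>2) ^ 0) * cmod (exp (\<mu> * (cnj z)\<^sup>2))"
          by (simp only: norm_mult norm_divide norm_power norm_fact power_mult_distrib power_0 norm_one) simp
        also have "\<dots> \<le> (cmod \<xi> ^ n / fact n) * (fact (n + 0) / \<epsilon> ^ (n + 0) * exp (\<epsilon> * (cmod z)\<^sup>2)) * exp (cmod (\<mu> * (cnj z)\<^sup>2))"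
          by (intro mult_mono square_power_bound[OF \<epsilon>(1)] norm_exp_le order_refl mult_nonneg_nonneg) (use \<epsilon>(1) in auto)
        also have "\<dots> = (cmod \<xi> ^ n / fact n * (fact n / \<epsilon> ^ n)) * exp ((\<epsilon> + cmod \<mu>) * (cmod z)\<^sup>2)"
          by (simp add: norm_mult norm_power distrib_right exp_add)
        finally show ?thesis .
      qed
    qed (use \<epsilon> a in auto)
  qed
  define q where "q = 4 * \<xi> * \<mu> / of_real (a\<^sup>2)"
  have q1: "cmod q < 1"
  proof -
    have "4 * (cmod \<xi> * cmod \<mu>) \<le> (cmod \<xi> + cmod \<mu>)\<^sup>2"
      using zero_le_power2[of "cmod \<xi> - cmod \<mu>"] by (simp add: power2_eq_square algebra_simps)
    also have "\<dots> < a\<^sup>2" using \<mu> by (intro power_strict_mono) auto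
    finally show ?thesis using a by (simp add: q_def norm_mult norm_divide norm_power)
  qed
  have "integral\<^sup>L area_measure (f n) = of_real (2 * fact \<nu> / a\<^sup>2) * (of_nat ((n + \<nu>) choose \<nu>) * q ^ n)" for n
  proof -
    have fn: "f n = (\<lambda>z. (\<xi> ^ n / fact n) * ((z\<^sup>2) ^ n * exp (\<mu> * (cnj z)\<^sup>2) * of_real (radial_weight a \<nu> z)))"
      by (simp add: f_def power_mult_distrib fun_eq_iff)
    have "integral\<^sup>L area_measure (f n) = (\<xi> ^ n / fact n) * (\<integral>z. (z\<^sup>2) ^ n * exp (\<mu> * (cnj z)\<^sup>2) * of_real (radial_weight a \<nu> z) \<partial>area_measure)"
      by (simp only: integral_mult_right_zero fn)
    also have "\<dots> = (\<xi> ^ n / fact n) * (\<mu> ^ n / fact n * of_real (radial_moment a \<nu> n))"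
      unfolding radial_moment_exp[OF a \<nu> \<mu>a] ..
    also have "\<dots> = (\<xi> * \<mu>) ^ n * of_real (fact (n + \<nu>) / (fact n * (2 * ((a / 2)\<^sup>2) ^ Suc n)))"
      by (simp add: radial_moment_def power_mult_distrib)
    also have "fact (n + \<nu>) / (fact n * (2 * ((a / 2)\<^sup>2) ^ Suc n)) = (2 * fact \<nu> / a\<^sup>2) * (of_nat ((n + \<nu>) choose \<nu>) * (4 / a\<^sup>2) ^ n)"
    proof -
      have "of_nat ((n + \<nu>) choose \<nu>) = (fact (n + \<nu>) / (fact \<nu> * fact n) :: real)"
        by (subst binomial_fact) auto
      then show ?thesis using a by (simp add: power_divide field_simps)
    qed
    finally show ?thesis by (simp add: q_def power_mult_distrib power_divide)
  qed
  then show "(\<lambda>n. integral\<^sup>L area_measure (f n)) sums (of_real (2 * fact \<nu> / a\<^sup>2) / (1 - 4 * \<xi> * \<mu> / of_real (a\<^sup>2)) ^ Suc \<nu>)"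
    using sums_mult[OF negative_binomial_sums(1)[OF q1, of \<nu>], of "of_real (2 * fact \<nu> / a\<^sup>2)"]
    by (simp add: q_def)
qed

section \<open>From generating functions to orthogonality\<close>

text \<open>The majorant series has nonnegative terms and a closed form, so it bounds all partial
  sums at once; this is the dominating function for termwise integration.\<close>

lemma laguerre_partial_sum_bound:
  assumes "cmod s < 1"
  shows "cmod (\<Sum>j<n. s ^ j * laguerre \<nu> j x) \<le>
    exp (cmod x * cmod s / (1 - cmod s)) / (1 - cmod s) ^ Suc \<nu>"
proof -
  have "cmod (\<Sum>j<n. s ^ j * laguerre \<nu> j x) \<le> (\<Sum>j<n. cmod s ^ j * laguerre \<nu> j (- cmod x))"
    by (rule sum_norm_le) (simp add: norm_mult norm_power mult_left_mono norm_laguerre_le)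
  also have "\<dots> \<le> (\<Sum>j. cmod s ^ j * laguerre \<nu> j (- cmod x))"
    using laguerre_sums[of "cmod s" \<nu> "- cmod x"] assms
    by (intro sum_le_suminf) (auto simp: sums_iff laguerre_nonneg)
  also have "\<dots> = exp (cmod x * cmod s / (1 - cmod s)) / (1 - cmod s) ^ Suc \<nu>"
    using sums_unique[OF laguerre_sums[of "cmod s" \<nu> "- cmod x"]] assms by simp
  finally show ?thesis .
qed

lemma borel_measurable_laguerre [measurable]:
  "laguerre \<nu> j \<in> borel_measurable (borel :: complex measure)"
  unfolding laguerre_def by measurable

text \<open>One term of the nonnegative generating series is at most the whole sum, and
  \<open>r = \<epsilon> / (1 + \<epsilon>)\<close> gives the exponent
  \<open>r / (1 - r) = \<epsilon>\<close>. A fixed Laguerre polynomial thus costs arbitrarily little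
  exponential growth.\<close>

lemma laguerre_norm_bound:
  assumes "\<epsilon> > 0"
  obtains C where "\<And>x :: complex. cmod (laguerre \<nu> j x) \<le> C * exp (\<epsilon> * cmod x)"
proof
  fix x :: complex
  define r where "r = \<epsilon> / (1 + \<epsilon>)"
  have r: "0 < r" "r < 1" "r / (1 - r) = \<epsilon>" using assms by (auto simp: r_def field_simps)
  have "r ^ j * laguerre \<nu> j (- cmod x) \<le> (\<Sum>j. r ^ j * laguerre \<nu> j (- cmod x))"
    using laguerre_sums[of r \<nu> "- cmod x"] r sum_le_suminf[of "\<lambda>j. r ^ j * laguerre \<nu> j (- cmod x)" "{j}"]
    by (auto simp: sums_iff laguerre_nonneg)
  also have "\<dots> = exp (\<epsilon> * cmod x) / (1 - r) ^ Suc \<nu>"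
  proof -
    have "(\<Sum>j. r ^ j * laguerre \<nu> j (- cmod x)) = exp (- (- cmod x * r / (1 - r))) / (1 - r) ^ Suc \<nu>"
      by (rule sums_unique[OF laguerre_sums, symmetric]) (use r in auto)
    also have "- (- cmod x * r / (1 - r)) = \<epsilon> * cmod x" unfolding r(3)[symmetric] by simp
    finally show ?thesis .
  qed
  finally have "laguerre \<nu> j (- cmod x) \<le> (exp (\<epsilon> * cmod x) / (1 - r) ^ Suc \<nu>) / r ^ j"
    using r by (simp add: field_simps)
  then show "cmod (laguerre \<nu> j x) \<le> (1 / (1 - \<epsilon> / (1 + \<epsilon>)) ^ Suc \<nu> / (\<epsilon> / (1 + \<epsilon>)) ^ j) * exp (\<epsilon> * cmod x)"
    using norm_laguerre_le[of \<nu> j x] by (simp add: r_def[symmetric] field_simps)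
qed

text \<open>The generating function is integrated term by term against a weighted test function. The
  variable \<open>v z\<close> is \<open>z\<^sup>2\<close> or its conjugate.\<close>

lemma laguerre_integral_sums:
  fixes g v :: "complex \<Rightarrow> complex"
  assumes [measurable]: "g \<in> borel_measurable borel" "v \<in> borel_measurable borel"
    and v: "\<And>z. cmod (v z) = (cmod z)\<^sup>2"
    and g: "\<And>z. cmod (g z) \<le> C * exp (c * (cmod z)\<^sup>2)"
    and s: "cmod s < 1" and a: "a > 0" and b: "b \<ge> 0" and \<kappa>: "\<kappa> \<ge> 0"
    and growth: "b / 2 + \<kappa> * cmod s / (1 - cmod s) + c < a"
  shows "(\<lambda>j. s ^ j * (\<integral>z. exp (of_real (b / 2) * v z) * laguerre \<nu> j (of_real \<kappa> * v z) * g z * of_real (radial_weight a \<nu> z) \<partial>area_measure)) sums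
    (1 / (1 - s) ^ Suc \<nu> * (\<integral>z. exp ((of_real (b / 2) - of_real \<kappa> * s / (1 - s)) * v z) * g z * of_real (radial_weight a \<nu> z) \<partial>area_measure))"
proof -
  define P where "P z = exp (of_real (b / 2) * v z) * g z * complex_of_real (radial_weight a \<nu> z)" for z
  define f where "f j z = s ^ j * laguerre \<nu> j (of_real \<kappa> * v z) * P z" for j z
  define F where "F z = exp (- (of_real \<kappa> * v z * s / (1 - s))) / (1 - s) ^ Suc \<nu> * P z" for z
  have "0 \<le> C * exp (c * (cmod 0)\<^sup>2)" by (rule order_trans[OF norm_ge_zero g])
  then have C: "C \<ge> 0" by (meson exp_gt_zero mult_neg_pos not_le)
  have Pn: "cmod (P z) \<le> C * exp ((b / 2 + c) * (cmod z)\<^sup>2) * radial_weight a \<nu> z" for z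
  proof -
    have "cmod (P z) = cmod (exp (of_real (b / 2) * v z)) * cmod (g z) * radial_weight a \<nu> z"
      by (simp only: P_def norm_mult norm_of_real abs_of_nonneg[OF radial_weight_nonneg])
    also have "\<dots> \<le> exp (cmod (of_real (b / 2) * v z)) * (C * exp (c * (cmod z)\<^sup>2)) * radial_weight a \<nu> z"
      by (intro mult_mono g norm_exp_le radial_weight_nonneg order_refl mult_nonneg_nonneg) (use C in auto)
    also have "\<dots> = C * exp ((b / 2 + c) * (cmod z)\<^sup>2) * radial_weight a \<nu> z"
      using b by (simp add: norm_mult v distrib_right exp_add)
    finally show ?thesis .
  qed
  define K where "K = C / (1 - cmod s) ^ Suc \<nu>"
  have bound: "cmod (\<Sum>j<n. f j z) \<le> K * exp ((b / 2 + \<kappa> * cmod s / (1 - cmod s) + c) * (cmod z)\<^sup>2) * radial_weight a \<nu> z" for n z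
  proof -
    have "(\<Sum>j<n. f j z) = (\<Sum>j<n. s ^ j * laguerre \<nu> j (of_real \<kappa> * v z)) * P z"
      unfolding f_def sum_distrib_right ..
    then have "cmod (\<Sum>j<n. f j z) = cmod (\<Sum>j<n. s ^ j * laguerre \<nu> j (of_real \<kappa> * v z)) * cmod (P z)"
      by (simp only: norm_mult)
    also have "\<dots> \<le> (exp (cmod (of_real \<kappa> * v z) * cmod s / (1 - cmod s)) / (1 - cmod s) ^ Suc \<nu>) * (C * exp ((b / 2 + c) * (cmod z)\<^sup>2) * radial_weight a \<nu> z)"
      using s by (intro mult_mono laguerre_partial_sum_bound[OF s] Pn) auto
    also have "\<dots> = K * exp ((b / 2 + \<kappa> * cmod s / (1 - cmod s) + c) * (cmod z)\<^sup>2) * radial_weight a \<nu> z"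
    proof -
      have "exp ((b / 2 + \<kappa> * cmod s / (1 - cmod s) + c) * (cmod z)\<^sup>2) =
         exp (cmod (of_real \<kappa> * v z) * cmod s / (1 - cmod s)) * exp ((b / 2 + c) * (cmod z)\<^sup>2)"
        using \<kappa> by (simp add: exp_add[symmetric] norm_mult v algebra_simps)
      then show ?thesis by (simp add: K_def)
    qed
    finally show ?thesis .
  qed
  have Pm [measurable]: "P \<in> borel_measurable borel" unfolding P_def by measurable
  have int: "integrable area_measure (f j)" for j
  proof -
    have grow': "b / 2 + c < a"
    proof -
      have "\<kappa> * cmod s / (1 - cmod s) \<ge> 0" using \<kappa> s by simp
      then show ?thesis using growth by linarith
    qed
    \<comment> \<open>A single term is allowed half of the gap to \<open>a\<close>; dividing by
      \<open>\<kappa> + 1\<close> below converts this rate in \<open>|z|^2\<close> into a rate in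
      the Laguerre argument.\<close>
    define \<epsilon> where "\<epsilon> = (a - (b / 2 + c)) / 2"
    have \<epsilon>: "\<epsilon> > 0" "b / 2 + c + \<epsilon> < a" using grow' by (auto simp: \<epsilon>_def field_simps)
    define \<epsilon>' where "\<epsilon>' = \<epsilon> / (\<kappa> + 1)"
    have \<epsilon>': "\<epsilon>' > 0" "\<epsilon>' * \<kappa> \<le> \<epsilon>" using \<epsilon>(1) \<kappa> by (auto simp: \<epsilon>'_def field_simps)
    obtain D where D: "\<And>x :: complex. cmod (laguerre \<nu> j x) \<le> D * exp (\<epsilon>' * cmod x)"
      using laguerre_norm_bound[OF \<epsilon>'(1)] by blast
    have D0: "D \<ge> 0" using order_trans[OF norm_ge_zero D[of 0]] by simp
    show ?thesis
    proof (rule Bochner_Integration.integrable_bound)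
      show "integrable area_measure (\<lambda>z. (cmod s ^ j * D * C) * exp ((b / 2 + c + \<epsilon>) * (cmod z)\<^sup>2) * radial_weight a \<nu> z)"
        by (rule integrable_exp_radial_weight[OF \<epsilon>(2) a])
      show "f j \<in> borel_measurable area_measure" unfolding f_def by measurable
      show "AE z in area_measure. cmod (f j z) \<le> norm ((cmod s ^ j * D * C) * exp ((b / 2 + c + \<epsilon>) * (cmod z)\<^sup>2) * radial_weight a \<nu> z)"
      proof (rule AE_I2)
        fix z
        have "cmod (f j z) = cmod s ^ j * cmod (laguerre \<nu> j (of_real \<kappa> * v z)) * cmod (P z)"
          by (simp only: f_def norm_mult norm_power)
        also have "\<dots> \<le> cmod s ^ j * (D * exp (\<epsilon> * (cmod z)\<^sup>2)) * (C * exp ((b / 2 + c) * (cmod z)\<^sup>2) * radial_weight a \<nu> z)"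
        proof (intro mult_mono Pn order_refl mult_nonneg_nonneg)
          have "\<epsilon>' * cmod (of_real \<kappa> * v z) = (\<epsilon>' * \<kappa>) * (cmod z)\<^sup>2" using \<kappa> by (simp add: norm_mult v)
          also have "\<dots> \<le> \<epsilon> * (cmod z)\<^sup>2" by (intro mult_right_mono \<epsilon>') auto
          finally show "cmod (laguerre \<nu> j (of_real \<kappa> * v z)) \<le> D * exp (\<epsilon> * (cmod z)\<^sup>2)"
            using order_trans[OF D mult_left_mono[OF _ D0]] by (metis exp_le_cancel_iff)
        qed (use D0 in auto)
        also have "\<dots> = (cmod s ^ j * D * C) * exp ((b / 2 + c + \<epsilon>) * (cmod z)\<^sup>2) * radial_weight a \<nu> z"
          by (simp add: distrib_right exp_add)
        also have "\<dots> \<le> norm \<dots>" by simp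
        finally show "cmod (f j z) \<le> norm ((cmod s ^ j * D * C) * exp ((b / 2 + c + \<epsilon>) * (cmod z)\<^sup>2) * radial_weight a \<nu> z)" .
      qed
    qed
  qed
  have "(\<lambda>j. integral\<^sup>L area_measure (f j)) sums integral\<^sup>L area_measure F"
  proof (rule sums_integral_dominated[OF int _ bound integrable_exp_radial_weight[OF growth a]])
    show "(\<lambda>j. f j z) sums F z" for z
      unfolding f_def F_def by (intro sums_mult2 laguerre_sums s)
  qed
  moreover have "integral\<^sup>L area_measure (f j) = s ^ j * (\<integral>z. exp (of_real (b / 2) * v z) * laguerre \<nu> j (of_real \<kappa> * v z) * g z * of_real (radial_weight a \<nu> z) \<partial>area_measure)" for j
  proof -
    have "f j = (\<lambda>z. s ^ j * (exp (of_real (b / 2) * v z) * laguerre \<nu> j (of_real \<kappa> * v z) * g z * of_real (radial_weight a \<nu> z)))"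
      by (simp add: f_def P_def fun_eq_iff)
    then show ?thesis by (simp only: integral_mult_right_zero)
  qed
  moreover have "integral\<^sup>L area_measure F = 1 / (1 - s) ^ Suc \<nu> * (\<integral>z. exp ((of_real (b / 2) - of_real \<kappa> * s / (1 - s)) * v z) * g z * of_real (radial_weight a \<nu> z) \<partial>area_measure)"
  proof -
    have e: "exp (- (of_real \<kappa> * v z * s / (1 - s))) * exp (of_real (b / 2) * v z) = exp ((of_real (b / 2) - of_real \<kappa> * s / (1 - s)) * v z)" for z
      by (simp add: exp_add[symmetric] algebra_simps)
    have "F = (\<lambda>z. 1 / (1 - s) ^ Suc \<nu> * (exp ((of_real (b / 2) - of_real \<kappa> * s / (1 - s)) * v z) * g z * of_real (radial_weight a \<nu> z)))"
      unfolding F_def P_def e[symmetric] by (simp add: fun_eq_iff)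
    then show ?thesis by (simp only: integral_mult_right_zero)
  qed
  ultimately show ?thesis by simp
qed

text \<open>The parameters \<open>b = a \<tau>\<close> and \<open>\<kappa> = (a\<^sup>2 - b\<^sup>2) / (2 b)\<close> are those of the weight
  \<open>K\<^sub>\<nu>(a|u|) |u|\<^sup>\<nu> exp (b Re u)\<close>; the exponential is split evenly between the two factors.\<close>

definition weighted_laguerre :: "real \<Rightarrow> real \<Rightarrow> nat \<Rightarrow> nat \<Rightarrow> complex \<Rightarrow> complex" where
  "weighted_laguerre a \<tau> \<nu> j u = exp (of_real (a * \<tau> / 2) * u) * laguerre \<nu> j (of_real (a * (1 - \<tau>\<^sup>2) / (2 * \<tau>)) * u)"

lemma borel_measurable_weighted_laguerre [measurable]:
  "weighted_laguerre a \<tau> \<nu> j \<in> borel_measurable borel"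
  unfolding weighted_laguerre_def by measurable

lemma weighted_laguerre_bound:
  assumes a: "a > 0" and \<tau>: "0 < \<tau>" "\<tau> < 1" and \<epsilon>: "\<epsilon> > 0"
  obtains C where "\<And>u. cmod (weighted_laguerre a \<tau> \<nu> j u) \<le> C * exp ((a * \<tau> / 2 + \<epsilon>) * cmod u)"
proof -
  define \<kappa> where "\<kappa> = a * (1 - \<tau>\<^sup>2) / (2 * \<tau>)"
  have \<kappa>: "\<kappa> > 0" using a \<tau> by (simp add: \<kappa>_def power_less_one_iff)
  obtain C where C: "\<And>x :: complex. cmod (laguerre \<nu> j x) \<le> C * exp ((\<epsilon> / \<kappa>) * cmod x)"
    using laguerre_norm_bound[of "\<epsilon> / \<kappa>"] \<epsilon> \<kappa> by auto
  show ?thesis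
  proof
    fix u
    have "cmod (weighted_laguerre a \<tau> \<nu> j u) = cmod (exp (of_real (a * \<tau> / 2) * u)) * cmod (laguerre \<nu> j (of_real \<kappa> * u))"
      by (simp only: weighted_laguerre_def \<kappa>_def norm_mult)
    also have "\<dots> \<le> exp (cmod (of_real (a * \<tau> / 2) * u)) * (C * exp ((\<epsilon> / \<kappa>) * cmod (of_real \<kappa> * u)))"
      by (intro mult_mono norm_exp_le C) auto
    also have "\<dots> = C * exp ((a * \<tau> / 2 + \<epsilon>) * cmod u)"
      using a \<tau> \<kappa> by (simp add: norm_mult distrib_right exp_add)
    finally show "cmod (weighted_laguerre a \<tau> \<nu> j u) \<le> C * exp ((a * \<tau> / 2 + \<epsilon>) * cmod u)" .
  qed
qed

text \<open>After integration, \<open>(1 - s) (1 - 4 \<xi> \<mu> / a^2)\<close> is affine in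
  \<open>s\<close>, equal to \<open>\<alpha>0 - \<beta>0 s\<close>. The integrated generating
  function is therefore again a negative binomial series, whose coefficients are the claimed
  integrals.\<close>

lemma weighted_laguerre_exp_integral:
  assumes a: "a > 0" and \<nu>: "\<nu> \<ge> 1" and \<tau>: "0 < \<tau>" "\<tau> < 1" and \<mu>: "cmod \<mu> < a * (1 - \<tau> / 2)"
  shows "(\<integral>z. weighted_laguerre a \<tau> \<nu> i (z\<^sup>2) * exp (\<mu> * (cnj z)\<^sup>2) * of_real (radial_weight a \<nu> z) \<partial>area_measure) =
    of_real (2 * fact \<nu> / a\<^sup>2) / (1 - 2 * \<mu> * of_real (\<tau> / a)) ^ Suc \<nu> * of_nat ((i + \<nu>) choose \<nu>) *
      ((1 - 2 * \<mu> / of_real (a * \<tau>)) / (1 - 2 * \<mu> * of_real (\<tau> / a))) ^ i"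
proof -
  define b \<kappa> where "b = a * \<tau>" and "\<kappa> = a * (1 - \<tau>\<^sup>2) / (2 * \<tau>)"
  have \<kappa>: "\<kappa> > 0" using a \<tau> by (simp add: \<kappa>_def power_less_one_iff)
  have b: "b > 0" using a \<tau> by (simp add: b_def)
  have gap: "a - b / 2 - cmod \<mu> > 0" using \<mu> by (simp add: b_def algebra_simps)
  define \<alpha>0 \<beta>0 where "\<alpha>0 = 1 - 2 * \<mu> * of_real (\<tau> / a)" and "\<beta>0 = 1 - 2 * \<mu> / of_real (a * \<tau>)"
  have "\<tau> * (2 - \<tau>) < 1"
    using zero_less_power2[of "1 - \<tau>"] \<tau> by (simp add: power2_eq_square algebra_simps)
  moreover have "cmod (2 * \<mu> * of_real (\<tau> / a)) \<le> \<tau> * (2 - \<tau>)"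
  proof -
    have "cmod (2 * \<mu> * of_real (\<tau> / a)) = 2 * cmod \<mu> * (\<tau> / a)" using a \<tau> by (simp add: norm_mult norm_divide)
    also have "\<dots> \<le> 2 * (a * (1 - \<tau> / 2)) * (\<tau> / a)" using \<mu> a \<tau> by (intro mult_right_mono mult_left_mono) auto
    also have "\<dots> = \<tau> * (2 - \<tau>)" using a by (simp add: field_simps)
    finally show ?thesis .
  qed
  ultimately have "cmod (2 * \<mu> * of_real (\<tau> / a)) < 1" by linarith
  then have \<alpha>0: "\<alpha>0 \<noteq> 0" by (auto simp: \<alpha>0_def)
  \<comment> \<open>Three demands on \<open>s\<close>: \<open>1 / 2\<close> gives
    \<open>|s| / (1 - |s|) \<le> 2 |s|\<close>, the second entry keeps the total exponential growth
    below \<open>a\<close>, and the third makes the series in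
    \<open>(\<beta>0 / \<alpha>0) s\<close> converge.\<close>
  define r where "r = min (1 / 2) (min ((a - b / 2 - cmod \<mu>) / (4 * \<kappa>)) (cmod \<alpha>0 / (cmod \<beta>0 + 1)))"
  have r: "r > 0" using gap \<kappa> \<alpha>0 by (auto simp: r_def add_nonneg_pos)
  define d where "d j = (\<integral>z. weighted_laguerre a \<tau> \<nu> j (z\<^sup>2) * exp (\<mu> * (cnj z)\<^sup>2) * of_real (radial_weight a \<nu> z) \<partial>area_measure)" for j
  define \<Phi> where "\<Phi> s = of_real (2 * fact \<nu> / a\<^sup>2) / (\<alpha>0 - \<beta>0 * s) ^ Suc \<nu>" for s :: complex
  define c0 where "c0 = of_real (2 * fact \<nu> / a\<^sup>2) / \<alpha>0 ^ Suc \<nu>"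
  have left: "(\<lambda>j. d j * s ^ j) sums \<Phi> s" if s: "cmod s < r" for s
  proof -
    have s1: "cmod s < 1 / 2" "cmod s < (a - b / 2 - cmod \<mu>) / (4 * \<kappa>)" using s by (auto simp: r_def)
    have "cmod s / (1 - cmod s) \<le> 2 * cmod s"
    proof -
      have "0 \<le> cmod s * (1 - 2 * cmod s)" using s1 by simp
      then show ?thesis using s1 by (simp add: divide_simps algebra_simps)
    qed
    then have ks: "\<kappa> * cmod s / (1 - cmod s) \<le> 2 * \<kappa> * cmod s"
      using mult_left_mono[of "cmod s / (1 - cmod s)" "2 * cmod s" \<kappa>] \<kappa> by simp
    also have "2 * \<kappa> * cmod s \<le> (a - b / 2 - cmod \<mu>) / 2" using s1(2) \<kappa> by (simp add: field_simps)
    finally have ks2: "\<kappa> * cmod s / (1 - cmod s) \<le> (a - b / 2 - cmod \<mu>) / 2" .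
    have growth: "b / 2 + \<kappa> * cmod s / (1 - cmod s) + cmod \<mu> < a" using ks2 gap by argo
    have S: "(\<lambda>j. s ^ j * d j) sums
      (1 / (1 - s) ^ Suc \<nu> * (\<integral>z. exp ((of_real (b / 2) - of_real \<kappa> * s / (1 - s)) * z\<^sup>2) * exp (\<mu> * (cnj z)\<^sup>2) * of_real (radial_weight a \<nu> z) \<partial>area_measure))"
      unfolding d_def weighted_laguerre_def b_def[symmetric] \<kappa>_def[symmetric]
    proof (rule laguerre_integral_sums[where C = 1 and c = "cmod \<mu>"])
      show "cmod (exp (\<mu> * (cnj z)\<^sup>2)) \<le> 1 * exp (cmod \<mu> * (cmod z)\<^sup>2)" for z
        using norm_exp_le[of "\<mu> * (cnj z)\<^sup>2"] by (simp add: norm_mult norm_power)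
    qed (use a b \<kappa> s1 growth in \<open>auto simp: norm_power\<close>)
    define \<xi> where "\<xi> = of_real (b / 2) - of_real \<kappa> * s / (1 - s)"
    have sne: "1 - s \<noteq> 0" using s1 by auto
    have n1s: "1 - cmod s \<le> cmod (1 - s)" using norm_triangle_ineq2[of 1 s] by simp
    have "cmod \<xi> \<le> b / 2 + \<kappa> * cmod s / (1 - cmod s)"
    proof -
      have "cmod \<xi> \<le> cmod (of_real (b / 2)) + cmod (of_real \<kappa> * s / (1 - s))" unfolding \<xi>_def by (rule norm_triangle_ineq4)
      also have "\<dots> = b / 2 + \<kappa> * cmod s / cmod (1 - s)" using b \<kappa> by (simp add: norm_mult norm_divide)
      also have "\<dots> \<le> b / 2 + \<kappa> * cmod s / (1 - cmod s)"
        using n1s s1 \<kappa> by (intro add_left_mono divide_left_mono mult_pos_pos) auto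
      finally show ?thesis .
    qed
    then have "cmod \<xi> + cmod \<mu> < a" using growth by linarith
    note I = radial_exp_inner_product[OF a \<nu> this]
    have "(1 - s) * (1 - 4 * \<xi> * \<mu> / of_real (a\<^sup>2)) = \<alpha>0 - \<beta>0 * s"
    proof -
      have e0: "(1 - s) * (of_real \<kappa> * s / (1 - s)) = of_real \<kappa> * s" using sne by simp
      have "(1 - s) * \<xi> = (1 - s) * of_real (b / 2) - of_real \<kappa> * s"
        by (simp only: \<xi>_def right_diff_distrib e0)
      also have "\<dots> = of_real (b / 2) - of_real (b / 2 + \<kappa>) * s" by (simp add: algebra_simps del: of_real_divide)
      \<comment> \<open>The value of \<open>\<kappa>\<close> enters here. It makes
        \<open>\<beta>0\<close> vanish at \<open>\<mu> = b / 2\<close>, the exponent already present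
        in the weighted polynomials; orthogonality rests on this.\<close>
      also have "b / 2 + \<kappa> = a / (2 * \<tau>)" using \<tau> by (simp add: b_def \<kappa>_def field_simps power2_eq_square)
      finally have e1: "(1 - s) * \<xi> = of_real (b / 2) - of_real (a / (2 * \<tau>)) * s" .
      have "(1 - s) * (1 - 4 * \<xi> * \<mu> / of_real (a\<^sup>2)) = (1 - s) - 4 * ((1 - s) * \<xi>) * \<mu> / of_real (a\<^sup>2)"
        by (simp add: algebra_simps)
      also have "\<dots> = \<alpha>0 - \<beta>0 * s"
        unfolding e1 \<alpha>0_def \<beta>0_def b_def using a \<tau> by (simp add: field_simps power2_eq_square)
      finally show ?thesis .
    qed
    then have "1 / (1 - s) ^ Suc \<nu> * (of_real (2 * fact \<nu> / a\<^sup>2) / (1 - 4 * \<xi> * \<mu> / of_real (a\<^sup>2)) ^ Suc \<nu>) = \<Phi> s"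
      by (simp only: \<Phi>_def times_divide_times_eq power_mult_distrib[symmetric] mult_1)
    with S show ?thesis unfolding \<xi>_def[symmetric] I by (simp add: mult.commute)
  qed
  have right: "(\<lambda>j. (c0 * of_nat ((j + \<nu>) choose \<nu>) * (\<beta>0 / \<alpha>0) ^ j) * s ^ j) sums \<Phi> s" if s: "cmod s < r" for s
  proof -
    have q: "cmod (\<beta>0 / \<alpha>0 * s) < 1"
    proof -
      have "cmod s < cmod \<alpha>0 / (cmod \<beta>0 + 1)" using s by (simp add: r_def)
      then have "cmod s * (cmod \<beta>0 + 1) < cmod \<alpha>0"
        by (subst (asm) pos_less_divide_eq) (auto simp: add_nonneg_pos)
      moreover have "cmod \<beta>0 * cmod s \<le> cmod s * (cmod \<beta>0 + 1)" by (simp add: algebra_simps)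
      ultimately have "cmod \<beta>0 * cmod s < cmod \<alpha>0" by linarith
      then show ?thesis using \<alpha>0 by (simp add: norm_mult norm_divide)
    qed
    have e: "c0 * (1 / (1 - \<beta>0 / \<alpha>0 * s) ^ Suc \<nu>) = \<Phi> s"
    proof -
      have "\<alpha>0 - \<beta>0 * s = \<alpha>0 * (1 - \<beta>0 / \<alpha>0 * s)" using \<alpha>0 by (simp add: field_simps)
      then show ?thesis by (simp only: c0_def \<Phi>_def power_mult_distrib times_divide_times_eq mult_1_right)
    qed
    have "(\<lambda>j. c0 * (of_nat ((j + \<nu>) choose \<nu>) * (\<beta>0 / \<alpha>0 * s) ^ j)) sums (c0 * (1 / (1 - \<beta>0 / \<alpha>0 * s) ^ Suc \<nu>))"
      by (intro sums_mult negative_binomial_sums q)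
    then show ?thesis unfolding e by (simp only: power_mult_distrib mult.assoc)
  qed
  have "d i = c0 * of_nat ((i + \<nu>) choose \<nu>) * (\<beta>0 / \<alpha>0) ^ i"
    by (rule power_series_unique[OF r left right])
  then show ?thesis by (simp only: d_def c0_def \<alpha>0_def \<beta>0_def)
qed

lemma integrable_weighted_laguerre:
  assumes a: "a > 0" and \<tau>: "0 < \<tau>" "\<tau> < 1"
  shows "integrable area_measure (\<lambda>z. weighted_laguerre a \<tau> \<nu> i (z\<^sup>2) * weighted_laguerre a \<tau> \<nu> j ((cnj z)\<^sup>2) * of_real (radial_weight a \<nu> z))"
proof -
  define \<epsilon> where "\<epsilon> = a * (1 - \<tau>) / 3"
  have \<epsilon>: "\<epsilon> > 0" "(a * \<tau> / 2 + \<epsilon>) + (a * \<tau> / 2 + \<epsilon>) < a" using a \<tau> by (auto simp: \<epsilon>_def field_simps)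
  obtain C where C: "\<And>u. cmod (weighted_laguerre a \<tau> \<nu> i u) \<le> C * exp ((a * \<tau> / 2 + \<epsilon>) * cmod u)"
    using weighted_laguerre_bound[OF a \<tau> \<epsilon>(1)] by blast
  obtain D where D: "\<And>u. cmod (weighted_laguerre a \<tau> \<nu> j u) \<le> D * exp ((a * \<tau> / 2 + \<epsilon>) * cmod u)"
    using weighted_laguerre_bound[OF a \<tau> \<epsilon>(1)] by blast
  have C0: "C \<ge> 0" using order_trans[OF norm_ge_zero C[of 0]] by simp
  show ?thesis
  proof (rule integrable_radial_weight[where C = "C * D", OF _ _ \<epsilon>(2) a])
    fix z
    have "cmod (weighted_laguerre a \<tau> \<nu> i (z\<^sup>2) * weighted_laguerre a \<tau> \<nu> j ((cnj z)\<^sup>2)) \<le>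
       (C * exp ((a * \<tau> / 2 + \<epsilon>) * cmod (z\<^sup>2))) * (D * exp ((a * \<tau> / 2 + \<epsilon>) * cmod ((cnj z)\<^sup>2)))"
      unfolding norm_mult by (intro mult_mono C D) (use C0 in auto)
    also have "\<dots> = C * D * exp ((a * \<tau> / 2 + \<epsilon> + (a * \<tau> / 2 + \<epsilon>)) * (cmod z)\<^sup>2)"
    proof -
      have "(C * exp (e * x)) * (D * exp (e * x)) = C * D * exp ((e + e) * x)" for e x
      proof -
        have "exp ((e + e) * x) = exp (e * x) * exp (e * x)" by (simp only: distrib_right exp_add)
        then show ?thesis by (simp only: mult_ac)
      qed
      from this[of "a * \<tau> / 2 + \<epsilon>" "(cmod z)\<^sup>2"] show ?thesis by (simp only: norm_power complex_mod_cnj)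
    qed
    finally show "cmod (weighted_laguerre a \<tau> \<nu> i (z\<^sup>2) * weighted_laguerre a \<tau> \<nu> j ((cnj z)\<^sup>2)) \<le> C * D * exp ((a * \<tau> / 2 + \<epsilon> + (a * \<tau> / 2 + \<epsilon>)) * (cmod z)\<^sup>2)" .
  qed measurable
qed

text \<open>The second factor is replaced by its generating function, i.e. by exponentials with rate
  \<open>\<mu>\<close> depending on \<open>s\<close>. Inserted in
  \<open>weighted_laguerre_exp_integral\<close>, the Moebius quotient becomes
  \<open>s / \<tau>^2\<close> and the powers of \<open>1 - s\<close> cancel. What remains is the
  single monomial \<open>h s^i\<close>, which gives vanishing and norm together.\<close>

lemma weighted_laguerre_orthogonal:
  assumes a: "a > 0" and \<nu>: "\<nu> \<ge> 1" and \<tau>: "0 < \<tau>" "\<tau> < 1"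
  shows "(\<integral>z. weighted_laguerre a \<tau> \<nu> i (z\<^sup>2) * weighted_laguerre a \<tau> \<nu> j ((cnj z)\<^sup>2) * of_real (radial_weight a \<nu> z) \<partial>area_measure) =
    (if i = j then of_real (2 * fact \<nu> / a\<^sup>2 * real ((i + \<nu>) choose \<nu>) / ((1 - \<tau>\<^sup>2) ^ Suc \<nu> * (\<tau>\<^sup>2) ^ i)) else 0)"
proof -
  define b \<kappa> where "b = a * \<tau>" and "\<kappa> = a * (1 - \<tau>\<^sup>2) / (2 * \<tau>)"
  have \<kappa>: "\<kappa> > 0" using a \<tau> by (simp add: \<kappa>_def power_less_one_iff)
  have b: "b > 0" "b < a" using a \<tau> by (auto simp: b_def)
  \<comment> \<open>Each of the two factors grows at rate \<open>b / 2\<close> plus at most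
    \<open>\<epsilon>\<close>, so the total \<open>b + 2 \<epsilon>\<close> stays below
    \<open>a = b + 4 \<epsilon>\<close>.\<close>
  define \<epsilon> where "\<epsilon> = (a - b) / 4"
  have \<epsilon>: "\<epsilon> > 0" using b by (simp add: \<epsilon>_def)
  define W where "W z = complex_of_real (radial_weight a \<nu> z)" for z
  define d where "d j = (\<integral>z. weighted_laguerre a \<tau> \<nu> j ((cnj z)\<^sup>2) * weighted_laguerre a \<tau> \<nu> i (z\<^sup>2) * W z \<partial>area_measure)" for j
  define h :: complex where "h = of_real (2 * fact \<nu> / a\<^sup>2 * real ((i + \<nu>) choose \<nu>) / ((1 - \<tau>\<^sup>2) ^ Suc \<nu> * (\<tau>\<^sup>2) ^ i) :: real)"
  define r where "r = min (1 / 2) (\<epsilon> / (4 * \<kappa>))"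
  have r: "r > 0" using \<epsilon> \<kappa> by (simp add: r_def)
  obtain C where C: "\<And>u. cmod (weighted_laguerre a \<tau> \<nu> i u) \<le> C * exp ((a * \<tau> / 2 + \<epsilon>) * cmod u)"
    using weighted_laguerre_bound[OF a \<tau> \<epsilon>] by blast
  have left: "(\<lambda>j. d j * s ^ j) sums (h * s ^ i)" if s: "cmod s < r" for s
  proof -
    have s1: "cmod s < 1 / 2" "cmod s < \<epsilon> / (4 * \<kappa>)" using s by (auto simp: r_def)
    have "cmod s / (1 - cmod s) \<le> 2 * cmod s"
    proof -
      have "0 \<le> cmod s * (1 - 2 * cmod s)" using s1 by simp
      then show ?thesis using s1 by (simp add: divide_simps algebra_simps)
    qed
    then have ks: "\<kappa> * cmod s / (1 - cmod s) \<le> 2 * \<kappa> * cmod s"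
      using mult_left_mono[of "cmod s / (1 - cmod s)" "2 * cmod s" \<kappa>] \<kappa> by simp
    also have "2 * \<kappa> * cmod s \<le> \<epsilon>" using s1(2) \<kappa> \<epsilon> by (simp add: field_simps)
    finally have ks2: "\<kappa> * cmod s / (1 - cmod s) \<le> \<epsilon>" .
    have growth: "b / 2 + \<kappa> * cmod s / (1 - cmod s) + (b / 2 + \<epsilon>) < a"
    proof -
      have "a = b + 4 * \<epsilon>" by (simp add: \<epsilon>_def field_simps)
      then show ?thesis using ks2 \<epsilon> by linarith
    qed
    define \<mu> where "\<mu> = of_real (b / 2) - of_real \<kappa> * s / (1 - s)"
    have S: "(\<lambda>j. s ^ j * d j) sums
      (1 / (1 - s) ^ Suc \<nu> * (\<integral>z. exp (\<mu> * (cnj z)\<^sup>2) * weighted_laguerre a \<tau> \<nu> i (z\<^sup>2) * W z \<partial>area_measure))"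
      unfolding d_def weighted_laguerre_def[of a \<tau> \<nu> _ "(cnj _)\<^sup>2"] b_def[symmetric] \<kappa>_def[symmetric] \<mu>_def W_def
    proof (rule laguerre_integral_sums[where C = C and c = "b / 2 + \<epsilon>"])
      show "cmod (weighted_laguerre a \<tau> \<nu> i (z\<^sup>2)) \<le> C * exp ((b / 2 + \<epsilon>) * (cmod z)\<^sup>2)" for z
        using C[of "z\<^sup>2"] by (simp add: norm_power b_def)
    qed (use a b \<kappa> s1 growth in \<open>auto simp: norm_power\<close>)
    have sne: "1 - s \<noteq> 0" using s1 by auto
    have n1s: "1 - cmod s \<le> cmod (1 - s)" using norm_triangle_ineq2[of 1 s] by simp
    have "cmod \<mu> \<le> b / 2 + \<kappa> * cmod s / (1 - cmod s)"
    proof -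
      have "cmod \<mu> \<le> cmod (of_real (b / 2)) + cmod (of_real \<kappa> * s / (1 - s))" unfolding \<mu>_def by (rule norm_triangle_ineq4)
      also have "\<dots> = b / 2 + \<kappa> * cmod s / cmod (1 - s)" using b \<kappa> by (simp add: norm_mult norm_divide)
      also have "\<dots> \<le> b / 2 + \<kappa> * cmod s / (1 - cmod s)"
        using n1s s1 \<kappa> by (intro add_left_mono divide_left_mono mult_pos_pos) auto
      finally show ?thesis .
    qed
    then have \<mu>a: "cmod \<mu> < a * (1 - \<tau> / 2)" using growth \<epsilon> by (simp add: b_def algebra_simps)
    have "(\<integral>z. exp (\<mu> * (cnj z)\<^sup>2) * weighted_laguerre a \<tau> \<nu> i (z\<^sup>2) * W z \<partial>area_measure) =
      of_real (2 * fact \<nu> / a\<^sup>2) / (1 - 2 * \<mu> * of_real (\<tau> / a)) ^ Suc \<nu> * of_nat ((i + \<nu>) choose \<nu>) *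
      ((1 - 2 * \<mu> / of_real (a * \<tau>)) / (1 - 2 * \<mu> * of_real (\<tau> / a))) ^ i"
      unfolding weighted_laguerre_exp_integral[OF a \<nu> \<tau> \<mu>a, symmetric] W_def by (simp only: mult.commute[of "exp _"])
    also have "1 - 2 * \<mu> * of_real (\<tau> / a) = of_real (1 - \<tau>\<^sup>2) / (1 - s)"
      using sne a \<tau> by (simp add: \<mu>_def b_def \<kappa>_def field_simps power2_eq_square)
    also have "(1 - 2 * \<mu> / of_real (a * \<tau>)) / (of_real (1 - \<tau>\<^sup>2) / (1 - s)) = s / of_real (\<tau>\<^sup>2)"
    proof -
      have t: "1 - \<tau>\<^sup>2 \<noteq> 0" using \<tau> by (simp add: power2_eq_1_iff)
      have "1 - 2 * \<mu> / of_real (a * \<tau>) = 2 * (of_real \<kappa> * s / (1 - s)) / of_real (a * \<tau>)"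
      proof -
        have "2 * \<mu> = of_real (a * \<tau>) - 2 * (of_real \<kappa> * s / (1 - s))" by (simp add: \<mu>_def b_def)
        then show ?thesis using a \<tau> by (simp only: diff_divide_distrib) simp
      qed
      also have "\<dots> = of_real (2 * \<kappa> / (a * \<tau>)) * (s / (1 - s))" by (simp add: mult_ac)
      also have "2 * \<kappa> / (a * \<tau>) = (1 - \<tau>\<^sup>2) / \<tau>\<^sup>2" using a \<tau> by (simp add: \<kappa>_def power2_eq_square)
      finally show ?thesis using sne t by (simp del: of_real_diff of_real_power)
    qed
    finally have I: "(\<integral>z. exp (\<mu> * (cnj z)\<^sup>2) * weighted_laguerre a \<tau> \<nu> i (z\<^sup>2) * W z \<partial>area_measure) = of_real (2 * fact \<nu> / a\<^sup>2) / (of_real (1 - \<tau>\<^sup>2) / (1 - s)) ^ Suc \<nu> * of_nat ((i + \<nu>) choose \<nu>) * (s / of_real (\<tau>\<^sup>2)) ^ i" .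
    have "1 / (1 - s) ^ Suc \<nu> * (\<integral>z. exp (\<mu> * (cnj z)\<^sup>2) * weighted_laguerre a \<tau> \<nu> i (z\<^sup>2) * W z \<partial>area_measure) = h * s ^ i"
    proof -
      have key: "1 / X * (c0 / (Y / X) * B * (S / T)) = c0 * B / (Y * T) * S" if "X \<noteq> 0" for X Y c0 B S T :: complex
        using that by simp
      have hh: "h = of_real (2 * fact \<nu> / a\<^sup>2) * of_nat ((i + \<nu>) choose \<nu>) / (of_real (1 - \<tau>\<^sup>2) ^ Suc \<nu> * of_real (\<tau>\<^sup>2) ^ i)"
        by (simp add: h_def)
      have X: "(1 - s) ^ Suc \<nu> \<noteq> 0" using sne by (simp del: power_Suc)
      show ?thesis unfolding I hh power_divide by (rule key[OF X])
    qed
    with S show ?thesis by (simp add: mult.commute)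
  qed
  have right: "(\<lambda>j. (if j = i then h else 0) * s ^ j) sums (h * s ^ i)" for s
    using sums_single[of i "\<lambda>j. h * s ^ j"] by (simp add: if_distrib[of "\<lambda>x. x * _"] cong: if_cong)
  have "d j = (if j = i then h else 0)"
    by (rule power_series_unique[OF r left right])
  moreover have "d j = (\<integral>z. weighted_laguerre a \<tau> \<nu> i (z\<^sup>2) * weighted_laguerre a \<tau> \<nu> j ((cnj z)\<^sup>2) * of_real (radial_weight a \<nu> z) \<partial>area_measure)"
    unfolding d_def W_def by (simp only: mult.commute[of "weighted_laguerre a \<tau> \<nu> j _"])
  ultimately show ?thesis by (simp add: h_def)
qed

section \<open>Contour integrals\<close>

lemma integral_cis_period:
  fixes k M :: nat
  shows "(LBINT \<theta>:{- pi..pi}. cis (real k * \<theta> - real M * \<theta>)) = (if k = M then of_real (2 * pi) else 0)"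
proof (cases "k = M")
  case True
  have "(LBINT \<theta>. indicator {- pi..pi} \<theta> *\<^sub>R (1::complex)) = of_real pi - of_real (- pi)"
  proof (rule integral_FTC_atLeastAtMost[of "- pi" pi of_real])
    show "((\<lambda>x. of_real x :: complex) has_vector_derivative 1) (at x within {- pi..pi})" for x
      by (rule has_vector_derivative_real_field) (auto intro!: derivative_eq_intros)
  qed auto
  then show ?thesis using True by (simp add: set_lebesgue_integral_def)
next
  case False
  define d where "d = real k - real M"
  have d: "d \<noteq> 0" using False by (simp add: d_def)
  define F where "F x = exp (\<i> * of_real d * x) / (\<i> * of_real d)" for x :: complex
  have c: "cis (real k * \<theta> - real M * \<theta>) = exp (\<i> * of_real d * of_real \<theta>)" for \<theta>
    by (simp add: cis_conv_exp d_def algebra_simps)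
  have "(LBINT \<theta>. indicator {- pi..pi} \<theta> *\<^sub>R exp (\<i> * of_real d * of_real \<theta>)) = F (of_real pi) - F (of_real (- pi))"
  proof (rule integral_FTC_atLeastAtMost[of "- pi" pi "\<lambda>x. F (of_real x)"])
    show "((\<lambda>x. F (of_real x)) has_vector_derivative exp (\<i> * of_real d * of_real x)) (at x within {- pi..pi})" for x
      unfolding F_def using d by (intro has_vector_derivative_real_field) (auto intro!: derivative_eq_intros)
  qed (auto intro!: continuous_intros)
  also have "\<dots> = 0"
  proof -
    have "exp (\<i> * of_real d * of_real pi) = cis (d * pi)" "exp (\<i> * of_real d * of_real (- pi)) = cis (- (d * pi))"
      by (simp_all add: cis_conv_exp mult.assoc)
    moreover have "sin (d * pi) = 0" by (simp add: d_def left_diff_distrib sin_diff sin_npi)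
    then have "cis (d * pi) = cis (- (d * pi))" by (simp add: complex_eq_iff)
    ultimately have "exp (\<i> * of_real d * of_real pi) = exp (\<i> * of_real d * of_real (- pi))" by (simp only:)
    then show ?thesis by (simp only: F_def diff_self)
  qed
  finally show ?thesis using False unfolding c set_lebesgue_integral_def by simp
qed

text \<open>Multiplication by \<open>1 / (1 - s)\<close> turns coefficients into their partial sums;
  the coefficient of index \<open>M\<close> is read off by integrating over a circle inside the
  pole, where the series converges absolutely.\<close>

lemma contour_partial_sum:
  fixes a :: "nat \<Rightarrow> complex"
  assumes r: "0 < r" "r < 1" and summ: "summable (\<lambda>j. cmod (a j) * r ^ j)"
    and G: "\<And>s. cmod s = r \<Longrightarrow> (\<lambda>j. a j * s ^ j) sums G s"
  shows "of_real (2 * pi) * (\<Sum>j\<le>M. a j) =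
    (LBINT \<theta>:{- pi..pi}. G (of_real r * cis \<theta>) / (1 - of_real r * cis \<theta>) / (of_real r * cis \<theta>) ^ M)"
proof -
  define b where "b k = (\<Sum>i\<le>k. a i)" for k
  have conv: "(\<Sum>i\<le>k. (a i * s ^ i) * s ^ (k - i)) = b k * s ^ k" for k s
    unfolding b_def sum_distrib_right by (intro sum.cong refl) (simp add: mult.assoc power_add[symmetric])
  have bs: "(\<lambda>k. b k * s ^ k) sums (G s / (1 - s))" if s: "cmod s = r" for s
  proof -
    have "summable (\<lambda>j. cmod (a j * s ^ j))" using summ s by (simp add: norm_mult norm_power)
    moreover have "summable (\<lambda>j. cmod (s ^ j))" using r s by (simp add: norm_power summable_geometric)
    ultimately have "(\<lambda>k. \<Sum>i\<le>k. (a i * s ^ i) * s ^ (k - i)) sums ((\<Sum>j. a j * s ^ j) * (\<Sum>j. s ^ j))"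
      by (rule Cauchy_product_sums)
    moreover have "(\<Sum>j. a j * s ^ j) = G s" using G[OF s] by (simp add: sums_iff)
    moreover have "(\<Sum>j. s ^ j) = 1 / (1 - s)" using r s by (intro suminf_geometric) simp
    ultimately show ?thesis by (simp add: conv)
  qed
  have bsum: "summable (\<lambda>k. cmod (b k) * r ^ k)"
  proof (rule summable_comparison_test')
    have "(\<lambda>k. \<Sum>i\<le>k. (cmod (a i) * r ^ i) * r ^ (k - i)) sums ((\<Sum>j. cmod (a j) * r ^ j) * (\<Sum>j. r ^ j))"
      using summ r by (intro Cauchy_product_sums) (auto simp: abs_mult power_abs)
    then show "summable (\<lambda>k. \<Sum>i\<le>k. (cmod (a i) * r ^ i) * r ^ (k - i))" by (simp add: sums_iff)
    fix k
    have "cmod (b k) * r ^ k \<le> (\<Sum>i\<le>k. cmod (a i)) * r ^ k"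
      unfolding b_def using r by (intro mult_right_mono norm_sum) auto
    also have "\<dots> = (\<Sum>i\<le>k. (cmod (a i) * r ^ i) * r ^ (k - i))"
      unfolding sum_distrib_right by (intro sum.cong refl) (simp add: mult.assoc power_add[symmetric])
    finally show "norm (cmod (b k) * r ^ k) \<le> (\<Sum>i\<le>k. (cmod (a i) * r ^ i) * r ^ (k - i))" using r by simp
  qed
  define z where "z \<theta> = of_real r * cis \<theta>" for \<theta>
  have z: "cmod (z \<theta>) = r" for \<theta> using r by (simp add: z_def norm_mult)
  have cz: "continuous_on UNIV z" unfolding z_def by (intro continuous_intros)
  then have [measurable]: "z \<in> borel_measurable borel" by (rule borel_measurable_continuous_onI)
  define f where "f k \<theta> = indicator {- pi..pi} \<theta> *\<^sub>R (b k * z \<theta> ^ k / z \<theta> ^ M)" for k \<theta>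
  define B where "B = (\<Sum>k. cmod (b k) * r ^ k)"
  have "(\<lambda>k. integral\<^sup>L lborel (f k)) sums (LBINT \<theta>. indicator {- pi..pi} \<theta> *\<^sub>R (G (z \<theta>) / (1 - z \<theta>) / z \<theta> ^ M))"
  proof (rule sums_integral_dominated)
    show "integrable lborel (\<lambda>\<theta>. indicator {- pi..pi} \<theta> *\<^sub>R (B / r ^ M))"
      by (intro integrable_scaleR_left) simp
    show "(\<lambda>k. f k \<theta>) sums (indicator {- pi..pi} \<theta> *\<^sub>R (G (z \<theta>) / (1 - z \<theta>) / z \<theta> ^ M))" for \<theta>
      unfolding f_def by (intro sums_scaleR_right sums_divide bs z)
    show "cmod (\<Sum>k<n. f k \<theta>) \<le> indicator {- pi..pi} \<theta> *\<^sub>R (B / r ^ M)" for n \<theta>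
    proof -
      have "cmod (\<Sum>k<n. f k \<theta>) \<le> (\<Sum>k<n. indicator {- pi..pi} \<theta> * (cmod (b k) * r ^ k / r ^ M))"
        by (rule sum_norm_le) (simp add: f_def norm_mult norm_divide norm_power z)
      also have "\<dots> = indicator {- pi..pi} \<theta> * ((\<Sum>k<n. cmod (b k) * r ^ k) / r ^ M)"
        by (simp add: sum_distrib_left sum_divide_distrib)
      also have "\<dots> \<le> indicator {- pi..pi} \<theta> * (B / r ^ M)"
        unfolding B_def using r by (intro mult_left_mono divide_right_mono sum_le_suminf bsum) auto
      finally show ?thesis by simp
    qed
    show "integrable lborel (f k)" for k
    proof -
      have "z \<theta> \<noteq> 0" for \<theta> using z[of \<theta>] r by auto
      then have "set_integrable lborel {- pi..pi} (\<lambda>\<theta>. b k * z \<theta> ^ k / z \<theta> ^ M)"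
        unfolding set_integrable_def
        by (intro borel_integrable_compact) (auto intro!: continuous_intros continuous_on_subset[OF cz])
      then show ?thesis unfolding set_integrable_def f_def .
    qed
  qed
  moreover have "integral\<^sup>L lborel (f k) = (if k = M then of_real (2 * pi) * b k else 0)" for k
  proof -
    have "f k = (\<lambda>\<theta>. (b k * of_real (r ^ k / r ^ M)) * (indicator {- pi..pi} \<theta> *\<^sub>R cis (real k * \<theta> - real M * \<theta>)))"
    proof
      fix \<theta>
      have "z \<theta> ^ k / z \<theta> ^ M = of_real (r ^ k / r ^ M) * (cis (real k * \<theta>) / cis (real M * \<theta>))"
        by (simp add: z_def power_mult_distrib Complex.DeMoivre)
      then show "f k \<theta> = (b k * of_real (r ^ k / r ^ M)) * (indicator {- pi..pi} \<theta> *\<^sub>R cis (real k * \<theta> - real M * \<theta>))"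
        by (simp add: f_def cis_divide times_divide_eq_right[symmetric] del: times_divide_eq_right)
    qed
    then have "integral\<^sup>L lborel (f k) = (b k * of_real (r ^ k / r ^ M)) * (LBINT \<theta>:{- pi..pi}. cis (real k * \<theta> - real M * \<theta>))"
      unfolding set_lebesgue_integral_def by (simp only: integral_mult_right_zero)
    then show ?thesis unfolding integral_cis_period using r by simp
  qed
  ultimately have "(\<lambda>k. if k = M then of_real (2 * pi) * b k else 0) sums (LBINT \<theta>:{- pi..pi}. G (z \<theta>) / (1 - z \<theta>) / z \<theta> ^ M)"
    by (simp add: set_lebesgue_integral_def)
  from sums_unique2[OF this sums_single[of M "\<lambda>k. of_real (2 * pi) * b k"]]
  show ?thesis by (simp add: b_def z_def)
qed

section \<open>Gaussian integrals along the line of real part -1\<close>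

text \<open>The imaginary part of the shift is handled by the characteristic function of the
  standard normal law and the real part by translation invariance, so no contour has to be
  moved.\<close>

lemma gaussian_integral_complex_shift:
  "integrable lborel (\<lambda>x. exp (- (of_real x + \<beta>)\<^sup>2 / 2))"
  "(LBINT x. exp (- (of_real x + \<beta>)\<^sup>2 / 2)) = complex_of_real (sqrt (2 * pi))"
proof -
  define p \<eta> where "p = Re \<beta>" and "\<eta> = Im \<beta>"
  have ints: "integrable std_normal_distribution (\<lambda>x. iexp (- \<eta> * x))"
  proof -
    interpret real_distribution std_normal_distribution by (rule real_dist_normal_dist)
    show ?thesis by (rule integrable_iexp) auto
  qed
  have dens: "(\<lambda>x. ennreal (std_normal_density x)) \<in> borel_measurable lborel" by measurable
  have i1: "integrable lborel (\<lambda>x. std_normal_density x *\<^sub>R iexp (- \<eta> * x))"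
    using ints by (subst (asm) integrable_density) auto
  have v1: "(LBINT x. std_normal_density x *\<^sub>R iexp (- \<eta> * x)) = of_real (exp (- (\<eta>\<^sup>2) / 2))"
    using fun_cong[OF char_std_normal_distribution, of "- \<eta>"] unfolding char_def
    by (subst (asm) integral_density) auto
  have eq: "exp (- (of_real x + \<i> * of_real \<eta>)\<^sup>2 / 2) =
    of_real (sqrt (2 * pi) * exp (\<eta>\<^sup>2 / 2)) * (std_normal_density x *\<^sub>R iexp (- \<eta> * x))" for x
  proof -
    have "- (of_real x + \<i> * of_real \<eta>)\<^sup>2 / 2 = of_real (\<eta>\<^sup>2 / 2) + (of_real (- x\<^sup>2 / 2) + \<i> * of_real (- \<eta> * x))"
      by (simp add: power2_eq_square field_simps)
    then have "exp (- (of_real x + \<i> * of_real \<eta>)\<^sup>2 / 2) = of_real (exp (\<eta>\<^sup>2 / 2)) * (of_real (exp (- x\<^sup>2 / 2)) * iexp (- \<eta> * x))"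
      by (simp only: exp_add exp_of_real)
    also have "exp (- x\<^sup>2 / 2) = sqrt (2 * pi) * std_normal_density x" by (simp add: std_normal_density_def)
    finally show ?thesis by (simp add: scaleR_conv_of_real)
  qed
  have i2: "integrable lborel (\<lambda>x. exp (- (of_real x + \<i> * of_real \<eta>)\<^sup>2 / 2))"
    unfolding eq by (rule integrable_mult_right[OF i1])
  have v2: "(LBINT x. exp (- (of_real x + \<i> * of_real \<eta>)\<^sup>2 / 2)) = of_real (sqrt (2 * pi))"
  proof -
    have "exp (\<eta>\<^sup>2 / 2) * exp (- (\<eta>\<^sup>2) / 2) = 1" by (simp add: exp_add[symmetric])
    then show ?thesis
      unfolding eq integral_mult_right_zero v1 by (simp only: of_real_mult[symmetric] mult.assoc mult_1_right)
  qed
  have \<beta>: "\<beta> = of_real p + \<i> * of_real \<eta>" by (simp add: p_def \<eta>_def complex_eq_iff)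
  show "integrable lborel (\<lambda>x. exp (- (of_real x + \<beta>)\<^sup>2 / 2))"
    using lborel_integrable_real_affine[OF i2, of 1 p] by (simp add: \<beta> add_ac)
  show "(LBINT x. exp (- (of_real x + \<beta>)\<^sup>2 / 2)) = complex_of_real (sqrt (2 * pi))"
    using v2 by (subst (asm) lborel_integral_real_affine[where c=1 and t=p]) (simp_all add: \<beta> add_ac)
qed

lemma integral_exp_halfline:
  assumes \<omega>: "Re \<omega> = -1"
  shows "integrable lborel (\<lambda>s. indicator {0..} s *\<^sub>R exp (\<omega> * of_real s))"
    and "(LBINT s. indicator {0..} s *\<^sub>R exp (\<omega> * of_real s)) = 1 / (- \<omega>)"
proof -
  have ne: "\<omega> \<noteq> 0" using \<omega> by auto
  have e: "cmod (exp (\<omega> * of_real s)) = exp (- s)" for s using \<omega> by simp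
  have r: "integrable lborel (\<lambda>s::real. indicator {0..} s *\<^sub>R exp (- s))"
    using gamma_mixture_integrable[of 0 1] by (simp add: set_integrable_def)
  have m: "(\<lambda>s. indicator {0..} s *\<^sub>R exp (\<omega> * of_real s)) \<in> borel_measurable lborel" by measurable
  show "integrable lborel (\<lambda>s. indicator {0..} s *\<^sub>R exp (\<omega> * of_real s))"
    by (rule Bochner_Integration.integrable_bound[OF r m]) (simp add: \<omega>)
  define F where "F x = exp (\<omega> * x) / \<omega>" for x
  have v: "(LBINT s. indicator {0..real n} s *\<^sub>R exp (\<omega> * of_real s)) = F (of_real (real n)) - F (of_real 0)" for n
  proof (rule integral_FTC_atLeastAtMost[of 0 "real n" "\<lambda>x. F (of_real x)"])
    show "((\<lambda>x. F (of_real x)) has_vector_derivative exp (\<omega> * of_real x)) (at x within {0..real n})" for x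
      unfolding F_def using ne by (intro has_vector_derivative_real_field) (auto intro!: derivative_eq_intros)
  qed (auto intro!: continuous_intros)
  have "(\<lambda>n. LBINT s. indicator {0..real n} s *\<^sub>R exp (\<omega> * of_real s)) \<longlonglongrightarrow> (LBINT s. indicator {0..} s *\<^sub>R exp (\<omega> * of_real s))"
  proof (rule integral_dominated_convergence[OF m _ r])
    show "AE s in lborel. (\<lambda>n. indicator {0..real n} s *\<^sub>R exp (\<omega> * of_real s)) \<longlonglongrightarrow> indicator {0..} s *\<^sub>R exp (\<omega> * of_real s)"
    proof (rule AE_I2, rule tendsto_eventually)
      fix s :: real
      show "\<forall>\<^sub>F n in sequentially. indicator {0..real n} s *\<^sub>R exp (\<omega> * of_real s) = indicator {0..} s *\<^sub>R exp (\<omega> * of_real s)"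
        using eventually_ge_at_top[of "nat \<lceil>s\<rceil>"] by eventually_elim (auto simp: indicator_def nat_le_iff ceiling_le_iff)
    qed
    show "AE s in lborel. norm (indicator {0..real n} s *\<^sub>R exp (\<omega> * of_real s)) \<le> indicator {0..} s *\<^sub>R exp (- s)" for n
      by (rule AE_I2) (auto simp: \<omega> indicator_def)
  qed measurable
  moreover have "(\<lambda>n. F (of_real (real n)) - F (of_real 0)) \<longlonglongrightarrow> 0 - F 0"
  proof -
    have "(\<lambda>n. exp (- real n)) \<longlonglongrightarrow> 0" by real_asymp
    then have "(\<lambda>n. exp (\<omega> * of_real (real n))) \<longlonglongrightarrow> 0"
      by (rule Lim_null_comparison[rotated]) (simp only: e, simp)
    from tendsto_divide[OF this tendsto_const[of \<omega>]] have "(\<lambda>n. F (of_real (real n))) \<longlonglongrightarrow> 0" using ne by (simp add: F_def)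
    from tendsto_diff[OF this tendsto_const[of "F 0"]] show ?thesis by simp
  qed
  ultimately show "(LBINT s. indicator {0..} s *\<^sub>R exp (\<omega> * of_real s)) = 1 / (- \<omega>)"
    unfolding v using LIMSEQ_unique by (fastforce simp: F_def)
qed

text \<open>Completing the square with \<open>\<omega> = -1 + \<i> \<phi>\<close>: the difference
  \<open>\<omega> - Z\<close> equals \<open>\<i> (\<phi> + \<i> (1 + Z))\<close>.\<close>

lemma integrable_gaussian_line:
  "integrable lborel (\<lambda>\<phi>. exp ((Complex (-1) \<phi>)\<^sup>2 / 2 - Z * Complex (-1) \<phi>))"
  "(LBINT \<phi>. exp ((Complex (-1) \<phi>)\<^sup>2 / 2 - Z * Complex (-1) \<phi>)) = of_real (sqrt (2 * pi)) * exp (- Z\<^sup>2 / 2)"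
proof -
  have eq: "exp ((Complex (-1) \<phi>)\<^sup>2 / 2 - Z * Complex (-1) \<phi>) = exp (- Z\<^sup>2 / 2) * exp (- (of_real \<phi> + \<i> * (1 + Z))\<^sup>2 / 2)" for \<phi>
  proof -
    have "(Complex (-1) \<phi>)\<^sup>2 / 2 - Z * Complex (-1) \<phi> = - Z\<^sup>2 / 2 + - (of_real \<phi> + \<i> * (1 + Z))\<^sup>2 / 2"
      by (simp add: Complex_eq power2_eq_square field_simps)
    then show ?thesis by (simp only: exp_add)
  qed
  show "integrable lborel (\<lambda>\<phi>. exp ((Complex (-1) \<phi>)\<^sup>2 / 2 - Z * Complex (-1) \<phi>))"
    unfolding eq by (rule integrable_mult_right[OF gaussian_integral_complex_shift(1)])
  show "(LBINT \<phi>. exp ((Complex (-1) \<phi>)\<^sup>2 / 2 - Z * Complex (-1) \<phi>)) = of_real (sqrt (2 * pi)) * exp (- Z\<^sup>2 / 2)"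
    unfolding eq integral_mult_right_zero gaussian_integral_complex_shift(2) by (rule mult.commute)
qed

text \<open>The pole is written as \<open>1 / (- \<omega>) = \<integral>\<^sub>0\<^sup>\<infinity> exp (\<omega> s) ds\<close>, which turns the contour integral into an
  integral of Gaussians.\<close>

lemma erfc_contour_integral:
  "(LBINT \<phi>. exp ((Complex (-1) \<phi>)\<^sup>2 / 2 - Z * Complex (-1) \<phi>) / (- Complex (-1) \<phi>)) =
    of_real pi * erfc (- (Z / of_real (sqrt 2)))"
proof -
  define h where "h \<phi> = exp ((Complex (-1) \<phi>)\<^sup>2 / 2 - Z * Complex (-1) \<phi>)" for \<phi>
  have hint: "integrable lborel h" unfolding h_def by (rule integrable_gaussian_line(1))
  have [measurable]: "h \<in> borel_measurable borel" using borel_measurable_integrable[OF hint] by simp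
  have [measurable]: "(\<lambda>\<phi>. Complex (-1) \<phi>) \<in> borel_measurable borel" unfolding Complex_eq by measurable
  define f where "f \<phi> s = h \<phi> * (indicator {0..} s *\<^sub>R exp (Complex (-1) \<phi> * of_real s))" for \<phi> s :: real
  have fm: "case_prod f \<in> borel_measurable (lborel \<Otimes>\<^sub>M lborel)" unfolding f_def by measurable
  have fi: "integrable lborel (f \<phi>)" for \<phi>
    unfolding f_def by (intro integrable_mult_right integral_exp_halfline) simp
  have fint: "integrable (lborel \<Otimes>\<^sub>M lborel) (case_prod f)"
  proof (rule lborel_pair.Fubini_integrable[OF fm])
    show "AE \<phi> in lborel. integrable lborel (\<lambda>s. case_prod f (\<phi>, s))" using fi by simp
    have r: "(LBINT s. indicator {0..} s *\<^sub>R exp (- s)) = (1::real)"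
    proof -
      have "(LBINT s. indicator {0..} s *\<^sub>R exp (- s)) = enn2real (\<integral>\<^sup>+s. ennreal (s ^ 0 * exp (- 1 * s)) * indicator {0..} s \<partial>lborel)"
        by (subst integral_eq_nn_integral) (auto intro!: arg_cong[where f=enn2real] nn_integral_cong simp: indicator_def)
      then show ?thesis using nn_integral_power_exp[of 1 0] by simp
    qed
    have "(LBINT s. norm (f \<phi> s)) = norm (h \<phi>)" for \<phi>
    proof -
      have "norm (f \<phi> s) = norm (h \<phi>) * (indicator {0..} s *\<^sub>R exp (- s))" for s
        by (simp add: f_def norm_mult indicator_def)
      then have "(LBINT s. norm (f \<phi> s)) = norm (h \<phi>) * (LBINT s. indicator {0..} s *\<^sub>R exp (- s))"
        by (simp only: integral_mult_right_zero)
      then show ?thesis unfolding r by simp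
    qed
    then show "integrable lborel (\<lambda>\<phi>. LBINT s. norm (case_prod f (\<phi>, s)))"
      using integrable_norm[OF hint] by simp
  qed
  have "(LBINT \<phi>. h \<phi> / (- Complex (-1) \<phi>)) = (LBINT \<phi>. LBINT s. f \<phi> s)"
  proof (intro Bochner_Integration.integral_cong refl)
    fix \<phi>
    have "(LBINT s. f \<phi> s) = h \<phi> * (LBINT s. indicator {0..} s *\<^sub>R exp (Complex (-1) \<phi> * of_real s))"
      unfolding f_def by (rule integral_mult_right_zero)
    also have "(LBINT s. indicator {0..} s *\<^sub>R exp (Complex (-1) \<phi> * of_real s)) = 1 / (- Complex (-1) \<phi>)"
      by (rule integral_exp_halfline) simp
    finally show "h \<phi> / (- Complex (-1) \<phi>) = (LBINT s. f \<phi> s)" by simp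
  qed
  also have "\<dots> = (LBINT s. LBINT \<phi>. f \<phi> s)"
    by (rule lborel_pair.Fubini_integral[symmetric]) (use fint in \<open>simp add: case_prod_unfold\<close>)
  also have "\<dots> = (LBINT s. of_real (sqrt (2 * pi)) * (indicator {0..} s *\<^sub>R exp (- (Z - of_real s)\<^sup>2 / 2)))"
  proof (intro Bochner_Integration.integral_cong refl)
    fix s :: real
    have "f \<phi> s = of_real (indicator {0..} s) * exp ((Complex (-1) \<phi>)\<^sup>2 / 2 - (Z - of_real s) * Complex (-1) \<phi>)" for \<phi>
      by (simp add: f_def h_def scaleR_conv_of_real exp_add[symmetric] algebra_simps)
    then have "(LBINT \<phi>. f \<phi> s) = of_real (indicator {0..} s) * (of_real (sqrt (2 * pi)) * exp (- (Z - of_real s)\<^sup>2 / 2))"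
      by (simp only: integral_mult_right_zero integrable_gaussian_line(2))
    then show "(LBINT \<phi>. f \<phi> s) = of_real (sqrt (2 * pi)) * (indicator {0..} s *\<^sub>R exp (- (Z - of_real s)\<^sup>2 / 2))"
      by (simp add: scaleR_conv_of_real mult_ac)
  qed
  also have "\<dots> = of_real (sqrt (2 * pi)) * (LBINT s. indicator {0..} s *\<^sub>R exp (- (Z - of_real s)\<^sup>2 / 2))"
    by (rule integral_mult_right_zero)
  also have "(LBINT s. indicator {0..} s *\<^sub>R exp (- (Z - of_real s)\<^sup>2 / 2)) =
    of_real (sqrt 2) * (LBINT s. indicator {0..} s *\<^sub>R exp (- (- (Z / of_real (sqrt 2)) + of_real s)\<^sup>2))"
  proof -
    have s2: "(complex_of_real (sqrt 2))\<^sup>2 = 2" by (simp flip: of_real_power)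
    have "(LBINT s. indicator {0..} s *\<^sub>R exp (- (Z - of_real s)\<^sup>2 / 2)) =
      sqrt 2 *\<^sub>R (LBINT s. indicator {0..} (sqrt 2 * s) *\<^sub>R exp (- (Z - of_real (sqrt 2 * s))\<^sup>2 / 2))"
      by (subst lborel_integral_real_affine[where c="sqrt 2" and t=0]) auto
    also have "(LBINT s. indicator {0..} (sqrt 2 * s) *\<^sub>R exp (- (Z - of_real (sqrt 2 * s))\<^sup>2 / 2)) =
      (LBINT s. indicator {0..} s *\<^sub>R exp (- (- (Z / of_real (sqrt 2)) + of_real s)\<^sup>2))"
    proof (intro Bochner_Integration.integral_cong refl)
      fix s :: real
      have "(- (Z / of_real (sqrt 2)) + of_real s)\<^sup>2 = (Z - of_real (sqrt 2 * s))\<^sup>2 / 2"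
      proof -
        have "- (Z / of_real (sqrt 2)) + of_real s = - ((Z - of_real (sqrt 2 * s)) / of_real (sqrt 2))"
          by (simp add: field_simps)
        then show ?thesis by (simp only: power2_minus power_divide s2)
      qed
      moreover have "indicator {0..} (sqrt 2 * s) = (indicator {0..} s :: real)"
        by (simp add: indicator_def zero_le_mult_iff)
      ultimately show "indicator {0..} (sqrt 2 * s) *\<^sub>R exp (- (Z - of_real (sqrt 2 * s))\<^sup>2 / 2) = indicator {0..} s *\<^sub>R exp (- (- (Z / of_real (sqrt 2)) + of_real s)\<^sup>2)"
        by (simp only: minus_divide_left)
    qed
    finally show ?thesis by (simp add: scaleR_conv_of_real)
  qed
  also have "of_real (sqrt (2 * pi)) * (of_real (sqrt 2) * (LBINT s. indicator {0..} s *\<^sub>R exp (- (- (Z / of_real (sqrt 2)) + of_real s)\<^sup>2))) =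
    of_real pi * erfc (- (Z / of_real (sqrt 2)))"
  proof -
    have "sqrt (2 * pi) * sqrt 2 = pi * (2 / sqrt pi)"
      by (simp add: real_sqrt_mult real_div_sqrt field_simps)
    then have "complex_of_real (sqrt (2 * pi)) * of_real (sqrt 2) = of_real pi * of_real (2 / sqrt pi)"
      by (metis of_real_mult)
    then show ?thesis unfolding erfc_def set_lebesgue_integral_def by (simp only: mult.assoc[symmetric])
  qed
  finally show ?thesis unfolding h_def .
qed

section \<open>Saddle point asymptotics\<close>

text \<open>Since \<open>m d\<close> converges, \<open>d\<close> tends to 0, and
  \<open>m (Ln (1 + d) - d)\<close> is of order \<open>|m d| |d|\<close>, hence negligible.\<close>

lemma tendsto_one_plus_power:
  fixes d :: "nat \<Rightarrow> complex"
  assumes m: "filterlim m at_top sequentially" and L: "(\<lambda>i. of_nat (m i) * d i) \<longlonglongrightarrow> L"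
  shows "(\<lambda>i. (1 + d i) ^ m i) \<longlonglongrightarrow> exp L"
proof -
  have inv: "(\<lambda>i. 1 / of_nat (m i) :: complex) \<longlonglongrightarrow> 0"
    using tendsto_of_real[OF filterlim_compose[OF lim_inverse_n' m], where 'a = complex] by simp
  have mpos: "eventually (\<lambda>i. m i > 0) sequentially"
    using m[unfolded filterlim_at_top, rule_format, of 1] by eventually_elim simp
  have d0: "d \<longlonglongrightarrow> 0"
  proof -
    have "(\<lambda>i. (of_nat (m i) * d i) * (1 / of_nat (m i))) \<longlonglongrightarrow> L * 0" by (intro tendsto_mult L inv)
    moreover have "eventually (\<lambda>i. (of_nat (m i) * d i) * (1 / of_nat (m i)) = d i) sequentially"
      using mpos by eventually_elim simp
    ultimately show ?thesis by (simp add: tendsto_cong)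
  qed
  have small: "eventually (\<lambda>i. cmod (d i) < 1 / 2) sequentially"
    using tendstoD[OF d0, of "1 / 2"] by (simp add: dist_norm)
  have "(\<lambda>i. 2 * (cmod (of_nat (m i) * d i) * cmod (d i))) \<longlonglongrightarrow> 2 * (cmod L * cmod 0)"
    by (intro tendsto_intros L d0)
  then have b: "(\<lambda>i. 2 * (cmod (of_nat (m i) * d i) * cmod (d i))) \<longlonglongrightarrow> 0" by simp
  have diff: "(\<lambda>i. of_nat (m i) * Ln (1 + d i) - of_nat (m i) * d i) \<longlonglongrightarrow> 0"
  proof (rule Lim_null_comparison[OF _ b])
    show "eventually (\<lambda>i. norm (of_nat (m i) * Ln (1 + d i) - of_nat (m i) * d i) \<le> 2 * (cmod (of_nat (m i) * d i) * cmod (d i))) sequentially"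
      using small
    proof eventually_elim
      case (elim i)
      have "cmod (Ln (1 + d i) - d i) \<le> (cmod (d i))\<^sup>2 / (1 - cmod (d i))"
        using elim by (intro Ln_approx_linear) simp
      also have "\<dots> \<le> (cmod (d i))\<^sup>2 / (1 / 2)"
        using elim by (intro divide_left_mono mult_pos_pos) auto
      finally have "of_nat (m i) * cmod (Ln (1 + d i) - d i) \<le> of_nat (m i) * ((cmod (d i))\<^sup>2 / (1 / 2))"
        by (intro mult_left_mono) auto
      moreover have "of_nat (m i) * Ln (1 + d i) - of_nat (m i) * d i = of_nat (m i) * (Ln (1 + d i) - d i)"
        by (rule right_diff_distrib[symmetric])
      ultimately show ?case by (simp only: norm_mult norm_of_nat) (simp add: power2_eq_square mult_ac)
    qed
  qed
  have "(\<lambda>i. of_nat (m i) * Ln (1 + d i)) \<longlonglongrightarrow> L"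
    using tendsto_add[OF diff L] by simp
  then have "(\<lambda>i. exp (of_nat (m i) * Ln (1 + d i))) \<longlonglongrightarrow> exp L" by (rule tendsto_exp)
  moreover have "eventually (\<lambda>i. exp (of_nat (m i) * Ln (1 + d i)) = (1 + d i) ^ m i) sequentially"
    using small
  proof eventually_elim
    case (elim i)
    have "1 + d i \<noteq> 0"
    proof
      assume "1 + d i = 0"
      then have "d i = -1" by (simp add: eq_neg_iff_add_eq_0 add.commute)
      then show False using elim by simp
    qed
    then show ?case by (simp add: exp_of_nat_mult)
  qed
  ultimately show ?thesis by (simp add: tendsto_cong)
qed

text \<open>The ratio of the coefficients of \<open>\<nu>! bessel_series \<nu> (\<nu> z)\<close> to
  those of \<open>exp z\<close>. It lies in [0, 1] and tends to 1 as \<open>\<nu>\<close>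
  grows.\<close>

definition bessel_coeff :: "nat \<Rightarrow> nat \<Rightarrow> real" where
  "bessel_coeff \<nu> k = fact \<nu> * real \<nu> ^ k / fact (k + \<nu>)"

lemma bessel_coeff_Suc: "bessel_coeff \<nu> (Suc k) = bessel_coeff \<nu> k * (real \<nu> / (real \<nu> + real (Suc k)))"
  by (simp add: bessel_coeff_def add_ac mult_ac)

lemma bessel_coeff_bounds: "0 \<le> bessel_coeff \<nu> k" "bessel_coeff \<nu> k \<le> 1"
proof -
  show 1: "0 \<le> bessel_coeff \<nu> k" for k by (simp add: bessel_coeff_def)
  show "bessel_coeff \<nu> k \<le> 1"
  proof (induction k)
    case (Suc k)
    have "real \<nu> / (real \<nu> + real (Suc k)) \<le> 1" by (simp add: divide_simps)
    then show ?case unfolding bessel_coeff_Suc using Suc 1[of k] by (intro mult_le_one) auto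
  qed (simp add: bessel_coeff_def)
qed

lemma bessel_coeff_tendsto:
  assumes "filterlim \<nu> at_top sequentially"
  shows "(\<lambda>i. bessel_coeff (\<nu> i) k) \<longlonglongrightarrow> 1"
proof (induction k)
  case (Suc k)
  have "(\<lambda>n. real n / (real n + real (Suc k))) \<longlonglongrightarrow> 1" by real_asymp
  from tendsto_mult[OF Suc.IH filterlim_compose[OF this assms]]
  show ?case unfolding bessel_coeff_Suc by simp
qed (simp add: bessel_coeff_def)

lemma bessel_series_scaled_sums:
  "(\<lambda>k. z ^ k / fact k * of_real (bessel_coeff \<nu> k)) sums (fact \<nu> * bessel_series \<nu> (of_nat \<nu> * z))"
  using sums_mult[OF bessel_series_sums(1)[of "of_nat \<nu> * z" \<nu>], of "fact \<nu>"]
  by (simp add: bessel_coeff_def power_mult_distrib mult_ac)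

lemma bessel_series_scaled_bound:
  "cmod (fact \<nu> * bessel_series \<nu> (of_nat \<nu> * z)) \<le> exp (cmod z)"
proof -
  have le: "cmod (z ^ k / fact k * of_real (bessel_coeff \<nu> k)) \<le> cmod z ^ k / fact k" for k
    using mult_left_mono[OF bessel_coeff_bounds(2)[of \<nu> k], of "cmod z ^ k / fact k"] bessel_coeff_bounds(1)[of \<nu> k]
    by (simp add: norm_mult norm_divide norm_power)
  have "cmod (suminf (\<lambda>k. z ^ k / fact k * of_real (bessel_coeff \<nu> k))) \<le> suminf (\<lambda>k. cmod z ^ k / fact k)"
    using sums_summable[OF exp_sums_div[of "cmod z"]] le by (intro norm_suminf_le) auto
  then show ?thesis using bessel_series_scaled_sums[of z \<nu>] exp_sums_div[of "cmod z"] by (simp add: sums_iff)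
qed

text \<open>Tannery's theorem: the coefficient ratios tend to 1 one by one, and the exponential
  series at a bound of the arguments dominates uniformly in \<open>\<nu>\<close>.\<close>

lemma bessel_series_scaled_tendsto:
  assumes \<nu>: "filterlim \<nu> at_top sequentially" and z: "z \<longlonglongrightarrow> \<zeta>"
  shows "(\<lambda>i. fact (\<nu> i) * bessel_series (\<nu> i) (of_nat (\<nu> i) * z i)) \<longlonglongrightarrow> exp \<zeta>"
proof -
  obtain R where R: "R > 0" "\<And>i. cmod (z i) \<le> R"
    using convergent_imp_Bseq[OF convergentI[OF z]] by (auto simp: Bseq_def)
  have "eventually (\<lambda>i. summable (\<lambda>k. norm (z i ^ k / fact k * of_real (bessel_coeff (\<nu> i) k)))) sequentially \<and>
    summable (\<lambda>k. norm (\<zeta> ^ k / fact k)) \<and>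
    (\<lambda>i. suminf (\<lambda>k. z i ^ k / fact k * of_real (bessel_coeff (\<nu> i) k))) \<longlonglongrightarrow> suminf (\<lambda>k. \<zeta> ^ k / fact k)"
  proof (rule tannerys_theorem[where M = "\<lambda>k. R ^ k / fact k"])
    show "(\<lambda>i. z i ^ k / fact k * of_real (bessel_coeff (\<nu> i) k)) \<longlonglongrightarrow> \<zeta> ^ k / fact k" for k
      using tendsto_mult[OF tendsto_divide[OF tendsto_power[OF z] tendsto_const] tendsto_of_real[OF bessel_coeff_tendsto[OF \<nu>]], of "fact k" k k]
      by simp
    show "\<forall>\<^sub>F (k, i) in at_top \<times>\<^sub>F sequentially. norm (z i ^ k / fact k * of_real (bessel_coeff (\<nu> i) k)) \<le> R ^ k / fact k"
    proof (intro always_eventually allI, clarify)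
      fix k i
      have "cmod (z i) ^ k * bessel_coeff (\<nu> i) k \<le> R ^ k * 1"
        by (intro mult_mono power_mono R bessel_coeff_bounds) (use R(1) in auto)
      then show "norm (z i ^ k / fact k * of_real (bessel_coeff (\<nu> i) k)) \<le> R ^ k / fact k"
        using bessel_coeff_bounds(1)[of "\<nu> i" k] by (simp add: norm_mult norm_divide norm_power divide_right_mono)
    qed
    show "summable (\<lambda>k. R ^ k / fact k)" using exp_sums_div[of R] by (simp add: sums_iff)
  qed auto
  moreover have "suminf (\<lambda>k. z i ^ k / fact k * of_real (bessel_coeff (\<nu> i) k)) = fact (\<nu> i) * bessel_series (\<nu> i) (of_nat (\<nu> i) * z i)" for i
    by (rule sums_unique[OF bessel_series_scaled_sums, symmetric])
  moreover have "suminf (\<lambda>k. \<zeta> ^ k / fact k) = exp \<zeta>"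
    by (rule sums_unique[OF exp_sums_div, symmetric])
  ultimately show ?thesis by simp
qed

lemma exp_quadratic_remainder_tendsto:
  fixes y :: "nat \<Rightarrow> complex"
  assumes y: "y \<longlonglongrightarrow> 0" and ne: "\<And>i. y i \<noteq> 0"
  shows "(\<lambda>i. (exp (y i) - 1 - y i) / (y i)\<^sup>2) \<longlonglongrightarrow> 1 / 2"
proof -
  have "(\<lambda>i. exp (cmod (y i)) * cmod (y i) / 2) \<longlonglongrightarrow> exp (cmod 0) * cmod (0::complex) / 2"
    by (intro tendsto_intros y) auto
  then have b: "(\<lambda>i. exp (cmod (y i)) * cmod (y i) / 2) \<longlonglongrightarrow> 0" by simp
  have "(\<lambda>i. (exp (y i) - 1 - y i) / (y i)\<^sup>2 - 1 / 2) \<longlonglongrightarrow> 0"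
  proof (rule Lim_null_comparison[OF always_eventually b], rule allI)
    fix i
    have "(exp (y i) - 1 - y i) / (y i)\<^sup>2 - 1 / 2 = (exp (y i) - (\<Sum>k\<le>2. y i ^ k / fact k)) / (y i)\<^sup>2"
      using ne[of i] by (simp add: numeral_2_eq_2 field_simps)
    also have "norm \<dots> \<le> exp (cmod (y i)) * cmod (y i) ^ Suc 2 / fact 2 / (cmod (y i))\<^sup>2"
      unfolding norm_divide norm_power by (intro divide_right_mono Taylor_exp_field) auto
    also have "\<dots> = exp (cmod (y i)) * cmod (y i) / 2"
      using ne[of i] by (simp add: power2_eq_square power3_eq_cube numeral_3_eq_3)
    finally show "norm ((exp (y i) - 1 - y i) / (y i)\<^sup>2 - 1 / 2) \<le> exp (cmod (y i)) * cmod (y i) / 2" .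
  qed
  then show ?thesis by (rule LIM_zero_cancel)
qed

section \<open>The saddle point at the critical parameter\<close>

text \<open>The square \<open>N + N^2 / \<nu>\<close> is the second derivative at
  \<open>y = 0\<close> of the exponent
  \<open>- \<nu> log (1 - (N / \<nu>) (exp y - 1)) - N y\<close>, so
  \<open>y = \<omega> / \<rho>\<close> makes the quadratic term
  \<open>\<omega>^2 / 2\<close>.\<close>

definition saddle_scale :: "nat \<Rightarrow> nat \<Rightarrow> real" where
  "saddle_scale N \<nu> = sqrt (real N * (real N + real \<nu>) / real \<nu>)"

text \<open>With \<open>t = N / (N + \<nu>)\<close> this is \<open>(1 - t s) / (1 - t)\<close>.\<close>

definition saddle_denom :: "nat \<Rightarrow> nat \<Rightarrow> complex \<Rightarrow> complex" where
  "saddle_denom N \<nu> s = 1 - of_real (real N / real \<nu>) * (s - 1)"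

text \<open>The sizes form an arbitrary divergent sequence, since uniform convergence is tested
  along sizes and arguments chosen together. Positivity at every index makes \<open>q\<close> and
  \<open>\<rho>\<close> genuine positive numbers from the start.\<close>

locale saddle_sequence =
  fixes N \<nu> :: "nat \<Rightarrow> nat" and \<alpha> :: real
  assumes N: "filterlim N at_top sequentially" and \<alpha>: "\<alpha> > 0"
    and ratio: "(\<lambda>i. real (\<nu> i) / real (N i)) \<longlonglongrightarrow> \<alpha>"
    and N_pos: "\<And>i. N i \<ge> 1" and \<nu>_pos: "\<And>i. \<nu> i \<ge> 1"
begin

abbreviation "\<rho> i \<equiv> saddle_scale (N i) (\<nu> i)"
abbreviation "q i \<equiv> real (N i) / real (\<nu> i)"

lemma q_pos: "q i > 0" using N_pos[of i] \<nu>_pos[of i] by simp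

lemma q_tendsto: "q \<longlonglongrightarrow> 1 / \<alpha>"
  using tendsto_divide[OF tendsto_const[of 1] ratio] \<alpha> by simp

lemma \<nu>_at_top: "filterlim \<nu> at_top sequentially"
proof -
  have "filterlim (\<lambda>i. real (N i)) at_top sequentially"
    using filterlim_compose[OF filterlim_real_sequentially N] .
  then have "filterlim (\<lambda>i. real (\<nu> i) / real (N i) * real (N i)) at_top sequentially"
    by (rule filterlim_tendsto_pos_mult_at_top[OF ratio \<alpha>])
  moreover have "real (\<nu> i) / real (N i) * real (N i) = real (\<nu> i)" for i using N_pos[of i] by simp
  ultimately have "filterlim (\<lambda>i. real (\<nu> i)) at_top sequentially" by simp
  then show ?thesis by (simp add: filterlim_sequentially_iff_filterlim_real)
qed

lemma \<rho>_sq: "(\<rho> i)\<^sup>2 = real (\<nu> i) * q i * (1 + q i)"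
  using \<nu>_pos[of i] by (simp add: saddle_scale_def field_simps)

lemma \<rho>_ge: "\<rho> i \<ge> 1" "\<rho> i > 0"
proof -
  have "real (N i) * (real (N i) + real (\<nu> i)) \<ge> 1 * real (\<nu> i)"
    using N_pos[of i] by (intro mult_mono) auto
  then have "real (N i) * (real (N i) + real (\<nu> i)) / real (\<nu> i) \<ge> 1" using \<nu>_pos[of i] by (simp add: field_simps)
  then show "\<rho> i \<ge> 1" by (simp add: saddle_scale_def)
  then show "\<rho> i > 0" by simp
qed

lemma \<rho>_at_top: "filterlim \<rho> at_top sequentially"
proof (rule filterlim_at_top_mono)
  show "filterlim (\<lambda>i. sqrt (real (N i))) at_top sequentially"
    using filterlim_compose[OF sqrt_at_top filterlim_compose[OF filterlim_real_sequentially N]] .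
  have "real (N i) \<le> real (N i) * (real (N i) + real (\<nu> i)) / real (\<nu> i)" for i
    using \<nu>_pos[of i] by (simp add: field_simps)
  then show "\<forall>\<^sub>F i in sequentially. sqrt (real (N i)) \<le> \<rho> i"
    by (simp add: saddle_scale_def)
qed

lemma inverse_\<rho>: "(\<lambda>i. \<omega> / of_real (\<rho> i) :: complex) \<longlonglongrightarrow> 0"
proof -
  have "(\<lambda>i. inverse (\<rho> i)) \<longlonglongrightarrow> 0"
    by (rule tendsto_inverse_0_at_top[OF \<rho>_at_top])
  from tendsto_mult[OF tendsto_const[of \<omega>] tendsto_of_real[OF this, where 'a = complex]]
  show ?thesis by (simp add: divide_inverse)
qed

lemma scaled_exp_tendsto:
  fixes \<omega> :: complex
  assumes "\<omega> \<noteq> 0"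
  shows "(\<lambda>i. of_real (\<rho> i) * (exp (\<omega> / of_real (\<rho> i)) - 1)) \<longlonglongrightarrow> \<omega>"
proof -
  define y where "y i = \<omega> / of_real (\<rho> i)" for i
  have ne: "y i \<noteq> 0" for i using assms \<rho>_ge(2)[of i] by (simp add: y_def)
  have y0: "y \<longlonglongrightarrow> 0" unfolding y_def by (rule inverse_\<rho>)
  have "(\<lambda>i. \<omega> * (1 + y i * ((exp (y i) - 1 - y i) / (y i)\<^sup>2))) \<longlonglongrightarrow> \<omega> * (1 + 0 * (1 / 2))"
    by (intro tendsto_intros y0 exp_quadratic_remainder_tendsto ne)
  moreover have "\<omega> * (1 + y i * ((exp (y i) - 1 - y i) / (y i)\<^sup>2)) = of_real (\<rho> i) * (exp (y i) - 1)" for i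
  proof -
    have "\<omega> = of_real (\<rho> i) * y i" using \<rho>_ge(2)[of i] by (simp add: y_def)
    moreover have "y i * (y i * ((exp (y i) - 1 - y i) / (y i)\<^sup>2)) = exp (y i) - 1 - y i"
      using ne[of i] by (simp add: power2_eq_square)
    then have "y i * (1 + y i * ((exp (y i) - 1 - y i) / (y i)\<^sup>2)) = exp (y i) - 1"
      by (simp only: distrib_left) simp
    ultimately show ?thesis by (simp only: mult.assoc)
  qed
  ultimately show ?thesis by (simp add: y_def)
qed

lemma saddle_denom_tendsto: "(\<lambda>i. saddle_denom (N i) (\<nu> i) (exp (\<omega> / of_real (\<rho> i)))) \<longlonglongrightarrow> 1"
proof -
  have "(\<lambda>i. 1 - of_real (q i) * (exp (\<omega> / of_real (\<rho> i)) - 1)) \<longlonglongrightarrow> 1 - of_real (1 / \<alpha>) * (exp 0 - 1)"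
    by (intro tendsto_intros q_tendsto inverse_\<rho>)
  then show ?thesis by (simp add: saddle_denom_def)
qed

text \<open>Both factors are powers of exponent \<open>\<nu>\<close> and combine to
  \<open>(1 + \<delta>)^(- \<nu>)\<close> with \<open>1 + \<delta> = D exp (Q y)\<close>. The terms
  linear in \<open>y\<close> cancel, so \<open>\<delta>\<close> is of order \<open>y^2\<close>,
  while \<open>\<nu> y^2\<close> stays bounded.\<close>

lemma main_factor_tendsto:
  assumes \<omega>: "\<omega> \<noteq> 0"
  shows "(\<lambda>i. 1 / saddle_denom (N i) (\<nu> i) (exp (\<omega> / of_real (\<rho> i))) ^ \<nu> i * exp (- (of_nat (N i) * \<omega> / of_real (\<rho> i)))) \<longlonglongrightarrow> exp (\<omega>\<^sup>2 / 2)"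
proof -
  define y where "y i = \<omega> / of_real (\<rho> i)" for i
  define Q where "Q i = complex_of_real (q i)" for i
  define Q0 where "Q0 = complex_of_real (1 / \<alpha>)"
  define E where "E y = (exp y - 1 - y) / y\<^sup>2" for y :: complex
  have ne: "y i \<noteq> 0" for i using \<omega> \<rho>_ge(2)[of i] by (simp add: y_def)
  have y0: "y \<longlonglongrightarrow> 0" unfolding y_def by (rule inverse_\<rho>)
  have Qt: "Q \<longlonglongrightarrow> Q0" unfolding Q_def Q0_def by (intro tendsto_of_real q_tendsto)
  have Qne: "Q i \<noteq> 0" for i using N_pos[of i] \<nu>_pos[of i] by (simp add: Q_def)
  have Q1ne: "1 + Q i \<noteq> 0" for i
  proof -
    have "1 + Q i = of_real (1 + q i)" by (simp add: Q_def)
    then show ?thesis using q_pos[of i] by (simp del: of_real_add)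
  qed
  have Q0ne: "Q0 \<noteq> 0" "1 + Q0 \<noteq> 0"
  proof -
    show "Q0 \<noteq> 0" using \<alpha> by (simp add: Q0_def)
    have "1 + Q0 = of_real (1 + 1 / \<alpha>)" by (simp add: Q0_def)
    moreover have "1 + 1 / \<alpha> > 0" using \<alpha> by (simp add: add_pos_pos)
    ultimately show "1 + Q0 \<noteq> 0" by (simp del: of_real_add)
  qed
  have Et: "(\<lambda>i. E (y i)) \<longlonglongrightarrow> 1 / 2" unfolding E_def by (intro exp_quadratic_remainder_tendsto y0 ne)
  have Qy0: "(\<lambda>i. Q i * y i) \<longlonglongrightarrow> 0" using tendsto_mult[OF Qt y0] by simp
  have Et2: "(\<lambda>i. E (Q i * y i)) \<longlonglongrightarrow> 1 / 2" unfolding E_def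
    by (intro exp_quadratic_remainder_tendsto Qy0) (simp add: ne Qne)
  define \<delta> where "\<delta> i = saddle_denom (N i) (\<nu> i) (exp (y i)) * exp (Q i * y i) - 1" for i
  \<comment> \<open>This is \<open>\<delta> / y^2\<close>, written exactly with the second-order
    remainders \<open>E\<close>. Its limit \<open>- Q0 (1 + Q0) / 2\<close> cancels the denominator
    in \<open>\<nu> y^2 = \<omega>^2 / (Q (1 + Q))\<close> and leaves
    \<open>- \<omega>^2 / 2\<close>.\<close>
  define X where "X i = (Q i)\<^sup>2 * E (Q i * y i) - (Q i)\<^sup>2 - (Q i) ^ 3 * y i * E (Q i * y i) - Q i * E (y i)
     - (Q i)\<^sup>2 * y i * E (y i) - (Q i) ^ 3 * (y i)\<^sup>2 * E (y i) * E (Q i * y i)" for i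
  have \<delta>: "\<delta> i = (y i)\<^sup>2 * X i" for i
  proof -
    have e1: "exp (y i) - 1 = y i + (y i)\<^sup>2 * E (y i)" using ne[of i] by (simp add: E_def)
    have e2: "exp (Q i * y i) = 1 + Q i * y i + (Q i * y i)\<^sup>2 * E (Q i * y i)" using ne[of i] Qne[of i] by (simp add: E_def)
    have "\<delta> i = (1 - Q i * (exp (y i) - 1)) * exp (Q i * y i) - 1" by (simp add: \<delta>_def saddle_denom_def Q_def)
    also have "\<dots> = (1 - Q i * (y i + (y i)\<^sup>2 * E (y i))) * (1 + Q i * y i + (Q i * y i)\<^sup>2 * E (Q i * y i)) - 1"
      unfolding e1 e2 ..
    also have "\<dots> = (y i)\<^sup>2 * X i" unfolding X_def by (simp add: power2_eq_square power3_eq_cube algebra_simps)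
    finally show ?thesis .
  qed
  have Xt: "X \<longlonglongrightarrow> Q0\<^sup>2 * (1 / 2) - Q0\<^sup>2 - Q0 ^ 3 * 0 * (1 / 2) - Q0 * (1 / 2) - Q0\<^sup>2 * 0 * (1 / 2) - Q0 ^ 3 * 0\<^sup>2 * (1 / 2) * (1 / 2)"
    unfolding X_def by (intro tendsto_intros Qt y0 Et Et2)
  have \<nu>y: "of_nat (\<nu> i) * (y i)\<^sup>2 = \<omega>\<^sup>2 / (Q i * (1 + Q i))" for i
  proof -
    have "(complex_of_real (\<rho> i))\<^sup>2 = of_real (real (\<nu> i) * q i * (1 + q i))"
      by (simp only: of_real_power[symmetric] \<rho>_sq)
    then have "(complex_of_real (\<rho> i))\<^sup>2 = of_nat (\<nu> i) * (Q i * (1 + Q i))" by (simp add: Q_def)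
    then show ?thesis using \<nu>_pos[of i] by (simp add: y_def power_divide)
  qed
  have "(\<lambda>i. \<omega>\<^sup>2 / (Q i * (1 + Q i)) * X i) \<longlonglongrightarrow> \<omega>\<^sup>2 / (Q0 * (1 + Q0)) * (Q0\<^sup>2 * (1 / 2) - Q0\<^sup>2 - Q0 ^ 3 * 0 * (1 / 2) - Q0 * (1 / 2) - Q0\<^sup>2 * 0 * (1 / 2) - Q0 ^ 3 * 0\<^sup>2 * (1 / 2) * (1 / 2))"
    using Q0ne by (intro tendsto_intros Qt Xt) auto
  also have "\<omega>\<^sup>2 / (Q0 * (1 + Q0)) * (Q0\<^sup>2 * (1 / 2) - Q0\<^sup>2 - Q0 ^ 3 * 0 * (1 / 2) - Q0 * (1 / 2) - Q0\<^sup>2 * 0 * (1 / 2) - Q0 ^ 3 * 0\<^sup>2 * (1 / 2) * (1 / 2)) = - (\<omega>\<^sup>2 / 2)"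
  proof -
    have "Q0\<^sup>2 * (1 / 2) - Q0\<^sup>2 - Q0 ^ 3 * 0 * (1 / 2) - Q0 * (1 / 2) - Q0\<^sup>2 * 0 * (1 / 2) - Q0 ^ 3 * 0\<^sup>2 * (1 / 2) * (1 / 2) = - (Q0 * (1 + Q0)) / 2"
      by (simp add: power2_eq_square field_simps)
    then show ?thesis using Q0ne by simp
  qed
  also have "(\<lambda>i. \<omega>\<^sup>2 / (Q i * (1 + Q i)) * X i) = (\<lambda>i. of_nat (\<nu> i) * \<delta> i)"
    unfolding \<delta> \<nu>y[symmetric] by (simp add: mult.assoc)
  finally have "(\<lambda>i. (1 + \<delta> i) ^ \<nu> i) \<longlonglongrightarrow> exp (- (\<omega>\<^sup>2 / 2))"
    by (rule tendsto_one_plus_power[OF \<nu>_at_top])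
  from tendsto_inverse[OF this] have "(\<lambda>i. inverse ((1 + \<delta> i) ^ \<nu> i)) \<longlonglongrightarrow> exp (\<omega>\<^sup>2 / 2)"
    by (simp add: exp_minus)
  moreover have "inverse ((1 + \<delta> i) ^ \<nu> i) = 1 / saddle_denom (N i) (\<nu> i) (exp (\<omega> / of_real (\<rho> i))) ^ \<nu> i * exp (- (of_nat (N i) * \<omega> / of_real (\<rho> i)))" for i
  proof -
    have "exp (Q i * y i) ^ \<nu> i = exp (of_nat (\<nu> i) * (Q i * y i))" by (rule exp_of_nat_mult[symmetric])
    also have "of_nat (\<nu> i) * (Q i * y i) = of_nat (N i) * \<omega> / of_real (\<rho> i)"
      using \<nu>_pos[of i] by (simp add: Q_def y_def)
    finally have "(1 + \<delta> i) ^ \<nu> i = saddle_denom (N i) (\<nu> i) (exp (y i)) ^ \<nu> i * exp (of_nat (N i) * \<omega> / of_real (\<rho> i))"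
      by (simp add: \<delta>_def power_mult_distrib)
    then show ?thesis by (simp add: y_def exp_minus divide_inverse)
  qed
  ultimately show ?thesis by simp
qed

end

section \<open>Gaussian domination on the whole circle\<close>

text \<open>Uses \<open>1 - cos \<theta> = 2 sin^2 (\<theta> / 2)\<close> and
  \<open>sin x \<ge> x / 3\<close> on [0, 2], where the cubic Taylor error is at most
  \<open>2 x / 3\<close>; then \<open>2 (\<theta> / 6)^2 = \<theta>^2 / 18\<close>.\<close>

lemma one_minus_cos_ge:
  assumes "\<bar>\<theta>\<bar> \<le> pi"
  shows "1 - cos \<theta> \<ge> \<theta>\<^sup>2 / 18"
proof -
  define x where "x = \<bar>\<theta>\<bar> / 2"
  have x: "0 \<le> x" "x \<le> 2" using assms pi_less_4 by (auto simp: x_def)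
  have "\<bar>sin x - (\<Sum>m<3. sin_coeff m * x ^ m)\<bar> \<le> inverse (fact 3) * \<bar>x\<bar> ^ 3"
    by (rule Maclaurin_sin_bound)
  also have "(\<Sum>m<3. sin_coeff m * x ^ m) = x"
    by (simp add: sin_coeff_def numeral_3_eq_3)
  also have "inverse (fact 3) * \<bar>x\<bar> ^ 3 = x * (x\<^sup>2 / 6)" using x by (simp add: fact_numeral power3_eq_cube power2_eq_square)
  also have "\<dots> \<le> x * (2\<^sup>2 / 6)" using x by (intro mult_left_mono divide_right_mono power_mono) auto
  finally have "\<bar>sin x - x\<bar> \<le> x * (2 * 2 / 6)" by (simp only: power2_eq_square)
  then have "sin x \<ge> x / 3" by linarith
  then have "(sin x)\<^sup>2 \<ge> (x / 3)\<^sup>2" using x by (intro power_mono) auto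
  moreover have "cos \<theta> = 1 - 2 * (sin x)\<^sup>2"
    using cos_double_sin[of x] by (simp add: x_def)
  ultimately show ?thesis by (simp add: x_def power_divide)
qed

text \<open>Separates the value on the real axis from a nonnegative term proportional to
  \<open>1 - cos \<theta>\<close>, which is the source of the decay in the angle.\<close>

lemma saddle_denom_cmod_sq:
  fixes N \<nu> :: nat
  defines "q \<equiv> real N / real \<nu>"
  shows "(cmod (saddle_denom N \<nu> (of_real r * cis \<theta>)))\<^sup>2 = (1 + q - q * r)\<^sup>2 + 2 * q * (1 + q) * r * (1 - cos \<theta>)"
proof -
  have re: "Re (saddle_denom N \<nu> (of_real r * cis \<theta>)) = 1 + q - q * r * cos \<theta>"
    and im: "Im (saddle_denom N \<nu> (of_real r * cis \<theta>)) = - (q * r * sin \<theta>)"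
    unfolding saddle_denom_def q_def[symmetric] by (simp_all add: algebra_simps)
  have "(q * r * sin \<theta>)\<^sup>2 = (q * r)\<^sup>2 * (1 - (cos \<theta>)\<^sup>2)" by (simp add: power_mult_distrib sin_squared_eq)
  then show ?thesis unfolding cmod_power2 re im by (simp add: power2_eq_square algebra_simps)
qed

text \<open>With \<open>k = q / (27 (1 + q))\<close> this is \<open>k / (1 + 16 k)\<close>. The 27
  combines radius at least 1/3 with \<open>1 - cos \<theta> \<ge> \<theta>^2 / 18\<close>; the 16
  bounds \<open>\<theta>^2\<close> by means of \<open>pi < 4\<close>, so that
  \<open>log (1 + x) \<ge> x / (1 + x)\<close> yields a rate independent of
  \<open>\<theta>\<close>.\<close>

definition saddle_rate :: "real \<Rightarrow> real" where
  "saddle_rate q = (q / (27 * (1 + q))) / (1 + 16 * (q / (27 * (1 + q))))"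

lemma saddle_rate_pos: "q > 0 \<Longrightarrow> saddle_rate q > 0"
  by (simp add: saddle_rate_def add_pos_pos)

text \<open>The gain is needed for all angles, not only near the saddle, because the integral runs
  over the full circle. The lower bound 1/3 on the radius will come from
  \<open>exp (- 1 / \<rho>) \<ge> exp (-1)\<close>.\<close>

lemma saddle_denom_lower:
  fixes N \<nu> :: nat
  defines "q \<equiv> real N / real \<nu>"
  assumes q: "q > 0" and r: "1 / 3 \<le> r" "r \<le> 1" and \<theta>: "\<bar>\<theta>\<bar> \<le> pi"
  shows "(cmod (saddle_denom N \<nu> (of_real r * cis \<theta>)))\<^sup>2 \<ge> (1 + q - q * r)\<^sup>2 * exp (saddle_rate q * \<theta>\<^sup>2)"
proof -
  define k where "k = q / (27 * (1 + q))"
  have k: "k > 0" using q by (simp add: k_def)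
  define X where "X = k * \<theta>\<^sup>2"
  have X: "X \<ge> 0" using k by (simp add: X_def)
  have th: "\<theta>\<^sup>2 \<le> 16"
  proof -
    have "\<bar>\<theta>\<bar>\<^sup>2 \<le> 4\<^sup>2" using \<theta> pi_less_4 by (intro power_mono) auto
    then show ?thesis by simp
  qed
  have "saddle_rate q * \<theta>\<^sup>2 = X / (1 + 16 * k)" by (simp add: saddle_rate_def k_def X_def)
  also have "\<dots> \<le> X / (1 + X)"
    using X k th by (intro divide_left_mono mult_pos_pos) (auto simp: X_def add_pos_nonneg)
  finally have "exp (saddle_rate q * \<theta>\<^sup>2) \<le> exp (X / (1 + X))" by simp
  also have "\<dots> \<le> 1 + X"
  proof -
    have "1 + - (X / (1 + X)) \<le> exp (- (X / (1 + X)))" by (rule exp_ge_add_one_self)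
    moreover have "1 + - (X / (1 + X)) = 1 / (1 + X)" using X by (simp add: field_simps)
    ultimately have "1 / (1 + X) \<le> 1 / exp (X / (1 + X))" by (simp add: exp_minus divide_inverse)
    then show ?thesis using X by (simp add: divide_simps split: if_splits)
  qed
  finally have e: "exp (saddle_rate q * \<theta>\<^sup>2) \<le> 1 + k * \<theta>\<^sup>2" by (simp add: X_def)
  have "q * r \<le> q * 1" using q r by (intro mult_left_mono) auto
  moreover have "0 \<le> q * r" using q r by (intro mult_nonneg_nonneg) auto
  ultimately have d0: "0 \<le> 1 + q - q * r" "1 + q - q * r \<le> 1 + q" by linarith+
  then have d2: "(1 + q - q * r)\<^sup>2 \<le> (1 + q)\<^sup>2" by (intro power_mono)
  have "(1 + q - q * r)\<^sup>2 * exp (saddle_rate q * \<theta>\<^sup>2) \<le> (1 + q - q * r)\<^sup>2 * (1 + k * \<theta>\<^sup>2)"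
    using e by (intro mult_left_mono) auto
  also have "\<dots> = (1 + q - q * r)\<^sup>2 + (1 + q - q * r)\<^sup>2 * (k * \<theta>\<^sup>2)" by (simp add: distrib_left)
  also have "\<dots> \<le> (1 + q - q * r)\<^sup>2 + (1 + q)\<^sup>2 * (k * \<theta>\<^sup>2)"
    using d2 k by (intro add_left_mono mult_right_mono) auto
  also have "(1 + q)\<^sup>2 * (k * \<theta>\<^sup>2) = 2 * q * (1 + q) * (1 / 3) * (\<theta>\<^sup>2 / 18)"
  proof -
    have "k * (1 + q) = (q * (1 + q)) / (27 * (1 + q))" by (simp only: k_def times_divide_eq_left)
    also have "\<dots> = q / 27" by (rule nonzero_mult_divide_mult_cancel_right) (use q in simp)
    finally have kk: "k * (1 + q) = q / 27" .
    have "(1 + q)\<^sup>2 * (k * \<theta>\<^sup>2) = (1 + q) * (k * (1 + q)) * \<theta>\<^sup>2" by (simp add: power2_eq_square)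
    also have "\<dots> = 2 * q * (1 + q) * (1 / 3) * (\<theta>\<^sup>2 / 18)" unfolding kk by (simp add: algebra_simps)
    finally show ?thesis .
  qed
  also have "2 * q * (1 + q) * (1 / 3) * (\<theta>\<^sup>2 / 18) \<le> 2 * q * (1 + q) * r * (1 - cos \<theta>)"
    using q r one_minus_cos_ge[OF \<theta>] by (intro mult_mono mult_left_mono) auto
  finally show ?thesis unfolding saddle_denom_cmod_sq q_def[symmetric] by simp
qed

lemma integrable_gauss:
  assumes "p > 0"
  shows "integrable lborel (\<lambda>x::real. M * exp (- p * x\<^sup>2))"
proof -
  have "integrable lborel (\<lambda>x. norm (exp (- (complex_of_real x + 0)\<^sup>2 / 2)))"
    by (rule integrable_norm[OF gaussian_integral_complex_shift(1)])
  moreover have "norm (exp (- (complex_of_real x + 0)\<^sup>2 / 2)) = exp (- (x\<^sup>2 / 2))" for x :: real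
    by (simp add: power2_eq_square)
  ultimately have "integrable lborel (\<lambda>x::real. exp (- (x\<^sup>2 / 2)))" by simp
  from lborel_integrable_real_affine[OF this, of "sqrt (2 * p)" 0]
  have "integrable lborel (\<lambda>x::real. exp (- p * x\<^sup>2))" using assms by (simp add: power_mult_distrib)
  then show ?thesis by (rule integrable_mult_right)
qed

text \<open>Grouped so that each factor has its own limit: the large powers give
  \<open>exp (\<omega>^2 / 2)\<close>, the middle factor gives
  \<open>exp (- (Z1 + Z2) \<omega>) exp (Z1 Z2)\<close>, and the last one gives the pole
  \<open>1 / (- \<omega>)\<close>.\<close>

definition saddle_integrand :: "nat \<Rightarrow> nat \<Rightarrow> complex \<Rightarrow> complex \<Rightarrow> complex \<Rightarrow> complex" where
  "saddle_integrand N \<nu> Z1 Z2 \<omega> =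
    (let \<rho> = of_real (saddle_scale N \<nu>); s = exp (\<omega> / \<rho>); D = saddle_denom N \<nu> s in
      (1 / D ^ \<nu> * exp (- (of_nat N * \<omega> / \<rho>))) *
      (1 / D * exp (- ((Z1 + Z2) * (\<rho> * (s - 1)) / D)) * (fact \<nu> * bessel_series \<nu> (of_nat \<nu> * (Z1 * Z2 * s / D\<^sup>2)))) *
      (s / (\<rho> * (1 - s))))"

text \<open>Hille--Hardy is applied at \<open>t s\<close>, and \<open>1 - t s = D / (1 + q)\<close>
  lets the prefactor \<open>(1 - t)^(\<nu>+1)\<close> normalise the denominator to \<open>D\<close>.
  The scaling \<open>\<nu> / \<rho>\<close> of the arguments makes the Bessel argument
  \<open>\<nu>\<close> times a bounded quantity.\<close>

lemma laguerre_partial_sum_contour: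
  fixes N \<nu> :: nat and Z1 Z2 :: complex
  assumes N: "N \<ge> 1" and \<nu>: "\<nu> \<ge> 1"
  defines "q \<equiv> real N / real \<nu>" and "\<rho> \<equiv> saddle_scale N \<nu>" and "t \<equiv> real N / (real N + real \<nu>)"
  defines "x \<equiv> of_real (real \<nu> / \<rho>) * Z1" and "y \<equiv> of_real (real \<nu> / \<rho>) * Z2"
  shows "of_real ((1 - t) ^ Suc \<nu> * fact \<nu>) * exp ((x + y) * of_real q) *
      (\<Sum>j<N. of_real t ^ j * (fact j / fact (j + \<nu>)) * laguerre \<nu> j x * laguerre \<nu> j y) =
    of_real (1 / (2 * pi)) * (LBINT \<phi>:{- pi * \<rho>..pi * \<rho>}. saddle_integrand N \<nu> Z1 Z2 (Complex (-1) \<phi>))"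
proof -
  have q: "q > 0" using N \<nu> by (simp add: q_def)
  have t: "0 < t" "t < 1" "t = q / (1 + q)" "1 - t = 1 / (1 + q)"
    using N \<nu> by (auto simp: t_def q_def field_simps)
  have \<rho>2: "\<rho>\<^sup>2 = real \<nu> * q * (1 + q)"
    using \<nu> by (simp add: \<rho>_def q_def saddle_scale_def field_simps)
  have \<rho>: "\<rho> > 0" using N \<nu> by (simp add: \<rho>_def saddle_scale_def)
  \<comment> \<open>On the circle of this radius \<open>s = exp (\<omega> / \<rho>)\<close> with
    \<open>\<omega> = -1 + \<i> \<phi>\<close>, so angles up to \<open>pi\<close> become
    \<open>|\<phi>| \<le> pi \<rho>\<close>.\<close>
  define r where "r = exp (- (1 / \<rho>))"
  have r: "0 < r" "r < 1" using \<rho> by (auto simp: r_def)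
  define a where "a j = of_real t ^ j * (fact j / fact (j + \<nu>)) * laguerre \<nu> j x * laguerre \<nu> j y" for j
  define G where "G s = exp (- ((x + y) * (of_real t * s) / (1 - of_real t * s))) / (1 - of_real t * s) ^ Suc \<nu> *
     bessel_series \<nu> (x * y * (of_real t * s) / (1 - of_real t * s)\<^sup>2)" for s
  have ts: "cmod (of_real t * s) < 1" if "cmod s = r" for s
  proof -
    have "cmod (of_real t * s) = t * r" using t(1) that by (simp add: norm_mult)
    also have "\<dots> < 1 * 1" using t r by (intro mult_strict_mono) auto
    finally show ?thesis by simp
  qed
  have aG: "(\<lambda>j. a j * s ^ j) sums G s" if "cmod s = r" for s
    using hille_hardy(1)[OF ts[OF that], of \<nu> x y] by (simp add: a_def G_def power_mult_distrib mult_ac)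
  have asum: "summable (\<lambda>j. cmod (a j) * r ^ j)"
  proof -
    have c: "cmod (of_real r) = r" using r by simp
    from hille_hardy(2)[OF ts[OF c], of \<nu> x y] show ?thesis
      using r t(1) by (simp add: a_def norm_mult norm_power norm_divide power_mult_distrib mult_ac)
  qed
  define C where "C = of_real ((1 - t) ^ Suc \<nu> * fact \<nu>) * exp ((x + y) * of_real q)"
  define g where "g \<theta> = G (of_real r * cis \<theta>) / (1 - of_real r * cis \<theta>) / (of_real r * cis \<theta>) ^ (N - 1)" for \<theta>
  have sumN: "(\<Sum>j<N. a j) = (\<Sum>j\<le>N - 1. a j)"
    using N by (intro sum.cong) auto
  have "of_real (2 * pi) * (\<Sum>j<N. a j) = (LBINT \<theta>:{- pi..pi}. g \<theta>)"
    unfolding sumN g_def by (rule contour_partial_sum[OF r asum aG])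
  also have "\<dots> = (1 / \<rho>) *\<^sub>R (LBINT \<phi>. indicator {- pi..pi} (\<phi> / \<rho>) *\<^sub>R g (\<phi> / \<rho>))"
    unfolding set_lebesgue_integral_def using \<rho>
    by (subst lborel_integral_real_affine[where c="1 / \<rho>" and t=0]) auto
  also have "(LBINT \<phi>. indicator {- pi..pi} (\<phi> / \<rho>) *\<^sub>R g (\<phi> / \<rho>)) = (LBINT \<phi>:{- pi * \<rho>..pi * \<rho>}. g (\<phi> / \<rho>))"
    unfolding set_lebesgue_integral_def using \<rho>
    by (intro Bochner_Integration.integral_cong refl) (simp add: indicator_def field_simps)
  finally have pre: "of_real (2 * pi) * (\<Sum>j<N. a j) = of_real (1 / \<rho>) * (LBINT \<phi>:{- pi * \<rho>..pi * \<rho>}. g (\<phi> / \<rho>))"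
    unfolding scaleR_conv_of_real .
  have "of_real (1 / (2 * pi)) * (of_real (2 * pi) * (\<Sum>j<N. a j)) = (\<Sum>j<N. a j)" by simp
  then have "(\<Sum>j<N. a j) = of_real (1 / (2 * pi)) * (of_real (1 / \<rho>) * (LBINT \<phi>:{- pi * \<rho>..pi * \<rho>}. g (\<phi> / \<rho>)))"
    unfolding pre by (rule sym)
  then have "C * (\<Sum>j<N. a j) = of_real (1 / (2 * pi)) * (C * of_real (1 / \<rho>) * (LBINT \<phi>:{- pi * \<rho>..pi * \<rho>}. g (\<phi> / \<rho>)))"
    by (simp only: mult_ac)
  also have "C * of_real (1 / \<rho>) * (LBINT \<phi>:{- pi * \<rho>..pi * \<rho>}. g (\<phi> / \<rho>)) =
    (LBINT \<phi>:{- pi * \<rho>..pi * \<rho>}. C * of_real (1 / \<rho>) * g (\<phi> / \<rho>))"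
    by (rule set_integral_mult_right[symmetric])
  also have "\<dots> = (LBINT \<phi>:{- pi * \<rho>..pi * \<rho>}. saddle_integrand N \<nu> Z1 Z2 (Complex (-1) \<phi>))"
  proof (intro set_lebesgue_integral_cong allI impI)
    fix \<phi>
    define \<omega> where "\<omega> = Complex (-1) \<phi>"
    define s where "s = exp (\<omega> / of_real \<rho>)"
    define D where "D = saddle_denom N \<nu> s"
    have s_eq: "of_real r * cis (\<phi> / \<rho>) = s"
    proof -
      have "\<omega> / of_real \<rho> = of_real (- (1 / \<rho>)) + \<i> * of_real (\<phi> / \<rho>)"
        by (simp add: \<omega>_def Complex_eq add_divide_distrib diff_divide_distrib)
      then show ?thesis by (simp only: s_def exp_add exp_of_real cis_conv_exp r_def)
    qed
    have s0: "s \<noteq> 0" by (simp add: s_def)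
    have D: "1 - of_real t * s = D / of_real (1 + q)"
    proof -
      have "(1 + q) * t = q" using t q by simp
      then have "of_real (1 + q) * of_real t = complex_of_real q" by (simp only: of_real_mult[symmetric])
      then have "of_real (1 + q) * (1 - of_real t * s) = D"
        by (simp add: right_diff_distrib mult.assoc[symmetric] D_def saddle_denom_def q_def[symmetric])
      moreover have "complex_of_real (1 + q) \<noteq> 0" using q by (simp del: of_real_add)
      ultimately show ?thesis by (simp add: field_simps del: of_real_add)
    qed
    have q1: "complex_of_real (1 + q) \<noteq> 0" using q by (simp del: of_real_add)
    have D0: "D \<noteq> 0"
    proof
      assume "D = 0"
      then have "of_real t * s = 1" using D by simp
      moreover have "cmod s = r" unfolding s_eq[symmetric] using r by (simp add: norm_mult)
      ultimately show False using ts[of s] by simp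
    qed
    \<comment> \<open>At \<open>s = 1\<close> the Hille--Hardy exponent is
      \<open>- (x + y) t / (1 - t) = - (x + y) q\<close>. The prefactor removes precisely this
      value, leaving a difference proportional to \<open>s - 1\<close> that survives multiplication
      by \<open>\<rho>\<close>.\<close>
    have e1: "exp (- ((x + y) * (of_real t * s) / (1 - of_real t * s))) * exp ((x + y) * of_real q) =
      exp (- ((Z1 + Z2) * (of_real \<rho> * (s - 1)) / D))"
    proof -
      have Dq: "D = 1 + of_real q - of_real q * s" by (simp add: D_def saddle_denom_def q_def[symmetric] algebra_simps)
      have tq: "of_real t * s * of_real (1 + q) = of_real q * s"
      proof -
        have "t * (1 + q) = q" using t q by simp
        then have "of_real t * complex_of_real (1 + q) = of_real q" by (simp only: of_real_mult[symmetric])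
        then show ?thesis by (metis mult.assoc mult.commute)
      qed
      have "- ((x + y) * (of_real t * s) / (1 - of_real t * s)) + (x + y) * of_real q =
        (x + y) * (of_real q - of_real t * s * of_real (1 + q) / D)"
        unfolding D by (simp add: algebra_simps del: of_real_add)
      also have "of_real q - of_real t * s * of_real (1 + q) / D = of_real q * of_real (1 + q) * (1 - s) / D"
        unfolding tq using D0 by (simp add: field_simps) (simp add: Dq algebra_simps)
      also have "(x + y) * (of_real q * of_real (1 + q) * (1 - s) / D) =
         of_real (real \<nu> / \<rho> * (q * (1 + q))) * (Z1 + Z2) * (1 - s) / D"
        by (simp add: x_def y_def algebra_simps add_divide_distrib diff_divide_distrib)
      also have "real \<nu> / \<rho> * (q * (1 + q)) = \<rho>" using \<rho>2 \<rho> by (simp add: field_simps power2_eq_square)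
      also have "of_real \<rho> * (Z1 + Z2) * (1 - s) / D = - ((Z1 + Z2) * (of_real \<rho> * (s - 1)) / D)"
      proof -
        have "of_real \<rho> * (Z1 + Z2) * (1 - s) = - ((Z1 + Z2) * (of_real \<rho> * (s - 1)))" by (simp add: algebra_simps)
        then show ?thesis by (simp only: minus_divide_left)
      qed
      finally show ?thesis by (simp only: exp_add[symmetric])
    qed
    have e2: "x * y * (of_real t * s) / (1 - of_real t * s)\<^sup>2 = of_nat \<nu> * (Z1 * Z2 * s / D\<^sup>2)"
    proof -
      have "(real \<nu> / \<rho>)\<^sup>2 * t * (1 + q)\<^sup>2 = real \<nu>"
      proof -
        have "(real \<nu> / \<rho>)\<^sup>2 * t * (1 + q)\<^sup>2 = (real \<nu>)\<^sup>2 * (q * (1 + q)) / \<rho>\<^sup>2"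
          using q by (simp add: t(3) power_divide power2_eq_square)
        then show ?thesis unfolding \<rho>2 using q \<nu> by (simp add: power2_eq_square)
      qed
      then have "complex_of_real ((real \<nu> / \<rho>)\<^sup>2 * t * (1 + q)\<^sup>2) = of_nat \<nu>" by simp
      moreover have "x * y * (of_real t * s) / (1 - of_real t * s)\<^sup>2 = complex_of_real ((real \<nu> / \<rho>)\<^sup>2 * t * (1 + q)\<^sup>2) * (Z1 * Z2 * s / D\<^sup>2)"
        unfolding D power_divide by (simp add: x_def y_def power2_eq_square)
      ultimately show ?thesis by (simp only:)
    qed
    have e3: "of_real ((1 - t) ^ Suc \<nu>) / (1 - of_real t * s) ^ Suc \<nu> = 1 / D ^ \<nu> * (1 / D)"
      unfolding D t(4) using q1 by (simp add: power_divide del: of_real_add)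
    \<comment> \<open>The sum stops at index \<open>N - 1\<close>; the spare factor \<open>s\<close>
      goes into the pole term and leaves the exact power \<open>N\<close> in the main
      factor.\<close>
    have e4: "1 / s ^ (N - 1) = exp (- (of_nat N * \<omega> / of_real \<rho>)) * s"
    proof -
      have "exp (of_nat N * (\<omega> / of_real \<rho>)) = s ^ N" unfolding s_def by (rule exp_of_nat_mult)
      moreover have "s ^ N = s * s ^ (N - 1)" using N by (simp add: power_eq_if)
      ultimately show ?thesis using s0 by (simp add: exp_minus field_simps)
    qed
    have "C * of_real (1 / \<rho>) * g (\<phi> / \<rho>) =
      (of_real ((1 - t) ^ Suc \<nu>) / (1 - of_real t * s) ^ Suc \<nu>) *
      (exp (- ((x + y) * (of_real t * s) / (1 - of_real t * s))) * exp ((x + y) * of_real q)) *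
      (fact \<nu> * bessel_series \<nu> (x * y * (of_real t * s) / (1 - of_real t * s)\<^sup>2)) * (1 / s ^ (N - 1)) * (1 / (of_real \<rho> * (1 - s)))"
      unfolding g_def s_eq C_def G_def by (simp add: mult_ac)
    also have "\<dots> = saddle_integrand N \<nu> Z1 Z2 \<omega>"
      unfolding e1 e2 e3 e4 saddle_integrand_def Let_def \<rho>_def[symmetric] s_def[symmetric] D_def[symmetric]
      by (simp add: mult_ac)
    finally show "C * of_real (1 / \<rho>) * g (\<phi> / \<rho>) = saddle_integrand N \<nu> Z1 Z2 (Complex (-1) \<phi>)" by (simp add: \<omega>_def)
  qed simp
  finally show ?thesis by (simp add: C_def a_def)
qed

context saddle_sequence
begin

lemma saddle_integrand_tendsto:
  assumes Z1: "Z1 \<longlonglongrightarrow> z1" and Z2: "Z2 \<longlonglongrightarrow> z2" and \<omega>: "\<omega> \<noteq> 0"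
  shows "(\<lambda>i. saddle_integrand (N i) (\<nu> i) (Z1 i) (Z2 i) \<omega>) \<longlonglongrightarrow> exp (z1 * z2) * (exp (\<omega>\<^sup>2 / 2 - (z1 + z2) * \<omega>) / (- \<omega>))"
proof -
  define s where "s i = exp (\<omega> / complex_of_real (\<rho> i))" for i
  define D where "D i = saddle_denom (N i) (\<nu> i) (s i)" for i
  have s1: "s \<longlonglongrightarrow> 1" unfolding s_def using tendsto_exp[OF inverse_\<rho>[of \<omega>]] by simp
  have D1: "D \<longlonglongrightarrow> 1" unfolding D_def s_def by (rule saddle_denom_tendsto)
  have sc: "(\<lambda>i. of_real (\<rho> i) * (s i - 1)) \<longlonglongrightarrow> \<omega>" unfolding s_def by (rule scaled_exp_tendsto[OF \<omega>])
  have mf: "(\<lambda>i. 1 / D i ^ \<nu> i * exp (- (of_nat (N i) * \<omega> / of_real (\<rho> i)))) \<longlonglongrightarrow> exp (\<omega>\<^sup>2 / 2)"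
    unfolding D_def s_def by (rule main_factor_tendsto[OF \<omega>])
  have bs: "(\<lambda>i. fact (\<nu> i) * bessel_series (\<nu> i) (of_nat (\<nu> i) * (Z1 i * Z2 i * s i / (D i)\<^sup>2))) \<longlonglongrightarrow> exp (z1 * z2 * 1 / 1\<^sup>2)"
    by (intro bessel_series_scaled_tendsto \<nu>_at_top tendsto_intros Z1 Z2 s1 D1) auto
  have ex: "(\<lambda>i. 1 / D i * exp (- ((Z1 i + Z2 i) * (of_real (\<rho> i) * (s i - 1)) / D i))) \<longlonglongrightarrow> 1 / 1 * exp (- ((z1 + z2) * \<omega> / 1))"
    by (intro tendsto_intros Z1 Z2 sc D1) auto
  have pole: "(\<lambda>i. s i / (- (of_real (\<rho> i) * (s i - 1)))) \<longlonglongrightarrow> 1 / (- \<omega>)"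
    using \<omega> by (intro tendsto_intros s1 sc) auto
  have pe: "of_real (\<rho> i) * (1 - s i) = - (of_real (\<rho> i) * (s i - 1))" for i by (simp add: algebra_simps)
  have "(\<lambda>i. saddle_integrand (N i) (\<nu> i) (Z1 i) (Z2 i) \<omega>) \<longlonglongrightarrow>
     exp (\<omega>\<^sup>2 / 2) * ((1 / 1 * exp (- ((z1 + z2) * \<omega> / 1))) * exp (z1 * z2 * 1 / 1\<^sup>2)) * (1 / (- \<omega>))"
    unfolding saddle_integrand_def Let_def s_def[symmetric] D_def[symmetric] pe
    by (intro tendsto_mult mf ex bs pole)
  also have "exp (\<omega>\<^sup>2 / 2) * ((1 / 1 * exp (- ((z1 + z2) * \<omega> / 1))) * exp (z1 * z2 * 1 / 1\<^sup>2)) * (1 / (- \<omega>)) =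
     exp (z1 * z2) * (exp (\<omega>\<^sup>2 / 2 - (z1 + z2) * \<omega>) / (- \<omega>))"
  proof -
    have "exp (\<omega>\<^sup>2 / 2 - (z1 + z2) * \<omega>) = exp (\<omega>\<^sup>2 / 2) * exp (- ((z1 + z2) * \<omega>))"
      by (simp only: diff_conv_add_uminus exp_add)
    then show ?thesis by (simp add: mult_ac)
  qed
  finally show ?thesis .
qed

text \<open>The integrand is compared with its value at \<open>\<phi> = 0\<close>, whose convergence
  is already known. Raising the bound on the squared modulus to the power \<open>\<nu>\<close> gives
  Gaussian decay in \<open>\<phi>\<close>.\<close>

lemma saddle_denom_power_bound:
  assumes \<phi>: "\<bar>\<phi>\<bar> \<le> pi * \<rho> i"
  defines "s \<equiv> exp (Complex (-1) \<phi> / of_real (\<rho> i))"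
  shows "cmod (saddle_denom (N i) (\<nu> i) s) \<ge> 1"
    and "1 / cmod (saddle_denom (N i) (\<nu> i) s) ^ \<nu> i \<le>
      cmod (1 / saddle_denom (N i) (\<nu> i) (exp (-1 / of_real (\<rho> i))) ^ \<nu> i) * exp (- (saddle_rate (q i) / (2 * q i * (1 + q i))) * \<phi>\<^sup>2)"
proof -
  define r \<theta> where "r = exp (- (1 / \<rho> i))" and "\<theta> = \<phi> / \<rho> i"
  have \<rho>: "\<rho> i \<ge> 1" "\<rho> i > 0" by (rule \<rho>_ge)+
  have q: "q i > 0" by (rule q_pos)
  have s: "s = of_real r * cis \<theta>"
  proof -
    have "Complex (-1) \<phi> / of_real (\<rho> i) = of_real (- (1 / \<rho> i)) + \<i> * of_real \<theta>"
      by (simp add: \<theta>_def Complex_eq add_divide_distrib diff_divide_distrib)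
    then show ?thesis by (simp only: s_def exp_add exp_of_real cis_conv_exp r_def)
  qed
  have "exp (-1) \<le> r" using \<rho> by (simp add: r_def)
  moreover have "exp (-1 :: real) \<ge> 1 / 3" using exp_le by (simp add: exp_minus field_simps)
  ultimately have "1 / 3 \<le> r" by linarith
  moreover have "r \<le> 1" using \<rho> by (simp add: r_def)
  ultimately have r: "1 / 3 \<le> r" "r \<le> 1" by auto
  have \<theta>: "\<bar>\<theta>\<bar> \<le> pi" using \<phi> \<rho> by (simp add: \<theta>_def field_simps)
  define d0 where "d0 = 1 + q i - q i * r"
  have "q i * r \<le> q i * 1" using q r by (intro mult_left_mono) auto
  then have d0: "d0 \<ge> 1" by (simp add: d0_def)
  have lower: "(cmod (saddle_denom (N i) (\<nu> i) s))\<^sup>2 \<ge> d0\<^sup>2 * exp (saddle_rate (q i) * \<theta>\<^sup>2)"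
    unfolding s d0_def by (rule saddle_denom_lower[OF q r \<theta>])
  have "1 * 1 \<le> d0\<^sup>2 * exp (saddle_rate (q i) * \<theta>\<^sup>2)"
    using d0 saddle_rate_pos[OF q] by (intro mult_mono) auto
  then have "1\<^sup>2 \<le> (cmod (saddle_denom (N i) (\<nu> i) s))\<^sup>2" using lower by simp
  then show ge1: "cmod (saddle_denom (N i) (\<nu> i) s) \<ge> 1" by (rule power2_le_imp_le) simp
  \<comment> \<open>From \<open>\<rho>^2 = \<nu> q (1 + q)\<close> one has
    \<open>\<nu> \<theta>^2 = \<phi>^2 / (q (1 + q))\<close>, so the rate depends on
    \<open>q\<close> alone; the factor 2 undoes the squared modulus.\<close>
  define k where "k = saddle_rate (q i) / (2 * q i * (1 + q i))"
  have dd: "cmod (1 / saddle_denom (N i) (\<nu> i) (exp (-1 / of_real (\<rho> i))) ^ \<nu> i) = 1 / d0 ^ \<nu> i"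
  proof -
    have "exp (-1 / of_real (\<rho> i)) = complex_of_real r" by (simp add: r_def exp_of_real[symmetric])
    moreover have "1 - of_real a * (of_real b - 1) = complex_of_real (1 + a - a * b)" for a b :: real
      by (simp add: algebra_simps)
    ultimately have "saddle_denom (N i) (\<nu> i) (exp (-1 / of_real (\<rho> i))) = of_real d0"
      by (simp only: saddle_denom_def d0_def)
    then show ?thesis using d0 by (simp add: norm_divide norm_power)
  qed
  have "(d0 ^ \<nu> i * exp (k * \<phi>\<^sup>2))\<^sup>2 = (d0\<^sup>2 * exp (saddle_rate (q i) * \<theta>\<^sup>2)) ^ \<nu> i"
  proof -
    have "real (\<nu> i) * (saddle_rate (q i) * \<theta>\<^sup>2) = 2 * (k * \<phi>\<^sup>2)"
    proof -
      have gen: "v * (R * (P / (v * X))) = 2 * (R / (2 * X) * P)" if "v \<noteq> 0" for v R P X :: real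
        using that by simp
      have th: "\<theta>\<^sup>2 = \<phi>\<^sup>2 / (real (\<nu> i) * (q i * (1 + q i)))"
        unfolding \<theta>_def power_divide \<rho>_sq by (simp only: mult.assoc)
      have kk: "k = saddle_rate (q i) / (2 * (q i * (1 + q i)))" unfolding k_def by (simp only: mult.assoc)
      show ?thesis unfolding th kk by (rule gen) (use \<nu>_pos[of i] in simp)
    qed
    then have "exp (saddle_rate (q i) * \<theta>\<^sup>2) ^ \<nu> i = exp (k * \<phi>\<^sup>2) ^ 2"
      by (simp add: exp_of_nat_mult[symmetric] exp_double[symmetric])
    then show ?thesis by (simp add: power_mult_distrib power_mult[symmetric] mult.commute)
  qed
  also have "\<dots> \<le> ((cmod (saddle_denom (N i) (\<nu> i) s))\<^sup>2) ^ \<nu> i"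
    using lower by (intro power_mono) auto
  also have "\<dots> = (cmod (saddle_denom (N i) (\<nu> i) s) ^ \<nu> i)\<^sup>2" by (simp add: power_mult[symmetric] mult.commute)
  finally have "d0 ^ \<nu> i * exp (k * \<phi>\<^sup>2) \<le> cmod (saddle_denom (N i) (\<nu> i) s) ^ \<nu> i"
    by (rule power2_le_imp_le) simp
  then have le: "d0 ^ \<nu> i * exp (k * \<phi>\<^sup>2) \<le> cmod (saddle_denom (N i) (\<nu> i) s) ^ \<nu> i" .
  have "0 < d0 ^ \<nu> i * exp (k * \<phi>\<^sup>2)" using d0 by (intro mult_pos_pos zero_less_power) auto
  then have "1 / cmod (saddle_denom (N i) (\<nu> i) s) ^ \<nu> i \<le> 1 / (d0 ^ \<nu> i * exp (k * \<phi>\<^sup>2))"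
    by (rule frac_le[OF zero_le_one order_refl _ le])
  also have "\<dots> = 1 / d0 ^ \<nu> i * exp (- k * \<phi>\<^sup>2)" by (simp add: exp_minus divide_inverse)
  finally show "1 / cmod (saddle_denom (N i) (\<nu> i) s) ^ \<nu> i \<le>
      cmod (1 / saddle_denom (N i) (\<nu> i) (exp (-1 / of_real (\<rho> i))) ^ \<nu> i) * exp (- (saddle_rate (q i) / (2 * q i * (1 + q i))) * \<phi>\<^sup>2)"
    unfolding dd k_def .
qed

end

context saddle_sequence
begin

text \<open>The main factor at \<open>\<phi> = 0\<close> tends to \<open>exp (1/2) < 3\<close> and
  carries a Gaussian in \<open>\<phi>\<close>. The exponential factor grows at most like
  \<open>exp (c (1 + |\<phi>|))\<close>, which half of the Gaussian absorbs; the Bessel and pole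
  factors are bounded.\<close>

lemma saddle_integrand_dominated:
  assumes Z1: "Z1 \<longlonglongrightarrow> z1" and Z2: "Z2 \<longlonglongrightarrow> z2"
  obtains M p where "p > 0"
    and "eventually (\<lambda>i. \<forall>\<phi>. \<bar>\<phi>\<bar> \<le> pi * \<rho> i \<longrightarrow>
      cmod (saddle_integrand (N i) (\<nu> i) (Z1 i) (Z2 i) (Complex (-1) \<phi>)) \<le> M * exp (- p * \<phi>\<^sup>2)) sequentially"
proof -
  obtain R1 where R1: "R1 > 0" "\<And>i. cmod (Z1 i) \<le> R1"
    using convergent_imp_Bseq[OF convergentI[OF Z1]] by (auto simp: Bseq_def)
  obtain R2 where R2: "R2 > 0" "\<And>i. cmod (Z2 i) \<le> R2"
    using convergent_imp_Bseq[OF convergentI[OF Z2]] by (auto simp: Bseq_def)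
  define kap where "kap q = saddle_rate q / (2 * q * (1 + q))" for q
  \<comment> \<open>Half of the limiting rate, so that the actual rates exceed it for all large
    indices.\<close>
  define p where "p = kap (1 / \<alpha>) / 2"
  have kpos: "kap (1 / \<alpha>) > 0" using saddle_rate_pos[of "1 / \<alpha>"] \<alpha> by (simp add: kap_def add_pos_pos)
  then have p: "p > 0" by (simp add: p_def)
  have "(\<lambda>i. kap (q i)) \<longlonglongrightarrow> kap (1 / \<alpha>)"
  proof -
    obtain Q where Q: "Q = 1 / \<alpha>" by blast
    have Q0: "Q > 0" using \<alpha> by (simp add: Q)
    have "27 * (1 + Q) > 0" "2 * Q * (1 + Q) > 0" using Q0 by simp_all
    moreover from this(1) have "1 + 16 * (Q / (27 * (1 + Q))) > 0" using Q0 by (intro add_pos_pos mult_pos_pos divide_pos_pos) auto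
    ultimately have nz: "27 * (1 + Q) \<noteq> 0" "2 * Q * (1 + Q) \<noteq> 0" "1 + 16 * (Q / (27 * (1 + Q))) \<noteq> 0" by linarith+
    show ?thesis
      unfolding kap_def saddle_rate_def Q[symmetric]
      by (intro tendsto_intros q_tendsto[folded Q] nz)
  qed
  moreover have "kap (1 / \<alpha>) > p" using kpos by (simp add: p_def)
  ultimately have ev1: "eventually (\<lambda>i. kap (q i) > p) sequentially" by (rule order_tendstoD(1))
  define mf where "mf i = 1 / saddle_denom (N i) (\<nu> i) (exp (-1 / of_real (\<rho> i))) ^ \<nu> i * exp (- (of_nat (N i) * -1 / of_real (\<rho> i)))" for i
  have "(\<lambda>i. cmod (mf i)) \<longlonglongrightarrow> cmod (exp ((-1)\<^sup>2 / 2))"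
    unfolding mf_def by (intro tendsto_norm main_factor_tendsto) simp
  moreover have "cmod (exp ((-1)\<^sup>2 / 2)) < 3"
  proof -
    have "exp (1 / 2 :: real) < 3" by (rule less_le_trans[OF _ exp_le]) simp
    then show ?thesis by (simp add: norm_exp_eq_Re)
  qed
  ultimately have ev2: "eventually (\<lambda>i. cmod (mf i) < 3) sequentially" by (rule order_tendstoD(2))
  have "(\<lambda>i. cmod (of_real (\<rho> i) * (exp (-1 / of_real (\<rho> i)) - 1))) \<longlonglongrightarrow> cmod (-1)"
    by (intro tendsto_norm scaled_exp_tendsto) simp
  then have ev3: "eventually (\<lambda>i. cmod (of_real (\<rho> i) * (exp (-1 / of_real (\<rho> i)) - 1)) > 1 / 2) sequentially"
    by (rule order_tendstoD(1)) simp
  define c where "c = (R1 + R2) * 3"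
  have c: "c > 0" using R1 R2 by (simp add: c_def)
  define M where "M = 3 * (exp (c + c\<^sup>2 / (2 * p)) * exp (R1 * R2)) * 2"
  show thesis
  proof (rule that)
    show "p / 2 > 0" using p by simp
    show "eventually (\<lambda>i. \<forall>\<phi>. \<bar>\<phi>\<bar> \<le> pi * \<rho> i \<longrightarrow>
      cmod (saddle_integrand (N i) (\<nu> i) (Z1 i) (Z2 i) (Complex (-1) \<phi>)) \<le> M * exp (- (p / 2) * \<phi>\<^sup>2)) sequentially"
      using ev1 ev2 ev3
    proof (eventually_elim, intro allI impI)
      fix i \<phi>
      assume e1: "kap (q i) > p" and e2: "cmod (mf i) < 3"
        and e3: "cmod (of_real (\<rho> i) * (exp (-1 / of_real (\<rho> i)) - 1)) > 1 / 2"
        and \<phi>: "\<bar>\<phi>\<bar> \<le> pi * \<rho> i"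
      define \<omega> where "\<omega> = Complex (-1) \<phi>"
      define s where "s = exp (\<omega> / of_real (\<rho> i))"
      define D where "D = saddle_denom (N i) (\<nu> i) s"
      have \<rho>: "\<rho> i \<ge> 1" "\<rho> i > 0" by (rule \<rho>_ge)+
      have D1: "cmod D \<ge> 1" unfolding D_def s_def \<omega>_def by (rule saddle_denom_power_bound(1)[OF \<phi>])
      have Re_w: "Re (\<omega> / of_real (\<rho> i)) = - (1 / \<rho> i)" by (simp add: \<omega>_def)
      have ns: "cmod s = exp (- (1 / \<rho> i))" unfolding s_def norm_exp_eq_Re Re_w ..
      have ns1: "cmod s \<le> 1" using \<rho> by (simp add: ns)
      have nw: "cmod \<omega> \<le> 1 + \<bar>\<phi>\<bar>" unfolding \<omega>_def using cmod_le[of "Complex (-1) \<phi>"] by simp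
      have A: "cmod (1 / D ^ \<nu> i * exp (- (of_nat (N i) * \<omega> / of_real (\<rho> i)))) \<le> 3 * exp (- p * \<phi>\<^sup>2)"
      proof -
        have re: "Re (- (of_nat (N i) * \<omega> / of_real (\<rho> i))) = Re (- (of_nat (N i) * -1 / of_real (\<rho> i)))"
          by (simp add: \<omega>_def)
        have "cmod (1 / D ^ \<nu> i * exp (- (of_nat (N i) * \<omega> / of_real (\<rho> i)))) =
          (1 / cmod D ^ \<nu> i) * cmod (exp (- (of_nat (N i) * -1 / of_real (\<rho> i))))"
          unfolding norm_mult norm_exp_eq_Re re by (simp add: norm_divide norm_power)
        also have "\<dots> \<le> (cmod (1 / saddle_denom (N i) (\<nu> i) (exp (-1 / of_real (\<rho> i))) ^ \<nu> i) * exp (- kap (q i) * \<phi>\<^sup>2)) * cmod (exp (- (of_nat (N i) * -1 / of_real (\<rho> i))))"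
          unfolding D_def s_def \<omega>_def kap_def by (intro mult_right_mono saddle_denom_power_bound(2)[OF \<phi>]) simp
        also have "\<dots> = cmod (mf i) * exp (- kap (q i) * \<phi>\<^sup>2)" unfolding mf_def norm_mult by (simp only: mult_ac)
        also have "\<dots> \<le> 3 * exp (- p * \<phi>\<^sup>2)"
          using e1 e2 by (intro mult_mono) (auto intro!: mult_right_mono)
        finally show ?thesis .
      qed
      have B: "cmod (1 / D * exp (- ((Z1 i + Z2 i) * (of_real (\<rho> i) * (s - 1)) / D))) \<le> exp (c * (1 + \<bar>\<phi>\<bar>))"
      proof -
        have "cmod (s - 1) \<le> exp \<bar>Re (\<omega> / of_real (\<rho> i))\<bar> * cmod (\<omega> / of_real (\<rho> i))"
          using Taylor_exp[of "\<omega> / of_real (\<rho> i)" 0] by (simp add: s_def)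
        also have "\<dots> \<le> 3 * (cmod \<omega> / \<rho> i)"
        proof (intro mult_mono)
          have "exp (1 / \<rho> i) \<le> 3" by (rule order_trans[OF _ exp_le]) (use \<rho> in simp)
          then show "exp \<bar>Re (\<omega> / of_real (\<rho> i))\<bar> \<le> 3" unfolding Re_w using \<rho> by simp
          show "cmod (\<omega> / of_real (\<rho> i)) \<le> cmod \<omega> / \<rho> i" using \<rho> by (simp add: norm_divide)
        qed auto
        finally have s1: "\<rho> i * cmod (s - 1) \<le> 3 * cmod \<omega>" using \<rho> by (simp add: field_simps)
        have "cmod ((Z1 i + Z2 i) * (of_real (\<rho> i) * (s - 1)) / D) \<le> cmod (Z1 i + Z2 i) * (\<rho> i * cmod (s - 1)) / 1"
          unfolding norm_divide norm_mult using D1 \<rho> by (intro frac_le) auto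
        also have "\<dots> \<le> (R1 + R2) * (3 * (1 + \<bar>\<phi>\<bar>))"
        proof -
          have c1: "cmod (Z1 i + Z2 i) \<le> R1 + R2" by (rule norm_triangle_le) (use R1(2)[of i] R2(2)[of i] in linarith)
          have c2: "\<rho> i * cmod (s - 1) \<le> 3 * (1 + \<bar>\<phi>\<bar>)"
            by (rule order_trans[OF s1 mult_left_mono[OF nw]]) simp
          have "cmod (Z1 i + Z2 i) * (\<rho> i * cmod (s - 1)) \<le> (R1 + R2) * (3 * (1 + \<bar>\<phi>\<bar>))"
            by (rule mult_mono[OF c1 c2]) (use \<rho> R1(1) R2(1) in auto)
          then show ?thesis by simp
        qed
        finally have "cmod (- ((Z1 i + Z2 i) * (of_real (\<rho> i) * (s - 1)) / D)) \<le> c * (1 + \<bar>\<phi>\<bar>)"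
          by (simp only: norm_minus_cancel c_def mult.assoc)
        then have "cmod (exp (- ((Z1 i + Z2 i) * (of_real (\<rho> i) * (s - 1)) / D))) \<le> exp (c * (1 + \<bar>\<phi>\<bar>))"
          using order_trans[OF norm_exp_le] by (metis exp_le_cancel_iff)
        moreover have "cmod (1 / D) \<le> 1"

        proof -
          have "1 / cmod D \<le> 1 / 1" by (rule frac_le) (use D1 in auto)
          then show ?thesis by (simp add: norm_divide)
        qed
        ultimately have "cmod (1 / D) * cmod (exp (- ((Z1 i + Z2 i) * (of_real (\<rho> i) * (s - 1)) / D))) \<le> 1 * exp (c * (1 + \<bar>\<phi>\<bar>))"
          by (intro mult_mono) auto
        then show ?thesis by (simp only: norm_mult mult_1_left)
      qed
      have Cb: "cmod (fact (\<nu> i) * bessel_series (\<nu> i) (of_nat (\<nu> i) * (Z1 i * Z2 i * s / D\<^sup>2))) \<le> exp (R1 * R2)"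
      proof (rule order_trans[OF bessel_series_scaled_bound])
        have "cmod (Z1 i * Z2 i * s / D\<^sup>2) \<le> (R1 * R2 * 1) / 1"
          unfolding norm_divide norm_mult norm_power
          using R1 R2 ns1 D1 by (intro frac_le mult_mono) (auto simp: one_le_power less_imp_le)
        then show "exp (cmod (Z1 i * Z2 i * s / D\<^sup>2)) \<le> exp (R1 * R2)" by simp
      qed
      \<comment> \<open>On the circle \<open>|1 - s|\<close> is at least \<open>1 - |s|\<close>, its
        value at \<open>\<phi> = 0\<close>, so the pole is controlled for all angles by the limit at
        \<open>\<omega> = -1\<close>.\<close>
      have Db: "cmod (s / (of_real (\<rho> i) * (1 - s))) \<le> 2"
      proof -
        have "complex_of_real (\<rho> i) * (exp (-1 / of_real (\<rho> i)) - 1) = of_real (\<rho> i * (exp (- (1 / \<rho> i)) - 1))"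
          by (simp add: exp_of_real[symmetric])
        then have "\<rho> i * \<bar>exp (- (1 / \<rho> i)) - 1\<bar> > 1 / 2" using e3 \<rho> by (simp only: norm_of_real abs_mult)
        moreover have "exp (- (1 / \<rho> i)) \<le> 1" using \<rho> by simp
        ultimately have "\<rho> i * (1 - exp (- (1 / \<rho> i))) > 1 / 2" by simp
        moreover have "cmod (1 - s) \<ge> 1 - exp (- (1 / \<rho> i))" using norm_triangle_ineq2[of 1 s] by (simp add: ns)
        then have "\<rho> i * cmod (1 - s) \<ge> \<rho> i * (1 - exp (- (1 / \<rho> i)))" using \<rho> by (intro mult_left_mono) auto
        ultimately have "\<rho> i * cmod (1 - s) \<ge> 1 / 2" by linarith
        moreover have "cmod (s / (of_real (\<rho> i) * (1 - s))) = cmod s / (\<rho> i * cmod (1 - s))" using \<rho> by (simp add: norm_divide norm_mult)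
        moreover have "cmod s / (\<rho> i * cmod (1 - s)) \<le> 1 / (1 / 2)" if "\<rho> i * cmod (1 - s) \<ge> 1 / 2"
          using ns1 that by (intro frac_le) auto
        ultimately show ?thesis by simp
      qed
      \<comment> \<open>Completing the square:
        \<open>c |\<phi>| \<le> (p / 2) \<phi>^2 + c^2 / (2 p)\<close>.\<close>
      have amgm: "- p * \<phi>\<^sup>2 + c * (1 + \<bar>\<phi>\<bar>) \<le> - (p / 2) * \<phi>\<^sup>2 + (c + c\<^sup>2 / (2 * p))"
      proof -
        have "0 \<le> (p * \<bar>\<phi>\<bar> - c)\<^sup>2 / (2 * p)" using p by simp
        also have "(p * \<bar>\<phi>\<bar> - c)\<^sup>2 / (2 * p) = (p / 2) * \<phi>\<^sup>2 - c * \<bar>\<phi>\<bar> + c\<^sup>2 / (2 * p)"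
        proof -
          have "(p * \<bar>\<phi>\<bar> - c)\<^sup>2 = p\<^sup>2 * \<phi>\<^sup>2 - 2 * p * c * \<bar>\<phi>\<bar> + c\<^sup>2"
            by (simp add: power2_diff power_mult_distrib)
          then show ?thesis using p by (simp add: add_divide_distrib diff_divide_distrib power2_eq_square)
        qed
        finally show ?thesis by (simp add: algebra_simps)
      qed
      define X1 where "X1 = 1 / D ^ \<nu> i * exp (- (of_nat (N i) * \<omega> / of_real (\<rho> i)))"
      define X2 where "X2 = 1 / D * exp (- ((Z1 i + Z2 i) * (of_real (\<rho> i) * (s - 1)) / D))"
      define X3 where "X3 = fact (\<nu> i) * bessel_series (\<nu> i) (of_nat (\<nu> i) * (Z1 i * Z2 i * s / D\<^sup>2))"
      define X4 where "X4 = s / (of_real (\<rho> i) * (1 - s))"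
      have "saddle_integrand (N i) (\<nu> i) (Z1 i) (Z2 i) \<omega> = X1 * (X2 * X3) * X4"
        unfolding saddle_integrand_def Let_def s_def D_def X1_def X2_def X3_def X4_def ..
      then have "cmod (saddle_integrand (N i) (\<nu> i) (Z1 i) (Z2 i) \<omega>) = cmod X1 * (cmod X2 * cmod X3) * cmod X4"
        by (simp only: norm_mult)
      also have "\<dots> \<le> (3 * exp (- p * \<phi>\<^sup>2)) * (exp (c * (1 + \<bar>\<phi>\<bar>)) * exp (R1 * R2)) * 2"
        by (intro mult_mono A[folded X1_def] B[folded X2_def] Cb[folded X3_def] Db[folded X4_def] mult_nonneg_nonneg) auto
      also have "\<dots> = 3 * (exp (- p * \<phi>\<^sup>2 + c * (1 + \<bar>\<phi>\<bar>)) * exp (R1 * R2)) * 2" by (simp only: exp_add mult.assoc)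
      also have "\<dots> \<le> 3 * (exp (- (p / 2) * \<phi>\<^sup>2 + (c + c\<^sup>2 / (2 * p))) * exp (R1 * R2)) * 2"
        using amgm by (intro mult_right_mono mult_left_mono) auto
      also have "\<dots> = M * exp (- (p / 2) * \<phi>\<^sup>2)" by (simp only: M_def exp_add mult_ac)
      finally show "cmod (saddle_integrand (N i) (\<nu> i) (Z1 i) (Z2 i) (Complex (-1) \<phi>)) \<le> M * exp (- (p / 2) * \<phi>\<^sup>2)"
        unfolding \<omega>_def .
    qed
  qed
qed

lemma borel_measurable_saddle_integrand [measurable]:
  "(\<lambda>\<phi>. saddle_integrand n m Z1 Z2 (Complex (-1) \<phi>)) \<in> borel_measurable borel"
proof -
  have [measurable]: "bessel_series m \<in> borel_measurable borel"
  proof (rule borel_measurable_LIMSEQ_metric)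
    show "(\<lambda>n. \<Sum>k<n. z ^ k / (fact k * fact (k + m))) \<longlonglongrightarrow> bessel_series m z" for z
      using bessel_series_sums(1)[of z m] by (simp add: sums_def)
  qed measurable
  then show ?thesis
    unfolding saddle_integrand_def Let_def saddle_denom_def Complex_eq by measurable
qed

text \<open>Dominated convergence on the whole line: the growing intervals
  \<open>|\<phi>| \<le> pi \<rho>\<close> eventually contain each point. The shift by
  \<open>i0\<close> is due to the domination holding only from some index on.\<close>

lemma saddle_integral_tendsto:
  assumes Z1: "Z1 \<longlonglongrightarrow> z1" and Z2: "Z2 \<longlonglongrightarrow> z2"
  shows "(\<lambda>i. LBINT \<phi>:{- pi * \<rho> i..pi * \<rho> i}. saddle_integrand (N i) (\<nu> i) (Z1 i) (Z2 i) (Complex (-1) \<phi>)) \<longlonglongrightarrow>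
    exp (z1 * z2) * (of_real pi * erfc (- ((z1 + z2) / of_real (sqrt 2))))"
proof -
  obtain M p where p: "p > 0" and ev: "eventually (\<lambda>i. \<forall>\<phi>. \<bar>\<phi>\<bar> \<le> pi * \<rho> i \<longrightarrow>
      cmod (saddle_integrand (N i) (\<nu> i) (Z1 i) (Z2 i) (Complex (-1) \<phi>)) \<le> M * exp (- p * \<phi>\<^sup>2)) sequentially"
    using saddle_integrand_dominated[OF Z1 Z2] by blast
  from ev obtain i0 where i0': "\<forall>i\<ge>i0. \<forall>\<phi>. \<bar>\<phi>\<bar> \<le> pi * \<rho> i \<longrightarrow>
      cmod (saddle_integrand (N i) (\<nu> i) (Z1 i) (Z2 i) (Complex (-1) \<phi>)) \<le> M * exp (- p * \<phi>\<^sup>2)"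
    unfolding eventually_sequentially by (rule exE)
  have i0: "cmod (saddle_integrand (N i) (\<nu> i) (Z1 i) (Z2 i) (Complex (-1) \<phi>)) \<le> M * exp (- p * \<phi>\<^sup>2)"
    if "i \<ge> i0" "\<bar>\<phi>\<bar> \<le> pi * \<rho> i" for i \<phi>
    using that by (rule i0'[rule_format])
  have M0: "M * exp (- p * \<phi>\<^sup>2) \<ge> 0" for \<phi>
  proof -
    have "\<bar>0\<bar> \<le> pi * \<rho> i0" using \<rho>_ge(2)[of i0] by simp
    from order_trans[OF norm_ge_zero i0[OF order_refl this]] have "M \<ge> 0" by simp
    then show ?thesis by simp
  qed
  define F where "F i \<phi> = indicator {- pi * \<rho> i..pi * \<rho> i} \<phi> *\<^sub>R saddle_integrand (N i) (\<nu> i) (Z1 i) (Z2 i) (Complex (-1) \<phi>)" for i \<phi>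
  define L where "L \<phi> = exp (z1 * z2) * (exp ((Complex (-1) \<phi>)\<^sup>2 / 2 - (z1 + z2) * Complex (-1) \<phi>) / (- Complex (-1) \<phi>))" for \<phi>
  have Lm: "L \<in> borel_measurable lborel" unfolding L_def Complex_eq by measurable
  have "(\<lambda>i. integral\<^sup>L lborel (F (i + i0))) \<longlonglongrightarrow> integral\<^sup>L lborel L"
  proof (rule integral_dominated_convergence[OF Lm _ integrable_gauss[OF p, of M]])
    show "F (i + i0) \<in> borel_measurable lborel" for i unfolding F_def by measurable
    show "AE \<phi> in lborel. norm (F (i + i0) \<phi>) \<le> M * exp (- p * \<phi>\<^sup>2)" for i
    proof (rule AE_I2)
      fix \<phi>
      show "norm (F (i + i0) \<phi>) \<le> M * exp (- p * \<phi>\<^sup>2)"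
      proof (cases "\<phi> \<in> {- pi * \<rho> (i + i0)..pi * \<rho> (i + i0)}")
        case True
        then have "\<bar>\<phi>\<bar> \<le> pi * \<rho> (i + i0)" by (simp add: abs_le_iff)
        from i0[OF _ this] True show ?thesis by (simp add: F_def)
      next
        case False
        then have "F (i + i0) \<phi> = 0" by (simp add: F_def)
        then show ?thesis using M0[of \<phi>] by simp
      qed
    qed
    show "AE \<phi> in lborel. (\<lambda>i. F (i + i0) \<phi>) \<longlonglongrightarrow> L \<phi>"
    proof (rule AE_I2)
      fix \<phi>
      have "Complex (-1) \<phi> \<noteq> 0" by (simp add: complex_eq_iff)
      from saddle_integrand_tendsto[OF Z1 Z2 this]
      have "(\<lambda>i. saddle_integrand (N i) (\<nu> i) (Z1 i) (Z2 i) (Complex (-1) \<phi>)) \<longlonglongrightarrow> L \<phi>" by (simp only: L_def)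
      moreover have "eventually (\<lambda>i. F i \<phi> = saddle_integrand (N i) (\<nu> i) (Z1 i) (Z2 i) (Complex (-1) \<phi>)) sequentially"
      proof -
        have "eventually (\<lambda>i. \<rho> i \<ge> \<bar>\<phi>\<bar>) sequentially"
          using \<rho>_at_top unfolding filterlim_at_top by blast
        then show ?thesis
        proof eventually_elim
          case (elim i)
          have "1 * \<rho> i \<le> pi * \<rho> i" using pi_gt3 \<rho>_ge(2)[of i] by (intro mult_right_mono) auto
          then have "\<bar>\<phi>\<bar> \<le> pi * \<rho> i" using elim by simp
          then show ?case by (simp add: F_def indicator_def abs_le_iff)
        qed
      qed
      ultimately have "(\<lambda>i. F i \<phi>) \<longlonglongrightarrow> L \<phi>" by (simp add: tendsto_cong)
      then show "(\<lambda>i. F (i + i0) \<phi>) \<longlonglongrightarrow> L \<phi>" by (rule LIMSEQ_ignore_initial_segment)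
    qed
  qed
  then have "(\<lambda>i. integral\<^sup>L lborel (F i)) \<longlonglongrightarrow> integral\<^sup>L lborel L" by (rule LIMSEQ_offset)
  moreover have "integral\<^sup>L lborel L = exp (z1 * z2) * (of_real pi * erfc (- ((z1 + z2) / of_real (sqrt 2))))"
    unfolding L_def integral_mult_right_zero erfc_contour_integral ..
  ultimately show ?thesis unfolding F_def set_lebesgue_integral_def by simp
qed

end

section \<open>Gamma mixtures\<close>

lemma gamma_integral:
  "integrable lborel (\<lambda>t::real. indicator {0..} t * (t ^ k * exp (- t)))"
  "(LBINT t. indicator {0..} t * (t ^ k * exp (- t))) = (fact k :: real)"
proof -
  have eq: "(\<integral>\<^sup>+t. ennreal (indicator {0..} t * (t ^ k * exp (- t))) \<partial>lborel) = ennreal (fact k)"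
    using nn_intergal_power_times_exp_Ici[of k]
    by (subst (asm) nn_integral_cong[of _ _ "\<lambda>t. ennreal (indicator {0..} t * (t ^ k * exp (- t)))"]) (auto simp: indicator_def)
  have "has_bochner_integral lborel (\<lambda>t::real. indicator {0..} t * (t ^ k * exp (- t))) (fact k)"
    using eq by (intro has_bochner_integral_nn_integral) (auto simp: indicator_def)
  then show "integrable lborel (\<lambda>t::real. indicator {0..} t * (t ^ k * exp (- t)))"
    "(LBINT t. indicator {0..} t * (t ^ k * exp (- t))) = (fact k :: real)"
    by (auto simp: has_bochner_integral_iff)
qed

text \<open>Makes \<open>K_\<nu>\<close> positive, so that away from 0 the logarithm in
  \<open>potential\<close> is taken of a positive number and can be undone by the
  exponential.\<close>

lemma gamma_mixture_pos:
  assumes c: "c \<ge> 0"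
  shows "gamma_mixture \<nu> c > 0"
proof -
  have "(LBINT t. exp (- 2 - c) * indicator {1..2::real} t) \<le> gamma_mixture \<nu> c"
    unfolding gamma_mixture_def set_lebesgue_integral_def
  proof (rule integral_mono)
    show "integrable lborel (\<lambda>t. exp (- 2 - c) * indicator {1..2::real} t)" by simp
    show "integrable lborel (\<lambda>t::real. indicator {0..} t *\<^sub>R (t ^ (\<nu> - 1) * exp (- t - c / t)))"
      using gamma_mixture_integrable[OF c, of \<nu>] unfolding set_integrable_def .
    fix t :: real
    show "exp (- 2 - c) * indicator {1..2} t \<le> indicator {0..} t *\<^sub>R (t ^ (\<nu> - 1) * exp (- t - c / t))"
    proof (cases "t \<in> {1..2}")
      case True
      then have t: "1 \<le> t" "t \<le> 2" by auto
      have "c / t \<le> c / 1" using t c by (intro divide_left_mono) auto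
      then have "exp (- 2 - c) \<le> exp (- t - c / t)" using t by simp
      moreover have "1 \<le> t ^ (\<nu> - 1)" using t by (simp add: one_le_power)
      ultimately have "1 * exp (- 2 - c) \<le> t ^ (\<nu> - 1) * exp (- t - c / t)" by (intro mult_mono) auto
      then show ?thesis using t by simp
    next
      case False
      then have "exp (- 2 - c) * indicator {1..2} t = 0" by (simp only: indicator_simps mult_zero_right simp_thms)
      then show ?thesis by (cases "t \<ge> 0") simp_all
    qed
  qed
  moreover have "(LBINT t. exp (- 2 - c) * indicator {1..2::real} t) = exp (- 2 - c)" by simp
  ultimately show ?thesis using exp_gt_zero[of "- 2 - c"] by linarith
qed

lemma gamma_mixture_tendsto:
  assumes x: "x \<longlonglongrightarrow> c" and x0: "\<And>n. x n \<ge> 0"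
  shows "(\<lambda>n. gamma_mixture \<nu> (x n)) \<longlonglongrightarrow> gamma_mixture \<nu> c"
  unfolding gamma_mixture_def set_lebesgue_integral_def
proof (rule integral_dominated_convergence)
  show "integrable lborel (\<lambda>t::real. indicator {0..} t * (t ^ (\<nu> - 1) * exp (- t)))" by (rule gamma_integral)
  show "AE t in lborel. (\<lambda>n. indicator {0..} t *\<^sub>R (t ^ (\<nu> - 1) * exp (- t - x n / t))) \<longlonglongrightarrow> indicator {0..} t *\<^sub>R (t ^ (\<nu> - 1) * exp (- t - c / t))"
  proof (rule AE_I2)
    fix t :: real
    show "(\<lambda>n. indicator {0..} t *\<^sub>R (t ^ (\<nu> - 1) * exp (- t - x n / t))) \<longlonglongrightarrow> indicator {0..} t *\<^sub>R (t ^ (\<nu> - 1) * exp (- t - c / t))"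
    proof (cases "t = 0")
      case False
      then show ?thesis by (intro tendsto_intros x) auto
    qed simp
  qed
  show "AE t in lborel. norm (indicator {0..} t *\<^sub>R (t ^ (\<nu> - 1) * exp (- t - x n / t))) \<le> indicator {0..} t * (t ^ (\<nu> - 1) * exp (- t))" for n
  proof (rule AE_I2)
    fix t :: real
    show "norm (indicator {0..} t *\<^sub>R (t ^ (\<nu> - 1) * exp (- t - x n / t))) \<le> indicator {0..} t * (t ^ (\<nu> - 1) * exp (- t))"
    proof (cases "t \<ge> 0")
      case True
      then have "exp (- t - x n / t) \<le> exp (- t)" using x0[of n] by simp
      then have "t ^ (\<nu> - 1) * exp (- t - x n / t) \<le> t ^ (\<nu> - 1) * exp (- t)" using True by (intro mult_left_mono) auto
      then show ?thesis using True by (simp add: abs_mult)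
    qed simp
  qed
qed measurable

text \<open>Under the Gamma distribution of parameter \<open>\<nu>\<close> the variable \<open>\<nu> / t\<close> has mean close to one and
  variance of order \<open>1 / \<nu>\<close>.\<close>

lemma gamma_mixture_concentration:
  assumes \<nu>: "\<nu> \<ge> 3" and c: "c \<ge> 0"
  shows "\<bar>gamma_mixture \<nu> (real \<nu> * c) / fact (\<nu> - 1) - exp (- c)\<bar> \<le> c * sqrt ((real \<nu> + 2) / ((real \<nu> - 1) * (real \<nu> - 2)))"
proof -
  \<comment> \<open>The mean of \<open>(\<nu> / t - 1)^2\<close> under the Gamma density
    \<open>t^(\<nu>-1) exp (- t) / (\<nu> - 1)!\<close>; the inverse second moment is finite for
    \<open>\<nu> \<ge> 3\<close>.\<close>
  define v where "v = (real \<nu> + 2) / ((real \<nu> - 1) * (real \<nu> - 2))"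
  \<comment> \<open>The optimal weight in \<open>|y| \<le> \<eta> / 2 + y^2 / (2 \<eta>)\<close>:
    both halves contribute equally after integration, which reproduces the Cauchy--Schwarz
    bound.\<close>
  define \<eta> where "\<eta> = sqrt v"
  have \<nu>r: "real \<nu> \<ge> 3" using \<nu> by simp
  have v: "v > 0" using \<nu>r by (simp add: v_def)
  have \<eta>: "\<eta> > 0" "\<eta>\<^sup>2 = v" using v by (auto simp: \<eta>_def)
  define n where "n = real \<nu>"
  define P where "P k t = indicator {0..} t * (t ^ k * exp (- t))" for k and t :: real
  have Pint: "integrable lborel (P k)" "integral\<^sup>L lborel (P k) = fact k" for k
    unfolding P_def by (rule gamma_integral)+
  define g where "g t = indicator {0..} t *\<^sub>R (t ^ (\<nu> - 1) * exp (- t - n * c / t))" for t :: real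
  have gint: "integrable lborel g" and gval: "integral\<^sup>L lborel g = gamma_mixture \<nu> (n * c)"
    using gamma_mixture_integrable[of "n * c" \<nu>] c
    by (simp_all add: set_integrable_def g_def[abs_def] gamma_mixture_def set_lebesgue_integral_def n_def)
  define B where "B t = c * (\<eta> / 2 * P (\<nu> - 1) t + 1 / (2 * \<eta>) * (n\<^sup>2 * P (\<nu> - 3) t - 2 * n * P (\<nu> - 2) t + P (\<nu> - 1) t))" for t
  have Bint: "integrable lborel B" unfolding B_def
    by (intro integrable_mult_right Bochner_Integration.integrable_add Bochner_Integration.integrable_diff Pint)
  have Bval: "integral\<^sup>L lborel B = c * (\<eta> / 2 * fact (\<nu> - 1) + 1 / (2 * \<eta>) * (n\<^sup>2 * fact (\<nu> - 3) - 2 * n * fact (\<nu> - 2) + fact (\<nu> - 1)))"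
    unfolding B_def by (simp add: Pint)
  have dint: "integrable lborel (\<lambda>t. g t - exp (- c) * P (\<nu> - 1) t)"
    by (intro Bochner_Integration.integrable_diff integrable_mult_right gint Pint)
  have "\<bar>LBINT t. g t - exp (- c) * P (\<nu> - 1) t\<bar> \<le> (LBINT t. \<bar>g t - exp (- c) * P (\<nu> - 1) t\<bar>)"
    by (rule integral_abs_bound)
  also have "\<dots> \<le> integral\<^sup>L lborel B"
  proof (rule integral_mono_AE)
    show "integrable lborel (\<lambda>t. \<bar>g t - exp (- c) * P (\<nu> - 1) t\<bar>)" using dint by (rule integrable_abs)
    show "AE t in lborel. \<bar>g t - exp (- c) * P (\<nu> - 1) t\<bar> \<le> B t"
      using AE_lborel_singleton[of "0::real"]
    proof eventually_elim
      case (elim t)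
      show ?case
      proof (cases "t > 0")
        case t: True
        obtain y where y: "y = n / t - 1" by blast
        have "\<bar>exp (- (n * c / t)) - exp (- c)\<bar> \<le> \<bar>n * c / t - c\<bar>"
        proof -
          have lip: "exp (- a) - exp (- b) \<le> b - a" if "0 \<le> a" "a \<le> b" for a b :: real
          proof -
            have "1 + (a - b) \<le> exp (a - b)" by (rule exp_ge_add_one_self)
            then have "1 - exp (a - b) \<le> b - a" by linarith
            then have "exp (- a) * (1 - exp (a - b)) \<le> 1 * (b - a)" using that by (intro mult_mono) auto
            then show ?thesis by (simp add: right_diff_distrib exp_add[symmetric])
          qed
          have pos: "n * c / t \<ge> 0" using t c by (simp add: n_def)
          show ?thesis using lip[OF pos, of c] lip[OF c, of "n * c / t"] by (cases "n * c / t \<le> c") auto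
        qed
        also have "n * c / t - c = c * y" by (simp add: y algebra_simps)
        also have "\<bar>c * y\<bar> = c * \<bar>y\<bar>" using c by (simp add: abs_mult)
        also have "\<bar>y\<bar> \<le> \<eta> / 2 + 1 / (2 * \<eta>) * y\<^sup>2"
        proof -
          have "0 \<le> (\<eta> - \<bar>y\<bar>)\<^sup>2 / (2 * \<eta>)" using \<eta> by simp
          also have "\<dots> = \<eta> / 2 + 1 / (2 * \<eta>) * y\<^sup>2 - \<bar>y\<bar>"
            using \<eta>(1) by (simp add: power2_diff add_divide_distrib diff_divide_distrib) (simp add: power2_eq_square)
          finally show ?thesis by simp
        qed
        finally have d: "\<bar>exp (- (n * c / t)) - exp (- c)\<bar> \<le> c * (\<eta> / 2 + 1 / (2 * \<eta>) * y\<^sup>2)"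
          using c by (simp add: mult_left_mono)
        have "g t - exp (- c) * P (\<nu> - 1) t = (t ^ (\<nu> - 1) * exp (- t)) * (exp (- (n * c / t)) - exp (- c))"
        proof -
          have "exp (- t - n * c / t) = exp (- t) * exp (- (n * c / t))" by (simp add: exp_add[symmetric])
          then show ?thesis using t by (simp add: g_def P_def algebra_simps)
        qed
        then have "\<bar>g t - exp (- c) * P (\<nu> - 1) t\<bar> = (t ^ (\<nu> - 1) * exp (- t)) * \<bar>exp (- (n * c / t)) - exp (- c)\<bar>"
          using t by (simp add: abs_mult)
        also have "\<dots> \<le> (t ^ (\<nu> - 1) * exp (- t)) * (c * (\<eta> / 2 + 1 / (2 * \<eta>) * y\<^sup>2))"
          using t by (intro mult_left_mono d) auto
        also have "\<dots> = B t"
        proof -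
          obtain m where m: "\<nu> = m + 3" using \<nu> by (metis add.commute le_Suc_ex)
          have "t ^ (\<nu> - 1) * y\<^sup>2 = n\<^sup>2 * t ^ (\<nu> - 3) - 2 * n * t ^ (\<nu> - 2) + t ^ (\<nu> - 1)"
          proof -
            have "t ^ (\<nu> - 1) * y\<^sup>2 = t ^ m * (t * y)\<^sup>2" by (simp add: m power_add power2_eq_square)
            also have "t * y = n - t" using t by (simp add: y field_simps)
            finally show ?thesis by (simp add: m power2_eq_square algebra_simps power_add)
          qed
          moreover have "n\<^sup>2 * P (\<nu> - 3) t - 2 * n * P (\<nu> - 2) t + P (\<nu> - 1) t
            = (n\<^sup>2 * t ^ (\<nu> - 3) - 2 * n * t ^ (\<nu> - 2) + t ^ (\<nu> - 1)) * exp (- t)"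
            using t by (simp add: P_def algebra_simps)
          moreover have "P (\<nu> - 1) t = t ^ (\<nu> - 1) * exp (- t)" using t by (simp add: P_def)
          ultimately have "B t = c * (\<eta> / 2 * (t ^ (\<nu> - 1) * exp (- t)) + 1 / (2 * \<eta>) * ((t ^ (\<nu> - 1) * y\<^sup>2) * exp (- t)))"
            unfolding B_def by (simp only:)
          then show ?thesis by (simp only: distrib_left mult_ac)
        qed
        finally show ?thesis .
      next
        case False
        then have "t < 0" using elim by simp
        then show ?thesis by (simp add: g_def P_def B_def)
      qed
    qed
  qed (rule Bint)
  finally have main: "\<bar>gamma_mixture \<nu> (n * c) - exp (- c) * fact (\<nu> - 1)\<bar> \<le> c * (\<eta> / 2 * fact (\<nu> - 1) + 1 / (2 * \<eta>) * (n\<^sup>2 * fact (\<nu> - 3) - 2 * n * fact (\<nu> - 2) + fact (\<nu> - 1)))"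
    unfolding Bval using gint Pint by (simp add: gval)
  obtain m where m: "\<nu> = m + 3" using \<nu> by (metis add.commute le_Suc_ex)
  have f1: "fact (\<nu> - 1) = (n - 1) * (n - 2) * (fact m :: real)" and f2: "fact (\<nu> - 2) = (n - 2) * (fact m :: real)" and f3: "fact (\<nu> - 3) = (fact m :: real)"
    by (simp_all add: m n_def numeral_2_eq_2 algebra_simps)
  have n3: "n \<ge> 3" using \<nu>r by (simp add: n_def)
  have "n\<^sup>2 * fact (\<nu> - 3) - 2 * n * fact (\<nu> - 2) + fact (\<nu> - 1) = (n + 2) * (fact m :: real)"
    unfolding f1 f2 f3 by (simp add: power2_eq_square algebra_simps)
  also have "\<dots> = v * fact (\<nu> - 1)" unfolding f1 v_def n_def[symmetric] using n3 by simp
  finally have e: "n\<^sup>2 * fact (\<nu> - 3) - 2 * n * fact (\<nu> - 2) + fact (\<nu> - 1) = v * fact (\<nu> - 1)" .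
  have "1 / (2 * \<eta>) * (v * fact (\<nu> - 1)) = \<eta> / 2 * fact (\<nu> - 1)"
    using \<eta>(1) unfolding \<eta>(2)[symmetric] by (simp add: power2_eq_square)
  with main have "\<bar>gamma_mixture \<nu> (n * c) - exp (- c) * fact (\<nu> - 1)\<bar> \<le> c * (\<eta> / 2 * fact (\<nu> - 1) + \<eta> / 2 * fact (\<nu> - 1))"
    unfolding e by (simp only:)
  also have "\<dots> = c * \<eta> * fact (\<nu> - 1)" by (simp only: mult.assoc field_sum_of_halves distrib_right[symmetric])
  finally have main2: "\<bar>gamma_mixture \<nu> (n * c) - exp (- c) * fact (\<nu> - 1)\<bar> \<le> c * \<eta> * fact (\<nu> - 1)" .
  have "gamma_mixture \<nu> (n * c) / fact (\<nu> - 1) - exp (- c) = (gamma_mixture \<nu> (n * c) - exp (- c) * fact (\<nu> - 1)) / fact (\<nu> - 1)"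
    by (simp add: diff_divide_distrib)
  then have "\<bar>gamma_mixture \<nu> (n * c) / fact (\<nu> - 1) - exp (- c)\<bar> = \<bar>gamma_mixture \<nu> (n * c) - exp (- c) * fact (\<nu> - 1)\<bar> / fact (\<nu> - 1)"
    by simp
  also have "\<dots> \<le> c * \<eta>" using main2 by (simp add: pos_divide_le_eq)
  finally show ?thesis by (simp add: n_def \<eta>_def v_def)
qed

lemma gamma_mixture_scaled_tendsto:
  assumes \<nu>: "filterlim \<nu> at_top sequentially" and x: "x \<longlonglongrightarrow> c" and x0: "\<And>i. x i \<ge> 0"
  shows "(\<lambda>i. gamma_mixture (\<nu> i) (real (\<nu> i) * x i) / fact (\<nu> i - 1)) \<longlonglongrightarrow> exp (- c)"
proof -
  define w where "w n = sqrt ((real n + 2) / ((real n - 1) * (real n - 2)))" for n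
  have "w \<longlonglongrightarrow> 0" unfolding w_def by real_asymp
  from filterlim_compose[OF this \<nu>] have "(\<lambda>i. w (\<nu> i)) \<longlonglongrightarrow> 0" .
  from tendsto_mult[OF x this] have b: "(\<lambda>i. x i * w (\<nu> i)) \<longlonglongrightarrow> 0" by simp
  have "eventually (\<lambda>i. \<nu> i \<ge> 3) sequentially" using \<nu> unfolding filterlim_at_top by blast
  then have "eventually (\<lambda>i. norm (gamma_mixture (\<nu> i) (real (\<nu> i) * x i) / fact (\<nu> i - 1) - exp (- x i)) \<le> x i * w (\<nu> i)) sequentially"
  proof eventually_elim
    case (elim i)
    then show ?case using gamma_mixture_concentration[OF elim x0[of i]] by (simp add: w_def)
  qed
  from Lim_null_comparison[OF this b]
  have "(\<lambda>i. gamma_mixture (\<nu> i) (real (\<nu> i) * x i) / fact (\<nu> i - 1) - exp (- x i)) \<longlonglongrightarrow> 0" .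
  from tendsto_add[OF this tendsto_exp[OF tendsto_minus[OF x]]] show ?thesis by simp
qed

section \<open>The determinantal structure\<close>

lemma sigma_finite_area_measure: "sigma_finite_measure area_measure"
  unfolding area_measure_density
  by (subst sigma_finite_measure.sigma_finite_iff_density_finite[OF sigma_finite_lborel]) simp_all

lemma AE_area_measure_nonzero: "AE z in area_measure. z \<noteq> 0"
  unfolding area_measure_density
  using AE_lborel_singleton[of "0::complex"] by (subst AE_density) auto

lemma cnj_laguerre: "cnj (laguerre \<nu> j x) = laguerre \<nu> j (cnj x)"
  by (simp add: laguerre_def)

text \<open>A polynomial in \<open>u = \<zeta>^2\<close> with the scaling \<open>\<kappa>\<close>
  moved into the coefficients, the form in which \<open>det_poly_matrix\<close> compares it with the
  Vandermonde determinant.\<close>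

definition laguerre_poly :: "nat \<Rightarrow> nat \<Rightarrow> 'a::field_char_0 \<Rightarrow> 'a poly" where
  "laguerre_poly \<nu> j \<kappa> = (\<Sum>m\<le>j. monom (of_nat ((j + \<nu>) choose (j - m)) * (- \<kappa>) ^ m / fact m) m)"

lemma poly_laguerre_poly: "poly (laguerre_poly \<nu> j \<kappa>) u = laguerre \<nu> j (\<kappa> * u)"
  unfolding laguerre_poly_def laguerre_def poly_sum poly_monom
proof (rule sum.cong)
  fix m
  have "(- (\<kappa> * u)) ^ m = (- \<kappa>) ^ m * u ^ m" by (simp add: power_mult_distrib[symmetric])
  then show "of_nat ((j + \<nu>) choose (j - m)) * (- \<kappa>) ^ m / fact m * u ^ m = of_nat ((j + \<nu>) choose (j - m)) * (- (\<kappa> * u)) ^ m / fact m"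
    by simp
qed simp

lemma degree_laguerre_poly: "degree (laguerre_poly \<nu> j \<kappa>) \<le> j"
  unfolding laguerre_poly_def
  by (rule degree_sum_le) (auto intro: order_trans[OF degree_monom_le])

lemma coeff_laguerre_poly: "coeff (laguerre_poly \<nu> j \<kappa>) j = (- \<kappa>) ^ j / fact j"
proof -
  have "coeff (laguerre_poly \<nu> j \<kappa>) j = (\<Sum>m\<le>j. if m = j then of_nat ((j + \<nu>) choose (j - m)) * (- \<kappa>) ^ m / fact m else 0)"
    unfolding laguerre_poly_def coeff_sum by (intro sum.cong) auto
  then show ?thesis by simp
qed

lemma det_scale_rows:
  fixes f :: "nat \<Rightarrow> nat \<Rightarrow> 'a::comm_ring_1"
  shows "Determinant.det (mat n n (\<lambda>(i, j). s i * f i j)) = (\<Prod>i<n. s i) * Determinant.det (mat n n (\<lambda>(i, j). f i j))"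
proof -
  have "Determinant.det (mat n n (\<lambda>(i, j). s i * f i j)) = (\<Sum>p\<in>{p. p permutes {0..<n}}. signof p * (\<Prod>i = 0..<n. s i * f i (p i)))"
    by (subst Determinant.det_def'[of _ n]) (auto intro!: sum.cong prod.cong simp: permutes_in_image[of _ "{0..<n}", simplified])
  also have "\<dots> = (\<Prod>i<n. s i) * (\<Sum>p\<in>{p. p permutes {0..<n}}. signof p * (\<Prod>i = 0..<n. f i (p i)))"
    by (simp add: prod.distrib sum_distrib_left mult_ac atLeast0LessThan)
  also have "(\<Sum>p\<in>{p. p permutes {0..<n}}. signof p * (\<Prod>i = 0..<n. f i (p i))) = Determinant.det (mat n n (\<lambda>(i, j). f i j))"
    by (subst Determinant.det_def'[of _ n]) (auto intro!: sum.cong prod.cong simp: permutes_in_image[of _ "{0..<n}", simplified])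
  finally show ?thesis .
qed

section \<open>The ensemble at fixed size\<close>

locale dirac_ensemble =
  fixes N \<nu> :: nat and \<tau> :: real
  assumes N: "N \<ge> 1" and \<nu>: "\<nu> \<ge> 1" and \<tau>: "0 < \<tau>" "\<tau> < 1"
begin

definition a where "a = 2 / (1 - \<tau>\<^sup>2) * real N"
definition \<kappa> where "\<kappa> = a * (1 - \<tau>\<^sup>2) / (2 * \<tau>)"
definition weight_const where "weight_const = (1 / 2) * (2 / a) ^ \<nu>"
text \<open>The squared norms found in \<open>weighted_laguerre_orthogonal\<close>. The constant
  \<open>weight_const\<close> of the true weight is kept out of them and goes into
  \<open>density_const\<close>.\<close>

definition norm_const where
  "norm_const j = 2 * fact \<nu> / a\<^sup>2 * real ((j + \<nu>) choose \<nu>) / ((1 - \<tau>\<^sup>2) ^ Suc \<nu> * (\<tau>\<^sup>2) ^ j)"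

lemma one_minus_\<tau>: "1 - \<tau>\<^sup>2 > 0" using \<tau> by (simp add: power_less_one_iff)
lemma a_pos: "a > 0" using one_minus_\<tau> N by (simp add: a_def)
lemma \<kappa>_pos: "\<kappa> > 0" using one_minus_\<tau> a_pos \<tau> by (simp add: \<kappa>_def)
lemma weight_const_pos: "weight_const > 0" using a_pos by (simp add: weight_const_def)
lemma norm_const_pos: "norm_const j > 0"
  using a_pos one_minus_\<tau> \<tau> by (simp add: norm_const_def)

lemma exp_potential_zero: "exp (- (real N * potential N \<nu> \<tau> 0)) = 1"
  by (simp add: potential_def)

text \<open>The factor \<open>|\<zeta>|^(2 \<nu>)\<close> cancels the negative power in front of the
  Gamma mixture. One factor \<open>|\<zeta>|^2\<close> is left over, up to a constant the Jacobian
  of \<open>\<zeta> \<mapsto> \<zeta>^2\<close>.\<close>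

lemma exp_potential:
  assumes "\<zeta> \<noteq> 0"
  shows "exp (- (real N * potential N \<nu> \<tau> \<zeta>)) = weight_const * exp (a * \<tau> * Re (\<zeta>\<^sup>2)) * radial_weight a \<nu> \<zeta>"
proof -
  define r where "r = (cmod \<zeta>)\<^sup>2"
  have r: "r > 0" using assms by (simp add: r_def)
  define K where "K = bessel_K (real \<nu>) (a * r)"
  have K: "K = (1 / 2) * (2 / (a * r)) ^ \<nu> * gamma_mixture \<nu> ((a / 2)\<^sup>2 * r\<^sup>2)"
    unfolding K_def using bessel_K_eq_gamma_mixture[of "a * r" \<nu>] r a_pos \<nu> by (simp add: power_mult_distrib power_divide)
  have "K > 0" unfolding K using r a_pos by (intro mult_pos_pos gamma_mixture_pos zero_less_power) auto
  moreover have p: "cmod \<zeta> ^ (2 * \<nu> + 2) = r ^ \<nu> * r" by (simp add: r_def power_add power_mult power2_eq_square)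
  ultimately have pos: "K * cmod \<zeta> ^ (2 * \<nu> + 2) > 0" using r by simp
  have e: "real N * potential N \<nu> \<tau> \<zeta> = ln (1 / (K * cmod \<zeta> ^ (2 * \<nu> + 2))) - a * \<tau> * Re (\<zeta>\<^sup>2)"
    using N by (simp add: potential_def Let_def K_def a_def r_def right_diff_distrib)
  have "exp (- (ln (1 / x) - c)) = x * exp c" if "x > 0" for x c :: real
    using that by (simp add: ln_div exp_add)
  from this[OF pos] have "exp (- (real N * potential N \<nu> \<tau> \<zeta>)) = K * cmod \<zeta> ^ (2 * \<nu> + 2) * exp (a * \<tau> * Re (\<zeta>\<^sup>2))"
    unfolding e .
  also have "K * cmod \<zeta> ^ (2 * \<nu> + 2) = weight_const * radial_weight a \<nu> \<zeta>"
    unfolding p K radial_weight_def weight_const_def r_def[symmetric] using r by (simp add: power_divide power_mult_distrib)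
  finally show ?thesis by (simp only: mult_ac)
qed

text \<open>The value at \<open>0\<close> matches \<open>exp_potential_zero\<close>, where \<open>ln (1 / 0) = 0\<close>; it makes
  \<open>norm_amplitude\<close> hold at every point.\<close>

definition amplitude :: "complex \<Rightarrow> complex" where
  "amplitude \<zeta> = (if \<zeta> = 0 then of_real (sqrt (1 / weight_const))
     else exp (of_real (a * \<tau> / 2) * \<zeta>\<^sup>2) * of_real (sqrt (radial_weight a \<nu> \<zeta>)))"

lemma norm_amplitude: "exp (- (real N * potential N \<nu> \<tau> \<zeta>)) = weight_const * (cmod (amplitude \<zeta>))\<^sup>2"
proof (cases "\<zeta> = 0")
  case True
  have "weight_const \<noteq> 0" using weight_const_pos by simp
  then show ?thesis using weight_const_pos by (simp add: True exp_potential_zero amplitude_def norm_mult power_mult_distrib)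
next
  case False
  have "(exp (a * \<tau> / 2 * Re (\<zeta>\<^sup>2)))\<^sup>2 = exp (a * \<tau> * Re (\<zeta>\<^sup>2))" by (simp add: exp_double[symmetric])
  moreover have "cmod (amplitude \<zeta>) = exp (a * \<tau> / 2 * Re (\<zeta>\<^sup>2)) * sqrt (radial_weight a \<nu> \<zeta>)"
    using False radial_weight_nonneg[of a \<nu> \<zeta>] by (simp add: amplitude_def norm_mult)
  ultimately show ?thesis
    unfolding exp_potential[OF False] using radial_weight_nonneg[of a \<nu> \<zeta>] by (simp only: power_mult_distrib real_sqrt_pow2 mult_ac)
qed

lemma borel_measurable_amplitude [measurable]: "amplitude \<in> borel_measurable borel"
  unfolding amplitude_def by measurable

definition orthonormal_fun :: "nat \<Rightarrow> complex \<Rightarrow> complex" where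
  "orthonormal_fun j \<zeta> = amplitude \<zeta> * (of_real (1 / sqrt (norm_const j)) * laguerre \<nu> j (of_real \<kappa> * \<zeta>\<^sup>2))"

text \<open>Stated for two distinct points because it serves both the orthonormality relations and
  the off-diagonal kernel.\<close>

lemma orthonormal_fun_product:
  assumes "\<zeta> \<noteq> 0" "\<omega> \<noteq> 0"
  shows "orthonormal_fun i \<zeta> * cnj (orthonormal_fun j \<omega>) =
    of_real (sqrt (radial_weight a \<nu> \<zeta>) * sqrt (radial_weight a \<nu> \<omega>)) *
    (of_real (1 / (sqrt (norm_const i) * sqrt (norm_const j))) *
    (weighted_laguerre a \<tau> \<nu> i (\<zeta>\<^sup>2) * weighted_laguerre a \<tau> \<nu> j ((cnj \<omega>)\<^sup>2)))"
proof -
  have "cnj (exp (of_real (a * \<tau> / 2) * \<omega>\<^sup>2)) = exp (of_real (a * \<tau> / 2) * (cnj \<omega>)\<^sup>2)"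
    by (simp add: exp_cnj)
  moreover have "cnj (laguerre \<nu> j (of_real \<kappa> * \<omega>\<^sup>2)) = laguerre \<nu> j (of_real \<kappa> * (cnj \<omega>)\<^sup>2)"
    by (simp add: cnj_laguerre)
  ultimately have "cnj (orthonormal_fun j \<omega>) = exp (of_real (a * \<tau> / 2) * (cnj \<omega>)\<^sup>2) * of_real (sqrt (radial_weight a \<nu> \<omega>)) *
    (of_real (1 / sqrt (norm_const j)) * laguerre \<nu> j (of_real \<kappa> * (cnj \<omega>)\<^sup>2))"
    using assms unfolding orthonormal_fun_def amplitude_def complex_cnj_mult complex_cnj_complex_of_real by simp
  moreover have "complex_of_real (1 / (sqrt (norm_const i) * sqrt (norm_const j))) = of_real (1 / sqrt (norm_const i)) * of_real (1 / sqrt (norm_const j))"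
    by simp
  ultimately show ?thesis
    using assms unfolding weighted_laguerre_def \<kappa>_def[symmetric] orthonormal_fun_def[of i] amplitude_def[of \<zeta>]
    by (simp only: if_False of_real_mult mult_ac)
qed

lemma borel_measurable_orthonormal_fun [measurable]: "orthonormal_fun j \<in> borel_measurable borel"
  unfolding orthonormal_fun_def by measurable

lemma orthonormal_fun_product_AE:
  "AE z in area_measure. orthonormal_fun i z * cnj (orthonormal_fun j z) =
    of_real (1 / (sqrt (norm_const i) * sqrt (norm_const j))) *
    (weighted_laguerre a \<tau> \<nu> i (z\<^sup>2) * weighted_laguerre a \<tau> \<nu> j ((cnj z)\<^sup>2) * of_real (radial_weight a \<nu> z))"
  using AE_area_measure_nonzero
proof eventually_elim
  case (elim z)
  have "sqrt (radial_weight a \<nu> z) * sqrt (radial_weight a \<nu> z) = radial_weight a \<nu> z"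
    using radial_weight_nonneg[of a \<nu> z] by simp
  then show ?case unfolding orthonormal_fun_product[OF elim elim] by (simp only: mult_ac)
qed

lemma orthonormal:
  "integrable area_measure (\<lambda>z. orthonormal_fun i z * cnj (orthonormal_fun j z))"
  "(\<integral>z. orthonormal_fun i z * cnj (orthonormal_fun j z) \<partial>area_measure) = (if i = j then 1 else 0)"
proof -
  note int = integrable_weighted_laguerre[OF a_pos \<tau>, of \<nu> i j]
  show "integrable area_measure (\<lambda>z. orthonormal_fun i z * cnj (orthonormal_fun j z))"
    by (subst integrable_cong_AE[OF _ _ orthonormal_fun_product_AE[of i j]])
      (measurable, intro integrable_mult_right int)
  have "(\<integral>z. orthonormal_fun i z * cnj (orthonormal_fun j z) \<partial>area_measure) =
    (\<integral>z. of_real (1 / (sqrt (norm_const i) * sqrt (norm_const j))) *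
    (weighted_laguerre a \<tau> \<nu> i (z\<^sup>2) * weighted_laguerre a \<tau> \<nu> j ((cnj z)\<^sup>2) * of_real (radial_weight a \<nu> z)) \<partial>area_measure)"
    by (rule integral_cong_AE[OF _ _ orthonormal_fun_product_AE[of i j]]) measurable
  also have "\<dots> = of_real (1 / (sqrt (norm_const i) * sqrt (norm_const j))) * (if i = j then of_real (norm_const i) else 0)"
    unfolding integral_mult_right_zero weighted_laguerre_orthogonal[OF a_pos \<nu> \<tau>] norm_const_def ..
  also have "\<dots> = (if i = j then 1 else 0)"
    using norm_const_pos[of i] by (auto simp: of_real_mult[symmetric] simp del: of_real_mult)
  finally show "(\<integral>z. orthonormal_fun i z * cnj (orthonormal_fun j z) \<partial>area_measure) = (if i = j then 1 else 0)" .
qed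

lemma exp_neg_hamiltonian:
  "exp_neg (hamiltonian N \<nu> \<tau> \<zeta>) =
    (cmod (Determinant.det (mat N N (\<lambda>(i, j). ((\<zeta> i)\<^sup>2) ^ j))))\<^sup>2 * (\<Prod>i<N. exp (- (real N * potential N \<nu> \<tau> (\<zeta> i))))"
proof -
  define I where "I = {(j, l). j < N \<and> l < N \<and> j \<noteq> l}"
  define d where "d = (\<lambda>(j, l). cmod ((\<zeta> j)\<^sup>2 - (\<zeta> l)\<^sup>2))"
  have fin: "finite I" by (rule finite_subset[of _ "{..<N} \<times> {..<N}"]) (auto simp: I_def)
  have H: "hamiltonian N \<nu> \<tau> \<zeta> = (\<Sum>x\<in>I. log_recip (d x)) + ereal (real N * (\<Sum>j<N. potential N \<nu> \<tau> (\<zeta> j)))"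
    unfolding hamiltonian_def I_def d_def by (simp add: case_prod_unfold)
  have V: "(cmod (Determinant.det (mat N N (\<lambda>(i, j). ((\<zeta> i)\<^sup>2) ^ j))))\<^sup>2 = (\<Prod>x\<in>I. d x)"
    unfolding I_def d_def by (rule prod_offdiagonal_norm[where u = "\<lambda>i. (\<zeta> i)\<^sup>2", symmetric])
  show ?thesis
  \<comment> \<open>If two squares coincide, the energy is infinite and the Vandermonde product
    contains a zero, so both sides vanish.\<close>
  proof (cases "\<exists>x\<in>I. d x = 0")
    case True
    then obtain x where x: "x \<in> I" "d x = 0" by blast
    then have "log_recip (d x) = \<infinity>" by (simp add: log_recip_def)
    then have "(\<Sum>x\<in>I. log_recip (d x)) = \<infinity>" using x fin unfolding sum_Pinfty by blast
    moreover have "(\<Prod>x\<in>I. d x) = 0" using x fin by (simp add: prod_zero_iff) blast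
    ultimately show ?thesis unfolding V H by (simp add: exp_neg_def)
  next
    case False
    have pos: "d x > 0" if "x \<in> I" for x
    proof -
      have "d x \<ge> 0" by (simp add: d_def case_prod_unfold)
      moreover have "d x \<noteq> 0" using False that by blast
      ultimately show ?thesis by simp
    qed
    have "(\<Sum>x\<in>I. log_recip (d x)) = (\<Sum>x\<in>I. ereal (ln (1 / d x)))"
      using False by (intro sum.cong) (auto simp: log_recip_def)
    then have "hamiltonian N \<nu> \<tau> \<zeta> = ereal ((\<Sum>x\<in>I. ln (1 / d x)) + real N * (\<Sum>j<N. potential N \<nu> \<tau> (\<zeta> j)))"
      unfolding H by simp
    then have "exp_neg (hamiltonian N \<nu> \<tau> \<zeta>) = exp (\<Sum>x\<in>I. - ln (1 / d x)) * exp (\<Sum>j<N. - (real N * potential N \<nu> \<tau> (\<zeta> j)))"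
      by (simp add: exp_neg_def sum_negf sum_distrib_left exp_add[symmetric])
    also have "exp (\<Sum>x\<in>I. - ln (1 / d x)) = (\<Prod>x\<in>I. d x)"
      unfolding exp_sum[OF fin]
    proof (rule prod.cong)
      show "exp (- ln (1 / d x)) = d x" if "x \<in> I" for x using pos[OF that] by (simp add: ln_div)
    qed simp
    finally show ?thesis unfolding V exp_sum[OF finite_lessThan] .
  qed
qed

definition leading_coeff where "leading_coeff j = (- \<kappa>) ^ j / fact j / sqrt (norm_const j)"

text \<open>Collects the constant of the weight and the change from monomials to orthonormal
  polynomials. It is common to numerator and partition function and cancels in
  \<open>correlation\<close>.\<close>

definition density_const where "density_const = weight_const ^ N / (\<Prod>j<N. leading_coeff j)\<^sup>2"

lemma leading_coeff_nonzero: "leading_coeff j \<noteq> 0"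
  using \<kappa>_pos norm_const_pos[of j] by (simp add: leading_coeff_def)

lemma density_const_pos: "density_const > 0"
  using weight_const_pos by (simp add: density_const_def leading_coeff_nonzero)

text \<open>Row factors are pulled out as amplitudes, and the remaining polynomial matrix is the
  Vandermonde one up to leading coefficients. Validity at every point, including 0, allows the first
  \<open>k\<close> points to be fixed arbitrarily.\<close>

lemma exp_neg_hamiltonian_det:
  "exp_neg (hamiltonian N \<nu> \<tau> \<zeta>) =
    density_const * (cmod (Determinant.det (mat N N (\<lambda>(i, j). orthonormal_fun j (\<zeta> i)))))\<^sup>2"
proof -
  define V where "V = Determinant.det (mat N N (\<lambda>(i, j). ((\<zeta> i)\<^sup>2) ^ j))"
  define p where "p j = Polynomial.smult (of_real (1 / sqrt (norm_const j))) (laguerre_poly \<nu> j (of_real \<kappa> :: complex))" for j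
  have c: "coeff (p j) j = of_real (leading_coeff j)" for j
    by (simp add: p_def coeff_laguerre_poly leading_coeff_def)
  have "Determinant.det (mat N N (\<lambda>(i, j). orthonormal_fun j (\<zeta> i))) =
      (\<Prod>i<N. amplitude (\<zeta> i)) * Determinant.det (mat N N (\<lambda>(i, j). poly (p j) ((\<zeta> i)\<^sup>2)))"
    unfolding orthonormal_fun_def det_scale_rows by (simp add: p_def poly_laguerre_poly)
  also have "Determinant.det (mat N N (\<lambda>(i, j). poly (p j) ((\<zeta> i)\<^sup>2))) = V * (\<Prod>j<N. coeff (p j) j)"
    unfolding V_def
  proof (rule det_poly_matrix)
    show "degree (p j) \<le> j" for j
      unfolding p_def by (rule order_trans[OF degree_smult_le degree_laguerre_poly])
  qed
  also have "(\<Prod>j<N. coeff (p j) j) = of_real (\<Prod>j<N. leading_coeff j)" by (simp add: c)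
  finally have "(cmod (Determinant.det (mat N N (\<lambda>(i, j). orthonormal_fun j (\<zeta> i)))))\<^sup>2 =
    (\<Prod>i<N. (cmod (amplitude (\<zeta> i)))\<^sup>2) * ((cmod V)\<^sup>2 * (\<Prod>j<N. leading_coeff j)\<^sup>2)"
    by (simp only: norm_mult norm_of_real power_mult_distrib power2_abs prod_norm[symmetric] prod_power_distrib)
  moreover have "exp_neg (hamiltonian N \<nu> \<tau> \<zeta>) = (cmod V)\<^sup>2 * (weight_const ^ N * (\<Prod>i<N. (cmod (amplitude (\<zeta> i)))\<^sup>2))"
    unfolding exp_neg_hamiltonian V_def norm_amplitude prod.distrib by simp
  moreover have "(\<Prod>j<N. leading_coeff j)\<^sup>2 \<noteq> 0" by (simp add: leading_coeff_nonzero)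
  ultimately show ?thesis unfolding density_const_def by simp
qed

lemma density_integral:
  assumes "k \<le> N"
  shows "complex_of_real (\<integral>\<eta>. exp_neg (hamiltonian N \<nu> \<tau> (\<lambda>j. if j < k then \<zeta> j else \<eta> j)) \<partial>(\<Pi>\<^sub>M j\<in>{k..<N}. area_measure)) =
    of_real density_const * (fact (N - k) * Determinant.det (mat k k (\<lambda>(i, l). \<Sum>j<N. orthonormal_fun j (\<zeta> i) * cnj (orthonormal_fun j (\<zeta> l)))))"
proof -
  define M where "M = (\<Pi>\<^sub>M j\<in>{k..<N}. area_measure)"
  define D where "D \<eta> = (cmod (Determinant.det (mat N N (\<lambda>(i, j). orthonormal_fun j (if i < k then \<zeta> i else \<eta> i)))))\<^sup>2" for \<eta>
  have "(\<integral>\<eta>. exp_neg (hamiltonian N \<nu> \<tau> (\<lambda>j. if j < k then \<zeta> j else \<eta> j)) \<partial>M) = (\<integral>\<eta>. density_const * D \<eta> \<partial>M)"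
    by (rule Bochner_Integration.integral_cong[OF refl]) (simp only: exp_neg_hamiltonian_det D_def)
  also have "\<dots> = density_const * integral\<^sup>L M D" by (rule integral_mult_right_zero)
  finally have "complex_of_real (\<integral>\<eta>. exp_neg (hamiltonian N \<nu> \<tau> (\<lambda>j. if j < k then \<zeta> j else \<eta> j)) \<partial>M) = of_real density_const * (\<integral>\<eta>. complex_of_real (D \<eta>) \<partial>M)"
    by (simp only: of_real_mult integral_complex_of_real)
  then show ?thesis
    unfolding D_def M_def
      sigma_finite_measure.integral_det_squared[OF sigma_finite_area_measure assms orthonormal(1) orthonormal(2), of \<zeta>] .
qed

lemma correlation_eq_det:
  assumes "k \<le> N"
  shows "complex_of_real (correlation N \<nu> \<tau> k \<zeta>) =
    Determinant.det (mat k k (\<lambda>(i, l). \<Sum>j<N. orthonormal_fun j (\<zeta> i) * cnj (orthonormal_fun j (\<zeta> l))))"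
proof -
  \<comment> \<open>The partition function is the case \<open>k = 0\<close> of the same integral,
    the determinant of the empty matrix being 1.\<close>
  have Z: "complex_of_real (partition_function N \<nu> \<tau>) = of_real density_const * fact N"
    using density_integral[of 0] by (simp add: partition_function_def atLeast0LessThan det_dim_zero)
  have "of_real density_const \<noteq> (0 :: complex)" using density_const_pos by simp
  moreover have "complex_of_real (correlation N \<nu> \<tau> k \<zeta>) = 1 / (of_real density_const * fact N) * (fact N / fact (N - k)) *
    (of_real density_const * (fact (N - k) * Determinant.det (mat k k (\<lambda>(i, l). \<Sum>j<N. orthonormal_fun j (\<zeta> i) * cnj (orthonormal_fun j (\<zeta> l))))))"
    unfolding correlation_def of_real_mult of_real_divide density_integral[OF assms] Z by simp
  ultimately show ?thesis by simp
qed

end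

section \<open>Convergence of the kernel\<close>

text \<open>Tychonoff's theorem, transferred from the abstract product topology to the topology of
  the function type.\<close>

lemma compact_PiE_UNIV:
  fixes S :: "'i \<Rightarrow> 'a::topological_space set"
  assumes "\<And>i. compact (S i)"
  shows "compact (Pi\<^sub>E UNIV S)"
proof -
  have "compactin (product_topology (\<lambda>i. euclidean) UNIV) (Pi\<^sub>E UNIV S)"
    using assms by (subst compactin_PiE) simp
  then show ?thesis by (simp add: euclidean_product_topology)
qed

lemma tendsto_coordinate: "(f \<longlongrightarrow> l) F \<Longrightarrow> ((\<lambda>x. f x i) \<longlongrightarrow> l i) F"
  using continuous_on_product_coordinates[of i] by (rule continuous_on_tendsto_compose) auto

text \<open>Continuous convergence on a compact set is uniform; the continuity of the limit function comes
  for free by a diagonal argument.\<close>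

lemma uniform_limit_sequentially_compact:
  fixes f :: "nat \<Rightarrow> 'a::first_countable_topology \<Rightarrow> 'b::metric_space"
  assumes K: "compact K"
    and conv: "\<And>r x l. filterlim r at_top sequentially \<Longrightarrow> (\<And>i. x i \<in> K) \<Longrightarrow> l \<in> K \<Longrightarrow> x \<longlonglongrightarrow> l \<Longrightarrow>
      (\<lambda>i. f (r i) (x i)) \<longlonglongrightarrow> g l"
  shows "uniform_limit K f g sequentially"
proof (rule ccontr)
  have r_at_top: "filterlim r at_top sequentially" if "\<And>i. r i \<ge> i" for r :: "nat \<Rightarrow> nat"
    by (rule filterlim_at_top_mono[OF filterlim_ident]) (simp add: that)
  assume "\<not> ?thesis"
  then obtain e where e: "e > 0" and ne: "\<not> (\<forall>\<^sub>F n in sequentially. \<forall>x\<in>K. dist (f n x) (g x) < e)"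
    unfolding uniform_limit_iff by blast
  have "\<exists>n x. n \<ge> i \<and> x \<in> K \<and> dist (f n x) (g x) \<ge> e" for i
    using ne unfolding eventually_sequentially by (metis not_less)
  then obtain n x where n: "\<And>i. n i \<ge> i" and xK: "\<And>i. x i \<in> K" and far: "\<And>i. dist (f (n i) (x i)) (g (x i)) \<ge> e"
    by metis
  obtain l s where l: "l \<in> K" and s: "strict_mono s" and lim: "(x \<circ> s) \<longlonglongrightarrow> l"
    using compact_imp_seq_compact[OF K] xK unfolding seq_compact_def by metis
  have lim': "(\<lambda>i. x (s i)) \<longlonglongrightarrow> l" using lim by (simp add: comp_def)
  have nlim: "filterlim (\<lambda>i. n (s i)) at_top sequentially"
    by (rule r_at_top) (metis n s seq_suble le_trans)
  have A: "(\<lambda>i. f (n (s i)) (x (s i))) \<longlonglongrightarrow> g l"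
    by (rule conv[OF nlim _ l lim']) (rule xK)
  \<comment> \<open>Replacing \<open>g (x (s i))\<close> by a nearby value
    \<open>f m (x (s i))\<close> yields another admissible sequence; its convergence to
    \<open>g l\<close> shows that \<open>g (x (s i))\<close> tends to \<open>g l\<close> as
    well.\<close>
  have "\<exists>m. m \<ge> i \<and> dist (f m (x (s i))) (g (x (s i))) < inverse (real (Suc i))" for i
  proof -
    have "(\<lambda>m. f m (x (s i))) \<longlonglongrightarrow> g (x (s i))"
      by (rule conv[of "\<lambda>m. m"]) (auto simp: xK filterlim_ident)
    then have "\<forall>\<^sub>F m in sequentially. dist (f m (x (s i))) (g (x (s i))) < inverse (real (Suc i))"
      by (rule tendstoD) simp
    then show ?thesis unfolding eventually_sequentially by (metis le_cases)
  qed
  then obtain m where m: "\<And>i. m i \<ge> i" and close: "\<And>i. dist (f (m i) (x (s i))) (g (x (s i))) < inverse (real (Suc i))"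
    by metis
  have B: "(\<lambda>i. f (m i) (x (s i))) \<longlonglongrightarrow> g l"
    by (rule conv[OF r_at_top[OF m] _ l lim']) (rule xK)
  have C: "(\<lambda>i. dist (f (m i) (x (s i))) (g (x (s i)))) \<longlonglongrightarrow> 0"
  proof (rule real_tendsto_sandwich[OF _ _ tendsto_const LIMSEQ_inverse_real_of_nat])
    show "\<forall>\<^sub>F i in sequentially. dist (f (m i) (x (s i))) (g (x (s i))) \<le> inverse (real (Suc i))"
      by (intro always_eventually allI less_imp_le close)
  qed simp
  have D: "(\<lambda>i. dist (f (n (s i)) (x (s i))) (g l) + dist (f (m i) (x (s i))) (g l) + dist (f (m i) (x (s i))) (g (x (s i)))) \<longlonglongrightarrow> 0 + 0 + 0"
    by (intro tendsto_add C A[unfolded tendsto_dist_iff[of _ "g l"]] B[unfolded tendsto_dist_iff[of _ "g l"]])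
  have "e \<le> dist (f (n (s i)) (x (s i))) (g l) + dist (f (m i) (x (s i))) (g l) + dist (f (m i) (x (s i))) (g (x (s i)))" for i
    using far[of "s i"] dist_triangle[of "f (n (s i)) (x (s i))" "g (x (s i))" "g l"]
      dist_triangle3[of "g l" "g (x (s i))" "f (m i) (x (s i))"] by linarith
  then have "e \<le> 0 + 0 + 0"
    by (intro tendsto_lowerbound[OF D]) (auto intro!: always_eventually)
  then show False using e by simp
qed

lemma tendsto_det:
  fixes f :: "'a \<Rightarrow> nat \<Rightarrow> nat \<Rightarrow> complex"
  assumes "\<And>i l. i < k \<Longrightarrow> l < k \<Longrightarrow> ((\<lambda>x. f x i l) \<longlongrightarrow> g i l) F"
  shows "((\<lambda>x. Determinant.det (mat k k (\<lambda>(i, l). f x i l))) \<longlongrightarrow> Determinant.det (mat k k (\<lambda>(i, l). g i l))) F"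
proof -
  have eq: "Determinant.det (mat k k (\<lambda>(i, l). h i l)) = (\<Sum>p\<in>{p. p permutes {0..<k}}. signof p * (\<Prod>i = 0..<k. h i (p i)))" for h :: "nat \<Rightarrow> nat \<Rightarrow> complex"
    by (subst Determinant.det_def'[of _ k]) (auto intro!: sum.cong prod.cong dest: permutes_in_image)
  show ?thesis unfolding eq
  proof (intro tendsto_sum tendsto_mult tendsto_const tendsto_prod)
    fix p i assume "p \<in> {p. p permutes {0..<k}}" "i \<in> {0..<k}"
    then have "i < k" "p i < k" using permutes_in_image[of p "{0..<k}" i] by auto
    then show "((\<lambda>x. f x i (p i)) \<longlongrightarrow> g i (p i)) F" by (rule assms)
  qed
qed

lemma continuous_laguerre [continuous_intros]:
  fixes f :: "'a::topological_space \<Rightarrow> complex"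
  assumes "continuous_on S f"
  shows "continuous_on S (\<lambda>x. laguerre \<nu> j (f x))"
  unfolding laguerre_def by (intro continuous_intros assms) simp_all

section \<open>The rescaled kernel at the critical parameter\<close>

text \<open>Normalised by the mass \<open>(\<nu> - 1)!\<close> of the Gamma weight, so that it tends
  to \<open>exp (- |z|^4)\<close> and its square root supplies \<open>exp (- |z|^4 / 2)\<close> in
  the limit kernel.\<close>

definition edge_gamma :: "nat \<Rightarrow> complex \<Rightarrow> real" where
  "edge_gamma \<nu> z = gamma_mixture \<nu> (real \<nu> * cmod z ^ 4) / fact (\<nu> - 1)"

definition laguerre_partial_sum :: "nat \<Rightarrow> nat \<Rightarrow> complex \<Rightarrow> complex \<Rightarrow> complex" where
  "laguerre_partial_sum N \<nu> Z1 Z2 =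
    (let t = real N / (real N + real \<nu>);
         x = of_real (real \<nu> / saddle_scale N \<nu>) * Z1; y = of_real (real \<nu> / saddle_scale N \<nu>) * Z2
     in of_real ((1 - t) ^ Suc \<nu> * fact \<nu>) * exp ((x + y) * of_real (real N / real \<nu>)) *
      (\<Sum>j<N. of_real t ^ j * (fact j / fact (j + \<nu>)) * laguerre \<nu> j x * laguerre \<nu> j y))"

text \<open>For nonzero arguments it is the rescaled reproducing kernel. Being continuous with value
  0 at \<open>z = 0\<close> or \<open>w = 0\<close>, it also supplies the values where the amplitude
  is only conventional.\<close>

definition finite_kernel :: "nat \<Rightarrow> nat \<Rightarrow> complex \<Rightarrow> complex \<Rightarrow> complex" where
  "finite_kernel N \<nu> z w =
    of_real (2 * cmod z * cmod w * sqrt (edge_gamma \<nu> z * edge_gamma \<nu> w)) *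
    laguerre_partial_sum N \<nu> (z\<^sup>2) ((cnj w)\<^sup>2)"

lemma tendsto_edge_gamma:
  assumes "(f \<longlongrightarrow> z) F"
  shows "((\<lambda>x. edge_gamma \<nu> (f x)) \<longlongrightarrow> edge_gamma \<nu> z) F"
proof -
  have "continuous_on {0..} (gamma_mixture \<nu>)"
    unfolding continuous_on_sequentially comp_def using gamma_mixture_tendsto by auto
  then have "continuous_on UNIV (edge_gamma \<nu>)"
    unfolding edge_gamma_def by (intro continuous_intros) (auto intro!: continuous_on_compose2[of "{0..}" "gamma_mixture \<nu>"] continuous_intros)
  then show ?thesis by (rule continuous_on_tendsto_compose[OF _ assms]) auto
qed

lemma tendsto_finite_kernel:
  assumes f: "(f \<longlongrightarrow> z) F" and g: "(g \<longlongrightarrow> w) F"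
  shows "((\<lambda>x. finite_kernel N \<nu> (f x) (g x)) \<longlongrightarrow> finite_kernel N \<nu> z w) F"
proof -
  have "continuous_on UNIV (laguerre \<nu> j :: complex \<Rightarrow> complex)" for j by (intro continuous_intros)
  then have lag: "((\<lambda>x. laguerre \<nu> j (h x)) \<longlongrightarrow> laguerre \<nu> j c) F" if "(h \<longlongrightarrow> c) F" for j h and c :: complex
    by (rule continuous_on_tendsto_compose[OF _ that]) auto
  show ?thesis
    unfolding finite_kernel_def laguerre_partial_sum_def Let_def
    by (intro tendsto_intros tendsto_edge_gamma lag f g)
qed

lemma finite_kernel_tendsto:
  assumes sq: "saddle_sequence N \<nu> \<alpha>" and z: "z \<longlonglongrightarrow> z0" and w: "w \<longlonglongrightarrow> w0"
  shows "(\<lambda>i. finite_kernel (N i) (\<nu> i) (z i) (w i)) \<longlonglongrightarrow> limit_kernel z0 w0"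
proof -
  interpret saddle_sequence N \<nu> \<alpha> by (rule sq)
  have edge: "(\<lambda>i. edge_gamma (\<nu> i) (u i)) \<longlonglongrightarrow> exp (- (cmod u0 ^ 4))" if "u \<longlonglongrightarrow> u0" for u u0
    unfolding edge_gamma_def by (rule gamma_mixture_scaled_tendsto[OF \<nu>_at_top]) (intro tendsto_intros that, simp)
  have Z1: "(\<lambda>i. (z i)\<^sup>2) \<longlonglongrightarrow> z0\<^sup>2" and Z2: "(\<lambda>i. (cnj (w i))\<^sup>2) \<longlonglongrightarrow> (cnj w0)\<^sup>2"
    by (intro tendsto_intros z w)+
  have L: "laguerre_partial_sum (N i) (\<nu> i) Z1 Z2 = of_real (1 / (2 * pi)) * (LBINT \<phi>:{- pi * \<rho> i..pi * \<rho> i}. saddle_integrand (N i) (\<nu> i) Z1 Z2 (Complex (-1) \<phi>))" for i Z1 Z2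
    unfolding laguerre_partial_sum_def Let_def by (rule laguerre_partial_sum_contour[OF N_pos \<nu>_pos])
  have S: "(\<lambda>i. laguerre_partial_sum (N i) (\<nu> i) ((z i)\<^sup>2) ((cnj (w i))\<^sup>2)) \<longlonglongrightarrow>
    of_real (1 / (2 * pi)) * (exp (z0\<^sup>2 * (cnj w0)\<^sup>2) * (of_real pi * erfc (- ((z0\<^sup>2 + (cnj w0)\<^sup>2) / of_real (sqrt 2)))))"
    unfolding L by (intro tendsto_mult tendsto_const saddle_integral_tendsto Z1 Z2)
  have "(\<lambda>i. finite_kernel (N i) (\<nu> i) (z i) (w i)) \<longlonglongrightarrow>
    of_real (2 * cmod z0 * cmod w0 * sqrt (exp (- (cmod z0 ^ 4)) * exp (- (cmod w0 ^ 4)))) *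
    (of_real (1 / (2 * pi)) * (exp (z0\<^sup>2 * (cnj w0)\<^sup>2) * (of_real pi * erfc (- ((z0\<^sup>2 + (cnj w0)\<^sup>2) / of_real (sqrt 2))))))"
    unfolding finite_kernel_def by (intro tendsto_intros S edge z w)
  moreover have "sqrt (exp (- (cmod z0 ^ 4)) * exp (- (cmod w0 ^ 4))) = exp (- (cmod z0 ^ 4) / 2 - cmod w0 ^ 4 / 2)"
    by (rule real_sqrt_unique) (simp_all add: exp_add[symmetric] exp_double[symmetric] algebra_simps)
  moreover have "exp (z0\<^sup>2 * (cnj w0)\<^sup>2 - complex_of_real (cmod z0 ^ 4) / 2 - complex_of_real (cmod w0 ^ 4) / 2) =
      exp (z0\<^sup>2 * (cnj w0)\<^sup>2) * of_real (exp (- (cmod z0 ^ 4) / 2 - cmod w0 ^ 4 / 2))"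
    by (simp add: exp_of_real[symmetric] exp_add[symmetric] algebra_simps)
  ultimately show ?thesis
    unfolding limit_kernel_def by (simp add: norm_mult field_simps)
qed

text \<open>With \<open>m\<close>, \<open>h\<close>, \<open>s\<close> the square roots of
  \<open>N\<close>, \<open>N + \<nu>\<close>, \<open>\<nu>\<close>, every constant becomes a
  monomial: \<open>a = 2 m^2 h^2 / s^2\<close>, \<open>sqrt p = m^2 h^2 / s^3\<close>,
  \<open>\<kappa> = m h\<close> and \<open>\<rho> = m h / s\<close>. The scaling prescribed for the
  process thus agrees exactly with the saddle scale.\<close>

lemma critical_scaling:
  fixes N \<nu> :: nat
  assumes N: "N \<ge> 1" and \<nu>: "\<nu> \<ge> 1"
  defines "\<tau> \<equiv> critical_tau N \<nu>" and "p \<equiv> scaling N \<nu> (critical_tau N \<nu>)"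
  shows "dirac_ensemble N \<nu> \<tau>" "\<tau>\<^sup>2 = real N / (real N + real \<nu>)" "p > 0"
    "(dirac_ensemble.a N \<tau> / 2)\<^sup>2 = real \<nu> * p"
    "dirac_ensemble.a N \<tau> * \<tau> / 2 / sqrt p = real N / saddle_scale N \<nu>"
    "dirac_ensemble.\<kappa> N \<tau> / sqrt p = real \<nu> / saddle_scale N \<nu>"
proof -
  define n v where "n = real N" and "v = real \<nu>"
  have n: "n > 0" and v: "v > 0" using assms by (auto simp: n_def v_def)
  have \<tau>0: "\<tau> = sqrt (n / (n + v))"
    using n v by (simp add: \<tau>_def critical_tau_def n_def[symmetric] v_def[symmetric] real_sqrt_divide field_simps)
  show \<tau>2: "\<tau>\<^sup>2 = real N / (real N + real \<nu>)"
    using n v unfolding \<tau>0 n_def[symmetric] v_def[symmetric] by simp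
  have "\<tau> > 0" unfolding \<tau>0 using n v by simp
  moreover have "\<tau> < 1" unfolding \<tau>0 using n v by simp
  ultimately show de: "dirac_ensemble N \<nu> \<tau>" using assms by unfold_locales auto
  have \<tau>: "\<tau> > 0" by fact
  have omt: "1 - \<tau>\<^sup>2 = v / (n + v)" using n v unfolding \<tau>2 n_def[symmetric] v_def[symmetric] by (simp add: field_simps)
  define s where "s = sqrt v"
  define m where "m = sqrt n"
  define h where "h = sqrt (n + v)"
  have s: "s > 0" "v = s\<^sup>2" and m: "m > 0" "n = m\<^sup>2" and h: "h > 0" "n + v = h\<^sup>2" using n v by (auto simp: s_def m_def h_def)
  have \<tau>': "\<tau> = m / h" unfolding \<tau>0 m_def h_def by (rule real_sqrt_divide)
  have p: "p = (m\<^sup>2 * h\<^sup>2 / s ^ 3)\<^sup>2"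
  proof -
    have "p = n * (1 / ((v / (n + v))\<^sup>2 * (v / n)))"
      unfolding p_def scaling_def \<tau>_def[symmetric] omt n_def[symmetric] v_def[symmetric] ..
    also have "\<dots> = (m\<^sup>2 * h\<^sup>2 / s ^ 3)\<^sup>2"
      unfolding h(2) unfolding s(2) m(2) using s(1) h(1) m(1) by (simp add: field_simps)
    finally show ?thesis .
  qed
  then show "p > 0" using m h s by simp
  have sp: "sqrt p = m\<^sup>2 * h\<^sup>2 / s ^ 3" unfolding p using m h s by simp
  define A where "A = dirac_ensemble.a N \<tau>"
  have a: "A = 2 * m\<^sup>2 * h\<^sup>2 / s\<^sup>2"
    unfolding A_def dirac_ensemble.a_def[OF de] omt n_def[symmetric] h(2) unfolding s(2) m(2) by simp
  have \<rho>: "saddle_scale N \<nu> = m * h / s"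
    unfolding saddle_scale_def n_def[symmetric] v_def[symmetric] real_sqrt_divide real_sqrt_mult m_def h_def s_def ..
  have nN: "real N = m\<^sup>2" and vN: "real \<nu> = s\<^sup>2" using m s by (auto simp: n_def v_def)
  show "(dirac_ensemble.a N \<tau> / 2)\<^sup>2 = real \<nu> * p" unfolding A_def[symmetric] a p vN using s(1)
    by (simp add: field_simps eval_nat_numeral)
  show "dirac_ensemble.a N \<tau> * \<tau> / 2 / sqrt p = real N / saddle_scale N \<nu>"
    unfolding A_def[symmetric] a sp \<rho> nN unfolding \<tau>' using s(1) m(1) h(1) by (simp add: field_simps eval_nat_numeral)
  have "dirac_ensemble.\<kappa> N \<tau> = m * h"
    unfolding dirac_ensemble.\<kappa>_def[OF de] A_def[symmetric] a omt unfolding \<tau>' h(2) unfolding s(2) using s(1) m(1) h(1) by (simp add: field_simps eval_nat_numeral)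
  then show "dirac_ensemble.\<kappa> N \<tau> / sqrt p = real \<nu> / saddle_scale N \<nu>"
    unfolding sp \<rho> vN using s(1) m(1) h(1) by (simp add: field_simps eval_nat_numeral)
qed

lemma orthonormal_sum_eq_finite_kernel:
  fixes N \<nu> :: nat
  assumes N: "N \<ge> 1" and \<nu>: "\<nu> \<ge> 1" and z: "z \<noteq> 0" and w: "w \<noteq> 0"
  defines "\<tau> \<equiv> critical_tau N \<nu>" and "p \<equiv> scaling N \<nu> (critical_tau N \<nu>)"
  shows "(\<Sum>j<N. dirac_ensemble.orthonormal_fun N \<nu> \<tau> j (z / of_real (p powr (1 / 4))) *
      cnj (dirac_ensemble.orthonormal_fun N \<nu> \<tau> j (w / of_real (p powr (1 / 4))))) =
    of_real (sqrt p) * finite_kernel N \<nu> z w"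
proof -
  note cs = critical_scaling[OF N \<nu>, folded \<tau>_def p_def]
  interpret dirac_ensemble N \<nu> \<tau> by (rule cs)
  define \<rho> where "\<rho> = saddle_scale N \<nu>"
  define t where "t = real N / (real N + real \<nu>)"
  have p: "p > 0" by (rule cs)
  define e where "e = p powr (1 / 4)"
  have e0: "e > 0" using p by (simp add: e_def)
  have e2: "e\<^sup>2 = sqrt p" using p by (simp add: e_def power2_eq_square powr_add[symmetric] powr_half_sqrt)
  define g where "g u = sqrt (gamma_mixture \<nu> (real \<nu> * cmod u ^ 4))" for u
  have rw: "sqrt (radial_weight a \<nu> (u / of_real e)) = cmod u * g u / e" for u
  proof -
    have "(cmod (u / of_real e))\<^sup>2 = (cmod u)\<^sup>2 / e\<^sup>2" by (simp add: norm_divide power_divide)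
    moreover have "(a / 2)\<^sup>2 * ((cmod u)\<^sup>2 / e\<^sup>2)\<^sup>2 = real \<nu> * cmod u ^ 4"
      unfolding cs(4) e2 using p by (simp add: power_divide)
    ultimately have "radial_weight a \<nu> (u / of_real e) = (cmod u / e)\<^sup>2 * gamma_mixture \<nu> (real \<nu> * cmod u ^ 4)"
      by (simp add: radial_weight_def power_divide)
    then show ?thesis using e0 by (simp add: real_sqrt_mult g_def)
  qed
  have wl: "weighted_laguerre a \<tau> \<nu> j (Z / of_real (sqrt p)) = exp (of_real (real N / \<rho>) * Z) * laguerre \<nu> j (of_real (real \<nu> / \<rho>) * Z)" for j Z
  proof -
    have "of_real (a * \<tau> / 2) * (Z / of_real (sqrt p)) = of_real (a * \<tau> / 2 / sqrt p) * Z" by simp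
    moreover have "of_real \<kappa> * (Z / of_real (sqrt p)) = of_real (\<kappa> / sqrt p) * Z" by simp
    ultimately show ?thesis unfolding weighted_laguerre_def \<kappa>_def[symmetric] \<rho>_def cs(5,6)[symmetric] by simp
  qed
  have sq: "(u / of_real e)\<^sup>2 = u\<^sup>2 / of_real (sqrt p)" for u :: complex
    unfolding power_divide e2[symmetric] by simp
  have csq: "(cnj (u / of_real e))\<^sup>2 = (cnj u)\<^sup>2 / of_real (sqrt p)" for u :: complex
    unfolding complex_cnj_divide complex_cnj_complex_of_real sq ..
  \<comment> \<open>The inverse norms carry the factor \<open>t^j j! / (j + \<nu>)!\<close> with
    \<open>t = \<tau>^2\<close>, which makes the orthonormal sum a truncated Hille--Hardy
    series.\<close>
  have hn: "1 / (sqrt (norm_const j) * sqrt (norm_const j)) = 2 * (real \<nu> * p) * (1 - t) ^ Suc \<nu> * (t ^ j * (fact j / fact (j + \<nu>)))" for j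
  proof -
    have t1: "1 - t > 0" "t > 0" using N \<nu> by (auto simp: t_def field_simps)
    have "sqrt (norm_const j) * sqrt (norm_const j) = norm_const j" using norm_const_pos[of j] by simp
    also have "norm_const j = 2 * fact \<nu> / (4 * (real \<nu> * p)) * (fact (j + \<nu>) / (fact \<nu> * fact j)) / ((1 - t) ^ Suc \<nu> * t ^ j)"
      unfolding norm_const_def cs(2) t_def[symmetric] cs(4)[symmetric] by (simp add: binomial_fact power_divide)
    finally have h: "sqrt (norm_const j) * sqrt (norm_const j) = 2 * fact \<nu> / (4 * (real \<nu> * p)) * (fact (j + \<nu>) / (fact \<nu> * fact j)) / ((1 - t) ^ Suc \<nu> * t ^ j)" .
    define d where "d = 1 - t"
    show ?thesis using t1 p \<nu> unfolding h d_def[symmetric] by (simp add: field_simps)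
  qed
  define x y where "x = of_real (real \<nu> / \<rho>) * z\<^sup>2" and "y = of_real (real \<nu> / \<rho>) * (cnj w)\<^sup>2"
  define E where "E = exp ((x + y) * of_real (real N / real \<nu>))"
  define T where "T j = of_real t ^ j * (fact j / fact (j + \<nu>)) * laguerre \<nu> j x * laguerre \<nu> j y" for j
  define E1 E2 where "E1 = exp (of_real (real N / \<rho>) * z\<^sup>2)" and "E2 = exp (of_real (real N / \<rho>) * (cnj w)\<^sup>2)"
  have E: "E = E1 * E2"
  proof -
    have c: "complex_of_real (real \<nu> / \<rho>) * of_real (real N / real \<nu>) = of_real (real N / \<rho>)"
      using \<nu> unfolding of_real_mult[symmetric] by simp
    have "(c1 * A + c1 * B) * c2 = c1 * c2 * A + c1 * c2 * B" for A B c1 c2 :: complex by (simp add: algebra_simps)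
    from this[of "of_real (real \<nu> / \<rho>)" "z\<^sup>2" "(cnj w)\<^sup>2" "of_real (real N / real \<nu>)"]
    show ?thesis unfolding E_def E1_def E2_def x_def y_def c exp_add[symmetric] by (rule arg_cong)
  qed
  have "z / of_real e \<noteq> 0" "w / of_real e \<noteq> 0" using z w e0 by auto
  note pr = orthonormal_fun_product[OF this]
  have "(\<Sum>j<N. orthonormal_fun j (z / of_real e) * cnj (orthonormal_fun j (w / of_real e))) =
    (\<Sum>j<N. of_real (cmod z * g z / e * (cmod w * g w / e)) * of_real (2 * (real \<nu> * p) * (1 - t) ^ Suc \<nu>) * E * T j)"
  proof (rule sum.cong[OF refl])
    fix j
    show "orthonormal_fun j (z / of_real e) * cnj (orthonormal_fun j (w / of_real e)) =
      of_real (cmod z * g z / e * (cmod w * g w / e)) * of_real (2 * (real \<nu> * p) * (1 - t) ^ Suc \<nu>) * E * T j"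
      unfolding pr rw sq csq wl hn E E1_def[symmetric] E2_def[symmetric] T_def x_def[symmetric] y_def[symmetric]
      by (simp only: of_real_mult of_real_power of_real_divide of_real_fact mult_ac)
  qed
  also have "\<dots> = of_real (cmod z * g z / e * (cmod w * g w / e)) * of_real (2 * (real \<nu> * p) * (1 - t) ^ Suc \<nu>) * E * (\<Sum>j<N. T j)"
    by (simp only: sum_distrib_left)
  also have "\<dots> = of_real (cmod z * cmod w * (g z * g w) * (2 * real \<nu> * sqrt p * (1 - t) ^ Suc \<nu>)) * E * (\<Sum>j<N. T j)"
  proof -
    have "p / (e * e) = sqrt p" using p e2 by (simp add: power2_eq_square real_div_sqrt)
    moreover have "cmod z * g z / e * (cmod w * g w / e) * (2 * (real \<nu> * p) * (1 - t) ^ Suc \<nu>) = cmod z * cmod w * (g z * g w) * (2 * real \<nu> * (p / (e * e)) * (1 - t) ^ Suc \<nu>)"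
      by simp
    ultimately show ?thesis by (simp only: of_real_mult[symmetric])
  qed
  also have "\<dots> = of_real (sqrt p) * finite_kernel N \<nu> z w"
  proof -
    have "fact \<nu> = real \<nu> * fact (\<nu> - 1)" using \<nu> by (simp add: fact_reduce)
    moreover have "sqrt (edge_gamma \<nu> z * edge_gamma \<nu> w) = g z * g w / fact (\<nu> - 1)"
      unfolding edge_gamma_def g_def by (simp add: real_sqrt_mult real_sqrt_divide)
    ultimately have r: "cmod z * cmod w * (g z * g w) * (2 * real \<nu> * sqrt p * (1 - t) ^ Suc \<nu>) =
      sqrt p * ((2 * cmod z * cmod w * sqrt (edge_gamma \<nu> z * edge_gamma \<nu> w)) * ((1 - t) ^ Suc \<nu> * fact \<nu>))"
      by simp
    show ?thesis
      unfolding finite_kernel_def laguerre_partial_sum_def Let_def t_def[symmetric] \<rho>_def[symmetric] x_def[symmetric] y_def[symmetric]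
        E_def[symmetric] T_def[symmetric] r by (simp only: of_real_mult mult_ac)
  qed
  finally show ?thesis unfolding e_def .
qed

lemma rescaled_correlation_nonzero_eq_det:
  assumes N: "N \<ge> 1" and \<nu>: "\<nu> \<ge> 1" and k: "k \<le> N" and z: "\<forall>j<k. z j \<noteq> 0"
  shows "complex_of_real (rescaled_correlation_nonzero N \<nu> (critical_tau N \<nu>) k z) =
    Determinant.det (mat k k (\<lambda>(i, l). finite_kernel N \<nu> (z i) (z l)))"
proof -
  define \<tau> p where "\<tau> = critical_tau N \<nu>" and "p = scaling N \<nu> (critical_tau N \<nu>)"
  interpret dirac_ensemble N \<nu> \<tau> unfolding \<tau>_def by (rule critical_scaling[OF N \<nu>])
  have p: "p > 0" unfolding p_def by (rule critical_scaling[OF N \<nu>])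
  have "complex_of_real (correlation N \<nu> \<tau> k (\<lambda>j. z j / of_real (p powr (1 / 4)))) =
    Determinant.det (mat k k (\<lambda>(i, l). of_real (sqrt p) * finite_kernel N \<nu> (z i) (z l)))"
    unfolding correlation_eq_det[OF k]
  proof (rule arg_cong[where f = Determinant.det], rule eq_matI)
    fix i l assume il: "i < dim_row (mat k k (\<lambda>(i, l). of_real (sqrt p) * finite_kernel N \<nu> (z i) (z l)))"
      "l < dim_col (mat k k (\<lambda>(i, l). of_real (sqrt p) * finite_kernel N \<nu> (z i) (z l)))"
    then have "z i \<noteq> 0" "z l \<noteq> 0" using z by auto
    from orthonormal_sum_eq_finite_kernel[OF N \<nu> this, folded \<tau>_def p_def] il
    show "mat k k (\<lambda>(i, l). \<Sum>j<N. orthonormal_fun j (z i / of_real (p powr (1 / 4))) * cnj (orthonormal_fun j (z l / of_real (p powr (1 / 4))))) $$ (i, l) =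
      mat k k (\<lambda>(i, l). of_real (sqrt p) * finite_kernel N \<nu> (z i) (z l)) $$ (i, l)" by simp
  qed simp_all
  also have "\<dots> = of_real (sqrt p) ^ k * Determinant.det (mat k k (\<lambda>(i, l). finite_kernel N \<nu> (z i) (z l)))"
    unfolding det_scale_rows by simp
  also have "of_real (sqrt p) ^ k = complex_of_real (p powr (real k / 2))"
    using p by (simp add: powr_half_sqrt[symmetric] powr_realpow[symmetric] powr_powr of_real_power[symmetric] del: of_real_power)
  finally show ?thesis
    using p unfolding rescaled_correlation_nonzero_def \<tau>_def[symmetric] p_def[folded \<tau>_def, symmetric] by simp
qed

text \<open>At points with a vanishing coordinate the value is a limit of determinants of the
  continuous \<open>finite_kernel\<close>, hence the determinant at the point itself.\<close>

lemma rescaled_correlation_eq_det: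
  assumes N: "N \<ge> 1" and \<nu>: "\<nu> \<ge> 1" and k: "k \<le> N"
  shows "complex_of_real (rescaled_correlation N \<nu> (critical_tau N \<nu>) k z) =
    Determinant.det (mat k k (\<lambda>(i, l). finite_kernel N \<nu> (z i) (z l)))"
proof (cases "\<forall>j<k. z j \<noteq> 0")
  case True
  then show ?thesis unfolding rescaled_correlation_def using rescaled_correlation_nonzero_eq_det[OF N \<nu> k] by simp
next
  case False
  define S where "S = {w :: nat \<Rightarrow> complex. \<forall>j<k. w j \<noteq> 0}"
  define f where "f = rescaled_correlation_nonzero N \<nu> (critical_tau N \<nu>) k"
  define D where "D z = Determinant.det (mat k k (\<lambda>(i, l). finite_kernel N \<nu> (z i) (z l)))" for z
  have fD: "complex_of_real (f w) = D w" if "w \<in> S" for w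
    using rescaled_correlation_nonzero_eq_det[OF N \<nu> k] that by (simp add: f_def D_def S_def)
  \<comment> \<open>\<open>Lim\<close> is determined only if the punctured filter is nontrivial;
    replacing the zero coordinates by \<open>1 / (n + 1)\<close> gives points of \<open>S\<close>
    approaching \<open>z\<close>.\<close>
  have "z islimpt S"
    unfolding islimpt_sequential
  proof (intro exI conjI allI)
    define x where "x n j = (if z j = 0 then complex_of_real (inverse (real (Suc n))) else z j)" for n j
    show "x n \<in> S - {z}" for n
    proof -
      obtain j where "j < k" "z j = 0" using False by blast
      then have "x n j \<noteq> z j" by (simp add: x_def del: of_nat_Suc)
      then have "x n \<noteq> z" by metis
      moreover have "x n \<in> S" by (auto simp: S_def x_def simp del: of_nat_Suc)
      ultimately show ?thesis by simp
    qed
    have "(\<lambda>n. x n j) \<longlonglongrightarrow> z j" for j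
    proof (cases "z j = 0")
      case True
      then show ?thesis using tendsto_of_real[OF LIMSEQ_inverse_real_of_nat, where 'a = complex] by (simp add: x_def)
    qed (simp add: x_def)
    then have "limitin (product_topology (\<lambda>i. euclidean) UNIV) x z sequentially"
      by (simp add: limitin_componentwise)
    then show "x \<longlonglongrightarrow> z" by (simp add: euclidean_product_topology)
  qed
  then have nt: "at z within S \<noteq> bot" by (simp add: trivial_limit_within)
  have "(D \<longlongrightarrow> D z) (at z within S)"
    unfolding D_def by (intro tendsto_det tendsto_finite_kernel tendsto_coordinate[OF tendsto_ident_at])
  moreover have "\<forall>\<^sub>F w in at z within S. D w = complex_of_real (f w)"
    unfolding eventually_at_filter using fD by (intro always_eventually allI impI) simp
  ultimately have lim: "((\<lambda>w. complex_of_real (f w)) \<longlongrightarrow> D z) (at z within S)"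
    by (rule Lim_transform_eventually)
  \<comment> \<open>The limit in the definition is real while the determinant is complex; as a limit
    of real numbers the determinant is real, so nothing is lost by taking real parts.\<close>
  from tendsto_Re[OF this] have fl: "(f \<longlongrightarrow> Re (D z)) (at z within S)" by simp
  then have "((\<lambda>w. complex_of_real (f w)) \<longlongrightarrow> of_real (Re (D z))) (at z within S)" by (rule tendsto_of_real)
  then have "D z = of_real (Re (D z))" using tendsto_unique[OF nt lim] by blast
  moreover have "rescaled_correlation N \<nu> (critical_tau N \<nu>) k z = Re (D z)"
    using tendsto_Lim[OF nt fl] unfolding rescaled_correlation_def if_not_P[OF False] f_def S_def .
  ultimately show ?thesis unfolding D_def by simp
qed

theorem theorem3:
  fixes \<alpha> :: real and \<nu> :: "nat \<Rightarrow> nat" and k :: nat and C :: "complex set"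
  assumes "\<alpha> > 0"
    and "\<And>N. N \<ge> 1 \<Longrightarrow> \<nu> N \<ge> 1"
    and "(\<lambda>N. real (\<nu> N) / real N) \<longlonglongrightarrow> \<alpha>"
    and "k \<ge> 1"
    and "compact C"
  shows "uniform_limit {z. \<forall>j<k. z j \<in> C}
    (\<lambda>N z. complex_of_real (rescaled_correlation N (\<nu> N) (critical_tau N (\<nu> N)) k z))
    (\<lambda>z. Determinant.det (mat k k (\<lambda>(j, l). limit_kernel (z j) (z l))))
    sequentially"
proof -
  \<comment> \<open>The set in the statement leaves the coordinates from \<open>k\<close> on free
    and need not be compact. Pinning them to 0 gives a compact set on which the same values are
    attained, as only the first \<open>k\<close> coordinates enter.\<close>
  define K where "K = Pi\<^sub>E UNIV (\<lambda>j. if j < k then C else {0})"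
  \<comment> \<open>The shift by \<open>k\<close> ensures \<open>k \<le> N\<close> and, as
    \<open>k \<ge> 1\<close>, also \<open>N \<ge> 1\<close> for every index; it is removed again at
    the end, since only large \<open>N\<close> matter.\<close>
  define D where "D n z = Determinant.det (mat k k (\<lambda>(i, l). finite_kernel (n + k) (\<nu> (n + k)) (z i) (z l)))" for n z
  define G where "G z = Determinant.det (mat k k (\<lambda>(i, l). limit_kernel (z i) (z l)))" for z
  have "compact K" unfolding K_def using assms(5) by (intro compact_PiE_UNIV) simp
  then have unif: "uniform_limit K D G sequentially"
  proof (rule uniform_limit_sequentially_compact)
    fix r :: "nat \<Rightarrow> nat" and x :: "nat \<Rightarrow> nat \<Rightarrow> complex" and l
    assume r: "filterlim r at_top sequentially" and x: "x \<longlonglongrightarrow> l"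
    have rk: "filterlim (\<lambda>i. r i + k) at_top sequentially"
      by (rule filterlim_at_top_mono[OF r]) simp
    have "saddle_sequence (\<lambda>i. r i + k) (\<lambda>i. \<nu> (r i + k)) \<alpha>"
    proof
      show "(\<lambda>i. real (\<nu> (r i + k)) / real (r i + k)) \<longlonglongrightarrow> \<alpha>"
        by (rule filterlim_compose[OF assms(3) rk])
    qed (use assms rk in auto)
    then show "(\<lambda>i. D (r i) (x i)) \<longlonglongrightarrow> G l"
      unfolding D_def G_def by (intro tendsto_det finite_kernel_tendsto tendsto_coordinate[OF x])
  qed
  have eq: "complex_of_real (rescaled_correlation (n + k) (\<nu> (n + k)) (critical_tau (n + k) (\<nu> (n + k))) k z) = D n z" for n z
    unfolding D_def using assms by (intro rescaled_correlation_eq_det) auto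
  have "uniform_limit {z. \<forall>j<k. z j \<in> C} D G sequentially"
    unfolding uniform_limit_iff
  proof (intro allI impI)
    fix e :: real assume "e > 0"
    with unif have "\<forall>\<^sub>F n in sequentially. \<forall>z\<in>K. dist (D n z) (G z) < e" unfolding uniform_limit_iff by blast
    then show "\<forall>\<^sub>F n in sequentially. \<forall>z\<in>{z. \<forall>j<k. z j \<in> C}. dist (D n z) (G z) < e"
    proof (eventually_elim, intro ballI)
      fix n and z :: "nat \<Rightarrow> complex"
      assume *: "\<forall>z\<in>K. dist (D n z) (G z) < e" and z: "z \<in> {z. \<forall>j<k. z j \<in> C}"
      define z' where "z' j = (if j < k then z j else 0)" for j
      have "z' \<in> K" using z by (auto simp: K_def z'_def)
      moreover have "D n z' = D n z" "G z' = G z"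
        unfolding D_def G_def by (auto intro!: arg_cong[where f = Determinant.det] eq_matI simp: z'_def)
      ultimately show "dist (D n z) (G z) < e" using * by metis
    qed
  qed
  then have "uniform_limit {z. \<forall>j<k. z j \<in> C}
    (\<lambda>n z. complex_of_real (rescaled_correlation (n + k) (\<nu> (n + k)) (critical_tau (n + k) (\<nu> (n + k))) k z)) G sequentially"
    unfolding eq .
  then have *: "\<forall>e>0. \<forall>\<^sub>F n in sequentially. \<forall>z\<in>{z. \<forall>j<k. z j \<in> C}.
      dist (complex_of_real (rescaled_correlation (n + k) (\<nu> (n + k)) (critical_tau (n + k) (\<nu> (n + k))) k z)) (G z) < e"
    unfolding uniform_limit_iff .
  show ?thesis
    unfolding uniform_limit_iff G_def[symmetric]
  proof (intro allI impI)
    fix e :: real assume "e > 0"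
    with * have "\<forall>\<^sub>F n in sequentially. \<forall>z\<in>{z. \<forall>j<k. z j \<in> C}.
      dist (complex_of_real (rescaled_correlation (n + k) (\<nu> (n + k)) (critical_tau (n + k) (\<nu> (n + k))) k z)) (G z) < e"
      by blast
    then show "\<forall>\<^sub>F n in sequentially. \<forall>z\<in>{z. \<forall>j<k. z j \<in> C}.
      dist (complex_of_real (rescaled_correlation n (\<nu> n) (critical_tau n (\<nu> n)) k z)) (G z) < e"
      by (rule eventually_sequentially_seg[THEN iffD1])
  qed
qed

end
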